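(* Let $N\geq 1$, $\alpha\in(0,1)$, $s>1$, $N>2s$, and let $B:=\{x\in\mathbb R^N:|x|<1\}$. The problem $$(-\Delta)^su=|u|^{2_s^\star-2}u,\qquad u\in D_0^s(B)\cap C^\alpha(\overline B),$$ does not admit nontrivial nonnegative solutions.
   Context: $(-\Delta)^s$ is the higher-order fractional Laplacian, i.e. the operator with Fourier symbol $|\xi|^{2s}$ (unitary Fourier transform $\widehat{\cdot}$). All functions are real-valued, and functions on $B$ are extended by zero to $\mathbb R^N$. $\mathcal E_s(u,v)=\int_{\mathbb R^N}|\xi|^{2s}\widehat u(\xi)\overline{\widehat v(\xi)}\,d\xi$, $\|u\|_s=\mathcal E_s(u,u)^{1/2}$, $D_0^s(B)$ is the closure of $C_c^\infty(B)$ with respect to $\|\cdot\|_s$, and $2_s^\star:=\frac{2N}{N-2s}$. A solution is a function $u$ in the indicated space that is a critical point of $J_s(u)=\frac12\|u\|_s^2-\frac{1}{2_s^\star}\int_B|u|^{2_s^\star}$ on $D_0^s(B)$, i.e. $\mathcal E_s(u,v)=\int_B|u|^{2_s^\star-2}uv$ for all $v\in D_0^s(B)$. *)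

theory Defs
  imports "HOL-Analysis.Analysis"
begin

text \<open>
  Existence and continuity of all iterated directional derivatives up to order \<open>k\<close>
  on the whole space.
\<close>
primrec Ck :: "nat \<Rightarrow> (real^'n \<Rightarrow> real) \<Rightarrow> bool" where
  "Ck 0 f \<longleftrightarrow> continuous_on UNIV f"
| "Ck (Suc k) f \<longleftrightarrow>
     f differentiable_on UNIV \<and> (\<forall>v. Ck k (\<lambda>x. frechet_derivative f (at x) v))"

definition test_functions :: "(real^'n) set \<Rightarrow> (real^'n \<Rightarrow> real) set" where
  "test_functions \<Omega> =
     {\<phi>. (\<forall>k. Ck k \<phi>) \<and> compact (closure {x. \<phi> x \<noteq> 0}) \<and> closure {x. \<phi> x \<noteq> 0} \<subseteq> \<Omega>}"

text \<open>
  The unitary Fourier transform, given by its integral formula. It is only applied to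
  square integrable functions that vanish outside the unit ball; these are integrable, so the
  formula agrees with the Fourier transform on \<open>L\<^sup>2\<close>.
\<close>
definition fourier :: "(real^'n \<Rightarrow> real) \<Rightarrow> real^'n \<Rightarrow> complex" where
  "fourier u \<xi> = of_real ((2 * pi) powr (- real CARD('n) / 2)) *
     (LINT x|lborel. cis (- (x \<bullet> \<xi>)) * of_real (u x))"

definition energy :: "real \<Rightarrow> (real^'n \<Rightarrow> real) \<Rightarrow> (real^'n \<Rightarrow> real) \<Rightarrow> complex" where
  "energy s u v = (LINT \<xi>|lborel. of_real (norm \<xi> powr (2 * s)) * fourier u \<xi> * cnj (fourier v \<xi>))"

text \<open>The integrand of \<open>energy s u u\<close> is real and nonnegative.\<close>
definition energy_norm :: "real \<Rightarrow> (real^'n \<Rightarrow> real) \<Rightarrow> real" where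
  "energy_norm s u = sqrt (Re (energy s u u))"

text \<open>
  The functions of finite energy on the unit ball, extended by zero. Membership does not depend
  on the (Borel) representative of the a.e.\ class; in particular the values on the unit sphere
  are irrelevant. The integrability requirement keeps the Bochner integral in \<open>energy s u u\<close>
  from defaulting to 0.
\<close>
definition finite_energy :: "real \<Rightarrow> (real^'n \<Rightarrow> real) set" where
  "finite_energy s = {u. u \<in> borel_measurable lborel \<and>
     (AE x in lborel. x \<notin> ball 0 1 \<longrightarrow> u x = 0) \<and>
     integrable lborel (\<lambda>x. (u x)\<^sup>2) \<and>
     integrable lborel (\<lambda>\<xi>. norm \<xi> powr (2 * s) * (cmod (fourier u \<xi>))\<^sup>2)}"

text \<open>
  The closure of \<open>C\<^sub>c\<^sup>\<infinity>(B)\<close>, \<open>B\<close> the unit ball, with respect to \<open>energy_norm s\<close>, realised as a set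
  of functions. For \<open>s > 0\<close> the energy norm controls the \<open>L\<^sup>2\<close>-norm of functions
  vanishing outside \<open>B\<close>, so every element of the abstract completion is represented.
\<close>
definition D0 :: "real \<Rightarrow> (real^'n \<Rightarrow> real) set" where
  "D0 s = {u \<in> finite_energy s. \<exists>\<phi>. (\<forall>n::nat. \<phi> n \<in> test_functions (ball 0 1)) \<and>
     (\<lambda>n. energy_norm s (\<lambda>x. \<phi> n x - u x)) \<longlonglongrightarrow> 0}"

definition holder_space :: "real \<Rightarrow> (real^'n) set \<Rightarrow> (real^'n \<Rightarrow> real) set" where
  "holder_space \<alpha> S = {u. \<exists>C. \<forall>x\<in>S. \<forall>y\<in>S. \<bar>u x - u y\<bar> \<le> C * norm (x - y) powr \<alpha>}"

definition critical_exponent :: "'n::finite itself \<Rightarrow> real \<Rightarrow> real" where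
  "critical_exponent _ s = 2 * real CARD('n) / (real CARD('n) - 2 * s)"

text \<open>
  Critical points of \<open>J\<^sub>s\<close> on \<open>D0 s\<close>: the weak form of \<open>(-\<Delta>)\<^sup>s u = |u|\<^bsup>2\<^sup>*-2\<^esup> u\<close> in the unit ball.
\<close>
definition is_solution :: "real \<Rightarrow> (real^'n \<Rightarrow> real) \<Rightarrow> bool" where
  "is_solution s u \<longleftrightarrow> u \<in> D0 s \<and>
     (\<forall>v\<in>D0 s. energy s u v =
        of_real (LINT x:ball 0 1|lborel.
          \<bar>u x\<bar> powr (critical_exponent TYPE('n) s - 2) * u x * v x))"

end

theory Submission
  imports Defs "HOL-Probability.Probability"
begin

text \<open>
  Let \<open>N\<close> be the dimension, \<open>p = 2\<^sub>s\<^sup>* - 1\<close>, \<open>u\<close> a nonnegative solution, and for \<open>r < 1\<close> let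
  \<open>u\<^sub>r(x) = r\<^bsup>-(N-2s)/2\<^esup> u(x/r)\<close>. Both the energy and the critical integral are invariant under
  this dilation, so the equation and the convexity of \<open>t\<^bsup>p+1\<^esup>\<close> give
  \<open>\<parallel>u - u\<^sub>r\<parallel>\<^sub>s\<^sup>2 = 2 \<integral> u\<^sup>p (u - u\<^sub>r) \<le> 2 \<integral> (u\<^sup>p - u\<^sub>r\<^sup>p)(u - u\<^sub>r) \<le> C \<parallel>u - u\<^sub>r\<parallel>\<^sub>2\<^sup>2\<close>.
  Splitting frequencies absorbs the high ones on the left, and on the low ones the transform
  of \<open>u - u\<^sub>r\<close> is \<open>O(1 - r)\<close>; hence \<open>\<parallel>u - u\<^sub>r\<parallel>\<^sub>s = O(1 - r)\<close>.

  The function \<open>G\<^sub>r(x) = (r\<^sup>2 - |x|\<^sup>2)\<^sub>+\<^sup>s\<close> satisfies \<open>(-\<Delta>)\<^sup>s G\<^sub>r = \<kappa>\<close> in the ball of radius \<open>r\<close>,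
  with \<open>\<kappa>\<close> independent of \<open>r\<close>. Thus \<open>G\<^sub>1 - G\<^sub>r\<close> is orthogonal to \<open>u\<^sub>r\<close>, and its pairing with \<open>u\<close> is at most
  \<open>\<parallel>u - u\<^sub>r\<parallel>\<^sub>s \<parallel>G\<^sub>1 - G\<^sub>r\<parallel>\<^sub>s = o(1 - r)\<close>. By the equation this pairing equals \<open>\<integral> u\<^sup>p (G\<^sub>1 - G\<^sub>r)\<close>, which is
  at least \<open>c (1 - r)\<close> with \<open>c > 0\<close> when \<open>u \<noteq> 0\<close>, because \<open>s \<ge> 1\<close>.
\<close>

section \<open>The Fourier transform and the heat kernel\<close>

text \<open>The usual tool is a Pohozaev identity, whose boundary term needs the behaviour of
  \<open>u\<close> at the sphere. Only boundedness and continuity off the sphere are at hand, so the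
  identity is replaced by a product of two estimates: a rate for \<open>u\<close> against its
  dilate, and bare convergence for the profiles, which is enough because the lower bound for the
  pairing has the full order 1 - r. For s > 1 no positivity or pointwise formula for the operator is
  called upon; everything is done in frequency. The constancy of the fractional Laplacian of the
  profile starts from exponents a in (-1, 0], where it is the classical fact that the Riesz
  potential of order -2a of (1 - |x|^2)^a is constant in the ball: each chord through a point
  contributes the same Beta integral. Differentiation in the dilation parameter then raises a by one
  until s is reached. The value of the resulting constant cancels in the argument. Fourier inversion
  is replaced by Gaussian damping: pairings of transforms become heat kernel pairings, and either
  integrating over the time or letting it tend to 0 gives the needed relations.\<close>

lemma nn_integral_lborel_affine:
  fixes f :: "'a::euclidean_space \<Rightarrow> ennreal" and t :: 'a
  assumes [measurable]: "f \<in> borel_measurable borel" and c: "c \<noteq> 0"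
  shows "(\<integral>\<^sup>+x. f x \<partial>lborel) = ennreal (\<bar>c\<bar> ^ DIM('a)) * (\<integral>\<^sup>+x. f (t + c *\<^sub>R x) \<partial>lborel)"
  by (subst lborel_affine[OF c, of t])
     (simp add: nn_integral_density nn_integral_distr nn_integral_cmult)

lemma lborel_integrable_affine:
  fixes f :: "'a::euclidean_space \<Rightarrow> 'b :: {banach, second_countable_topology}"
  assumes f: "integrable lborel f" and c: "c \<noteq> 0"
  shows "integrable lborel (\<lambda>x. f (t + c *\<^sub>R x))"
proof -
  have m[measurable]: "f \<in> borel_measurable borel" using f by auto
  have "ennreal (\<bar>c\<bar> ^ DIM('a)) * (\<integral>\<^sup>+x. ennreal (norm (f (t + c *\<^sub>R x))) \<partial>lborel)
      = (\<integral>\<^sup>+x. ennreal (norm (f x)) \<partial>lborel)"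
    by (subst nn_integral_lborel_affine[where c=c and t=t and f="\<lambda>x. ennreal (norm (f x))"]) (use c in auto)
  also have "\<dots> < \<infinity>" using f by (simp add: integrable_iff_bounded)
  finally show ?thesis
    using c by (auto simp: integrable_iff_bounded ennreal_mult_less_top)
qed

lemma lborel_integrable_affine_iff:
  fixes f :: "'a::euclidean_space \<Rightarrow> 'b :: {banach, second_countable_topology}"
  assumes c: "c \<noteq> 0"
  shows "integrable lborel (\<lambda>x. f (t + c *\<^sub>R x)) \<longleftrightarrow> integrable lborel f"
  using lborel_integrable_affine[of f c t] c
    lborel_integrable_affine[of "\<lambda>x. f (t + c *\<^sub>R x)" "1/c" "-(1/c) *\<^sub>R t"]
  by (auto simp: algebra_simps)

lemma lborel_integral_affine:
  fixes f :: "'a::euclidean_space \<Rightarrow> 'b :: {banach, second_countable_topology}"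
  assumes c: "c \<noteq> 0"
  shows "(\<integral>x. f x \<partial>lborel) = \<bar>c\<bar> ^ DIM('a) *\<^sub>R (\<integral>x. f (t + c *\<^sub>R x) \<partial>lborel)"
proof cases
  assume f[measurable]: "integrable lborel f" then show ?thesis
    using c f f[THEN borel_measurable_integrable] lborel_integrable_affine[OF f c, of t]
    by (subst lborel_affine[OF c, of t])
       (simp add: integral_density integral_distr)
next
  \<comment> \<open>Without integrability both sides take the default value 0, so the formula holds
    for every \<open>f\<close>.\<close>
  assume "\<not> integrable lborel f" with c show ?thesis
    by (simp add: lborel_integrable_affine_iff not_integrable_integral_eq)
qed

lemma AE_lborel_affine:
  fixes t :: "'a::euclidean_space"
  assumes c: "c \<noteq> 0" and P: "AE x in lborel. P x"
  shows "AE x in lborel. P (t + c *\<^sub>R x)"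
proof -
  obtain N where N: "{x. \<not> P x} \<subseteq> N" "N \<in> null_sets lborel" 
    using P by (auto elim!: AE_E simp: null_sets_def)
  then have [measurable]: "N \<in> sets borel" by auto
  have "(\<integral>\<^sup>+x. indicator N (t + c *\<^sub>R x) \<partial>lborel) = 0"
    using nn_integral_lborel_affine[of "indicator N" c t] c N(2) by auto
  then have "AE x in lborel. indicator N (t + c *\<^sub>R x) = (0::ennreal)"
    by (subst (asm) nn_integral_0_iff_AE) auto
  then show ?thesis using N(1) by (elim eventually_mono) (auto simp: indicator_def split: if_splits)
qed

lemma lborel_integrable_translate:
  fixes f :: "'a::euclidean_space \<Rightarrow> 'b :: {banach, second_countable_topology}"
  shows "integrable lborel f \<Longrightarrow> integrable lborel (\<lambda>x. f (x + t))"
  using lborel_integrable_affine[of f 1 t] by (simp add: add.commute)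

lemma lborel_integral_translate:
  fixes f :: "'a::euclidean_space \<Rightarrow> 'b :: {banach, second_countable_topology}"
  shows "(\<integral>x. f (x + t) \<partial>lborel) = (\<integral>x. f x \<partial>lborel)"
  using lborel_integral_affine[of 1 f t] by (simp add: add.commute)

section \<open>The unnormalised transform of integrable functions\<close>

definition ft :: "('a::euclidean_space \<Rightarrow> real) \<Rightarrow> 'a \<Rightarrow> complex" where
  "ft f \<xi> = (LINT x|lborel. cis (- (x \<bullet> \<xi>)) * of_real (f x))"

lemma cis_measurable [measurable]: "cis \<in> borel_measurable borel"
  by (intro borel_measurable_continuous_onI continuous_intros)

lemma norm_of_real_cis [simp]: "cmod (cis a * complex_of_real b) = \<bar>b\<bar>"
  by (simp add: norm_mult)

lemma integrable_ft:
  assumes "integrable lborel f"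
  shows "integrable lborel (\<lambda>x. cis (- (x \<bullet> \<xi>)) * complex_of_real (f x))"
  by (rule Bochner_Integration.integrable_bound[OF assms]) (use assms in auto)

lemma ft_measurable [measurable]:
  assumes [measurable]: "f \<in> borel_measurable borel"
  shows "ft f \<in> borel_measurable borel"
  unfolding ft_def by measurable

lemma ft_cong_AE:
  assumes [measurable]: "f \<in> borel_measurable borel" "g \<in> borel_measurable borel"
    and "AE x in lborel. f x = g x"
  shows "ft f \<xi> = ft g \<xi>"
  unfolding ft_def by (rule integral_cong_AE) (use assms(3) in auto)

lemma ft_bound:
  assumes "integrable lborel f"
  shows "cmod (ft f \<xi>) \<le> (LINT x|lborel. \<bar>f x\<bar>)"
  unfolding ft_def by (rule order_trans[OF integral_norm_bound]) simp

lemma ft_diff: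
  assumes "integrable lborel f" "integrable lborel g"
  shows "ft (\<lambda>x. f x - g x) \<xi> = ft f \<xi> - ft g \<xi>"
  using integrable_ft[OF assms(1)] integrable_ft[OF assms(2)]
  by (simp add: ft_def algebra_simps)

lemma ft_cmult: "ft (\<lambda>x. c * f x) \<xi> = of_real c * ft f \<xi>"
proof -
  have "(\<lambda>x. cis (- (x \<bullet> \<xi>)) * complex_of_real (c * f x)) = (\<lambda>x. complex_of_real c * (cis (- (x \<bullet> \<xi>)) * complex_of_real (f x)))"
    by (simp add: fun_eq_iff)
  then show ?thesis unfolding ft_def by (simp del: of_real_mult)
qed

lemma ft_scale:
  fixes f :: "'a::euclidean_space \<Rightarrow> real"
  assumes c: "c > 0"
  shows "ft (\<lambda>x. f (x /\<^sub>R c)) \<xi> = of_real (c ^ DIM('a)) * ft f (c *\<^sub>R \<xi>)"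
  unfolding ft_def using c
  by (subst lborel_integral_affine[of c _ 0]) (auto simp: scaleR_conv_of_real)

lemma ft_translate:
  "ft (\<lambda>x. f (x + t)) \<xi> = cis (t \<bullet> \<xi>) * ft f \<xi>"
proof -
  have "ft (\<lambda>x. f (x + t)) \<xi> = (LINT x|lborel. (\<lambda>y. cis (t \<bullet> \<xi>) * (cis (- (y \<bullet> \<xi>)) * of_real (f y))) (x + t))"
    unfolding ft_def by (auto simp: cis_mult[symmetric] inner_simps mult.assoc[symmetric] cis_mult intro!: Bochner_Integration.integral_cong)
  also have "\<dots> = (LINT y|lborel. cis (t \<bullet> \<xi>) * (cis (- (y \<bullet> \<xi>)) * of_real (f y)))"
    by (rule lborel_integral_translate)
  finally show ?thesis unfolding ft_def by simp
qed

lemma cis_diff_bound: "cmod (cis a - cis b) \<le> \<bar>a - b\<bar>"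
proof -
  have "cis a - cis b = cis b * (cis (a - b) - 1)"
    by (simp add: algebra_simps cis_mult)
  then have "cmod (cis a - cis b) = cmod (cis (a - b) - 1)"
    by (simp add: norm_mult)
  also have "\<dots> \<le> \<bar>a - b\<bar>"
    using iexp_approx1[of "a - b" 0] by (simp add: cis_conv_exp)
  finally show ?thesis .
qed

text \<open>The phases at two frequencies differ by at most
  \<open>norm x * norm (\<xi> - \<eta>)\<close>, and \<open>norm x < 1\<close> on the support. This
  is the source of the rate 1 - r at low frequencies and of the domination of difference quotients
  in the dilation parameter.\<close>

lemma ft_lipschitz:
  assumes f: "integrable lborel f" and supp: "AE x in lborel. norm x \<ge> 1 \<longrightarrow> f x = 0"
  shows "cmod (ft f \<xi> - ft f \<eta>) \<le> (LINT x|lborel. \<bar>f x\<bar>) * norm (\<xi> - \<eta>)"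
proof -
  have "ft f \<xi> - ft f \<eta> = (LINT x|lborel. cis (- (x \<bullet> \<xi>)) * complex_of_real (f x) - cis (- (x \<bullet> \<eta>)) * complex_of_real (f x))"
    unfolding ft_def using integrable_ft[OF f] by simp
  also have "cmod \<dots> \<le> (LINT x|lborel. \<bar>f x\<bar> * norm (\<xi> - \<eta>))"
  proof (rule order_trans[OF integral_norm_bound], rule integral_mono_AE)
    show "integrable lborel (\<lambda>x. \<bar>f x\<bar> * norm (\<xi> - \<eta>))" using f by simp
    show "integrable lborel (\<lambda>x. cmod (cis (- (x \<bullet> \<xi>)) * complex_of_real (f x) - cis (- (x \<bullet> \<eta>)) * complex_of_real (f x)))"
      using integrable_ft[OF f] by simp
    have "cmod (cis (- (x \<bullet> \<xi>)) * complex_of_real (f x) - cis (- (x \<bullet> \<eta>)) * complex_of_real (f x)) \<le> \<bar>f x\<bar> * norm (\<xi> - \<eta>)" 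
      if "norm x \<ge> 1 \<longrightarrow> f x = 0" for x
    proof (cases "norm x \<ge> 1")
      case False
      have "cmod (cis (- (x \<bullet> \<xi>)) - cis (- (x \<bullet> \<eta>))) \<le> \<bar>x \<bullet> (\<xi> - \<eta>)\<bar>"
        using cis_diff_bound[of "-(x \<bullet> \<xi>)" "-(x \<bullet> \<eta>)"] by (simp add: inner_simps abs_minus_commute)
      also have "\<dots> \<le> norm x * norm (\<xi> - \<eta>)" by (rule Cauchy_Schwarz_ineq2)
      also have "\<dots> \<le> 1 * norm (\<xi> - \<eta>)" using False by (intro mult_right_mono) auto
      finally show ?thesis
        by (subst left_diff_distrib[symmetric]) (simp add: norm_mult mult.commute[of _ "\<bar>f x\<bar>"] mult_left_mono)
    qed (use that in auto)
    then show "AE x in lborel. cmod (cis (- (x \<bullet> \<xi>)) * complex_of_real (f x) - cis (- (x \<bullet> \<eta>)) * complex_of_real (f x)) \<le> \<bar>f x\<bar> * norm (\<xi> - \<eta>)"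
      using supp by auto
  qed
  finally show ?thesis by simp
qed

lemma integral_cis_gaussian_real:
  assumes t: "t > 0"
  shows "(LINT x|lborel. cis (x * z) * complex_of_real (exp (- t * x\<^sup>2))) =
    of_real (sqrt (pi / t) * exp (- z\<^sup>2 / (4 * t)))"
proof -
  \<comment> \<open>With this \<open>c\<close>, \<open>t * (c * x)^2 = x^2 / 2\<close>, so the
    dilated integrand is the standard normal density up to its normalisation and the value is read
    off from its characteristic function.\<close>
  define c where "c = 1 / sqrt (2 * t)"
  have c: "c > 0" "c\<^sup>2 = 1 / (2*t)" using t by (auto simp: c_def power_divide)
  have "char std_normal_distribution (c * z) = (LINT x|lborel. std_normal_density x *\<^sub>R iexp (c * z * x))"
    unfolding char_def by (subst integral_density) (auto simp: normal_density_nonneg)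
  also have "\<dots> = (LINT x|lborel. of_real (1 / sqrt (2 * pi)) * (cis (c * x * z) * of_real (exp (- t * (c*x)\<^sup>2))))"
    unfolding std_normal_density_def
    using c t by (intro Bochner_Integration.integral_cong)
       (auto simp: cis_conv_exp scaleR_conv_of_real power_mult_distrib mult_ac)
  also have "\<dots> = of_real (1 / sqrt (2 * pi)) * (LINT x|lborel. cis (c * x * z) * of_real (exp (- t * (c*x)\<^sup>2)))"
    by (rule Bochner_Integration.integral_mult_right_zero)
  finally have *: "(LINT x|lborel. cis (c * x * z) * of_real (exp (- t * (c*x)\<^sup>2)))
     = of_real (sqrt (2 * pi) * exp (- (c*z)\<^sup>2 / 2))"
    by (simp add: char_std_normal_distribution field_simps)
  have "(LINT x|lborel. cis (x * z) * complex_of_real (exp (- t * x\<^sup>2)))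
     = c *\<^sub>R (LINT x|lborel. cis (c * x * z) * of_real (exp (- t * (c*x)\<^sup>2)))"
    by (subst lborel_integral_real_affine[of c _ 0]) (use c in auto)
  also have "\<dots> = of_real (c * (sqrt (2 * pi) * exp (- (c*z)\<^sup>2 / 2)))"
    unfolding * by (simp add: scaleR_conv_of_real)
  also have "c * sqrt (2*pi) = sqrt (pi / t)"
    unfolding c_def using t by (simp add: real_sqrt_divide real_sqrt_mult)
  then have "c * (sqrt (2 * pi) * exp (- (c*z)\<^sup>2 / 2)) = sqrt (pi / t) * exp (- z\<^sup>2 / (4 * t))"
    using c t by (simp add: power_mult_distrib mult.assoc[symmetric])
  finally show ?thesis .
qed

text \<open>The evaluated integral already forces integrability: a nonintegrable function has
  integral 0 by default, whereas \<open>integral_cis_gaussian_real\<close> at frequency 0 gives a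
  positive value.\<close>

lemma integrable_gaussian_real:
  assumes t: "t > 0"
  shows "integrable lborel (\<lambda>x::real. exp (- t * x\<^sup>2))"
proof (rule ccontr)
  assume "\<not> ?thesis"
  then have "(LINT x|lborel. exp (- t * x\<^sup>2)) = 0" by (rule not_integrable_integral_eq)
  moreover have "complex_of_real (LINT x|lborel. exp (- t * x\<^sup>2)) = of_real (sqrt (pi / t))"
    using integral_cis_gaussian_real[OF t, of 0] by (simp del: integral_of_real add: integral_complex_of_real)
  ultimately show False using t by simp
qed

text \<open>\<open>lborel\<close> is the image of a product of real Lebesgue measures under the
  basis expansion, so products of one-variable factors integrate factor by factor. Gaussians and
  plane waves are of this form.\<close>

lemma integral_lborel_prod_Basis:
  fixes F :: "'a::euclidean_space \<Rightarrow> real \<Rightarrow> 'c::{real_normed_field,banach,second_countable_topology}"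
  assumes F: "\<And>b. b \<in> Basis \<Longrightarrow> integrable lborel (F b)"
  shows "integrable lborel (\<lambda>x::'a. \<Prod>b\<in>Basis. F b (x \<bullet> b))"
    and "(LINT x|lborel. (\<Prod>b\<in>Basis. F b (x \<bullet> b))) = (\<Prod>b\<in>Basis. (LINT x|lborel. F b x))"
proof -
  interpret product_sigma_finite "\<lambda>_::'a. lborel::real measure" ..
  have [measurable]: "F b \<in> borel_measurable borel" if "b \<in> Basis" for b using F[OF that] by auto
  have [measurable]: "(\<lambda>x::'a. \<Prod>b\<in>Basis. F b (x \<bullet> b)) \<in> borel_measurable borel"
    by (rule borel_measurable_prod) measurable
  have eq: "(\<Prod>b\<in>Basis. F b ((\<Sum>b\<in>Basis. f b *\<^sub>R b) \<bullet> b)) = (\<Prod>b\<in>Basis. F b (f b))" for f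
    by (intro prod.cong) (auto simp: inner_sum_left inner_Basis if_distrib sum.If_cases cong: if_cong)
  show "integrable lborel (\<lambda>x::'a. \<Prod>b\<in>Basis. F b (x \<bullet> b))"
    by (subst lborel_eq, subst integrable_distr_eq) (use product_integrable_prod[of Basis F] F in \<open>auto simp: eq\<close>)
  show "(LINT x|lborel. (\<Prod>b\<in>Basis. F b (x \<bullet> b))) = (\<Prod>b\<in>Basis. (LINT x|lborel. F b x))"
    by (subst lborel_eq, subst integral_distr) (use product_integral_prod[of Basis F] F in \<open>auto simp: eq\<close>)
qed

lemma norm_power2_sum_Basis: "(norm (x::'a::euclidean_space))\<^sup>2 = (\<Sum>b\<in>Basis. (x \<bullet> b)\<^sup>2)"
  unfolding power2_norm_eq_inner by (subst euclidean_inner) (simp add: power2_eq_square)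

lemma integral_cis_gaussian:
  fixes z :: "'a::euclidean_space"
  assumes t: "t > 0"
  shows "integrable lborel (\<lambda>x::'a. exp (- t * (norm x)\<^sup>2))"
    and "(LINT x|lborel. cis (x \<bullet> z) * complex_of_real (exp (- t * (norm x)\<^sup>2))) =
      of_real ((pi / t) powr (DIM('a) / 2) * exp (- (norm z)\<^sup>2 / (4 * t)))"
proof -
  have 1: "exp (- t * (norm x)\<^sup>2) = (\<Prod>b\<in>Basis. exp (- t * (x \<bullet> b)\<^sup>2))" for x :: 'a
    by (simp add: norm_power2_sum_Basis sum_distrib_left exp_sum[symmetric] sum_negf)
  have 2: "cis (x \<bullet> z) = (\<Prod>b\<in>Basis. cis ((x \<bullet> b) * (z \<bullet> b)))" for x :: 'a
    by (subst euclidean_inner) (simp add: cis_conv_exp exp_sum sum_distrib_left)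
  show "integrable lborel (\<lambda>x::'a. exp (- t * (norm x)\<^sup>2))"
    unfolding 1 by (rule integral_lborel_prod_Basis(1)) (rule integrable_gaussian_real[OF t])
  have "(LINT x|lborel. cis (x \<bullet> z) * complex_of_real (exp (- t * (norm x)\<^sup>2))) =
     (LINT x|lborel. (\<Prod>b\<in>Basis. cis ((x \<bullet> b) * (z \<bullet> b)) * complex_of_real (exp (- t * (x \<bullet> b)\<^sup>2))))"
    unfolding 1 2 by (simp add: prod.distrib)
  also have "\<dots> = (\<Prod>b\<in>Basis. (LINT x|lborel. cis (x * (z \<bullet> b)) * complex_of_real (exp (- t * x\<^sup>2))))"
    by (rule integral_lborel_prod_Basis(2),
        rule Bochner_Integration.integrable_bound[OF integrable_gaussian_real[OF t]]) auto
  also have "\<dots> = (\<Prod>b\<in>Basis. of_real (sqrt (pi / t) * exp (- (z \<bullet> b)\<^sup>2 / (4 * t))))"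
    by (intro prod.cong refl integral_cis_gaussian_real t)
  also have "\<dots> = of_real (sqrt (pi / t) ^ DIM('a) * exp (\<Sum>b\<in>Basis. - (z \<bullet> b)\<^sup>2 / (4 * t)))"
    by (simp add: prod.distrib exp_sum of_real_prod)
  also have "(\<Sum>b\<in>Basis. - (z \<bullet> b)\<^sup>2 / (4 * t)) = - (norm z)\<^sup>2 / (4 * t)"
    by (simp add: norm_power2_sum_Basis sum_divide_distrib sum_negf)
  also have "sqrt (pi / t) ^ DIM('a) = (pi / t) powr (DIM('a) / 2)"
    using t by (simp add: powr_half_sqrt[symmetric] powr_realpow[symmetric] powr_powr)
  finally show "(LINT x|lborel. cis (x \<bullet> z) * complex_of_real (exp (- t * (norm x)\<^sup>2))) =
      of_real ((pi / t) powr (DIM('a) / 2) * exp (- (norm z)\<^sup>2 / (4 * t)))" .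
qed

text \<open>Normalised so that \<open>heat t\<close> is the Fourier transform of \<open>exp (- t |\<xi>|\<^sup>2)\<close>.\<close>
definition heat :: "real \<Rightarrow> 'a::euclidean_space \<Rightarrow> real" where
  "heat t z = (pi / t) powr (DIM('a) / 2) * exp (- (norm z)\<^sup>2 / (4 * t))"

lemma heat_measurable [measurable (raw)]:
  assumes [measurable]: "f \<in> borel_measurable M" "g \<in> borel_measurable M"
  shows "(\<lambda>x. heat (f x) (g x)) \<in> borel_measurable M"
  unfolding heat_def by measurable

lemma heat_nonneg: "heat t z \<ge> 0"
  unfolding heat_def by simp

section \<open>Gaussian-damped pairings and the Plancherel inequality\<close>

lemma integral_lborel_pair_mult:
  fixes f :: "'a::euclidean_space \<Rightarrow> 'c::{real_normed_field,banach,second_countable_topology}"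
    and g :: "'b::euclidean_space \<Rightarrow> 'c"
  assumes f: "integrable lborel f" and g: "integrable lborel g"
  shows "integrable lborel (\<lambda>p. f (fst p) * g (snd p))"
    and "(LINT p|lborel. f (fst p) * g (snd p)) = (LINT x|lborel. f x) * (LINT y|lborel. g y)"
proof -
  note [measurable] = borel_measurable_integrable[OF f] borel_measurable_integrable[OF g]
  have I: "integrable (lborel \<Otimes>\<^sub>M lborel) (\<lambda>(x,y). f x * g y)"
    by (intro lborel_pair.Fubini_integrable) (use f g in \<open>auto simp: norm_mult\<close>)
  then show "integrable lborel (\<lambda>p. f (fst p) * g (snd p))"
    by (simp add: lborel_prod case_prod_unfold)
  show "(LINT p|lborel. f (fst p) * g (snd p)) = (LINT x|lborel. f x) * (LINT y|lborel. g y)"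
    using lborel_pair.integral_fst[OF I] by (simp add: lborel_prod case_prod_unfold)
qed

text \<open>The Gaussian makes the triple integral over the frequency and the two space variables
  absolutely convergent for merely integrable \<open>f\<close> and \<open>g\<close>. The frequency
  integral can then be done first and turns the phase of \<open>fst p - snd p\<close> into the heat
  kernel. The later Plancherel and Riesz relations arise by letting \<open>t\<close> tend to 0 or by
  integrating over \<open>t\<close>.\<close>

lemma gaussian_pairing:
  fixes f g :: "'a::euclidean_space \<Rightarrow> real"
  assumes f: "integrable lborel f" and g: "integrable lborel g" and t: "t > 0"
  shows "(LINT \<xi>|lborel. of_real (exp (- t * (norm \<xi>)\<^sup>2)) * ft f \<xi> * cnj (ft g \<xi>)) =
    of_real (LINT p|lborel. f (fst p) * g (snd p) * heat t (fst p - snd p))"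
    and "integrable lborel (\<lambda>p. f (fst p) * g (snd p) * heat t (fst p - snd p))"
proof -
  note [measurable] = borel_measurable_integrable[OF f] borel_measurable_integrable[OF g]
  define h where "h p = f (fst p) * g (snd p)" for p :: "'a \<times> 'a"
  have h: "integrable lborel h"
    unfolding h_def[abs_def] by (rule integral_lborel_pair_mult(1)[OF f g])
  note [measurable] = borel_measurable_integrable[OF h]
  show "integrable lborel (\<lambda>p. f (fst p) * g (snd p) * heat t (fst p - snd p))"
  proof (rule Bochner_Integration.integrable_bound[where f="\<lambda>p. (pi / t) powr (DIM('a) / 2) * h p"])
    show "integrable lborel (\<lambda>p. (pi / t) powr (DIM('a) / 2) * h p)" using h by simp
    show "AE p in lborel. norm (f (fst p) * g (snd p) * heat t (fst p - snd p)) \<le> norm ((pi / t) powr (DIM('a) / 2) * h p)"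
    proof (rule AE_I2)
      fix p :: "'a \<times> 'a"
      have "\<bar>heat t (fst p - snd p)\<bar> \<le> (pi / t) powr (DIM('a) / 2)"
        unfolding heat_def using t by (auto simp: abs_mult intro!: mult_left_le)
      then show "norm (f (fst p) * g (snd p) * heat t (fst p - snd p)) \<le> norm ((pi / t) powr (DIM('a) / 2) * h p)"
        by (simp add: h_def abs_mult mult_left_mono mult.commute[of "(pi / t) powr (DIM('a) / 2)"])
    qed
  qed (subst lborel_prod[symmetric], measurable)
  have A: "ft f \<xi> * cnj (ft g \<xi>) = (LINT p|lborel. cis (- ((fst p - snd p) \<bullet> \<xi>)) * of_real (h p))" for \<xi>
  proof -
    have sp: "cis (- ((x - y) \<bullet> \<xi>)) = cis (- (x \<bullet> \<xi>)) * cis (y \<bullet> \<xi>)" for x y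
      by (simp add: cis_mult inner_diff_left)
    have "(LINT p|lborel. cis (- ((fst p - snd p) \<bullet> \<xi>)) * of_real (h p)) = 
       (LINT p|lborel. (cis (- (fst p \<bullet> \<xi>)) * of_real (f (fst p))) * cnj (cis (- (snd p \<bullet> \<xi>)) * of_real (g (snd p))))"
      by (intro Bochner_Integration.integral_cong refl)
        (simp only: h_def sp, simp add: cis_cnj)
    also have "\<dots> = ft f \<xi> * cnj (ft g \<xi>)"
      using integral_lborel_pair_mult(2)[OF integrable_ft[OF f] integrable_cnj[OF integrable_ft[OF g]]]
      unfolding ft_def Bochner_Integration.integral_cnj .
    finally show ?thesis by simp
  qed
  let ?K = "\<lambda>\<xi> p. of_real (exp (- t * (norm \<xi>)\<^sup>2)) * (cis (- ((fst p - snd p) \<bullet> \<xi>)) * complex_of_real (h p))"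
  have "integrable lborel (\<lambda>q. exp (- t * (norm (fst q :: 'a))\<^sup>2) * h (snd q))"
    by (rule integral_lborel_pair_mult(1)[OF integral_cis_gaussian(1)[OF t] h])
  then have I1: "integrable lborel (\<lambda>q. complex_of_real (exp (- t * (norm (fst q :: 'a))\<^sup>2) * h (snd q)))"
    by (rule integrable_of_real)
  have "(\<lambda>q::'a \<times> 'a \<times> 'a. cis (- ((fst (snd q) - snd (snd q)) \<bullet> fst q))) \<in> borel_measurable borel"
    by (intro borel_measurable_continuous_onI continuous_intros)
  then have M1: "(\<lambda>q::'a \<times> 'a \<times> 'a. cis (- ((fst (snd q) - snd (snd q)) \<bullet> fst q))) \<in> borel_measurable lborel"
    by simp
  have "integrable lborel (\<lambda>q. cis (- ((fst (snd q) - snd (snd q)) \<bullet> fst q)) * 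
      complex_of_real (exp (- t * (norm (fst q))\<^sup>2) * h (snd q)))"
    by (rule Bochner_Integration.integrable_bound[OF I1])
      (use borel_measurable_times[OF M1 borel_measurable_integrable[OF I1]] in \<open>auto simp: norm_mult\<close>)
  then have int: "integrable (lborel \<Otimes>\<^sub>M lborel) (\<lambda>(\<xi>,p). ?K \<xi> p)"
    by (simp add: lborel_prod case_prod_unfold mult_ac)
  have "(LINT \<xi>|lborel. of_real (exp (- t * (norm \<xi>)\<^sup>2)) * ft f \<xi> * cnj (ft g \<xi>)) = (LINT \<xi>|lborel. (LINT p|lborel. ?K \<xi> p))"
    by (simp add: mult.assoc A)
  also have "\<dots> = (LINT p|lborel. (LINT \<xi>|lborel. ?K \<xi> p))"
    by (rule lborel_pair.Fubini_integral[symmetric, OF int])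
  also have "\<dots> = (LINT p|lborel. of_real (h p * heat t (fst p - snd p)))"
  proof (intro Bochner_Integration.integral_cong refl)
    fix p :: "'a \<times> 'a"
    have "(LINT \<xi>|lborel. ?K \<xi> p) = of_real (h p) * (LINT \<xi>|lborel. cis (\<xi> \<bullet> (snd p - fst p)) * of_real (exp (- t * (norm \<xi>)\<^sup>2)))"
      unfolding Bochner_Integration.integral_mult_right_zero[symmetric]
      by (intro Bochner_Integration.integral_cong refl) (simp add: inner_simps inner_commute)
    then show "(LINT \<xi>|lborel. ?K \<xi> p) = of_real (h p * heat t (fst p - snd p))"
      unfolding integral_cis_gaussian(2)[OF t] by (simp add: heat_def norm_minus_commute)
  qed
  finally show "(LINT \<xi>|lborel. of_real (exp (- t * (norm \<xi>)\<^sup>2)) * ft f \<xi> * cnj (ft g \<xi>)) =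
    of_real (LINT p|lborel. f (fst p) * g (snd p) * heat t (fst p - snd p))"
    by (simp add: h_def del: of_real_mult)
qed

lemma integrable_bounded_in_ball:
  fixes f :: "'a::euclidean_space \<Rightarrow> real"
  assumes [measurable]: "f \<in> borel_measurable borel" and b: "\<And>x. \<bar>f x\<bar> \<le> M"
    and supp: "\<And>x. norm x \<ge> R \<Longrightarrow> f x = 0"
  shows "integrable lborel f"
proof (rule Bochner_Integration.integrable_bound)
  show "integrable lborel (\<lambda>x. M * indicator (cball (0::'a) R) x)"
    by (intro Bochner_Integration.integrable_mult_right integrable_real_indicator) (use emeasure_lborel_cball_finite[of "0::'a" R] in \<open>auto simp: less_top\<close>)
  show "AE x in lborel. norm (f x) \<le> norm (M * indicator (cball 0 R) x)"
  proof (rule AE_I2)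
    fix x :: 'a
    show "norm (f x) \<le> norm (M * indicator (cball 0 R) x)"
      using b[of x] supp[of x] by (cases "norm x \<ge> R") (auto simp: indicator_def)
  qed
qed auto

text \<open>This is the Plancherel constant \<open>(2 * pi) ^ DIM('a)\<close> of the unnormalised
  transform. It enters the estimates as a positive constant and is kept as an integral.\<close>

definition heat_mass :: "'a::euclidean_space itself \<Rightarrow> real" where
  "heat_mass _ = (LINT z::'a|lborel. heat 1 z)"

lemma integrable_heat: "t > 0 \<Longrightarrow> integrable lborel (heat t :: 'a::euclidean_space \<Rightarrow> real)"
proof -
  assume t: "t > 0"
  have "heat t = (\<lambda>z::'a. (pi / t) powr (DIM('a) / 2) * exp (- (1 / (4 * t)) * (norm z)\<^sup>2))"
    by (simp add: heat_def fun_eq_iff)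
  then show ?thesis
    using integral_cis_gaussian(1)[of "1/(4*t)"] t by simp
qed

lemma heat_mass_pos: "heat_mass TYPE('a::euclidean_space) > 0"
proof -
  have "heat_mass TYPE('a) \<noteq> 0"
  proof
    assume "heat_mass TYPE('a) = 0"
    then have "AE z::'a in lborel. heat 1 z = 0"
      unfolding heat_mass_def
      by (subst (asm) integral_nonneg_eq_0_iff_AE) (auto intro: integrable_heat heat_nonneg)
    then have "AE z::'a in lborel. False"
      by (rule eventually_mono) (simp add: heat_def)
    then show False
      by (simp add: AE_iff_measurable[of UNIV] emeasure_lborel_UNIV)
  qed
  moreover have "heat_mass TYPE('a) \<ge> 0"
    unfolding heat_mass_def by (rule Bochner_Integration.integral_nonneg) (rule heat_nonneg)
  ultimately show ?thesis by simp
qed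

lemma heat_scale:
  assumes "t > 0"
  shows "sqrt t ^ DIM('a) * heat t (sqrt t *\<^sub>R z) = heat 1 (z::'a::euclidean_space)"
proof -
  have "sqrt t ^ DIM('a) * (pi / t) powr (DIM('a) / 2) = pi powr (DIM('a) / 2)"
    using assms by (simp add: powr_half_sqrt[symmetric] powr_realpow[symmetric] powr_powr powr_divide)
  then show ?thesis
    using assms unfolding heat_def by (simp add: mult.assoc[symmetric] power_mult_distrib)
qed

text \<open>The heat kernel is an approximate identity of total mass \<open>heat_mass\<close>. After
  rescaling, \<open>g\<close> is evaluated at points tending to \<open>fst p\<close>, so continuity
  is required at \<open>fst p\<close> only; the bad pairs form a null set times the whole space, and
  dominated convergence applies.\<close>

lemma heat_pairing_limit:
  fixes f g :: "'a::euclidean_space \<Rightarrow> real"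
  assumes f: "integrable lborel f" and [measurable]: "g \<in> borel_measurable borel"
    and gb: "\<And>x. \<bar>g x\<bar> \<le> M"
    and ae: "AE x in lborel. isCont g x"
  shows "(\<lambda>n. LINT p|lborel. f (fst p) * g (snd p) * heat (1 / real (Suc n)) (fst p - snd p))
     \<longlonglongrightarrow> heat_mass TYPE('a) * (LINT x|lborel. f x * g x)"
proof -
  note [measurable] = borel_measurable_integrable[OF f]
  have M: "M \<ge> 0" using gb[of 0] by linarith
  let ?t = "\<lambda>n. 1 / real (Suc n)"
  let ?s = "\<lambda>n. sqrt (?t n)"
  let ?h = "\<lambda>n p. f (fst p) * g (fst p - ?s n *\<^sub>R snd p) * heat 1 (snd p)"
  have fh: "integrable lborel (\<lambda>p::'a\<times>'a. f (fst p) * heat 1 (snd p))"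
    by (rule integral_lborel_pair_mult(1)[OF f integrable_heat]) simp
  have mh[measurable]: "?h n \<in> borel_measurable lborel" for n
    by (subst lborel_prod[symmetric]) measurable
  have hb: "norm (?h n p) \<le> M * norm (f (fst p) * heat 1 (snd p))" for n p
    using mult_right_mono[OF gb, of "\<bar>f (fst p)\<bar> * \<bar>heat 1 (snd p)\<bar>" "fst p - ?s n *\<^sub>R snd p"]
    by (simp add: abs_mult mult_ac)
  have ih: "integrable lborel (?h n)" for n
    by (rule Bochner_Integration.integrable_bound[where f="\<lambda>p. M * (f (fst p) * heat 1 (snd p))", OF _ mh])
      (use fh in simp, use hb M in \<open>auto simp: abs_mult\<close>)
  \<comment> \<open>The substitution y = x - sqrt t z moves the parameter out of the kernel and into
    the argument of \<open>g\<close>, which leaves a dominating function independent of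
    \<open>n\<close>.\<close>
  have eq: "(LINT p|lborel. f (fst p) * g (snd p) * heat (?t n) (fst p - snd p)) = (LINT p|lborel. ?h n p)" for n
  proof -
    have s: "?s n > 0" by simp
    have m1: "(\<lambda>p. f (fst p) * g (snd p) * heat (?t n) (fst p - snd p)) \<in> borel_measurable lborel"
      by (subst lborel_prod[symmetric]) measurable
    have inner: "(LINT y|lborel. f x * g y * heat (?t n) (x - y)) = (LINT z|lborel. f x * g (x - ?s n *\<^sub>R z) * heat 1 z)" for x
    proof -
      have "(LINT y|lborel. f x * g y * heat (?t n) (x - y)) =
         \<bar>- ?s n\<bar> ^ DIM('a) *\<^sub>R (LINT z|lborel. f x * g (x + (- ?s n) *\<^sub>R z) * heat (?t n) (x - (x + (- ?s n) *\<^sub>R z)))"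
        by (rule lborel_integral_affine) (use s in simp)
      also have "\<dots> = (LINT z|lborel. f x * g (x - ?s n *\<^sub>R z) * (?s n ^ DIM('a) * heat (?t n) (?s n *\<^sub>R z)))"
        unfolding real_scaleR_def Bochner_Integration.integral_mult_right_zero[symmetric]
        by (intro Bochner_Integration.integral_cong refl) simp
      also have "\<dots> = (LINT z|lborel. f x * g (x - ?s n *\<^sub>R z) * heat 1 z)"
        by (subst heat_scale) simp_all
      finally show ?thesis .
    qed
    have i1: "integrable (lborel \<Otimes>\<^sub>M lborel) (\<lambda>(x,y). f x * g y * heat (?t n) (x - y))"
    proof (rule lborel_pair.Fubini_integrable)
      show "(\<lambda>(x,y). f x * g y * heat (?t n) (x - y)) \<in> borel_measurable (lborel \<Otimes>\<^sub>M lborel)" by measurable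
      have k: "integrable lborel (\<lambda>y::'a. heat (?t n) (x - y))" for x
        using lborel_integrable_affine[OF integrable_heat[of "?t n"], of "-1" x] by simp
      have pb: "norm (f x * g y * heat (?t n) (x - y)) \<le> norm (f x) * (M * heat (?t n) (x - y))" for x y
        using mult_left_mono[OF gb, of "\<bar>f x\<bar> * heat (?t n) (x - y)" y] by (simp add: abs_mult heat_nonneg mult_ac)
      have "integrable lborel (\<lambda>y. norm (f x) * (M * heat (?t n) (x - y)))" for x using k by simp
      then show i: "AE x in lborel. integrable lborel (\<lambda>y. case (x, y) of (x,y) \<Rightarrow> f x * g y * heat (?t n) (x - y))"
        by (intro AE_I2, unfold case_prod_conv)
          (rule Bochner_Integration.integrable_bound[where f="\<lambda>y. norm (f x) * (M * heat (?t n) (x - y))" for x],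
           assumption, use pb[THEN order_trans, OF abs_ge_self] in auto)
      have "integrable lborel (\<lambda>x. norm (f x) * (M * (LINT z|lborel. heat (?t n) (z::'a))))" using f by simp
      then show "integrable lborel (\<lambda>x. LINT y|lborel. norm (case (x, y) of (x,y) \<Rightarrow> f x * g y * heat (?t n) (x - y)))"
      proof (rule Bochner_Integration.integrable_bound)
        show "AE x in lborel. norm (LINT y|lborel. norm (case (x, y) of (x,y) \<Rightarrow> f x * g y * heat (?t n) (x - y)))
           \<le> norm (norm (f x) * (M * (LINT z|lborel. heat (?t n) (z::'a))))"
        proof (rule AE_I2)
          fix x
          have "(LINT y|lborel. norm (f x * g y * heat (?t n) (x - y))) \<le> (LINT y|lborel. norm (f x) * (M * heat (?t n) (x - y)))"
            using k by (intro Bochner_Integration.integral_mono_AE' AE_I2 pb mult_nonneg_nonneg M heat_nonneg norm_ge_zero) simp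
          also have "\<dots> = norm (f x) * (M * (LINT y|lborel. heat (?t n) (x - y)))" by simp
          also have "(LINT y|lborel. heat (?t n) (x - y)) = (LINT z|lborel. heat (?t n) (z::'a))"
            using lborel_integral_affine[of "-1" "heat (?t n)" x] by simp
          finally have "(LINT y|lborel. norm (f x * g y * heat (?t n) (x - y))) \<le> norm (f x) * (M * (LINT z|lborel. heat (?t n) (z::'a)))" .
          moreover have "0 \<le> (LINT y|lborel. norm (f x * g y * heat (?t n) (x - y)))"
            by (rule Bochner_Integration.integral_nonneg) (rule norm_ge_zero)
          ultimately show "norm (LINT y|lborel. norm (case (x, y) of (x,y) \<Rightarrow> f x * g y * heat (?t n) (x - y)))
           \<le> norm (norm (f x) * (M * (LINT z|lborel. heat (?t n) (z::'a))))"
            unfolding case_prod_conv real_norm_def by linarith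
        qed
      qed measurable
    qed
    have i2: "integrable (lborel \<Otimes>\<^sub>M lborel) (\<lambda>(x,z). f x * g (x - ?s n *\<^sub>R z) * heat 1 z)"
      using ih[of n] by (simp add: lborel_prod case_prod_unfold)
    show ?thesis
      using lborel_pair.integral_fst[OF i1] lborel_pair.integral_fst[OF i2] inner
      by (simp add: lborel_prod case_prod_unfold)
  qed
  have "(\<lambda>n. LINT p|lborel. ?h n p) \<longlonglongrightarrow> (LINT p|lborel. f (fst p) * g (fst p) * heat 1 (snd p :: 'a))"
  proof (rule integral_dominated_convergence[where w="\<lambda>p. M * norm (f (fst p) * heat 1 (snd p))"])
    show "(\<lambda>p. f (fst p) * g (fst p) * heat 1 (snd p)) \<in> borel_measurable lborel"
      by (subst lborel_prod[symmetric]) measurable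
    show "integrable lborel (\<lambda>p::'a\<times>'a. M * norm (f (fst p) * heat 1 (snd p)))" using fh by simp
    show "AE p in lborel. norm (?h n p) \<le> M * norm (f (fst p) * heat 1 (snd p))" for n
      by (rule AE_I2) (rule hb)
    have "AE p in lborel \<Otimes>\<^sub>M (lborel::'a measure). isCont g (fst p)"
    proof -
      obtain N where N: "{x. \<not> isCont g x} \<subseteq> N" "N \<in> null_sets lborel" 
        using ae by (auto elim!: AE_E simp: null_sets_def)
      then have [measurable]: "N \<in> sets borel" by auto
      have "AE x in lborel. AE y in (lborel::'a measure). x \<notin> N"
        using AE_not_in[OF N(2)] by (elim eventually_mono) auto
      moreover have "Measurable.pred (lborel \<Otimes>\<^sub>M (lborel::'a measure)) (\<lambda>p. fst p \<notin> N)"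
        by measurable
      ultimately have "AE p in lborel \<Otimes>\<^sub>M (lborel::'a measure). fst p \<notin> N"
        by (intro lborel_pair.AE_pair_measure) (auto simp: pred_def)
      then show ?thesis by (rule eventually_mono) (use N(1) in auto)
    qed
    then show "AE p in lborel. (\<lambda>n. ?h n p) \<longlonglongrightarrow> f (fst p) * g (fst p) * heat 1 (snd p)"
      unfolding lborel_prod
    proof (rule eventually_mono)
      fix p :: "'a \<times> 'a" assume c: "isCont g (fst p)"
      have "(\<lambda>n. ?s n) \<longlonglongrightarrow> sqrt 0"
        by (intro tendsto_real_sqrt LIMSEQ_inverse_real_of_nat[unfolded inverse_eq_divide])
      then have "(\<lambda>n. fst p - ?s n *\<^sub>R snd p) \<longlonglongrightarrow> fst p - sqrt 0 *\<^sub>R snd p"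
        by (rule tendsto_diff[OF tendsto_const tendsto_scaleR[OF _ tendsto_const]])
      then have "(\<lambda>n. g (fst p - ?s n *\<^sub>R snd p)) \<longlonglongrightarrow> g (fst p)"
        using isCont_tendsto_compose[OF c, of "\<lambda>n. fst p - ?s n *\<^sub>R snd p"] by simp
      then show "(\<lambda>n. ?h n p) \<longlonglongrightarrow> f (fst p) * g (fst p) * heat 1 (snd p)"
        by (intro tendsto_intros)
    qed
  qed (rule mh)
  also have "(LINT p|lborel. f (fst p) * g (fst p) * heat 1 (snd p :: 'a)) = heat_mass TYPE('a) * (LINT x|lborel. f x * g x)"
  proof -
    have "integrable lborel (\<lambda>x. f x * g x)"
      by (rule Bochner_Integration.integrable_bound[where f="\<lambda>x. M * f x"])
        (use f M mult_left_mono[OF gb abs_ge_zero] in \<open>auto simp: abs_mult mult.commute[of M] intro!: AE_I2\<close>)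
    from integral_lborel_pair_mult(2)[OF this integrable_heat[of 1]] show ?thesis
      by (simp add: heat_mass_def mult.commute[of "integral\<^sup>L lborel (heat 1)"])
  qed
  finally show ?thesis unfolding eq .
qed

text \<open>Damping by a Gaussian only decreases the frequency integral, while the damped pairing
  tends to the left-hand side by \<open>heat_pairing_limit\<close>. Almost everywhere continuity is
  what that limit asks for and what functions cut off at a sphere provide.\<close>

lemma plancherel_inequality:
  fixes f :: "'a::euclidean_space \<Rightarrow> real"
  assumes [measurable]: "f \<in> borel_measurable borel" and b: "\<And>x. \<bar>f x\<bar> \<le> M"
    and supp: "\<And>x. norm x \<ge> R \<Longrightarrow> f x = 0"
    and ae: "AE x in lborel. isCont f x"
    and int: "integrable lborel (\<lambda>\<xi>. (cmod (ft f \<xi>))\<^sup>2)"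
  shows "heat_mass TYPE('a) * (LINT x|lborel. (f x)\<^sup>2) \<le> (LINT \<xi>|lborel. (cmod (ft f \<xi>))\<^sup>2)"
proof -
  have f: "integrable lborel f" by (rule integrable_bounded_in_ball[OF _ b supp]) auto
  have le: "(LINT p|lborel. f (fst p) * f (snd p) * heat (1 / real (Suc n)) (fst p - snd p)) \<le> (LINT \<xi>|lborel. (cmod (ft f \<xi>))\<^sup>2)" for n
  proof -
    let ?t = "1 / real (Suc n)"
    have "complex_of_real (LINT p|lborel. f (fst p) * f (snd p) * heat ?t (fst p - snd p)) =
      (LINT \<xi>|lborel. of_real (exp (- ?t * (norm \<xi>)\<^sup>2)) * ft f \<xi> * cnj (ft f \<xi>))"
      by (rule gaussian_pairing(1)[OF f f, symmetric]) simp
    also have "\<dots> = (LINT \<xi>|lborel. complex_of_real (exp (- ?t * (norm \<xi>)\<^sup>2) * (cmod (ft f \<xi>))\<^sup>2))"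
      by (simp add: mult.assoc complex_norm_square[symmetric] del: of_real_power)
    also have "\<dots> = of_real (LINT \<xi>|lborel. exp (- ?t * (norm \<xi>)\<^sup>2) * (cmod (ft f \<xi>))\<^sup>2)"
      by (rule integral_complex_of_real)
    finally have "(LINT p|lborel. f (fst p) * f (snd p) * heat ?t (fst p - snd p)) =
       (LINT \<xi>|lborel. exp (- ?t * (norm \<xi>)\<^sup>2) * (cmod (ft f \<xi>))\<^sup>2)"
      by (simp only: of_real_eq_iff)
    also have "\<dots> \<le> (LINT \<xi>|lborel. (cmod (ft f \<xi>))\<^sup>2)"
      by (rule Bochner_Integration.integral_mono_AE'[OF int]) (auto intro!: AE_I2 mult_left_le_one_le)
    finally show ?thesis .
  qed
  show ?thesis
    using LIMSEQ_le_const2[OF heat_pairing_limit[OF f _ b ae]] le by (auto simp: power2_eq_square)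
qed

section \<open>Riesz potentials of powers of the distance to the sphere\<close>

lemma nn_integral_inverse_interval:
  assumes "0 < a" "a < b"
  shows "(\<integral>\<^sup>+k. ennreal (1 / k) * indicator {a..b} k \<partial>lborel) = ennreal (ln (b / a))"
proof -
  have "(\<integral>\<^sup>+k. ennreal (1 / k) * indicator {a..b} k \<partial>lborel) = ennreal (ln b - ln a)"
    by (rule nn_integral_FTC_Icc[where F=ln]) (use assms in \<open>auto intro!: derivative_eq_intros\<close>)
  then show ?thesis using assms by (simp add: ln_div)
qed

text \<open>Integration in polar coordinates, with the sphere thickened to the shell \<open>1 \<le> |z| \<le> e\<close>.\<close>
lemma nn_integral_shell:
  fixes F :: "'a::euclidean_space \<Rightarrow> ennreal"
  assumes [measurable]: "F \<in> borel_measurable borel"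
  shows "(\<integral>\<^sup>+x. F x \<partial>lborel) =
    (\<integral>\<^sup>+z. indicator {z. 1 \<le> norm z \<and> norm z \<le> exp 1} z *
      (\<integral>\<^sup>+k. ennreal (k ^ (DIM('a) - 1)) * F (k *\<^sub>R z) * indicator {0<..} k \<partial>lborel) \<partial>(lborel::'a measure))"
proof -
  let ?A = "{z::'a. 1 \<le> norm z \<and> norm z \<le> exp 1}"
  have [measurable]: "?A \<in> sets borel" by measurable
  \<comment> \<open>The measure \<open>dk / k\<close> of those \<open>k\<close> that put
    \<open>x / k\<close> into the shell is ln e = 1. Inserting this 1, exchanging the integrals and
    substituting x = k z gives polar coordinates without a surface measure; the factor
    \<open>1 / k\<close> lowers the Jacobian to \<open>k ^ (DIM('a) - 1)\<close>.\<close>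
  have w: "(\<integral>\<^sup>+k. ennreal (1 / k) * indicator {norm x / exp 1..norm x} k \<partial>lborel) = 1" if "x \<noteq> 0" for x :: 'a
  proof -
    have "norm x / exp 1 < norm x" using that by (simp add: field_simps)
    then show ?thesis
      using that by (subst nn_integral_inverse_interval) auto
  qed
  have [measurable]: "Measurable.pred borel (\<lambda>x::'a. k \<in> {norm x / exp 1..norm x})" for k
    unfolding atLeastAtMost_iff by measurable
  have "Measurable.pred (borel \<Otimes>\<^sub>M borel) (\<lambda>p. fst p \<in> {norm (snd p :: 'a) / exp 1..norm (snd p)})"
    unfolding atLeastAtMost_iff by measurable
  then have [measurable]: "Measurable.pred (lborel \<Otimes>\<^sub>M lborel) (\<lambda>p. fst p \<in> {norm (snd p :: 'a) / exp 1..norm (snd p)})"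
    by (simp cong: measurable_cong_sets sets_pair_measure_cong)
  have "Measurable.pred (borel \<Otimes>\<^sub>M borel) (\<lambda>p. snd p \<in> {norm (fst p :: 'a) / exp 1..norm (fst p)})"
    unfolding atLeastAtMost_iff by measurable
  then have [measurable]: "Measurable.pred (lborel \<Otimes>\<^sub>M lborel) (\<lambda>p. snd p \<in> {norm (fst p :: 'a) / exp 1..norm (fst p)})"
    by (simp cong: measurable_cong_sets sets_pair_measure_cong)
  have "(\<integral>\<^sup>+x. F x \<partial>lborel) =
     (\<integral>\<^sup>+x. (\<integral>\<^sup>+k. F x * (ennreal (1 / k) * indicator {norm x / exp 1..norm x} k) * indicator {0<..} k \<partial>lborel) \<partial>lborel)"
  proof (rule nn_integral_cong_AE)
    have "AE x::'a in lborel. x \<noteq> 0" by (rule AE_lborel_singleton)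
    then show "AE x in lborel. F x = (\<integral>\<^sup>+k. F x * (ennreal (1 / k) * indicator {norm x / exp 1..norm x} k) * indicator {0<..} k \<partial>lborel)"
    proof (rule eventually_mono)
      fix x :: 'a assume x: "x \<noteq> 0"
      have "(\<integral>\<^sup>+k. F x * (ennreal (1 / k) * indicator {norm x / exp 1..norm x} k) * indicator {0<..} k \<partial>lborel)
        = (\<integral>\<^sup>+k. F x * (ennreal (1 / k) * indicator {norm x / exp 1..norm x} k) \<partial>lborel)"
      proof (rule nn_integral_cong)
        fix k :: real
        have "0 < norm x / exp 1" using x by simp
        then show "F x * (ennreal (1 / k) * indicator {norm x / exp 1..norm x} k) * indicator {0<..} k =
          F x * (ennreal (1 / k) * indicator {norm x / exp 1..norm x} k)"
          by (auto simp: indicator_def simp del: zero_less_divide_iff)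
      qed
      then show "F x = (\<integral>\<^sup>+k. F x * (ennreal (1 / k) * indicator {norm x / exp 1..norm x} k) * indicator {0<..} k \<partial>lborel)"
        using w[OF x] by (simp add: nn_integral_cmult)
    qed
  qed
  also have "\<dots> = (\<integral>\<^sup>+k. (\<integral>\<^sup>+x. F x * (ennreal (1 / k) * indicator {norm x / exp 1..norm x} k) * indicator {0<..} k \<partial>lborel) \<partial>lborel)"
    by (rule lborel_pair.Fubini') measurable
  also have "\<dots> = (\<integral>\<^sup>+k. (\<integral>\<^sup>+z. indicator ?A z * (ennreal (k ^ (DIM('a) - 1)) * F (k *\<^sub>R z) * indicator {0<..} k) \<partial>lborel) \<partial>lborel)"
  proof (rule nn_integral_cong)
    fix k :: real
    show "(\<integral>\<^sup>+x. F x * (ennreal (1 / k) * indicator {norm x / exp 1..norm x} k) * indicator {0<..} k \<partial>lborel) =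
      (\<integral>\<^sup>+z. indicator ?A z * (ennreal (k ^ (DIM('a) - 1)) * F (k *\<^sub>R z) * indicator {0<..} k) \<partial>lborel)"
    proof (cases "k > 0")
      case True
      define H where "H x = F x * (ennreal (1 / k) * indicator {norm x / exp 1..norm x} k) * indicator {0<..} k" for x
      have [measurable]: "H \<in> borel_measurable borel" unfolding H_def by measurable
      have "(\<integral>\<^sup>+x. H x \<partial>lborel) = ennreal (\<bar>k\<bar> ^ DIM('a)) * (\<integral>\<^sup>+z. H (0 + k *\<^sub>R z) \<partial>lborel)"
        by (rule nn_integral_lborel_affine) (use True in simp_all)
      also have "\<dots> = (\<integral>\<^sup>+z. ennreal (k ^ DIM('a)) * H (k *\<^sub>R z) \<partial>lborel)"
        using True by (subst nn_integral_cmult) auto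
      finally have "(\<integral>\<^sup>+x. F x * (ennreal (1 / k) * indicator {norm x / exp 1..norm x} k) * indicator {0<..} k \<partial>lborel) = \<dots>"
        unfolding H_def .
      also have "\<dots> = (\<integral>\<^sup>+z. ennreal (k ^ DIM('a)) * (F (k *\<^sub>R z) * (ennreal (1 / k) * indicator {norm (k *\<^sub>R z) / exp 1..norm (k *\<^sub>R z)} k) * indicator {0<..} k) \<partial>lborel)"
        unfolding H_def ..
      also have "\<dots> = (\<integral>\<^sup>+z. indicator ?A z * (ennreal (k ^ (DIM('a) - 1)) * F (k *\<^sub>R z) * indicator {0<..} k) \<partial>lborel)"
      proof (rule nn_integral_cong)
        fix z :: 'a
        have 1: "indicator {norm (k *\<^sub>R z) / exp 1..norm (k *\<^sub>R z)} k = (indicator ?A z :: ennreal)"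
          using True by (auto simp: indicator_def field_simps)
        have "k ^ DIM('a) * (1 / k) = k ^ (DIM('a) - 1)"
          using True by (simp add: power_diff)
        then have 2: "ennreal (k ^ DIM('a)) * ennreal (1 / k) = ennreal (k ^ (DIM('a) - 1))"
          using True by (metis ennreal_mult' less_eq_real_def zero_le_power)
        show "ennreal (k ^ DIM('a)) * (F (k *\<^sub>R z) * (ennreal (1 / k) * indicator {norm (k *\<^sub>R z) / exp 1..norm (k *\<^sub>R z)} k) * indicator {0<..} k)
          = indicator ?A z * (ennreal (k ^ (DIM('a) - 1)) * F (k *\<^sub>R z) * indicator {0<..} k)"
          unfolding 1 2[symmetric] by (simp add: mult_ac)
      qed
      finally show ?thesis .
    qed simp
  qed
  also have "\<dots> = (\<integral>\<^sup>+z. (\<integral>\<^sup>+k. indicator ?A z * (ennreal (k ^ (DIM('a) - 1)) * F (k *\<^sub>R z) * indicator {0<..} k) \<partial>lborel) \<partial>lborel)"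
    by (rule lborel_pair.Fubini') measurable
  also have "\<dots> = (\<integral>\<^sup>+z. indicator ?A z * (\<integral>\<^sup>+k. ennreal (k ^ (DIM('a) - 1)) * F (k *\<^sub>R z) * indicator {0<..} k \<partial>lborel) \<partial>lborel)"
    by (intro nn_integral_cong nn_integral_cmult) measurable
  finally show ?thesis .
qed

text \<open>Substitution on compact subintervals passes to the open interval by monotone
  convergence. This admits integrands and derivatives that blow up at the endpoints, and an
  unbounded image.\<close>

lemma nn_integral_substitution_open:
  fixes g g' :: "real \<Rightarrow> real" and F :: "real \<Rightarrow> ennreal"
  assumes [measurable]: "F \<in> borel_measurable borel"
    and deriv: "\<And>w. w \<in> {0<..<1} \<Longrightarrow> (g has_real_derivative g' w) (at w)"
    and cont: "continuous_on {0<..<1} g'"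
    and pos: "\<And>w. w \<in> {0<..<1} \<Longrightarrow> g' w > 0"
    and img: "g ` {0<..<1} = S" and [measurable]: "S \<in> sets borel"
  shows "(\<integral>\<^sup>+x. F x * indicator S x \<partial>lborel) = (\<integral>\<^sup>+w. F (g w) * ennreal (g' w) * indicator {0<..<1} w \<partial>lborel)"
proof -
  \<comment> \<open>The offset 3 makes even the first interval, from 1/3 to 2/3,
    nondegenerate.\<close>
  define a b :: "nat \<Rightarrow> real" where "a n = 1 / (real n + 3)" and "b n = 1 - 1 / (real n + 3)" for n
  have ab: "0 < a n" "a n < b n" "b n < 1" for n by (auto simp: a_def b_def field_simps)
  have mono: "a n \<le> a m" "b m \<le> b n" if "m \<le> n" for m n using that by (auto simp: a_def b_def field_simps)
  have gmono: "g x < g y" if "0 < x" "x < y" "y < 1" for x y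
    by (rule DERIV_pos_imp_increasing[OF that(2)]) (use deriv pos that in force)
  have UA: "(\<Union>n. {a n..b n}) = {0<..<1}"
  proof (intro equalityI subsetI)
    fix x :: real assume x: "x \<in> {0<..<1}"
    obtain n where n: "1 / x < real n" "1 / (1 - x) < real n" 
      using reals_Archimedean2[of "max (1/x) (1/(1-x))"] by auto
    then have "x \<in> {a n..b n}" using x by (auto simp: a_def b_def field_simps)
    then show "x \<in> (\<Union>n. {a n..b n})" by blast
  qed (use ab in \<open>auto intro: less_le_trans le_less_trans\<close>)
  have US: "(\<Union>n. {g (a n)..g (b n)}) = S"
  proof (intro equalityI subsetI)
    fix y assume "y \<in> (\<Union>n. {g (a n)..g (b n)})"
    then obtain n where n: "g (a n) \<le> y" "y \<le> g (b n)" by auto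
    have "continuous_on {a n..b n} g" using deriv ab[of n]
      by (intro continuous_at_imp_continuous_on ballI DERIV_isCont[OF deriv]) auto
    then obtain x where "a n \<le> x" "x \<le> b n" "g x = y" using IVT'[of g "a n" y "b n"] n ab[of n] by auto
    then show "y \<in> S" using img ab[of n] by force
  next
    fix y assume "y \<in> S"
    then obtain x where x: "x \<in> {0<..<1}" "y = g x" using img by auto
    then have "x \<in> (\<Union>n. {a n..b n})" unfolding UA by simp
    then obtain n where "a n \<le> x" "x \<le> b n" by auto
    then have "g (a n) \<le> y" "y \<le> g (b n)" using x ab[of n] gmono[of "a n" x] gmono[of x "b n"] by (auto simp: less_le)
    then show "y \<in> (\<Union>n. {g (a n)..g (b n)})" by auto
  qed
  have lim: "(\<integral>\<^sup>+x. H x * indicator (\<Union>n. C n) x \<partial>lborel) = (SUP n. \<integral>\<^sup>+x. H x * indicator (C n) x \<partial>lborel)"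
    if [measurable]: "H \<in> borel_measurable borel" "\<And>n. C n \<in> sets borel" and inc: "incseq C" for H :: "real \<Rightarrow> ennreal" and C :: "nat \<Rightarrow> real set"
    using SUP_emeasure_incseq[of C "density lborel H"] inc
    by (simp add: emeasure_density image_subset_iff)
  have step: "(\<integral>\<^sup>+x. F x * indicator {g (a n)..g (b n)} x \<partial>lborel) = (\<integral>\<^sup>+w. F (g w) * ennreal (g' w) * indicator {a n..b n} w \<partial>lborel)" for n
  proof (rule nn_integral_substitution_aux)
    show "x \<in> {a n..b n} \<Longrightarrow> 0 \<le> g' x" for x using pos[of x] ab[of n] by auto
  qed (use ab[of n] in \<open>auto intro!: deriv continuous_on_subset[OF cont]\<close>)
  have gm: "(\<lambda>w. F (g w) * ennreal (g' w) * indicator {0<..<1} w) \<in> borel_measurable borel"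
  proof -
    have 1: "(\<lambda>w. indicator {0<..<1} w *\<^sub>R g w) \<in> borel_measurable borel"
      by (intro borel_measurable_continuous_on_indicator continuous_at_imp_continuous_on ballI DERIV_isCont[OF deriv]) auto
    have 2: "(\<lambda>w. indicator {0<..<1} w *\<^sub>R g' w) \<in> borel_measurable borel"
      by (intro borel_measurable_continuous_on_indicator cont) auto
    have "(\<lambda>w. F (indicator {0<..<1} w *\<^sub>R g w) * ennreal (indicator {0<..<1} w *\<^sub>R g' w) * indicator {0<..<1} w) \<in> borel_measurable borel"
      using 1 2 by measurable
    also have "(\<lambda>w. F (indicator {0<..<1} w *\<^sub>R g w) * ennreal (indicator {0<..<1} w *\<^sub>R g' w) * indicator {0<..<1} w) = (\<lambda>w. F (g w) * ennreal (g' w) * indicator {0<..<1} w)"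
      by (auto simp: indicator_def fun_eq_iff)
    finally show ?thesis .
  qed
  have "(\<integral>\<^sup>+x. F x * indicator S x \<partial>lborel) = (SUP n. \<integral>\<^sup>+x. F x * indicator {g (a n)..g (b n)} x \<partial>lborel)"
    unfolding US[symmetric]
  proof (rule lim)
    show "incseq (\<lambda>n. {g (a n)..g (b n)})"
    proof (rule incseq_SucI)
      fix n
      have "g (a (Suc n)) \<le> g (a n)" "g (b n) \<le> g (b (Suc n))"
        using gmono[of "a (Suc n)" "a n"] gmono[of "b n" "b (Suc n)"] ab[of n] ab[of "Suc n"] mono[of n "Suc n"]
        by (cases "a (Suc n) = a n"; cases "b n = b (Suc n)"; force)+
      then show "{g (a n)..g (b n)} \<subseteq> {g (a (Suc n))..g (b (Suc n))}" by auto
    qed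
  qed auto
  also have "\<dots> = (SUP n. \<integral>\<^sup>+w. (F (g w) * ennreal (g' w) * indicator {0<..<1} w) * indicator {a n..b n} w \<partial>lborel)"
    unfolding step
  proof (intro SUP_cong refl nn_integral_cong)
    fix n w
    show "F (g w) * ennreal (g' w) * indicator {a n..b n} w = F (g w) * ennreal (g' w) * indicator {0<..<1} w * indicator {a n..b n} w"
      using ab[of n] by (cases "w \<in> {a n..b n}") auto
  qed
  also have "\<dots> = (\<integral>\<^sup>+w. (F (g w) * ennreal (g' w) * indicator {0<..<1} w) * indicator (\<Union>n. {a n..b n}) w \<partial>lborel)"
  proof (rule lim[OF gm, symmetric])
    show "incseq (\<lambda>n. {a n..b n})"
    proof (rule incseq_SucI)
      show "{a n..b n} \<subseteq> {a (Suc n)..b (Suc n)}" for n using mono[of n "Suc n"] by auto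
    qed
  qed auto
  also have "\<dots> = (\<integral>\<^sup>+w. F (g w) * ennreal (g' w) * indicator {0<..<1} w \<partial>lborel)"
    unfolding UA by (intro nn_integral_cong) (auto simp: indicator_def)
  finally show ?thesis .
qed

text \<open>For 0 < \<beta> < 1 this is Euler's Beta integral B(\<beta>, 1 - \<beta>) = pi / sin (pi
  \<beta>).\<close>

definition chord_const :: "real \<Rightarrow> ennreal" where
  "chord_const \<beta> = (\<integral>\<^sup>+q. ennreal (q powr (\<beta> - 1) / (1 + q)) * indicator {0<..} q \<partial>lborel)"

text \<open>The two bounds on \<beta> correspond to the two ends: near 0 the integrand is at most
  q^(\<beta> - 1), near infinity at most q^(\<beta> - 2).\<close>

lemma chord_const_finite:
  assumes "0 < \<beta>" "\<beta> < 1"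
  shows "chord_const \<beta> < \<infinity>"
proof -
  have 1: "(\<integral>\<^sup>+q. ennreal (q powr (\<beta> - 1)) * indicator {0..1} q \<partial>lborel) = ennreal (1 powr (\<beta> - 1 + 1) / (\<beta> - 1 + 1))"
    by (rule nn_integral_has_integral_lebesgue'[OF _ has_integral_powr_from_0]) (use assms in auto)
  have 2: "(\<integral>\<^sup>+q. ennreal (q powr (\<beta> - 2)) * indicator {1..} q \<partial>lborel) = ennreal (- (1 powr (\<beta> - 2 + 1)) / (\<beta> - 2 + 1))"
    by (rule nn_integral_has_integral_lebesgue'[OF _ has_integral_powr_to_inf]) (use assms in auto)
  have "chord_const \<beta> \<le> (\<integral>\<^sup>+q. (ennreal (q powr (\<beta> - 1)) * indicator {0..1} q + ennreal (q powr (\<beta> - 2)) * indicator {1..} q) \<partial>lborel)"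
    unfolding chord_const_def
  proof (rule nn_integral_mono)
    fix q :: real
    have a: "q powr (\<beta> - 1) / (1 + q) \<le> q powr (\<beta> - 1)" if "0 < q"
      using that by (simp add: field_simps mult_left_mono)
    have b: "q powr (\<beta> - 1) / (1 + q) \<le> q powr (\<beta> - 2)" if "1 < q"
    proof -
      have "q powr (\<beta> - 1) = q powr (\<beta> - 2) * q"
        using that powr_add[of q "\<beta> - 2" 1] by simp
      then show ?thesis using that by (simp add: field_simps mult_left_mono)
    qed
    show "ennreal (q powr (\<beta> - 1) / (1 + q)) * indicator {0<..} q \<le> ennreal (q powr (\<beta> - 1)) * indicator {0..1} q + ennreal (q powr (\<beta> - 2)) * indicator {1..} q"
    proof (cases "q \<le> 1")
      case True
      have "ennreal (q powr (\<beta> - 1) / (1 + q)) * indicator {0<..} q \<le> ennreal (q powr (\<beta> - 1)) * indicator {0..1} q"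
        using a True by (cases "0 < q") (auto intro!: ennreal_leI)
      then show ?thesis by (rule order_trans) simp
    next
      case False
      then have "ennreal (q powr (\<beta> - 1) / (1 + q)) * indicator {0<..} q \<le> ennreal (q powr (\<beta> - 2)) * indicator {1..} q"
        using b by (auto intro!: ennreal_leI)
      then show ?thesis by (rule order_trans) simp
    qed
  qed
  also have "\<dots> < \<infinity>"
    by (subst nn_integral_add) (simp_all add: 1 2)
  finally show ?thesis .
qed

text \<open>
  The substitutions are \<open>x = 2abw/((a+b) - (b-a)w)\<close> on the first half of the chord, its mirror image
  on the second half, and \<open>q = (1-e\<^sup>2)w\<^sup>2/(1-w\<^sup>2)\<close>, \<open>e = (b-a)/(a+b)\<close>, on the right-hand side.
\<close>
lemma chord_integral:
  assumes a: "0 < a" and b: "0 < b" and \<beta>: "0 < \<beta>" "\<beta> < 1"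
  shows "(\<integral>\<^sup>+x. ennreal (((b - x) * (a + x)) powr (-\<beta>) * x powr (2*\<beta> - 1)) * indicator {0<..<b} x \<partial>lborel)
     + (\<integral>\<^sup>+x. ennreal (((a - x) * (b + x)) powr (-\<beta>) * x powr (2*\<beta> - 1)) * indicator {0<..<a} x \<partial>lborel)
     = chord_const \<beta>"
proof -
  define T where "T a b w = ((4*a*b/(a+b)\<^sup>2) powr \<beta> * (1 - w\<^sup>2) powr (-\<beta>) * w powr (2*\<beta>-1) / (1 - ((b-a)/(a+b)) * w))" for a b w :: real
  have half: "(\<integral>\<^sup>+x. ennreal (((b - x) * (a + x)) powr (-\<beta>) * x powr (2*\<beta> - 1)) * indicator {0<..<b} x \<partial>lborel)
      = (\<integral>\<^sup>+w. ennreal (T a b w) * indicator {0<..<1} w \<partial>lborel)" if a: "0 < a" and b: "0 < b" for a b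
  proof -
    let ?D = "\<lambda>w. (a + b) - (b - a) * w"
    have D: "?D w > 0" if "0 < w" "w < 1" for w
    proof -
      have "?D w = a * (1 + w) + b * (1 - w)" by (simp add: algebra_simps)
      then show ?thesis using that a b by (simp add: add_pos_pos)
    qed
    let ?g = "\<lambda>w. 2*a*b*w / ?D w" and ?g' = "\<lambda>w. 2*a*b*(a+b) / (?D w)\<^sup>2"
    have img: "?g ` {0<..<1} = {0<..<b}"
    proof (intro equalityI subsetI)
      fix y assume "y \<in> ?g ` {0<..<1}"
      then obtain w where w: "0 < w" "w < 1" "y = ?g w" by auto
      have "b - ?g w = b * (a+b) * (1 - w) / ?D w" using D[OF w(1,2)] by (simp add: field_simps)
      then have "b - ?g w > 0" using D[OF w(1,2)] w a b by simp
      then show "y \<in> {0<..<b}" using D[OF w(1,2)] w a b by simp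
    next
      fix y assume y: "y \<in> {0<..<b}"
      \<comment> \<open>The solution of \<open>?g w = y\<close>; the substitution is a fractional
        linear map, hence explicitly invertible.\<close>
      define w where "w = y * (a + b) / (2*a*b + (b - a) * y)"
      have p: "2*a*b + (b-a)*y > 0"
      proof -
        have "2*a*b + (b-a)*y = a * b + a * (b - y) + b * y" by (simp add: algebra_simps)
        moreover have "a * b > 0" "a * (b - y) > 0" "b * y > 0" using y a b by auto
        ultimately show ?thesis by linarith
      qed
      have "1 - w = 2 * a * (b - y) / (2*a*b + (b-a)*y)" using p by (simp add: w_def field_simps)
      moreover have "2 * a * (b - y) / (2*a*b + (b-a)*y) > 0" using y a p by simp
      ultimately have "w < 1" by linarith
      moreover have "0 < w" unfolding w_def using y a b p by simp
      ultimately have w: "0 < w" "w < 1" by auto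
      have "?g w = y"
      proof -
        have "?D w = (a+b) * (2*a*b) / (2*a*b + (b-a)*y)" using p by (simp add: w_def field_simps)
        then show ?thesis using a b p by (simp add: w_def)
      qed
      then show "y \<in> ?g ` {0<..<1}" using w by force
    qed
    have "(\<integral>\<^sup>+x. ennreal (((b - x) * (a + x)) powr (-\<beta>) * x powr (2*\<beta> - 1)) * indicator {0<..<b} x \<partial>lborel)
      = (\<integral>\<^sup>+w. ennreal (((b - ?g w) * (a + ?g w)) powr (-\<beta>) * ?g w powr (2*\<beta> - 1)) * ennreal (?g' w) * indicator {0<..<1} w \<partial>lborel)"
    proof (rule nn_integral_substitution_open[OF _ _ _ _ img])
      fix w :: real assume w: "w \<in> {0<..<1}"
      show "(?g has_real_derivative ?g' w) (at w)"
        using D[of w] w by (auto intro!: derivative_eq_intros simp: power2_eq_square field_simps)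
      show "?g' w > 0" using D[of w] w a b by simp
    next
      show "continuous_on {0<..<1} ?g'"
        by (intro continuous_intros) (use D in force)
    qed auto
    also have "\<dots> = (\<integral>\<^sup>+w. ennreal (T a b w) * indicator {0<..<1} w \<partial>lborel)"
    proof (rule nn_integral_cong)
      fix w :: real
      show "ennreal (((b - ?g w) * (a + ?g w)) powr (-\<beta>) * ?g w powr (2*\<beta> - 1)) * ennreal (?g' w) * indicator {0<..<1} w
         = ennreal (T a b w) * indicator {0<..<1} w"
      proof (cases "w \<in> {0<..<1}")
        case True
        then have w: "0 < w" "w < 1" and D: "?D w > 0" using D by auto
        define d where "d = ?D w"
        have d: "d > 0" using D d_def by simp
        have e1: "(b - ?g w) * (a + ?g w) = (a*b) * (a+b)\<^sup>2 * (1 - w\<^sup>2) / d\<^sup>2"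
        proof -
          have A: "b - ?g w = b * (a+b) * (1 - w) / d" and B: "a + ?g w = a * (a+b) * (1 + w) / d"
            using D unfolding d_def by (simp_all add: field_simps)
          show ?thesis unfolding A B by (simp add: power2_eq_square) (simp add: algebra_simps)
        qed
        have e2: "?g w = (2 * (a*b)) * w / d" by (simp add: d_def)
        have w2: "0 < 1 - w\<^sup>2" using w by (simp add: power_less_one_iff)
        have e4: "1 - ((b-a)/(a+b)) * w = d / (a+b)" using a b by (simp add: d_def field_simps)
        have "((b - ?g w) * (a + ?g w)) powr (-\<beta>) * ?g w powr (2*\<beta> - 1) * ?g' w = T a b w"
        proof -
          define p where "p = a*b"
          define c where "c = a+b"
          define v where "v = 1 - w\<^sup>2"
          have pos: "p > 0" "c > 0" "v > 0" using a b w2 by (simp_all add: p_def c_def v_def)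
          have "(p * c\<^sup>2 * v / d\<^sup>2) powr (-\<beta>) * ((2*p) * w / d) powr (2*\<beta> - 1) * (2 * p * c / d\<^sup>2)
             = (4*p/c\<^sup>2) powr \<beta> * v powr (-\<beta>) * w powr (2*\<beta>-1) / (d / c)"
          proof -
            \<comment> \<open>Taking logarithms turns the identity between products of powers into a
              linear one; \<open>ln_mult[of 2 2]\<close> supplies ln 4 = 2 ln 2.\<close>
            have "ln ((p * c\<^sup>2 * v / d\<^sup>2) powr (-\<beta>) * ((2*p) * w / d) powr (2*\<beta> - 1) * (2 * p * c / d\<^sup>2))
             = ln ((4*p/c\<^sup>2) powr \<beta> * v powr (-\<beta>) * w powr (2*\<beta>-1) / (d / c))"
              using pos d w ln_mult[of 2 2] by (simp add: ln_mult ln_div ln_powr ln_realpow algebra_simps)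
            then show ?thesis using pos d w by (subst (asm) ln_inj_iff) auto
          qed
          moreover have "?g' w = 2 * p * c / d\<^sup>2" by (simp add: p_def c_def d_def)
          ultimately show ?thesis
            unfolding e1 unfolding e2 T_def e4 by (simp only: p_def[symmetric] c_def[symmetric] v_def[symmetric] mult.assoc[of 4] )
        qed
        then show ?thesis
          using w a b D by (simp add: ennreal_mult''[symmetric])
      qed simp
    qed
    finally show ?thesis .
  qed
  \<comment> \<open>The position of the point on the chord enters through \<open>e\<close> alone,
    and exchanging \<open>a\<close> and \<open>b\<close> changes its sign. The two halves thus share
    the numerator and have the denominators \<open>1 - e * w\<close> and
    \<open>1 + e * w\<close>.\<close>
  define e where "e = (b-a)/(a+b)"
  have e: "\<bar>e\<bar> < 1" using a b by (simp add: e_def abs_if field_simps)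
  have e2: "4*a*b/(a+b)\<^sup>2 = 1 - e\<^sup>2"
  proof -
    have "1 - e\<^sup>2 = ((a+b)\<^sup>2 - (b-a)\<^sup>2) / (a+b)\<^sup>2" using a b unfolding e_def power_divide by (subst diff_divide_distrib) simp
    also have "(a+b)\<^sup>2 - (b-a)\<^sup>2 = 4*a*b" by (simp add: power2_eq_square algebra_simps)
    finally show ?thesis by simp
  qed
  have e2p: "1 - e\<^sup>2 > 0" unfolding e2[symmetric] using a b by simp
  have Tab: "T a b w = (1 - e\<^sup>2) powr \<beta> * (1 - w\<^sup>2) powr (-\<beta>) * w powr (2*\<beta>-1) / (1 - e * w)" for w
    by (simp add: T_def e2 e_def)
  have Tba: "T b a w = (1 - e\<^sup>2) powr \<beta> * (1 - w\<^sup>2) powr (-\<beta>) * w powr (2*\<beta>-1) / (1 + e * w)" for w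
  proof -
    have "(a-b)/(b+a) = - e" using a b by (simp add: e_def field_simps)
    moreover have "4*b*a/(b+a)\<^sup>2 = 1 - e\<^sup>2" using e2 by (simp add: mult_ac add.commute)
    ultimately show ?thesis by (simp add: T_def)
  qed
  let ?g = "\<lambda>w. (1 - e\<^sup>2) * w\<^sup>2 / (1 - w\<^sup>2)" and ?g' = "\<lambda>w. (1 - e\<^sup>2) * 2 * w / (1 - w\<^sup>2)\<^sup>2"
  have w2: "1 - w\<^sup>2 > 0" if "0 < w" "w < 1" for w :: real using that by (simp add: power_less_one_iff)
  have img: "?g ` {0<..<1} = {0<..}"
  proof (intro equalityI subsetI)
    fix y assume "y \<in> ?g ` {0<..<1}" then show "y \<in> {0<..}" using w2 e2p by auto
  next
    fix y :: real assume y: "y \<in> {0<..}"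
    define w where "w = sqrt (y / (1 - e\<^sup>2 + y))"
    have "0 < y / (1 - e\<^sup>2 + y)" "y / (1 - e\<^sup>2 + y) < 1" using y e2p by (auto simp: field_simps)
    then have w: "0 < w" "w < 1" and ww: "w\<^sup>2 = y / (1 - e\<^sup>2 + y)" by (auto simp: w_def real_sqrt_lt_1_iff)
    have "1 - w\<^sup>2 = (1 - e\<^sup>2) / (1 - e\<^sup>2 + y)" using y e2p unfolding ww by (simp add: field_simps)
    then have "?g w = y" using y e2p unfolding ww by simp
    then show "y \<in> ?g ` {0<..<1}" using w by force
  qed
  have "chord_const \<beta> = (\<integral>\<^sup>+w. ennreal (?g w powr (\<beta> - 1) / (1 + ?g w)) * ennreal (?g' w) * indicator {0<..<1} w \<partial>lborel)"
    unfolding chord_const_def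
  proof (rule nn_integral_substitution_open[OF _ _ _ _ img])
    fix w :: real assume w: "w \<in> {0<..<1}"
    show "(?g has_real_derivative ?g' w) (at w)"
      using w2[of w] w by (auto intro!: derivative_eq_intros simp: power2_eq_square field_simps)
    show "?g' w > 0" using w2[of w] w e2p by simp
  next
    show "continuous_on {0<..<1} ?g'"
      by (intro continuous_intros) (use w2 in force)
  qed auto
  also have "\<dots> = (\<integral>\<^sup>+w. (ennreal (T a b w) * indicator {0<..<1} w + ennreal (T b a w) * indicator {0<..<1} w) \<partial>lborel)"
  proof (rule nn_integral_cong)
    fix w :: real
    show "ennreal (?g w powr (\<beta> - 1) / (1 + ?g w)) * ennreal (?g' w) * indicator {0<..<1} w =
       ennreal (T a b w) * indicator {0<..<1} w + ennreal (T b a w) * indicator {0<..<1} w"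
    proof (cases "w \<in> {0<..<1}")
      case True
      then have w: "0 < w" "w < 1" by auto
      define v where "v = 1 - w\<^sup>2" define f where "f = 1 - e\<^sup>2"
      have v: "v > 0" using w2[OF w] v_def by simp
      have f: "f > 0" using e2p f_def by simp
      have "\<bar>e * w\<bar> < 1" using e w mult_strict_mono[of "\<bar>e\<bar>" 1 w 1] by (simp add: abs_mult)
      then have ew: "1 - e * w > 0" "1 + e * w > 0" by auto
      have g1: "1 + ?g w = ((1 - e*w) * (1 + e*w)) / v"
        using v unfolding v_def by (simp add: field_simps power2_eq_square)
      have pw: "(f * w\<^sup>2 / v) powr (\<beta> - 1) * (f * 2 * w / v\<^sup>2) * v = 2 * (f powr \<beta> * v powr (-\<beta>) * w powr (2*\<beta>-1))"
      proof -
        have "ln ((f * w\<^sup>2 / v) powr (\<beta> - 1) * (f * 2 * w / v\<^sup>2) * v) = ln (2 * (f powr \<beta> * v powr (-\<beta>) * w powr (2*\<beta>-1)))"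
          using v f w by (simp add: ln_mult ln_div ln_powr ln_realpow algebra_simps)
        then show ?thesis using v f w by (subst (asm) ln_inj_iff) auto
      qed
      define P where "P = f powr \<beta> * v powr (-\<beta>) * w powr (2*\<beta>-1)"
      have "?g w powr (\<beta> - 1) / (1 + ?g w) * ?g' w = 
          ((f * w\<^sup>2 / v) powr (\<beta> - 1) * (f * 2 * w / v\<^sup>2) * v) / ((1 - e*w) * (1 + e*w))"
        unfolding g1 by (simp add: f_def v_def mult_ac)
      also have "\<dots> = 2 * P / ((1 - e*w) * (1 + e*w))" unfolding pw P_def ..
      \<comment> \<open>Partial fractions: \<open>1 + ?g w\<close> equals (1 - e^2 w^2) / (1 - w^2),
        and the two factors of its numerator are the denominators of the two half chords. This is
        why their sum no longer depends on \<open>a\<close> and \<open>b\<close>.\<close>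
      also have "\<dots> = P / (1 - e * w) + P / (1 + e * w)"
        using ew by (simp add: field_simps)
      also have "\<dots> = T a b w + T b a w"
        unfolding Tab Tba by (simp add: P_def f_def v_def)
      finally have *: "?g w powr (\<beta> - 1) / (1 + ?g w) * ?g' w = T a b w + T b a w" .
      have "T a b w \<ge> 0" "T b a w \<ge> 0" unfolding Tab Tba using ew by auto
      moreover have "?g' w \<ge> 0" using w w2[OF w] e2p by simp
      ultimately show ?thesis using True *
        by (simp add: ennreal_mult''[symmetric] ennreal_plus[symmetric] del: ennreal_plus)
    qed simp
  qed
  also have "\<dots> = (\<integral>\<^sup>+w. ennreal (T a b w) * indicator {0<..<1} w \<partial>lborel) + (\<integral>\<^sup>+w. ennreal (T b a w) * indicator {0<..<1} w \<partial>lborel)"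
    by (rule nn_integral_add) (auto simp: T_def)
  finally show ?thesis using half[OF a b] half[OF b a] by simp
qed

text \<open>Since \<open>0 powr a = 0\<close> for every \<open>a\<close>, the profile vanishes off
  the open ball also for negative \<open>a\<close>, and for \<open>a = 0\<close> it is the indicator
  of that ball.\<close>

definition ballpow :: "real \<Rightarrow> real \<Rightarrow> 'a::euclidean_space \<Rightarrow> real" where
  "ballpow a r x = (max 0 (r\<^sup>2 - (norm x)\<^sup>2)) powr a"

lemma ballpow_measurable [measurable]: "ballpow a r \<in> borel_measurable borel"
  unfolding ballpow_def by measurable

lemma ballpow_nonneg [simp]: "ballpow a r x \<ge> 0"
  by (simp add: ballpow_def)

lemma ballpow_outside: "norm x \<ge> r \<Longrightarrow> r \<ge> 0 \<Longrightarrow> ballpow a r x = 0"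
  by (simp add: ballpow_def max_def power_mono)

definition shell :: "'a::euclidean_space set" where
  "shell = {z. 1 \<le> norm z \<and> norm z \<le> exp 1}"

lemma shell_measurable [measurable]: "shell \<in> sets borel"
  unfolding shell_def by measurable

text \<open>In polar coordinates this is the area of the unit sphere times the integral of
  \<open>1 / k\<close> from 1 to e, hence just the area.\<close>

definition shell_mass :: "'a::euclidean_space itself \<Rightarrow> ennreal" where
  "shell_mass _ = (\<integral>\<^sup>+z. indicator shell z * ennreal (norm z powr (- real DIM('a))) \<partial>(lborel::'a measure))"

lemma shell_mass_finite: "shell_mass TYPE('a::euclidean_space) < \<infinity>"
proof -
  have "shell_mass TYPE('a) \<le> (\<integral>\<^sup>+z. indicator (cball 0 (exp 1)) z \<partial>(lborel::'a measure))"
    unfolding shell_mass_def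
  proof (rule nn_integral_mono)
    fix z :: 'a
    have "norm z powr (- real DIM('a)) \<le> 1" if "1 \<le> norm z"
      using that powr_mono[of "- real DIM('a)" 0 "norm z"] by (simp split: if_splits)
    then show "indicator shell z * ennreal (norm z powr (- real DIM('a))) \<le> indicator (cball 0 (exp 1)) z"
      by (auto simp: indicator_def shell_def)
  qed
  also have "\<dots> < \<infinity>" using emeasure_lborel_cball_finite[of "0::'a" "exp 1"] by simp
  finally show ?thesis .
qed

lemma shell_even: "- z \<in> shell \<longleftrightarrow> z \<in> shell"
  by (simp add: shell_def)

text \<open>
  On the line through \<open>x\<close> in direction \<open>z\<close> the weight \<open>1 - |x + kz|\<^sup>2\<close> is a multiple of \<open>(b - k)(a + k)\<close>,
  where \<open>-a < 0 < b\<close> are the parameters of the endpoints of the chord.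
\<close>
lemma riesz_potential_ray:
  fixes x z :: "'a::euclidean_space"
  assumes \<beta>: "0 < \<beta>" "\<beta> < 1" and x: "norm x < 1" and z: "z \<noteq> 0"
  defines "I \<equiv> \<lambda>z. (\<integral>\<^sup>+k. ennreal (k ^ (DIM('a) - 1)) *
     ennreal (ballpow (-\<beta>) 1 (x + k *\<^sub>R z) * norm (k *\<^sub>R z) powr (2*\<beta> - DIM('a))) * indicator {0<..} k \<partial>lborel)"
  shows "I z + I (- z) = ennreal (norm z powr (- real DIM('a))) * chord_const \<beta>"
proof -
  define n where "n = norm z"
  have n: "n > 0" using z by (simp add: n_def)
  \<comment> \<open>The root of the reduced discriminant of
    \<open>1 - (norm (x + k *\<^sub>R z))\<^sup>2\<close> as a quadratic in \<open>k\<close>; the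
    roots below are \<open>b\<close> and \<open>- a\<close>.\<close>
  define \<Delta> where "\<Delta> = sqrt ((x \<bullet> z)\<^sup>2 + n\<^sup>2 * (1 - (norm x)\<^sup>2))"
  have x2: "1 - (norm x)\<^sup>2 > 0" using x by (simp add: abs_square_less_1)
  have pos: "n\<^sup>2 * (1 - (norm x)\<^sup>2) > 0" using n x2 by simp
  have \<Delta>2: "\<Delta>\<^sup>2 = (x \<bullet> z)\<^sup>2 + n\<^sup>2 * (1 - (norm x)\<^sup>2)"
    unfolding \<Delta>_def using pos by (intro real_sqrt_pow2) (simp add: add_nonneg_pos less_imp_le)
  have \<Delta>: "\<bar>x \<bullet> z\<bar> < \<Delta>"
    unfolding \<Delta>_def using pos by (intro real_less_rsqrt) simp
  define a b where "a = (\<Delta> + x \<bullet> z) / n\<^sup>2" and "b = (\<Delta> - x \<bullet> z) / n\<^sup>2"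
  have ab: "a > 0" "b > 0" using \<Delta> n by (auto simp: a_def b_def)
  \<comment> \<open>Stated for arbitrary endpoints because the opposite direction \<open>- z\<close>
    has the same chord with \<open>a\<close> and \<open>b\<close> exchanged.\<close>
  have key: "I z = ennreal (n powr (- real DIM('a))) * (\<integral>\<^sup>+k. ennreal (((b - k) * (a + k)) powr (-\<beta>) * k powr (2*\<beta> - 1)) * indicator {0<..<b} k \<partial>lborel)"
    if z: "norm z = n" and ab: "a > 0" "b > 0" and prod: "a * b * n\<^sup>2 = 1 - (norm x)\<^sup>2" and diff: "(b - a) * n\<^sup>2 = - 2 * (x \<bullet> z)" for a b and z :: 'a
  proof -
    have q: "1 - (norm (x + k *\<^sub>R z))\<^sup>2 = n\<^sup>2 * ((b - k) * (a + k))" for k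
    proof -
      have "(norm (x + k *\<^sub>R z))\<^sup>2 = (norm x)\<^sup>2 + 2 * k * (x \<bullet> z) + k\<^sup>2 * n\<^sup>2"
        unfolding z[symmetric] power2_norm_eq_inner by (simp add: inner_simps inner_commute power2_eq_square algebra_simps)
      moreover have "n\<^sup>2 * ((b - k) * (a + k)) = a * b * n\<^sup>2 + k * ((b - a) * n\<^sup>2) - k\<^sup>2 * n\<^sup>2"
        by (simp add: power2_eq_square algebra_simps)
      ultimately show ?thesis unfolding prod diff by simp
    qed
    have "I z = (\<integral>\<^sup>+k. ennreal (n powr (- real DIM('a))) * (ennreal (((b - k) * (a + k)) powr (-\<beta>) * k powr (2*\<beta> - 1)) * indicator {0<..<b} k) \<partial>lborel)"
      unfolding I_def
    proof (rule nn_integral_cong)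
      fix k :: real
      show "ennreal (k ^ (DIM('a) - 1)) * ennreal (ballpow (-\<beta>) 1 (x + k *\<^sub>R z) * norm (k *\<^sub>R z) powr (2*\<beta> - DIM('a))) * indicator {0<..} k
        = ennreal (n powr (- real DIM('a))) * (ennreal (((b - k) * (a + k)) powr (-\<beta>) * k powr (2*\<beta> - 1)) * indicator {0<..<b} k)"
      proof (cases "0 < k \<and> k < b")
        case True
        then have c: "(b - k) * (a + k) > 0" using ab by simp
        have "ballpow (-\<beta>) 1 (x + k *\<^sub>R z) = (n\<^sup>2 * ((b - k) * (a + k))) powr (-\<beta>)"
          using n c by (simp add: ballpow_def q)
        also have "\<dots> = n powr (- 2 * \<beta>) * ((b - k) * (a + k)) powr (-\<beta>)"
          using n c by (simp add: powr_mult powr_powr flip: powr_numeral)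
        finally have 1: "ballpow (-\<beta>) 1 (x + k *\<^sub>R z) = n powr (- 2 * \<beta>) * ((b - k) * (a + k)) powr (-\<beta>)" .
        have 2: "norm (k *\<^sub>R z) powr (2*\<beta> - DIM('a)) = k powr (2*\<beta> - DIM('a)) * n powr (2*\<beta> - DIM('a))"
          using True n z by (simp add: powr_mult)
        have 3: "k ^ (DIM('a) - 1) = k powr (DIM('a) - 1)"
          using True by (simp add: powr_realpow[symmetric] of_nat_diff Suc_leI)
        have "k ^ (DIM('a) - 1) * (ballpow (-\<beta>) 1 (x + k *\<^sub>R z) * norm (k *\<^sub>R z) powr (2*\<beta> - DIM('a)))
          = (n powr (- 2 * \<beta>) * n powr (2*\<beta> - DIM('a))) * (((b - k) * (a + k)) powr (-\<beta>) * (k powr (DIM('a) - 1) * k powr (2*\<beta> - DIM('a))))"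
          unfolding 1 2 3 by (simp only: mult_ac)
        also have "\<dots> = n powr (- real DIM('a)) * (((b - k) * (a + k)) powr (-\<beta>) * k powr (2*\<beta> - 1))"
          by (simp add: powr_add[symmetric])
        finally show ?thesis using True by (simp add: ennreal_mult''[symmetric])
      next
        case False
        have "ballpow (-\<beta>) 1 (x + k *\<^sub>R z) = 0" if "k > 0"
        proof -
          have "(b - k) * (a + k) \<le> 0" using that False ab by (intro mult_nonpos_nonneg) auto
          then have "n\<^sup>2 * ((b - k) * (a + k)) \<le> 0" by (rule mult_nonneg_nonpos[rotated]) simp
          then show ?thesis by (simp add: ballpow_def q max_def)
        qed
        then show ?thesis using False by (auto simp: indicator_def)
      qed
    qed
    also have "\<dots> = ennreal (n powr (- real DIM('a))) * (\<integral>\<^sup>+k. ennreal (((b - k) * (a + k)) powr (-\<beta>) * k powr (2*\<beta> - 1)) * indicator {0<..<b} k \<partial>lborel)"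
      by (rule nn_integral_cmult) measurable
    finally show ?thesis .
  qed
  have n2: "n\<^sup>2 \<noteq> 0" using n by simp
  have "(\<Delta> + x \<bullet> z) * (\<Delta> - x \<bullet> z) = n\<^sup>2 * (1 - (norm x)\<^sup>2)"
    using \<Delta>2 by (simp add: power2_eq_square algebra_simps)
  then have prod: "a * b * n\<^sup>2 = 1 - (norm x)\<^sup>2"
  proof -
    assume p: "(\<Delta> + x \<bullet> z) * (\<Delta> - x \<bullet> z) = n\<^sup>2 * (1 - (norm x)\<^sup>2)"
    have "p / m * (q / m) * m = p * q / m" if "m \<noteq> 0" for p q m :: real using that by simp
    from this[OF n2, of "\<Delta> + x \<bullet> z" "\<Delta> - x \<bullet> z"]
    have "a * b * n\<^sup>2 = (\<Delta> + x \<bullet> z) * (\<Delta> - x \<bullet> z) / n\<^sup>2"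
      unfolding a_def b_def .
    then show ?thesis using n2 by (simp add: p)
  qed
  have diff: "(b - a) * n\<^sup>2 = - 2 * (x \<bullet> z)"
    unfolding a_def b_def using n2 by (simp add: field_simps)
  have "I z + I (-z) = ennreal (n powr (- real DIM('a))) * ((\<integral>\<^sup>+k. ennreal (((b - k) * (a + k)) powr (-\<beta>) * k powr (2*\<beta> - 1)) * indicator {0<..<b} k \<partial>lborel)
     + (\<integral>\<^sup>+k. ennreal (((a - k) * (b + k)) powr (-\<beta>) * k powr (2*\<beta> - 1)) * indicator {0<..<a} k \<partial>lborel))"
    using key[of z a b] key[of "-z" b a] ab prod diff
    by (simp add: n_def[symmetric] distrib_left mult.commute algebra_simps)
  then show ?thesis
    unfolding chord_integral[OF ab \<beta>] n_def .
qed

text \<open>Averaging the shell integral with its reflection joins opposite rays to full chords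
  through \<open>x\<close>, and by \<open>riesz_potential_ray\<close> a chord contributes an amount
  that does not see \<open>x\<close>. The factor 2 counts each chord in both directions. The
  potential is therefore constant in the ball.\<close>

lemma riesz_potential_ball:
  fixes x :: "'a::euclidean_space"
  assumes \<beta>: "0 < \<beta>" "\<beta> < 1" and x: "norm x < 1"
  shows "2 * (\<integral>\<^sup>+y. ennreal (ballpow (-\<beta>) 1 (x + y) * norm y powr (2*\<beta> - DIM('a))) \<partial>lborel)
    = shell_mass TYPE('a) * chord_const \<beta>"
proof -
  let ?F = "\<lambda>y::'a. ennreal (ballpow (-\<beta>) 1 (x + y) * norm y powr (2*\<beta> - DIM('a)))"
  define I where "I z = (\<integral>\<^sup>+k. ennreal (k ^ (DIM('a) - 1)) * ?F (k *\<^sub>R z) * indicator {0<..} k \<partial>lborel)" for z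
  have [measurable]: "I \<in> borel_measurable borel" unfolding I_def by measurable
  let ?J = "\<integral>\<^sup>+z. indicator shell z * I z \<partial>lborel"
  have 1: "(\<integral>\<^sup>+y. ?F y \<partial>lborel) = ?J"
    unfolding I_def shell_def by (rule nn_integral_shell) measurable
  have 2: "?J = (\<integral>\<^sup>+z. indicator shell z * I (- z) \<partial>lborel)"
    using nn_integral_lborel_affine[of "\<lambda>z. indicator shell z * I z" "-1" 0]
    by (simp add: indicator_def shell_even)
  have "2 * (\<integral>\<^sup>+y. ?F y \<partial>lborel) = ?J + (\<integral>\<^sup>+z. indicator shell z * I (- z) \<partial>lborel)"
    unfolding 1 2[symmetric] by (simp add: mult_2)
  also have "\<dots> = (\<integral>\<^sup>+z. indicator shell z * I z + indicator shell z * I (- z) \<partial>lborel)"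
    by (rule nn_integral_add[symmetric]) measurable
  also have "\<dots> = (\<integral>\<^sup>+z. indicator shell z * ennreal (norm z powr (- real DIM('a))) * chord_const \<beta> \<partial>(lborel::'a measure))"
  proof (rule nn_integral_cong)
    fix z :: 'a
    show "indicator shell z * I z + indicator shell z * I (- z) = indicator shell z * ennreal (norm z powr (- real DIM('a))) * chord_const \<beta>"
    proof (cases "z \<in> shell")
      case True
      then have "z \<noteq> 0" by (auto simp: shell_def)
      from riesz_potential_ray[OF \<beta> x this] True show ?thesis unfolding I_def by simp
    qed simp
  qed
  also have "\<dots> = shell_mass TYPE('a) * chord_const \<beta>"
    unfolding shell_mass_def by (rule nn_integral_multc) measurable
  finally show ?thesis .
qed

text \<open>For negative \<open>a\<close> the Riesz potential at the centre dominates: with \<beta>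
  = -a < 1 and dimension at least 2 the exponent \<open>2 * \<beta> - DIM('a)\<close> is negative,
  so the Riesz kernel is at least 1 in the ball.\<close>

lemma ballpow_integrable:
  assumes "-1 < a" and True: "2 \<le> DIM('a)"
  shows "integrable lborel (ballpow a 1 :: 'a::euclidean_space \<Rightarrow> real)"
proof (cases "a \<ge> 0")
  case True
  have "\<bar>ballpow a 1 x\<bar> \<le> 1" for x :: 'a
    using powr_mono2[OF True, of "max 0 (1 - (norm x)\<^sup>2)" 1] by (simp add: ballpow_def)
  then show ?thesis
    by (intro integrable_bounded_in_ball[where M=1 and R=1]) (auto simp: ballpow_outside)
next
  case False
    have b: "0 < -a" "-a < 1" using False assms by auto
    have "(\<integral>\<^sup>+y. ennreal (ballpow a 1 (y::'a)) \<partial>lborel) \<le> (\<integral>\<^sup>+y. ennreal (ballpow (-(-a)) 1 (0 + y) * norm (y::'a) powr (2*(-a) - DIM('a))) \<partial>lborel)"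
    proof (rule nn_integral_mono_AE)
      have "AE x::'a in lborel. x \<noteq> 0" by (rule AE_lborel_singleton)
      then show "AE y::'a in lborel. ennreal (ballpow a 1 y) \<le> ennreal (ballpow (-(-a)) 1 (0 + y) * norm y powr (2*(-a) - DIM('a)))"
      proof (rule eventually_mono)
        fix y :: 'a assume y: "y \<noteq> 0"
        have "1 \<le> norm y powr (2*(-a) - DIM('a))" if "norm y < 1"
          using powr_mono'[of "2*(-a) - DIM('a)" 0 "norm y"] that True b y by simp
        then show "ennreal (ballpow a 1 y) \<le> ennreal (ballpow (-(-a)) 1 (0 + y) * norm y powr (2*(-a) - DIM('a)))"
          by (cases "norm y < 1") (auto intro!: ennreal_leI mult_left_mono[of 1 _ "ballpow a 1 y", simplified] simp: ballpow_outside)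
      qed
    qed
    also have "\<dots> < \<infinity>"
    proof -
      have "shell_mass TYPE('a) * chord_const (-a) < \<infinity>"
        using shell_mass_finite[where 'a='a] chord_const_finite[OF b] by (simp add: ennreal_mult_less_top)
      then have "2 * (\<integral>\<^sup>+y. ennreal (ballpow (-(-a)) 1 (0 + y) * norm y powr (2*(-a) - DIM('a))) \<partial>(lborel::'a measure)) < \<infinity>"
        using riesz_potential_ball[OF b, of "0::'a"] by simp
      then show ?thesis by (auto simp: ennreal_mult_less_top intro: le_less_trans)
    qed
    finally show ?thesis by (intro integrableI_bounded) auto
qed

section \<open>Subordination: Riesz kernels as superpositions of heat kernels\<close>

text \<open>The weight in the subordination formula: \<open>|\<xi>|\<^bsup>-2\<beta>\<^esup>\<close> is \<open>1 / Gamma \<beta>\<close> times the integral of \<open>tpow \<beta> t exp (- t |\<xi>|\<^sup>2)\<close>.\<close>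
definition tpow :: "real \<Rightarrow> real \<Rightarrow> real" where
  "tpow \<beta> t = indicator {0<..} t * t powr (\<beta> - 1)"

lemma tpow_measurable [measurable]: "tpow \<beta> \<in> borel_measurable borel"
  unfolding tpow_def by measurable

lemma tpow_nonneg [simp]: "tpow \<beta> t \<ge> 0"
  by (simp add: tpow_def)

lemma tpow_scale: "c > 0 \<Longrightarrow> tpow \<beta> (c * t) = c powr (\<beta> - 1) * tpow \<beta> t"
  by (cases "t > 0") (auto simp: tpow_def indicator_def powr_mult zero_less_mult_iff)

lemma nn_integral_tpow_exp:
  assumes \<beta>: "\<beta> > 0" and k: "k > 0"
  shows "(\<integral>\<^sup>+t. ennreal (tpow \<beta> t * exp (- t * k)) \<partial>lborel) = ennreal (Gamma \<beta> * k powr (-\<beta>))"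
proof -
  have 1: "(\<integral>\<^sup>+t. ennreal (tpow \<beta> t * exp (- t)) \<partial>lborel) = ennreal (Gamma \<beta>)"
  proof -
    have "(\<integral>\<^sup>+t. ennreal (tpow \<beta> t * exp (- t)) \<partial>lborel) = (\<integral>\<^sup>+t. ennreal (indicator {0..} t * t powr (\<beta> - 1) / exp t) \<partial>lborel)"
      by (intro nn_integral_cong) (auto simp: tpow_def indicator_def exp_minus field_simps)
    then show ?thesis using Gamma_conv_nn_integral_real[OF \<beta>] by simp
  qed
  have "(\<integral>\<^sup>+t. ennreal (tpow \<beta> t * exp (- t * k)) \<partial>lborel) =
     ennreal \<bar>1/k\<bar> * (\<integral>\<^sup>+t. ennreal (tpow \<beta> (0 + (1/k) * t) * exp (- (0 + (1/k) * t) * k)) \<partial>lborel)"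
    by (rule nn_integral_real_affine) (use k in auto)
  also have "\<dots> = ennreal (1/k) * (\<integral>\<^sup>+t. ennreal ((1/k) powr (\<beta> - 1)) * ennreal (tpow \<beta> t * exp (- t)) \<partial>lborel)"
  proof -
    have "ennreal (tpow \<beta> (0 + (1/k) * t) * exp (- (0 + (1/k) * t) * k)) = ennreal ((1/k) powr (\<beta> - 1)) * ennreal (tpow \<beta> t * exp (- t))" for t
      using k tpow_scale[of "1/k" \<beta> t] by (simp add: ennreal_mult'[symmetric] mult.assoc)
    then show ?thesis using k by simp
  qed
  also have "\<dots> = ennreal (1/k) * (ennreal ((1/k) powr (\<beta> - 1)) * ennreal (Gamma \<beta>))"
    by (subst nn_integral_cmult) (simp_all add: 1)
  also have "\<dots> = ennreal ((1/k) * (1/k) powr (\<beta> - 1) * Gamma \<beta>)"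
    using k \<beta> by (simp add: ennreal_mult'[symmetric] mult.assoc Gamma_real_pos less_imp_le)
  also have "(1/k) * (1/k) powr (\<beta> - 1) = k powr (-\<beta>)"
    using k powr_add[of "1/k" 1 "\<beta> - 1"] by (simp add: powr_divide powr_minus_divide)
  finally show ?thesis by (simp add: mult.commute)
qed

text \<open>The subordinated heat kernel at distance 1. For \<beta> < N/2, with N =
  \<open>DIM('a)\<close>, the substitution t = 1/(4u) evaluates it to pi^(N/2) 4^(N/2 - \<beta>)
  Gamma(N/2 - \<beta>).\<close>

definition kernel_const :: "'a::euclidean_space itself \<Rightarrow> real \<Rightarrow> ennreal" where
  "kernel_const _ \<beta> = (\<integral>\<^sup>+t. ennreal (tpow \<beta> t * ((pi / t) powr (DIM('a) / 2) * exp (- 1 / (4 * t)))) \<partial>lborel)"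

text \<open>Scaling the time by \<open>(norm z)\<^sup>2\<close> extracts the homogeneity of the
  integral: heat kernels averaged with \<open>tpow \<beta>\<close> form a Riesz kernel.\<close>

lemma nn_integral_tpow_heat:
  fixes z :: "'a::euclidean_space"
  assumes z: "z \<noteq> 0"
  shows "(\<integral>\<^sup>+t. ennreal (tpow \<beta> t * heat t z) \<partial>lborel) = kernel_const TYPE('a) \<beta> * ennreal (norm z powr (2*\<beta> - DIM('a)))"
proof -
  define c where "c = (norm z)\<^sup>2"
  have c: "c > 0" using z by (simp add: c_def)
  have cp: "c * c powr (\<beta> - 1) * c powr (- (DIM('a) / 2)) = norm z powr (2*\<beta> - DIM('a))"
  proof -
    have "c * c powr (\<beta> - 1) * c powr (- (DIM('a) / 2)) = c powr (\<beta> - DIM('a)/2)"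
      using c by (simp add: powr_add[symmetric] powr_mult_base)
    also have "\<dots> = norm z powr (2 * (\<beta> - DIM('a)/2))"
      using z by (simp add: c_def powr_powr flip: powr_numeral)
    finally show ?thesis by (simp add: algebra_simps)
  qed
  have "(\<integral>\<^sup>+t. ennreal (tpow \<beta> t * heat t z) \<partial>lborel) = ennreal \<bar>c\<bar> * (\<integral>\<^sup>+t. ennreal (tpow \<beta> (0 + c * t) * heat (0 + c * t) z) \<partial>lborel)"
    by (rule nn_integral_real_affine) (use c in auto)
  also have "\<dots> = ennreal c * (\<integral>\<^sup>+t. ennreal (c powr (\<beta> - 1) * c powr (- (DIM('a) / 2))) * ennreal (tpow \<beta> t * ((pi / t) powr (DIM('a) / 2) * exp (- 1 / (4 * t)))) \<partial>lborel)"
  proof -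
    have "tpow \<beta> (0 + c * t) * heat (0 + c * t) z = (c powr (\<beta> - 1) * c powr (- (DIM('a) / 2))) * (tpow \<beta> t * ((pi / t) powr (DIM('a) / 2) * exp (- 1 / (4 * t))))" for t
    proof (cases "t > 0")
      case True
      have "(pi / (c * t)) powr (DIM('a) / 2) = c powr (- (DIM('a) / 2)) * (pi / t) powr (DIM('a) / 2)"
        using c True by (simp add: powr_divide powr_mult powr_minus field_simps)
      moreover have "- (norm z)\<^sup>2 / (4 * (c * t)) = - 1 / (4 * t)" using c by (simp add: c_def)
      ultimately show ?thesis using c by (simp add: tpow_scale heat_def)
    qed (use c in \<open>auto simp: tpow_def indicator_def zero_less_mult_iff\<close>)
    then show ?thesis using c by (simp add: ennreal_mult')
  qed
  also have "\<dots> = ennreal c * (ennreal (c powr (\<beta> - 1) * c powr (- (DIM('a) / 2))) * kernel_const TYPE('a) \<beta>)"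
    unfolding kernel_const_def by (subst nn_integral_cmult) simp_all
  also have "\<dots> = kernel_const TYPE('a) \<beta> * ennreal (c * c powr (\<beta> - 1) * c powr (- (DIM('a) / 2)))"
    using c by (simp add: ennreal_mult' mult_ac)
  finally show ?thesis unfolding cp .
qed

lemma exp_ge_power_div_fact: "0 \<le> x \<Longrightarrow> x ^ n / fact n \<le> exp (x::real)"
proof -
  assume x: "0 \<le> x"
  have "(\<Sum>k\<in>{n}. x ^ k /\<^sub>R fact k) \<le> (\<Sum>k. x ^ k /\<^sub>R fact k)"
    by (rule sum_le_suminf[OF summable_exp_generic]) (use x in auto)
  then show ?thesis by (simp add: exp_def divide_inverse mult.commute)
qed

text \<open>Near 0 the factor \<open>exp (- 1 / (4 * t))\<close> is at most
  \<open>fact N * (4 * t) ^ N\<close>, N the dimension, and beats t^(-N/2). Near infinity the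
  integrand decays like t^(\<beta> - 1 - N/2), which is integrable because \<beta> < 1 \<le>
  N/2.\<close>

lemma kernel_const_finite:
  assumes \<beta>: "0 < \<beta>" "\<beta> < 1" and N: "2 \<le> DIM('a)"
  shows "kernel_const TYPE('a::euclidean_space) \<beta> < \<infinity>"
proof -
  let ?N = "DIM('a)"
  define A where "A = pi powr (?N / 2) * (fact ?N * 4 ^ ?N)"
  define B where "B = pi powr (?N / 2)"
  have AB: "A \<ge> 0" "B \<ge> 0" by (auto simp: A_def B_def)
  have 1: "(\<integral>\<^sup>+q. ennreal (q powr (\<beta> - 1)) * indicator {0..1} q \<partial>lborel) = ennreal (1 powr (\<beta> - 1 + 1) / (\<beta> - 1 + 1))"
    by (rule nn_integral_has_integral_lebesgue'[OF _ has_integral_powr_from_0]) (use \<beta> in auto)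
  have 2: "(\<integral>\<^sup>+q. ennreal (q powr (\<beta> - 1 - ?N/2)) * indicator {1..} q \<partial>lborel) = ennreal (- (1 powr (\<beta> - 1 - ?N/2 + 1)) / (\<beta> - 1 - ?N/2 + 1))"
    by (rule nn_integral_has_integral_lebesgue'[OF _ has_integral_powr_to_inf]) (use \<beta> N in auto)
  have "kernel_const TYPE('a) \<beta> \<le> (\<integral>\<^sup>+q. (ennreal A * (ennreal (q powr (\<beta> - 1)) * indicator {0..1} q) + ennreal B * (ennreal (q powr (\<beta> - 1 - ?N/2)) * indicator {1..} q)) \<partial>lborel)"
    unfolding kernel_const_def
  proof (rule nn_integral_mono)
    fix t :: real
    let ?k = "ennreal (tpow \<beta> t * ((pi / t) powr (?N / 2) * exp (- 1 / (4 * t))))"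
    show "?k \<le> ennreal A * (ennreal (t powr (\<beta> - 1)) * indicator {0..1} t) + ennreal B * (ennreal (t powr (\<beta> - 1 - ?N/2)) * indicator {1..} t)"
    proof (cases "t > 0")
      case t: True
      have pw: "(pi / t) powr (?N / 2) = pi powr (?N/2) * t powr (- (?N / 2))"
        using t by (simp add: powr_divide powr_minus field_simps)
      show ?thesis
      proof (cases "t \<le> 1")
        case True
        have "(1 / (4*t)) ^ ?N / fact ?N \<le> exp (1 / (4*t))"
          using exp_ge_power_div_fact[of "1/(4*t)" ?N] t by simp
        then have "exp (- (1 / (4*t))) \<le> fact ?N * (4 * t) ^ ?N"
          using t by (simp add: exp_minus field_simps)
        then have e: "exp (- 1 / (4*t)) \<le> (fact ?N * 4 ^ ?N) * t powr ?N"
          using t by (simp add: power_mult_distrib powr_realpow mult_ac)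
        have p: "t powr (- (?N / 2)) * t powr ?N \<le> 1"
          using t True by (simp add: powr_add[symmetric] powr_le1)
        have "t powr (- (?N / 2)) * exp (- 1 / (4*t)) \<le> t powr (- (?N / 2)) * ((fact ?N * 4 ^ ?N) * t powr ?N)"
          by (rule mult_left_mono[OF e]) simp
        also have "\<dots> = (fact ?N * 4 ^ ?N) * (t powr (- (?N / 2)) * t powr ?N)" by (simp only: mult_ac)
        also have "\<dots> \<le> (fact ?N * 4 ^ ?N) * 1" by (rule mult_left_mono[OF p]) simp
        finally have "t powr (- (?N / 2)) * exp (- 1 / (4*t)) \<le> fact ?N * 4 ^ ?N" by simp
        then have "(pi / t) powr (?N / 2) * exp (- 1 / (4 * t)) \<le> A"
          unfolding pw A_def by (simp add: mult.assoc mult_left_mono)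
        then have "tpow \<beta> t * ((pi / t) powr (?N / 2) * exp (- 1 / (4 * t))) \<le> A * t powr (\<beta> - 1)"
          using t by (simp add: tpow_def mult.commute mult_left_mono)
        then have "?k \<le> ennreal A * (ennreal (t powr (\<beta> - 1)) * indicator {0..1} t)"
          using t True AB by (simp add: ennreal_mult'[symmetric] ennreal_leI)
        then show ?thesis by (rule order_trans) simp
      next
        case False
        have "exp (- 1 / (4 * t)) \<le> 1" using t by simp
        then have "(pi / t) powr (?N / 2) * exp (- 1 / (4 * t)) \<le> B * t powr (- (?N / 2))"
          unfolding pw B_def by (simp add: mult_left_le)
        then have "t powr (\<beta> - 1) * ((pi / t) powr (?N / 2) * exp (- 1 / (4 * t))) \<le> t powr (\<beta> - 1) * (B * t powr (- (?N / 2)))"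
          by (rule mult_left_mono) simp
        also have "\<dots> = B * t powr (\<beta> - 1 - ?N/2)"
          using powr_add[of t "\<beta> - 1" "- (?N/2)"] by (simp add: mult.left_commute)
        finally have "?k \<le> ennreal B * (ennreal (t powr (\<beta> - 1 - ?N/2)) * indicator {1..} t)"
          using t False AB by (simp add: ennreal_mult'[symmetric] ennreal_leI tpow_def)
        then show ?thesis by (rule order_trans) simp
      qed
    qed (simp add: tpow_def)
  qed
  also have "\<dots> < \<infinity>"
    by (subst nn_integral_add, simp, simp, subst nn_integral_cmult, simp, subst nn_integral_cmult, simp)
      (simp only: 1 2, simp add: ennreal_mult_less_top)
  finally show ?thesis .
qed

definition heatpot :: "real \<Rightarrow> real \<Rightarrow> 'a::euclidean_space \<Rightarrow> real" where
  "heatpot a t x = (LINT y|lborel. ballpow a 1 y * heat t (x - y))"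

lemma heatpot_nonneg: "heatpot a t x \<ge> 0"
  unfolding heatpot_def by (intro Bochner_Integration.integral_nonneg mult_nonneg_nonneg heat_nonneg ballpow_nonneg)

lemma heat_le: "t > 0 \<Longrightarrow> heat t (z::'a::euclidean_space) \<le> (pi / t) powr (DIM('a) / 2)"
  unfolding heat_def by (simp add: mult_left_le)

lemma ennreal_heatpot:
  fixes x :: "'a::euclidean_space"
  assumes "-1 < a" "2 \<le> DIM('a)" "t > 0"
  shows "ennreal (heatpot a t x) = (\<integral>\<^sup>+y. ennreal (ballpow a 1 y * heat t (x - y)) \<partial>lborel)"
proof -
  have "integrable lborel (\<lambda>y. ballpow a 1 y * heat t (x - y))"
  proof (rule Bochner_Integration.integrable_bound)
    show "integrable lborel (\<lambda>y. (pi / t) powr (DIM('a) / 2) * ballpow a 1 (y::'a))"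
      using ballpow_integrable[OF assms(1,2)] by simp
    show "AE y in lborel. norm (ballpow a 1 y * heat t (x - y)) \<le> norm ((pi / t) powr (DIM('a) / 2) * ballpow a 1 y)"
    proof (rule AE_I2)
      fix y
      show "norm (ballpow a 1 y * heat t (x - y)) \<le> norm ((pi / t) powr (DIM('a) / 2) * ballpow a 1 y)"
        using mult_left_mono[OF heat_le[OF assms(3), of "x - y"] ballpow_nonneg[of a 1 y]] heat_nonneg[of t "x - y"]
        by (simp add: abs_mult mult.commute)
    qed
  qed measurable
  then show ?thesis unfolding heatpot_def
    by (intro nn_integral_eq_integral[symmetric]) (auto simp: heat_nonneg)
qed

text \<open>The subordinated potential of the profile, evaluated at the centre;
  \<open>riesz_potential_ball'\<close> makes it the value at every point of the ball.\<close>

definition riesz_const :: "'a::euclidean_space itself \<Rightarrow> real \<Rightarrow> ennreal" where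
  "riesz_const _ \<beta> = kernel_const TYPE('a) \<beta> * (\<integral>\<^sup>+y. ennreal (ballpow (-\<beta>) 1 y * norm y powr (2*\<beta> - DIM('a))) \<partial>(lborel::'a measure))"

lemma riesz_potential_ball':
  fixes x :: "'a::euclidean_space"
  assumes \<beta>: "0 < \<beta>" "\<beta> < 1" and x: "norm x < 1"
  shows "(\<integral>\<^sup>+y. ennreal (ballpow (-\<beta>) 1 (x + y) * norm y powr (2*\<beta> - DIM('a))) \<partial>lborel)
    = (\<integral>\<^sup>+y. ennreal (ballpow (-\<beta>) 1 y * norm y powr (2*\<beta> - DIM('a))) \<partial>(lborel::'a measure))" (is "?A = ?B")
proof -
  have "2 * ?A = 2 * ?B"
    using riesz_potential_ball[OF \<beta> x] riesz_potential_ball[OF \<beta>, of "0::'a"] by simp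
  then show ?thesis by (subst (asm) ennreal_mult_cancel_left) auto
qed

lemma riesz_const_finite:
  assumes \<beta>: "0 < \<beta>" "\<beta> < 1" and N: "2 \<le> DIM('a)"
  shows "riesz_const TYPE('a::euclidean_space) \<beta> < \<infinity>"
proof -
  have "2 * (\<integral>\<^sup>+y. ennreal (ballpow (-\<beta>) 1 y * norm y powr (2*\<beta> - DIM('a))) \<partial>(lborel::'a measure)) < \<infinity>"
    using riesz_potential_ball[OF \<beta>, of "0::'a"] shell_mass_finite[where 'a='a] chord_const_finite[OF \<beta>]
    by (simp add: ennreal_mult_less_top)
  then have "(\<integral>\<^sup>+y. ennreal (ballpow (-\<beta>) 1 y * norm y powr (2*\<beta> - DIM('a))) \<partial>(lborel::'a measure)) < \<infinity>"
    by (auto simp: ennreal_mult_less_top intro: le_less_trans)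
  then show ?thesis
    unfolding riesz_const_def using kernel_const_finite[OF assms] by (simp add: ennreal_mult_less_top)
qed

text \<open>Tonelli exchanges time and space, the time integral of the heat kernel is a Riesz
  kernel, and the Riesz potential of the profile is constant in the ball.\<close>

lemma nn_integral_tpow_heatpot:
  fixes x :: "'a::euclidean_space"
  assumes \<beta>: "0 < \<beta>" "\<beta> < 1" and N: "2 \<le> DIM('a)" and x: "norm x < 1"
  shows "(\<integral>\<^sup>+t. ennreal (tpow \<beta> t * heatpot (-\<beta>) t x) \<partial>lborel) = riesz_const TYPE('a) \<beta>"
proof -
  have "(\<integral>\<^sup>+t. ennreal (tpow \<beta> t * heatpot (-\<beta>) t x) \<partial>lborel) =
     (\<integral>\<^sup>+t. (\<integral>\<^sup>+y. ennreal (ballpow (-\<beta>) 1 y) * ennreal (tpow \<beta> t * heat t (x - y)) \<partial>lborel) \<partial>lborel)"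
  proof (rule nn_integral_cong)
    fix t :: real
    show "ennreal (tpow \<beta> t * heatpot (-\<beta>) t x) = (\<integral>\<^sup>+y. ennreal (ballpow (-\<beta>) 1 y) * ennreal (tpow \<beta> t * heat t (x - y)) \<partial>lborel)"
    proof (cases "t > 0")
      case True
      have "ennreal (tpow \<beta> t * heatpot (-\<beta>) t x) = ennreal (tpow \<beta> t) * (\<integral>\<^sup>+y. ennreal (ballpow (-\<beta>) 1 y * heat t (x - y)) \<partial>lborel)"
        using \<beta> N True by (simp add: ennreal_mult' ennreal_heatpot)
      also have "\<dots> = (\<integral>\<^sup>+y. ennreal (tpow \<beta> t) * ennreal (ballpow (-\<beta>) 1 y * heat t (x - y)) \<partial>lborel)"
        by (rule nn_integral_cmult[symmetric]) measurable
      finally show ?thesis by (simp add: ennreal_mult' heat_nonneg mult_ac)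
    qed (simp add: tpow_def)
  qed
  also have "\<dots> = (\<integral>\<^sup>+y. (\<integral>\<^sup>+t. ennreal (ballpow (-\<beta>) 1 y) * ennreal (tpow \<beta> t * heat t (x - y)) \<partial>lborel) \<partial>lborel)"
    by (rule lborel_pair.Fubini') measurable
  also have "\<dots> = (\<integral>\<^sup>+y. kernel_const TYPE('a) \<beta> * ennreal (ballpow (-\<beta>) 1 y * norm (x - y) powr (2*\<beta> - DIM('a))) \<partial>lborel)"
  proof (rule nn_integral_cong_AE)
    have "AE y in lborel. y \<noteq> x" by (rule AE_lborel_singleton)
    then show "AE y in lborel. (\<integral>\<^sup>+t. ennreal (ballpow (-\<beta>) 1 y) * ennreal (tpow \<beta> t * heat t (x - y)) \<partial>lborel) = 
      kernel_const TYPE('a) \<beta> * ennreal (ballpow (-\<beta>) 1 y * norm (x - y) powr (2*\<beta> - DIM('a)))"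
    proof (rule eventually_mono)
      fix y assume "y \<noteq> x"
      then have z: "x - y \<noteq> 0" by simp
      show "(\<integral>\<^sup>+t. ennreal (ballpow (-\<beta>) 1 y) * ennreal (tpow \<beta> t * heat t (x - y)) \<partial>lborel) = 
      kernel_const TYPE('a) \<beta> * ennreal (ballpow (-\<beta>) 1 y * norm (x - y) powr (2*\<beta> - DIM('a)))"
        by (subst nn_integral_cmult, measurable, simp only: nn_integral_tpow_heat[OF z]) (simp add: ennreal_mult' mult_ac)
    qed
  qed
  also have "\<dots> = kernel_const TYPE('a) \<beta> * (\<integral>\<^sup>+y. ennreal (ballpow (-\<beta>) 1 y * norm (x - y) powr (2*\<beta> - DIM('a))) \<partial>lborel)"
    by (rule nn_integral_cmult) measurable
  also have "(\<integral>\<^sup>+y. ennreal (ballpow (-\<beta>) 1 y * norm (x - y) powr (2*\<beta> - DIM('a))) \<partial>lborel)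
     = (\<integral>\<^sup>+y. ennreal (ballpow (-\<beta>) 1 (x + y) * norm y powr (2*\<beta> - DIM('a))) \<partial>lborel)"
    using nn_integral_lborel_affine[of "\<lambda>y. ennreal (ballpow (-\<beta>) 1 y * norm (x - y) powr (2*\<beta> - DIM('a)))" 1 x] by simp
  finally show ?thesis unfolding riesz_potential_ball'[OF \<beta> x] riesz_const_def .
qed

section \<open>Energies of order between -1 and 0\<close>

lemma cnj_measurable [measurable]: "cnj \<in> borel_measurable borel"
  by (intro borel_measurable_continuous_onI continuous_intros)

lemma gaussian_energy:
  fixes f :: "'a::euclidean_space \<Rightarrow> real"
  assumes f: "integrable lborel f" and t: "t > 0"
  shows "(\<integral>\<^sup>+\<xi>. ennreal (exp (- t * (norm \<xi>)\<^sup>2) * (cmod (ft f \<xi>))\<^sup>2) \<partial>lborel) =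
    ennreal (LINT p|lborel. f (fst p) * f (snd p) * heat t (fst p - snd p))"
proof -
  note [measurable] = borel_measurable_integrable[OF f]
  have i: "integrable lborel (\<lambda>\<xi>. exp (- t * (norm \<xi>)\<^sup>2) * (cmod (ft f \<xi>))\<^sup>2)"
  proof (rule Bochner_Integration.integrable_bound)
    show "integrable lborel (\<lambda>\<xi>::'a. (LINT x|lborel. \<bar>f x\<bar>)\<^sup>2 * exp (- t * (norm \<xi>)\<^sup>2))"
      using integral_cis_gaussian(1)[OF t, where 'a='a] by (intro Bochner_Integration.integrable_mult_right)
    show "AE \<xi> in lborel. norm (exp (- t * (norm \<xi>)\<^sup>2) * (cmod (ft f \<xi>))\<^sup>2) \<le> norm ((LINT x|lborel. \<bar>f x\<bar>)\<^sup>2 * exp (- t * (norm \<xi>)\<^sup>2))"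
      using power_mono[OF ft_bound[OF f] norm_ge_zero, of _ 2] by (intro AE_I2) (simp add: abs_mult mult.commute[of "exp _"] mult_right_mono)
  qed measurable
  have "complex_of_real (LINT p|lborel. f (fst p) * f (snd p) * heat t (fst p - snd p)) =
    (LINT \<xi>|lborel. of_real (exp (- t * (norm \<xi>)\<^sup>2)) * ft f \<xi> * cnj (ft f \<xi>))"
    by (rule gaussian_pairing(1)[OF f f t, symmetric])
  also have "\<dots> = (LINT \<xi>|lborel. complex_of_real (exp (- t * (norm \<xi>)\<^sup>2) * (cmod (ft f \<xi>))\<^sup>2))"
    by (simp add: mult.assoc complex_norm_square[symmetric] del: of_real_power)
  also have "\<dots> = of_real (LINT \<xi>|lborel. exp (- t * (norm \<xi>)\<^sup>2) * (cmod (ft f \<xi>))\<^sup>2)"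
    by (rule integral_complex_of_real)
  finally show ?thesis
    using nn_integral_eq_integral[OF i] by (simp only: of_real_eq_iff) simp
qed

lemma nn_integral_pair_mult:
  fixes F :: "'a::euclidean_space \<Rightarrow> ennreal" and G :: "'a \<Rightarrow> 'b::euclidean_space \<Rightarrow> ennreal"
  assumes [measurable]: "F \<in> borel_measurable borel" "(\<lambda>p. G (fst p) (snd p)) \<in> borel_measurable (borel \<Otimes>\<^sub>M borel)"
  shows "(\<integral>\<^sup>+p. F (fst p) * G (fst p) (snd p) \<partial>lborel) = (\<integral>\<^sup>+x. F x * (\<integral>\<^sup>+y. G x y \<partial>lborel) \<partial>lborel)"
proof -
  have [measurable]: "(\<lambda>p. G (fst p) (snd p)) \<in> borel_measurable (lborel \<Otimes>\<^sub>M lborel)"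
    by (simp cong: measurable_cong_sets sets_pair_measure_cong)
  have "(\<integral>\<^sup>+p. F (fst p) * G (fst p) (snd p) \<partial>(lborel \<Otimes>\<^sub>M lborel)) = (\<integral>\<^sup>+x. (\<integral>\<^sup>+y. F x * G x y \<partial>lborel) \<partial>lborel)"
  proof -
    have m: "(\<lambda>p. F (fst p) * G (fst p) (snd p)) \<in> borel_measurable (lborel \<Otimes>\<^sub>M lborel)" by measurable
    show ?thesis using lborel.nn_integral_fst[OF m] by simp
  qed
  also have "\<dots> = (\<integral>\<^sup>+x. F x * (\<integral>\<^sup>+y. G x y \<partial>lborel) \<partial>lborel)"
  proof (intro nn_integral_cong nn_integral_cmult)
    fix x
    show "(\<lambda>y. G x y) \<in> borel_measurable lborel"
      using measurable_compose[OF measurable_Pair1'[of x borel borel] assms(2)] by simp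
  qed
  finally show ?thesis by (simp add: lborel_prod)
qed

lemma nn_integral_pairing_le:
  fixes f :: "'a::euclidean_space \<Rightarrow> real"
  assumes [measurable]: "f \<in> borel_measurable borel" "g \<in> borel_measurable borel" and t: "t > 0"
    and gb: "\<And>x. \<bar>g x\<bar> \<le> C * h x" and [measurable]: "h \<in> borel_measurable borel" 
  shows "ennreal (LINT p|lborel. f (fst p) * g (snd p) * heat t (fst p - snd p)) \<le>
    (\<integral>\<^sup>+x. ennreal \<bar>f x\<bar> * (\<integral>\<^sup>+y. ennreal (C * h y * heat t (x - y)) \<partial>lborel) \<partial>lborel)"
proof -
  let ?A = "LINT p|lborel. f (fst p) * g (snd p) * heat t (fst p - snd p)"
  have "ennreal ?A \<le> ennreal (norm ?A)" by (intro ennreal_leI) simp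
  also have "\<dots> \<le> (\<integral>\<^sup>+p. ennreal (norm (f (fst p) * g (snd p) * heat t (fst p - snd p))) \<partial>lborel)"
  \<comment> \<open>Without integrability the integral on the left is the default 0 and the bound is
    trivial.\<close>
  proof (cases "integrable lborel (\<lambda>p. f (fst p) * g (snd p) * heat t (fst p - snd p))")
    case True then show ?thesis by (rule Bochner_Integration.integral_norm_bound_ennreal)
  qed (simp add: not_integrable_integral_eq)
  also have "\<dots> \<le> (\<integral>\<^sup>+p. ennreal \<bar>f (fst p)\<bar> * ennreal (C * h (snd p) * heat t (fst p - snd p)) \<partial>lborel)"
  proof (rule nn_integral_mono)
    fix p :: "'a \<times> 'a"
    have "norm (f (fst p) * g (snd p) * heat t (fst p - snd p)) \<le> \<bar>f (fst p)\<bar> * (C * h (snd p) * heat t (fst p - snd p))"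
      using mult_left_mono[OF mult_right_mono[OF gb[of "snd p"] heat_nonneg[of t "fst p - snd p"]], of "\<bar>f (fst p)\<bar>"]
      by (simp add: abs_mult heat_nonneg mult.assoc)
    then show "ennreal (norm (f (fst p) * g (snd p) * heat t (fst p - snd p))) \<le> ennreal \<bar>f (fst p)\<bar> * ennreal (C * h (snd p) * heat t (fst p - snd p))"
      by (subst ennreal_mult'[symmetric]) (auto intro: ennreal_leI)
  qed
  also have "\<dots> = (\<integral>\<^sup>+x. ennreal \<bar>f x\<bar> * (\<integral>\<^sup>+y. ennreal (C * h y * heat t (x - y)) \<partial>lborel) \<partial>lborel)"
    by (rule nn_integral_pair_mult) measurable
  finally show ?thesis .
qed

text \<open>Writing the weight as a superposition of Gaussians turns the energy into a time integral
  of heat kernel pairings. These are dominated by the pairing of \<open>ballpow (-\<beta>) 1\<close>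
  with its own heat potential, and integrating over time leaves the finite constant
  \<open>riesz_const\<close> times the mass of the profile.\<close>

lemma negative_order_energy_finite:
  fixes f :: "'a::euclidean_space \<Rightarrow> real"
  assumes \<beta>: "0 < \<beta>" "\<beta> < 1" and N: "2 \<le> DIM('a)"
    and [measurable]: "f \<in> borel_measurable borel" and fb: "\<And>x. \<bar>f x\<bar> \<le> C * ballpow (-\<beta>) 1 x"
  shows "(\<integral>\<^sup>+\<xi>. ennreal (norm \<xi> powr (-2*\<beta>) * (cmod (ft f \<xi>))\<^sup>2) \<partial>lborel) < \<infinity>"
proof -
  have G: "integrable lborel (ballpow (-\<beta>) 1 :: 'a \<Rightarrow> real)" using ballpow_integrable[of "-\<beta>"] \<beta> N by simp
  have C: "C \<ge> 0"
  proof -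
    have "0 \<le> C * ballpow (-\<beta>) 1 (0::'a)" using order_trans[OF abs_ge_zero fb] .
    then show ?thesis by (simp add: ballpow_def)
  qed
  have f: "integrable lborel f"
    by (rule Bochner_Integration.integrable_bound[where f="\<lambda>x. C * ballpow (-\<beta>) 1 x"])
      (use G fb C in \<open>auto intro!: AE_I2 simp: abs_mult\<close>)
  have gauss_le: "(\<integral>\<^sup>+\<xi>. ennreal (tpow \<beta> t * exp (- t * (norm \<xi>)\<^sup>2)) * ennreal ((cmod (ft f \<xi>))\<^sup>2) \<partial>lborel)
     \<le> (\<integral>\<^sup>+x. ennreal (C\<^sup>2 * ballpow (-\<beta>) 1 x) * ennreal (tpow \<beta> t * heatpot (-\<beta>) t (x::'a)) \<partial>lborel)" for t
  proof (cases "t > 0")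
    case t: True
    have "(\<integral>\<^sup>+\<xi>. ennreal (tpow \<beta> t * exp (- t * (norm \<xi>)\<^sup>2)) * ennreal ((cmod (ft f \<xi>))\<^sup>2) \<partial>lborel)
      = ennreal (tpow \<beta> t) * (\<integral>\<^sup>+\<xi>. ennreal (exp (- t * (norm \<xi>)\<^sup>2) * (cmod (ft f \<xi>))\<^sup>2) \<partial>lborel)"
      by (subst nn_integral_cmult[symmetric]) (simp_all add: ennreal_mult' mult.assoc)
    also have "\<dots> = ennreal (tpow \<beta> t) * ennreal (LINT p|lborel. f (fst p) * f (snd p) * heat t (fst p - snd p))"
      by (simp only: gaussian_energy[OF f t])
    also have "\<dots> \<le> ennreal (tpow \<beta> t) * (\<integral>\<^sup>+x. ennreal \<bar>f x\<bar> * (\<integral>\<^sup>+y. ennreal (C * ballpow (-\<beta>) 1 y * heat t (x - y)) \<partial>lborel) \<partial>lborel)"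
      by (rule mult_left_mono[OF nn_integral_pairing_le[OF _ _ t fb]]) auto
    also have "\<dots> = ennreal (tpow \<beta> t) * (\<integral>\<^sup>+x. ennreal \<bar>f x\<bar> * (ennreal C * ennreal (heatpot (-\<beta>) t x)) \<partial>lborel)"
    proof -
      have "(\<integral>\<^sup>+y. ennreal (C * ballpow (-\<beta>) 1 y * heat t (x - y)) \<partial>lborel) = ennreal C * ennreal (heatpot (-\<beta>) t x)" for x :: 'a
        using \<beta> N t C by (subst ennreal_heatpot) (auto simp: mult.assoc ennreal_mult' nn_integral_cmult)
      then show ?thesis by simp
    qed
    also have "\<dots> \<le> ennreal (tpow \<beta> t) * (\<integral>\<^sup>+x. ennreal (C * ballpow (-\<beta>) 1 x) * (ennreal C * ennreal (heatpot (-\<beta>) t (x::'a))) \<partial>lborel)"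
      by (intro mult_left_mono nn_integral_mono mult_right_mono ennreal_leI fb) auto
    also have "\<dots> = (\<integral>\<^sup>+x. ennreal (C\<^sup>2 * ballpow (-\<beta>) 1 x) * ennreal (tpow \<beta> t * heatpot (-\<beta>) t (x::'a)) \<partial>lborel)"
    proof (subst nn_integral_cmult[symmetric])
      show "(\<lambda>x::'a. ennreal (C * ballpow (-\<beta>) 1 x) * (ennreal C * ennreal (heatpot (-\<beta>) t x))) \<in> borel_measurable lborel"
        unfolding heatpot_def by measurable
    qed (use C in \<open>simp add: ennreal_mult' power2_eq_square mult_ac\<close>)
    finally show ?thesis .
  qed (simp add: tpow_def)
  have "ennreal (Gamma \<beta>) * (\<integral>\<^sup>+\<xi>. ennreal (norm \<xi> powr (-2*\<beta>) * (cmod (ft f \<xi>))\<^sup>2) \<partial>lborel) =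
     (\<integral>\<^sup>+\<xi>. ennreal (Gamma \<beta>) * ennreal (norm \<xi> powr (-2*\<beta>) * (cmod (ft f \<xi>))\<^sup>2) \<partial>lborel)"
    by (rule nn_integral_cmult[symmetric]) measurable
  also have "\<dots> = (\<integral>\<^sup>+\<xi>. (\<integral>\<^sup>+t. ennreal (tpow \<beta> t * exp (- t * (norm \<xi>)\<^sup>2)) * ennreal ((cmod (ft f \<xi>))\<^sup>2) \<partial>lborel) \<partial>lborel)"
  proof (rule nn_integral_cong_AE)
    have "AE \<xi>::'a in lborel. \<xi> \<noteq> 0" by (rule AE_lborel_singleton)
    then show "AE \<xi> in lborel. ennreal (Gamma \<beta>) * ennreal (norm \<xi> powr (-2*\<beta>) * (cmod (ft f \<xi>))\<^sup>2)
       = (\<integral>\<^sup>+t. ennreal (tpow \<beta> t * exp (- t * (norm \<xi>)\<^sup>2)) * ennreal ((cmod (ft f \<xi>))\<^sup>2) \<partial>lborel)"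
    proof (rule eventually_mono)
      fix \<xi> :: 'a assume "\<xi> \<noteq> 0"
      then have k: "(norm \<xi>)\<^sup>2 > 0" by simp
      have p: "((norm \<xi>)\<^sup>2) powr (-\<beta>) = norm \<xi> powr (-2*\<beta>)"
        using \<open>\<xi> \<noteq> 0\<close> by (simp add: powr_powr flip: powr_numeral)
      have "(\<integral>\<^sup>+t. ennreal (tpow \<beta> t * exp (- t * (norm \<xi>)\<^sup>2)) * ennreal ((cmod (ft f \<xi>))\<^sup>2) \<partial>lborel)
         = ennreal (Gamma \<beta> * ((norm \<xi>)\<^sup>2) powr (-\<beta>)) * ennreal ((cmod (ft f \<xi>))\<^sup>2)"
        by (subst nn_integral_multc, measurable, subst nn_integral_tpow_exp[OF \<beta>(1) k], rule refl)
      then show "ennreal (Gamma \<beta>) * ennreal (norm \<xi> powr (-2*\<beta>) * (cmod (ft f \<xi>))\<^sup>2)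
       = (\<integral>\<^sup>+t. ennreal (tpow \<beta> t * exp (- t * (norm \<xi>)\<^sup>2)) * ennreal ((cmod (ft f \<xi>))\<^sup>2) \<partial>lborel)"
        using Gamma_real_pos[OF \<beta>(1)] by (simp add: p ennreal_mult' ennreal_mult'' mult.assoc)
    qed
  qed
  also have "\<dots> = (\<integral>\<^sup>+t. (\<integral>\<^sup>+\<xi>. ennreal (tpow \<beta> t * exp (- t * (norm \<xi>)\<^sup>2)) * ennreal ((cmod (ft f \<xi>))\<^sup>2) \<partial>lborel) \<partial>lborel)"
    by (rule lborel_pair.Fubini') measurable
  also have "\<dots> \<le> (\<integral>\<^sup>+t. (\<integral>\<^sup>+x. ennreal (C\<^sup>2 * ballpow (-\<beta>) 1 x) * ennreal (tpow \<beta> t * heatpot (-\<beta>) t (x::'a)) \<partial>lborel) \<partial>lborel)"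
    by (rule nn_integral_mono) (rule gauss_le)
  also have "\<dots> = (\<integral>\<^sup>+x. (\<integral>\<^sup>+t. ennreal (C\<^sup>2 * ballpow (-\<beta>) 1 x) * ennreal (tpow \<beta> t * heatpot (-\<beta>) t (x::'a)) \<partial>lborel) \<partial>lborel)"
    unfolding heatpot_def by (rule lborel_pair.Fubini') measurable
  also have "\<dots> = (\<integral>\<^sup>+x. ennreal (C\<^sup>2 * ballpow (-\<beta>) 1 x) * riesz_const TYPE('a) \<beta> \<partial>(lborel::'a measure))"
  proof (rule nn_integral_cong)
    fix x :: 'a
    have "(\<integral>\<^sup>+t. ennreal (C\<^sup>2 * ballpow (-\<beta>) 1 x) * ennreal (tpow \<beta> t * heatpot (-\<beta>) t x) \<partial>lborel)
      = ennreal (C\<^sup>2 * ballpow (-\<beta>) 1 x) * (\<integral>\<^sup>+t. ennreal (tpow \<beta> t * heatpot (-\<beta>) t x) \<partial>lborel)"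
      unfolding heatpot_def by (rule nn_integral_cmult) measurable
    then show "(\<integral>\<^sup>+t. ennreal (C\<^sup>2 * ballpow (-\<beta>) 1 x) * ennreal (tpow \<beta> t * heatpot (-\<beta>) t x) \<partial>lborel)
      = ennreal (C\<^sup>2 * ballpow (-\<beta>) 1 x) * riesz_const TYPE('a) \<beta>"
      using nn_integral_tpow_heatpot[OF \<beta> N, of x] by (cases "norm x < 1") (auto simp: ballpow_outside)
  qed
  also have "\<dots> = (\<integral>\<^sup>+x. ennreal (C\<^sup>2 * ballpow (-\<beta>) 1 x) \<partial>(lborel::'a measure)) * riesz_const TYPE('a) \<beta>"
    by (rule nn_integral_multc) measurable
  also have "\<dots> < \<infinity>"
    using integrable_mult_right[OF G, of "C\<^sup>2"] riesz_const_finite[OF \<beta> N]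
    by (subst nn_integral_eq_integral) (auto simp: ennreal_mult_less_top)
  finally have "ennreal (Gamma \<beta>) * (\<integral>\<^sup>+\<xi>. ennreal (norm \<xi> powr (-2*\<beta>) * (cmod (ft f \<xi>))\<^sup>2) \<partial>lborel) < \<infinity>" .
  then show ?thesis using Gamma_real_pos[OF \<beta>(1)] by (auto simp: ennreal_mult_less_top intro: le_less_trans)
qed

text \<open>The subordination is now used as an identity: both sides are integrals over time of a
  Gaussian-damped pairing. In space the profile's potential is constant on the support of
  \<open>v\<close>, so only the mass of \<open>v\<close> remains.\<close>

lemma negative_order_pairing:
  fixes v :: "'a::euclidean_space \<Rightarrow> real"
  assumes \<beta>: "0 < \<beta>" "\<beta> < 1" and N: "2 \<le> DIM('a)"
    and v: "integrable lborel v" and supp: "\<And>x. norm x \<ge> 1 \<Longrightarrow> v x = 0"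
    and int: "integrable lborel (\<lambda>\<xi>. norm \<xi> powr (-2*\<beta>) * cmod (ft v \<xi>))"
  shows "(LINT \<xi>|lborel. of_real (norm \<xi> powr (-2*\<beta>)) * ft v \<xi> * cnj (ft (ballpow (-\<beta>) 1) \<xi>)) =
     of_real (enn2real (riesz_const TYPE('a) \<beta>) / Gamma \<beta> * (LINT x|lborel. v x))"
proof -
  note [measurable] = borel_measurable_integrable[OF v]
  let ?G = "ballpow (-\<beta>) 1 :: 'a \<Rightarrow> real"
  have G: "integrable lborel ?G" using ballpow_integrable[of "-\<beta>"] \<beta> N by simp
  define h where "h \<xi> = ft v \<xi> * cnj (ft ?G \<xi>)" for \<xi>
  have [measurable]: "h \<in> borel_measurable borel" unfolding h_def by measurable
  have Gam: "Gamma \<beta> > 0" using Gamma_real_pos[OF \<beta>(1)] .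
  have ih: "integrable lborel (\<lambda>\<xi>. norm \<xi> powr (-2*\<beta>) * cmod (h \<xi>))"
  proof (rule Bochner_Integration.integrable_bound)
    show "integrable lborel (\<lambda>\<xi>. (LINT x|lborel. \<bar>?G x\<bar>) * (norm \<xi> powr (-2*\<beta>) * cmod (ft v \<xi>)))" using int by simp
    show "AE \<xi> in lborel. norm (norm \<xi> powr (-2*\<beta>) * cmod (h \<xi>)) \<le> norm ((LINT x|lborel. \<bar>?G x\<bar>) * (norm \<xi> powr (-2*\<beta>) * cmod (ft v \<xi>)))"
    proof (rule AE_I2)
      fix \<xi> :: 'a
      have "(norm \<xi> powr (-2*\<beta>) * cmod (ft v \<xi>)) * cmod (ft ?G \<xi>) \<le> (norm \<xi> powr (-2*\<beta>) * cmod (ft v \<xi>)) * (LINT x|lborel. \<bar>?G x\<bar>)"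
        by (rule mult_left_mono[OF ft_bound[OF G]]) simp
      then show "norm (norm \<xi> powr (-2*\<beta>) * cmod (h \<xi>)) \<le> norm ((LINT x|lborel. \<bar>?G x\<bar>) * (norm \<xi> powr (-2*\<beta>) * cmod (ft v \<xi>)))"
        by (simp add: h_def norm_mult abs_mult mult_ac)
    qed
  qed measurable
  have te: "has_bochner_integral lborel (\<lambda>t. tpow \<beta> t * exp (- t * (norm \<xi>)\<^sup>2)) (Gamma \<beta> * norm \<xi> powr (-2*\<beta>))" if "\<xi> \<noteq> 0" for \<xi> :: 'a
  proof (rule has_bochner_integral_nn_integral)
    have k: "(norm \<xi>)\<^sup>2 > 0" using that by simp
    have p: "((norm \<xi>)\<^sup>2) powr (-\<beta>) = norm \<xi> powr (-2*\<beta>)"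
      using that by (simp add: powr_powr flip: powr_numeral)
    show "(\<integral>\<^sup>+t. ennreal (tpow \<beta> t * exp (- t * (norm \<xi>)\<^sup>2)) \<partial>lborel) = ennreal (Gamma \<beta> * norm \<xi> powr (-2*\<beta>))"
      using nn_integral_tpow_exp[OF \<beta>(1) k] unfolding p .
  qed (use Gam in auto)
  let ?K = "\<lambda>\<xi> t. of_real (tpow \<beta> t * exp (- t * (norm \<xi>)\<^sup>2)) * h \<xi>"
  have AE0: "AE \<xi>::'a in lborel. \<xi> \<noteq> 0" by (rule AE_lborel_singleton)
  \<comment> \<open>The frequency side converges absolutely because the transform of the profile is
    bounded and that of \<open>v\<close> is integrable against the weight by
    \<open>int\<close>.\<close>
  have F1: "integrable (lborel \<Otimes>\<^sub>M lborel) (\<lambda>(\<xi>,t). ?K \<xi> t)"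
  proof (rule lborel_pair.Fubini_integrable)
    show "AE \<xi> in lborel. integrable lborel (\<lambda>t. case (\<xi>, t) of (\<xi>, t) \<Rightarrow> ?K \<xi> t)"
      using AE0
    proof (rule eventually_mono)
      fix \<xi> :: 'a assume "\<xi> \<noteq> 0"
      from te[OF this] have "integrable lborel (\<lambda>t. tpow \<beta> t * exp (- t * (norm \<xi>)\<^sup>2))" by (simp add: has_bochner_integral_iff)
      then have "integrable lborel (\<lambda>t. complex_of_real (tpow \<beta> t * exp (- t * (norm \<xi>)\<^sup>2)))" by (rule integrable_of_real)
      then show "integrable lborel (\<lambda>t. case (\<xi>, t) of (\<xi>, t) \<Rightarrow> ?K \<xi> t)"
        unfolding case_prod_conv by (rule integrable_mult_left)
    qed
    have "integrable lborel (\<lambda>\<xi>. Gamma \<beta> * (norm \<xi> powr (-2*\<beta>) * cmod (h \<xi>)))" using ih by simp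
    then show "integrable lborel (\<lambda>\<xi>. LINT t|lborel. norm (case (\<xi>, t) of (\<xi>, t) \<Rightarrow> ?K \<xi> t))"
    proof (rule integrable_cong_AE_imp)
      show "AE \<xi> in lborel. Gamma \<beta> * (norm \<xi> powr (-2*\<beta>) * cmod (h \<xi>)) = (LINT t|lborel. norm (case (\<xi>, t) of (\<xi>, t) \<Rightarrow> ?K \<xi> t))"
        using AE0
      proof (rule eventually_mono)
        fix \<xi> :: 'a assume "\<xi> \<noteq> 0"
        have "(LINT t|lborel. norm (?K \<xi> t)) = (LINT t|lborel. (tpow \<beta> t * exp (- t * (norm \<xi>)\<^sup>2)) * cmod (h \<xi>))"
          by (intro Bochner_Integration.integral_cong refl) (simp add: norm_mult abs_mult)
        also have "\<dots> = Gamma \<beta> * norm \<xi> powr (-2*\<beta>) * cmod (h \<xi>)"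
          using te[OF \<open>\<xi> \<noteq> 0\<close>] by (simp add: has_bochner_integral_iff)
        finally show "Gamma \<beta> * (norm \<xi> powr (-2*\<beta>) * cmod (h \<xi>)) = (LINT t|lborel. norm (case (\<xi>, t) of (\<xi>, t) \<Rightarrow> ?K \<xi> t))"
          by (simp only: case_prod_conv mult.assoc)
      qed
    qed measurable
  qed measurable
  define g where "g t x = tpow \<beta> t * heatpot (-\<beta>) t x" for t and x :: 'a
  have g_meas[measurable]: "(\<lambda>p. g (fst p) (snd p)) \<in> borel_measurable (lborel \<Otimes>\<^sub>M lborel)"
    unfolding g_def heatpot_def by measurable
  have g_nonneg: "g t x \<ge> 0" for t x unfolding g_def by (simp add: heatpot_nonneg)
  define R where "R = enn2real (riesz_const TYPE('a) \<beta>)"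
  have R: "ennreal R = riesz_const TYPE('a) \<beta>" unfolding R_def using riesz_const_finite[OF \<beta> N] by simp
  have gx: "has_bochner_integral lborel (\<lambda>t. g t x) R" if "norm x < 1" for x
  proof (rule has_bochner_integral_nn_integral)
    show "(\<integral>\<^sup>+t. ennreal (g t x) \<partial>lborel) = ennreal R"
      unfolding R g_def by (rule nn_integral_tpow_heatpot[OF \<beta> N that])
    show "(\<lambda>t. g t x) \<in> borel_measurable lborel"
      unfolding g_def heatpot_def by measurable
  qed (auto simp: g_nonneg R_def)
  have F2: "integrable (lborel \<Otimes>\<^sub>M lborel) (\<lambda>(x,t). v x * g t x)"
  proof (rule lborel_pair.Fubini_integrable)
    show "(\<lambda>(x,t). v x * g t x) \<in> borel_measurable (lborel \<Otimes>\<^sub>M lborel)"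
      unfolding g_def heatpot_def by measurable
    show "AE x in lborel. integrable lborel (\<lambda>t. case (x, t) of (x, t) \<Rightarrow> v x * g t x)"
    proof (rule AE_I2)
      fix x
      show "integrable lborel (\<lambda>t. case (x, t) of (x, t) \<Rightarrow> v x * g t x)"
        using gx[of x] supp[of x] by (cases "norm x < 1") (auto simp: has_bochner_integral_iff)
    qed
    have "(\<lambda>x. LINT t|lborel. norm (case (x, t) of (x, t) \<Rightarrow> v x * g t x)) = (\<lambda>x. \<bar>v x\<bar> * R)"
    proof
      fix x
      show "(LINT t|lborel. norm (case (x, t) of (x, t) \<Rightarrow> v x * g t x)) = \<bar>v x\<bar> * R"
        using gx[of x] supp[of x] by (cases "norm x < 1") (auto simp: has_bochner_integral_iff abs_mult g_nonneg)
    qed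
    then show "integrable lborel (\<lambda>x. LINT t|lborel. norm (case (x, t) of (x, t) \<Rightarrow> v x * g t x))"
      using v by simp
  qed
  have inner: "(LINT \<xi>|lborel. ?K \<xi> t) = of_real (LINT x|lborel. v x * g t x)" for t
  proof (cases "t > 0")
    case True
    have "(LINT \<xi>|lborel. ?K \<xi> t) = of_real (tpow \<beta> t) * (LINT \<xi>|lborel. of_real (exp (- t * (norm \<xi>)\<^sup>2)) * ft v \<xi> * cnj (ft ?G \<xi>))"
      unfolding Bochner_Integration.integral_mult_right_zero[symmetric] by (simp add: h_def mult.assoc)
    also have "\<dots> = of_real (tpow \<beta> t * (LINT p|lborel. v (fst p) * ?G (snd p) * heat t (fst p - snd p)))"
      using gaussian_pairing(1)[OF v G True] by simp
    also have "(LINT p|lborel. v (fst p) * ?G (snd p) * heat t (fst p - snd p)) = (LINT x|lborel. (LINT y|lborel. v x * ?G y * heat t (x - y)))"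
      using lborel_pair.integral_fst[of "\<lambda>x y. v x * ?G y * heat t (x - y)"] gaussian_pairing(2)[OF v G True]
      by (simp add: lborel_prod case_prod_unfold)
    also have "\<dots> = (LINT x|lborel. v x * heatpot (-\<beta>) t x)"
      unfolding heatpot_def by (simp add: mult.assoc)
    also have "tpow \<beta> t * (LINT x|lborel. v x * heatpot (-\<beta>) t x) = (LINT x|lborel. v x * g t x)"
      unfolding Bochner_Integration.integral_mult_right_zero[symmetric] g_def by (simp add: mult.left_commute)
    finally show ?thesis .
  qed (simp add: tpow_def g_def)
  have "of_real (Gamma \<beta>) * (LINT \<xi>|lborel. of_real (norm \<xi> powr (-2*\<beta>)) * h \<xi>) = (LINT \<xi>|lborel. (LINT t|lborel. ?K \<xi> t))"
    unfolding Bochner_Integration.integral_mult_right_zero[symmetric]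
  proof (rule integral_cong_AE)
    show "AE \<xi> in lborel. of_real (Gamma \<beta>) * (of_real (norm \<xi> powr (-2*\<beta>)) * h \<xi>) = (LINT t|lborel. ?K \<xi> t)"
      using AE0
    proof (rule eventually_mono)
      fix \<xi> :: 'a assume "\<xi> \<noteq> 0"
      have "(LINT t|lborel. ?K \<xi> t) = (LINT t|lborel. complex_of_real (tpow \<beta> t * exp (- t * (norm \<xi>)\<^sup>2))) * h \<xi>"
        by (rule Bochner_Integration.integral_mult_left_zero)
      also have "\<dots> = of_real (Gamma \<beta> * norm \<xi> powr (-2*\<beta>)) * h \<xi>"
        using te[OF \<open>\<xi> \<noteq> 0\<close>] by (simp add: has_bochner_integral_iff integral_complex_of_real del: of_real_mult)
      finally show "of_real (Gamma \<beta>) * (of_real (norm \<xi> powr (-2*\<beta>)) * h \<xi>) = (LINT t|lborel. ?K \<xi> t)"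
        by (simp only: of_real_mult mult.assoc)
    qed
  qed measurable
  also have "\<dots> = (LINT t|lborel. (LINT \<xi>|lborel. ?K \<xi> t))"
    by (rule lborel_pair.Fubini_integral[OF F1, symmetric])
  also have "\<dots> = of_real (LINT t|lborel. (LINT x|lborel. v x * g t x))"
    unfolding inner by (rule integral_complex_of_real)
  also have "(LINT t|lborel. (LINT x|lborel. v x * g t x)) = (LINT x|lborel. (LINT t|lborel. v x * g t x))"
    by (rule lborel_pair.Fubini_integral[OF F2])
  also have "\<dots> = (LINT x|lborel. v x * R)"
  proof (rule Bochner_Integration.integral_cong[OF refl])
    fix x
    show "(LINT t|lborel. v x * g t x) = v x * R"
      using gx[of x] supp[of x] by (cases "norm x < 1") (auto simp: has_bochner_integral_iff)
  qed
  finally have eq: "of_real (Gamma \<beta>) * (LINT \<xi>|lborel. of_real (norm \<xi> powr (-2*\<beta>)) * h \<xi>) = complex_of_real (LINT x|lborel. v x * R)" .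
  have "(LINT \<xi>|lborel. of_real (norm \<xi> powr (-2*\<beta>)) * h \<xi>) = 
      of_real (Gamma \<beta>) * (LINT \<xi>|lborel. of_real (norm \<xi> powr (-2*\<beta>)) * h \<xi>) / of_real (Gamma \<beta>)"
    using Gam by simp
  also have "\<dots> = complex_of_real (R / Gamma \<beta> * (LINT x|lborel. v x))"
    unfolding eq by simp
  finally show ?thesis unfolding h_def R_def mult.assoc .
qed

lemma AE_norm_neq: "AE x::'a::euclidean_space in lborel. norm x \<noteq> r"
proof -
  have "sphere (0::'a) r \<in> null_sets lebesgue"
    using negligible_sphere negligible_iff_null_sets by blast
  then have "sphere (0::'a) r \<in> null_sets lborel"
    by (subst (asm) null_sets_completion_iff) auto
  then have "AE x in lborel. x \<notin> sphere (0::'a) r" by (rule AE_not_in)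
  then show ?thesis by (rule eventually_mono) auto
qed

lemma isCont_ballpow:
  fixes x :: "'a::euclidean_space"
  assumes "norm x \<noteq> r" "r \<ge> 0"
  shows "isCont (ballpow a r) x"
proof (cases "norm x < r")
  case True
  then have "r\<^sup>2 - (norm x)\<^sup>2 > 0" by (simp add: power_strict_mono)
  then show ?thesis unfolding ballpow_def by (intro continuous_intros) (auto simp: max_def)
next
  case False
  have "eventually (\<lambda>y. r < norm y) (nhds x)"
  proof (rule eventually_nhds_in_open[of "{y. r < norm y}", simplified])
    show "open {y::'a. r < norm y}" by (intro open_Collect_less continuous_intros)
  qed (use False assms in auto)
  then have "eventually (\<lambda>y. ballpow a r y = 0) (nhds x)"
    by (rule eventually_mono) (use assms in \<open>auto simp: ballpow_outside\<close>)
  then show ?thesis by (subst isCont_cong[where g="\<lambda>_. 0"]) auto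
qed

lemma ballpow_mono_exponent:
  fixes x :: "'a::euclidean_space"
  assumes "a \<le> b" shows "ballpow b 1 x \<le> ballpow a 1 x"
proof (cases "norm x < 1")
  case True
  then have "1 - (norm x)\<^sup>2 > 0" by (simp add: abs_square_less_1)
  then show ?thesis using powr_mono'[OF assms, of "1 - (norm x)\<^sup>2"] by (simp add: ballpow_def)
qed (simp add: ballpow_outside)

lemma nn_integral_heat_shift:
  fixes x :: "'a::euclidean_space"
  assumes t: "t > 0"
  shows "(\<integral>\<^sup>+y. ennreal (heat t (x - y)) \<partial>lborel) = ennreal (heat_mass TYPE('a))"
proof -
  have s: "sqrt t > 0" using t by simp
  have "(\<integral>\<^sup>+y. ennreal (heat t (x - y)) \<partial>lborel) = ennreal (\<bar>- sqrt t\<bar> ^ DIM('a)) * (\<integral>\<^sup>+z. ennreal (heat t (x - (x + (- sqrt t) *\<^sub>R z))) \<partial>lborel)"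
    by (rule nn_integral_lborel_affine) (use s in auto)
  also have "\<dots> = (\<integral>\<^sup>+z. ennreal (sqrt t ^ DIM('a) * heat t (sqrt t *\<^sub>R (z::'a))) \<partial>lborel)"
    using t by (subst nn_integral_cmult[symmetric]) (auto simp: ennreal_mult')
  also have "\<dots> = (\<integral>\<^sup>+z. ennreal (heat 1 (z::'a)) \<partial>lborel)"
    by (simp only: heat_scale[OF t])
  also have "\<dots> = ennreal (heat_mass TYPE('a))"
    unfolding heat_mass_def by (rule nn_integral_eq_integral[OF integrable_heat]) (auto simp: heat_nonneg)
  finally show ?thesis .
qed

text \<open>At order 0 no subordination is at hand. The damped energies are bounded uniformly in
  time, as the heat kernel has constant mass and \<open>f\<close> is bounded, and Fatou's lemma
  removes the damping.\<close>

lemma order_zero_energy_finite: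
  fixes f :: "'a::euclidean_space \<Rightarrow> real"
  assumes [measurable]: "f \<in> borel_measurable borel" and fb: "\<And>x. \<bar>f x\<bar> \<le> C * ballpow 0 1 x"
  shows "(\<integral>\<^sup>+\<xi>. ennreal ((cmod (ft f \<xi>))\<^sup>2) \<partial>lborel) < \<infinity>"
proof -
  have C: "C \<ge> 0"
  proof -
    have "0 \<le> C * ballpow 0 1 (0::'a)" using order_trans[OF abs_ge_zero fb] .
    then show ?thesis by (simp add: ballpow_def)
  qed
  have b1: "ballpow 0 1 x \<le> 1" for x :: 'a by (simp add: ballpow_def)
  have bC: "C * ballpow 0 1 x \<le> C" for x :: 'a using mult_left_mono[OF b1 C] by simp
  have f: "integrable lborel f"
  proof (rule integrable_bounded_in_ball)
    show "\<bar>f x\<bar> \<le> C" for x using order_trans[OF fb bC] .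
    show "norm x \<ge> 1 \<Longrightarrow> f x = 0" for x using fb[of x] by (simp add: ballpow_outside)
  qed simp
  define B where "B = (\<integral>\<^sup>+x. ennreal \<bar>f x\<bar> * (ennreal C * ennreal (heat_mass TYPE('a))) \<partial>lborel)"
  have Bfin: "B < \<infinity>"
    unfolding B_def using f by (subst nn_integral_multc) (auto simp: ennreal_mult_less_top integrable_iff_bounded)
  let ?t = "\<lambda>n. 1 / real (Suc n)"
  have le: "(\<integral>\<^sup>+\<xi>. ennreal (exp (- ?t n * (norm \<xi>)\<^sup>2) * (cmod (ft f \<xi>))\<^sup>2) \<partial>lborel) \<le> B" for n
  proof -
    have t: "?t n > 0" by simp
    have "(\<integral>\<^sup>+\<xi>. ennreal (exp (- ?t n * (norm \<xi>)\<^sup>2) * (cmod (ft f \<xi>))\<^sup>2) \<partial>lborel) = ennreal (LINT p|lborel. f (fst p) * f (snd p) * heat (?t n) (fst p - snd p))"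
      by (rule gaussian_energy[OF f t])
    also have "\<dots> \<le> (\<integral>\<^sup>+x. ennreal \<bar>f x\<bar> * (\<integral>\<^sup>+y. ennreal (C * ballpow 0 1 y * heat (?t n) (x - y)) \<partial>lborel) \<partial>lborel)"
      by (rule nn_integral_pairing_le[OF _ _ t fb]) auto
    also have "\<dots> \<le> B" unfolding B_def
    proof (intro nn_integral_mono mult_left_mono)
      fix x :: 'a
      have "(\<integral>\<^sup>+y. ennreal (C * ballpow 0 1 y * heat (?t n) (x - y)) \<partial>lborel) \<le> (\<integral>\<^sup>+y. ennreal C * ennreal (heat (?t n) (x - y)) \<partial>lborel)"
        using mult_right_mono[OF bC heat_nonneg] C by (intro nn_integral_mono) (auto simp: ennreal_mult'[symmetric] intro!: ennreal_leI)
      also have "\<dots> = ennreal C * ennreal (heat_mass TYPE('a))"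
        by (subst nn_integral_cmult, measurable, simp only: nn_integral_heat_shift[OF t])
      finally show "(\<integral>\<^sup>+y. ennreal (C * ballpow 0 1 y * heat (?t n) (x - y)) \<partial>lborel) \<le> ennreal C * ennreal (heat_mass TYPE('a))" .
    qed auto
    finally show ?thesis .
  qed
  have lim: "(\<lambda>n. ennreal (exp (- ?t n * (norm \<xi>)\<^sup>2) * (cmod (ft f \<xi>))\<^sup>2)) \<longlonglongrightarrow> ennreal ((cmod (ft f \<xi>))\<^sup>2)" for \<xi>
  proof (rule tendsto_ennrealI)
    have "(\<lambda>n. ?t n) \<longlonglongrightarrow> 0" using LIMSEQ_inverse_real_of_nat by (simp add: inverse_eq_divide)
    then have "(\<lambda>n. exp (- ?t n * (norm \<xi>)\<^sup>2) * (cmod (ft f \<xi>))\<^sup>2) \<longlonglongrightarrow> exp (- 0 * (norm \<xi>)\<^sup>2) * (cmod (ft f \<xi>))\<^sup>2"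
      by (intro tendsto_mult tendsto_exp tendsto_minus tendsto_const)
    then show "(\<lambda>n. exp (- ?t n * (norm \<xi>)\<^sup>2) * (cmod (ft f \<xi>))\<^sup>2) \<longlonglongrightarrow> (cmod (ft f \<xi>))\<^sup>2" by simp
  qed
  have "(\<integral>\<^sup>+\<xi>. ennreal ((cmod (ft f \<xi>))\<^sup>2) \<partial>lborel) = (\<integral>\<^sup>+\<xi>. liminf (\<lambda>n. ennreal (exp (- ?t n * (norm \<xi>)\<^sup>2) * (cmod (ft f \<xi>))\<^sup>2)) \<partial>lborel)"
    by (intro nn_integral_cong lim_imp_Liminf[OF _ lim, symmetric]) simp
  also have "\<dots> \<le> liminf (\<lambda>n. \<integral>\<^sup>+\<xi>. ennreal (exp (- ?t n * (norm \<xi>)\<^sup>2) * (cmod (ft f \<xi>))\<^sup>2) \<partial>lborel)"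
    by (rule nn_integral_liminf) measurable
  also have "\<dots> \<le> B"
    by (rule Liminf_le) (use le in simp_all)
  finally show ?thesis using Bfin by (rule le_less_trans)
qed

text \<open>The range of \<open>a\<close> is that of \<open>s\<close> minus its ceiling, the order
  from which positive orders are reached in integer steps.\<close>

lemma nonpositive_order_energy_finite:
  fixes f :: "'a::euclidean_space \<Rightarrow> real"
  assumes a: "-1 < a" "a \<le> 0" and N: "2 \<le> DIM('a)"
    and [measurable]: "f \<in> borel_measurable borel" and fb: "\<And>x. \<bar>f x\<bar> \<le> C * ballpow a 1 x"
  shows "integrable lborel (\<lambda>\<xi>. norm \<xi> powr (2*a) * (cmod (ft f \<xi>))\<^sup>2)"
proof -
  have "(\<integral>\<^sup>+\<xi>. ennreal (norm \<xi> powr (2*a) * (cmod (ft f \<xi>))\<^sup>2) \<partial>lborel) < \<infinity>"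
  proof (cases "a = 0")
    case True
    have "(\<integral>\<^sup>+\<xi>. ennreal (norm \<xi> powr (2*a) * (cmod (ft f \<xi>))\<^sup>2) \<partial>lborel) \<le> (\<integral>\<^sup>+\<xi>. ennreal ((cmod (ft f \<xi>))\<^sup>2) \<partial>lborel)"
      using True by (intro nn_integral_mono ennreal_leI) auto
    also have "\<dots> < \<infinity>" using fb unfolding True by (intro order_zero_energy_finite) auto
    finally show ?thesis .
  next
    case False
    then show ?thesis using negative_order_energy_finite[of "-a" f C] a N fb by simp
  qed
  then show ?thesis by (intro integrableI_bounded) auto
qed

section \<open>The fractional Laplacian of the ball profile\<close>

text \<open>
  Weak form of \<open>(-\<Delta>)\<^sup>a (1 - |x|\<^sup>2)\<^sub>+\<^sup>a = \<kappa>\<close> in the unit ball. The decay required of the transform of \<open>v\<close> makes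
  the integral converge also for negative \<open>a\<close>, where the induction on \<open>a\<close> starts.
\<close>
definition pairing_at :: "'a::euclidean_space itself \<Rightarrow> real \<Rightarrow> real \<Rightarrow> bool" where
  "pairing_at _ a \<kappa> \<longleftrightarrow> (\<forall>v::'a \<Rightarrow> real. integrable lborel v \<longrightarrow> (\<forall>x. norm x \<ge> 1 \<longrightarrow> v x = 0) \<longrightarrow>
     (\<forall>j>-2. integrable lborel (\<lambda>\<xi>. norm \<xi> powr j * cmod (ft v \<xi>))) \<longrightarrow>
     (LINT \<xi>|lborel. of_real (norm \<xi> powr (2*a)) * ft v \<xi> * cnj (ft (ballpow a 1) \<xi>)) = of_real (\<kappa> * (LINT x|lborel. v x)))"

text \<open>Order 0 is Parseval's relation with the indicator of the ball. The damping is removed by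
  dominated convergence in frequency and by \<open>heat_pairing_limit\<close> in space, which brings
  in \<open>heat_mass\<close> as the constant.\<close>

lemma pairing_at_zero: "\<exists>\<kappa>. pairing_at TYPE('a::euclidean_space) 0 \<kappa>"
proof -
  let ?G = "ballpow 0 1 :: 'a \<Rightarrow> real"
  have b1: "\<bar>?G x\<bar> \<le> 1" for x :: 'a by (simp add: ballpow_def)
  have G: "integrable lborel ?G" by (rule integrable_bounded_in_ball[OF _ b1, where R=1]) (auto simp: ballpow_outside)
  have "pairing_at TYPE('a) 0 (heat_mass TYPE('a))"
    unfolding pairing_at_def
  proof (intro allI impI)
    fix v :: "'a \<Rightarrow> real"
    assume v: "integrable lborel v" and supp: "\<forall>x. norm x \<ge> 1 \<longrightarrow> v x = 0"
      and int: "\<forall>j>-2. integrable lborel (\<lambda>\<xi>. norm \<xi> powr j * cmod (ft v \<xi>))"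
    note [measurable] = borel_measurable_integrable[OF v]
    let ?t = "\<lambda>n. 1 / real (Suc n)"
    have AE0: "AE \<xi>::'a in lborel. \<xi> \<noteq> 0" by (rule AE_lborel_singleton)
    have "integrable lborel (\<lambda>\<xi>. norm \<xi> powr 0 * cmod (ft v \<xi>))" by (rule int[rule_format]) simp
    \<comment> \<open>\<open>0 powr 0 = 0\<close>, so the weight of order 0 equals 1 off the origin
      only; hence the passage through an almost everywhere equality.\<close>
    then have iv: "integrable lborel (\<lambda>\<xi>. cmod (ft v \<xi>))"
    proof (rule integrable_cong_AE_imp)
      show "AE \<xi> in lborel. norm \<xi> powr 0 * cmod (ft v \<xi>) = cmod (ft v \<xi>)"
        using AE0 by (rule eventually_mono) simp
    qed measurable
    have "(\<lambda>n. LINT \<xi>|lborel. of_real (exp (- ?t n * (norm \<xi>)\<^sup>2)) * ft v \<xi> * cnj (ft ?G \<xi>)) \<longlonglongrightarrow> (LINT \<xi>|lborel. ft v \<xi> * cnj (ft ?G \<xi>))"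
    proof (rule integral_dominated_convergence[where w="\<lambda>\<xi>. (LINT x|lborel. \<bar>?G x\<bar>) * cmod (ft v \<xi>)"])
      show "integrable lborel (\<lambda>\<xi>. (LINT x|lborel. \<bar>?G x\<bar>) * cmod (ft v \<xi>))" using iv by simp
      show "AE \<xi> in lborel. norm (of_real (exp (- ?t n * (norm \<xi>)\<^sup>2)) * ft v \<xi> * cnj (ft ?G \<xi>)) \<le> (LINT x|lborel. \<bar>?G x\<bar>) * cmod (ft v \<xi>)" for n
      proof (rule AE_I2)
        fix \<xi> :: 'a
        have "exp (- ?t n * (norm \<xi>)\<^sup>2) * (cmod (ft v \<xi>) * cmod (ft ?G \<xi>)) \<le> 1 * (cmod (ft v \<xi>) * (LINT x|lborel. \<bar>?G x\<bar>))"
          by (intro mult_mono mult_left_mono ft_bound[OF G]) auto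
        then show "norm (of_real (exp (- ?t n * (norm \<xi>)\<^sup>2)) * ft v \<xi> * cnj (ft ?G \<xi>)) \<le> (LINT x|lborel. \<bar>?G x\<bar>) * cmod (ft v \<xi>)"
          by (simp add: norm_mult mult_ac)
      qed
      show "AE \<xi> in lborel. (\<lambda>n. of_real (exp (- ?t n * (norm \<xi>)\<^sup>2)) * ft v \<xi> * cnj (ft ?G \<xi>)) \<longlonglongrightarrow> ft v \<xi> * cnj (ft ?G \<xi>)"
      proof (rule AE_I2)
        fix \<xi> :: 'a
        have "(\<lambda>n. ?t n) \<longlonglongrightarrow> 0" using LIMSEQ_inverse_real_of_nat by (simp add: inverse_eq_divide)
        then have "(\<lambda>n. of_real (exp (- ?t n * (norm \<xi>)\<^sup>2)) * ft v \<xi> * cnj (ft ?G \<xi>)) \<longlonglongrightarrow> of_real (exp (- 0 * (norm \<xi>)\<^sup>2)) * ft v \<xi> * cnj (ft ?G \<xi>)"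
          by (intro tendsto_mult tendsto_of_real tendsto_exp tendsto_minus tendsto_const)
        then show "(\<lambda>n. of_real (exp (- ?t n * (norm \<xi>)\<^sup>2)) * ft v \<xi> * cnj (ft ?G \<xi>)) \<longlonglongrightarrow> ft v \<xi> * cnj (ft ?G \<xi>)" by simp
      qed
    qed measurable
    moreover have "(\<lambda>n. LINT \<xi>|lborel. of_real (exp (- ?t n * (norm \<xi>)\<^sup>2)) * ft v \<xi> * cnj (ft ?G \<xi>)) \<longlonglongrightarrow> complex_of_real (heat_mass TYPE('a) * (LINT x|lborel. v x * ?G x))"
    proof -
      have eq: "(LINT \<xi>|lborel. of_real (exp (- ?t n * (norm \<xi>)\<^sup>2)) * ft v \<xi> * cnj (ft ?G \<xi>)) = complex_of_real (LINT p|lborel. v (fst p) * ?G (snd p) * heat (?t n) (fst p - snd p))" for n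
        by (rule gaussian_pairing(1)[OF v G]) simp
      have "AE x::'a in lborel. isCont ?G x"
        using AE_norm_neq[of 1] by (rule eventually_mono) (auto intro: isCont_ballpow)
      then show ?thesis unfolding eq by (intro tendsto_of_real heat_pairing_limit[OF v _ b1]) auto
    qed
    ultimately have "(LINT \<xi>|lborel. ft v \<xi> * cnj (ft ?G \<xi>)) = complex_of_real (heat_mass TYPE('a) * (LINT x|lborel. v x * ?G x))"
      by (rule LIMSEQ_unique)
    moreover have "(LINT \<xi>|lborel. of_real (norm \<xi> powr (2*0)) * ft v \<xi> * cnj (ft ?G \<xi>)) = (LINT \<xi>|lborel. ft v \<xi> * cnj (ft ?G \<xi>))"
    proof (rule integral_cong_AE)
      show "AE \<xi> in lborel. of_real (norm \<xi> powr (2*0)) * ft v \<xi> * cnj (ft ?G \<xi>) = ft v \<xi> * cnj (ft ?G \<xi>)"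
        using AE0 by (rule eventually_mono) simp
    qed measurable
    moreover have "v x * ?G x = v x" for x
    proof (cases "norm x < 1")
      case True
      then have "1 - (norm x)\<^sup>2 > 0" by (simp add: abs_square_less_1)
      then show ?thesis by (simp add: ballpow_def max_def)
    qed (use supp in auto)
    ultimately show "(LINT \<xi>|lborel. of_real (norm \<xi> powr (2*0)) * ft v \<xi> * cnj (ft ?G \<xi>)) = of_real (heat_mass TYPE('a) * (LINT x|lborel. v x))"
      by simp
  qed
  then show ?thesis by blast
qed

lemma pairing_at_nonpositive:
  assumes "-1 < a" "a \<le> 0" and N: "2 \<le> DIM('a)"
  shows "\<exists>\<kappa>. pairing_at TYPE('a::euclidean_space) a \<kappa>"
proof (cases "a = 0")
  case True then show ?thesis using pairing_at_zero by simp
next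
  case False
  have "pairing_at TYPE('a) a (enn2real (riesz_const TYPE('a) (-a)) / Gamma (-a))"
    unfolding pairing_at_def
  proof (intro allI impI)
    fix v :: "'a \<Rightarrow> real"
    assume v: "integrable lborel v" and supp: "\<forall>x. norm x \<ge> 1 \<longrightarrow> v x = 0"
      and int: "\<forall>j>-2. integrable lborel (\<lambda>\<xi>. norm \<xi> powr j * cmod (ft v \<xi>))"
    have "integrable lborel (\<lambda>\<xi>. norm \<xi> powr (2*a) * cmod (ft v \<xi>))" using int assms by auto
    then show "(LINT \<xi>|lborel. of_real (norm \<xi> powr (2*a)) * ft v \<xi> * cnj (ft (ballpow a 1) \<xi>)) = of_real (enn2real (riesz_const TYPE('a) (-a)) / Gamma (-a) * (LINT x|lborel. v x))"
      using negative_order_pairing[of "-a" v] assms False v supp by simp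
  qed
  then show ?thesis by blast
qed

section \<open>Directional derivatives on the frequency side\<close>

lemma integral_cis_interval:
  assumes "t > 0"
  shows "\<i> * of_real \<theta> * (LINT \<tau>|lborel. indicator {0..t} \<tau> *\<^sub>R cis (\<tau> * \<theta>)) = cis (t * \<theta>) - 1"
proof -
  have "(LINT \<tau>|lborel. indicator {0..t} \<tau> *\<^sub>R (\<i> * of_real \<theta> * cis (\<tau> * \<theta>))) = cis (t * \<theta>) - cis (0 * \<theta>)"
  proof (rule integral_FTC_Icc)
    fix x :: real
    show "((\<lambda>\<tau>. cis (\<tau> * \<theta>)) has_vector_derivative \<i> * of_real \<theta> * cis (x * \<theta>)) (at x within {0..t})"
      unfolding cis_conv_exp
      by (auto intro!: derivative_eq_intros has_vector_derivative_real_field simp: mult_ac)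
  qed (use assms in \<open>auto intro!: continuous_intros\<close>)
  also have "(LINT \<tau>|lborel. indicator {0..t} \<tau> *\<^sub>R (\<i> * of_real \<theta> * cis (\<tau> * \<theta>))) = 
     (LINT \<tau>|lborel. (\<i> * of_real \<theta>) * (indicator {0..t} \<tau> *\<^sub>R cis (\<tau> * \<theta>)))"
    by (intro Bochner_Integration.integral_cong refl) simp
  also have "\<dots> = \<i> * of_real \<theta> * (LINT \<tau>|lborel. indicator {0..t} \<tau> *\<^sub>R cis (\<tau> * \<theta>))"
    by (rule Bochner_Integration.integral_mult_right_zero)
  finally show ?thesis by simp
qed

lemma integrable_line_average:
  fixes g :: "'a::euclidean_space \<Rightarrow> real"
  assumes g: "integrable lborel g" and t: "t > 0"
  shows "integrable (lborel \<Otimes>\<^sub>M lborel) (\<lambda>(\<tau>,x). indicator {0..t} \<tau> * g (x + \<tau> *\<^sub>R w))"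
proof (rule lborel_pair.Fubini_integrable)
  note [measurable] = borel_measurable_integrable[OF g]
  show "(\<lambda>(\<tau>,x). indicator {0..t} \<tau> * g (x + \<tau> *\<^sub>R w)) \<in> borel_measurable (lborel \<Otimes>\<^sub>M lborel)" by measurable
  show "AE \<tau> in lborel. integrable lborel (\<lambda>x. case (\<tau>, x) of (\<tau>, x) \<Rightarrow> indicator {0..t} \<tau> * g (x + \<tau> *\<^sub>R w))"
    using lborel_integrable_translate[OF g] by simp
  have "(LINT x|lborel. norm (indicator {0..t} \<tau> * g (x + \<tau> *\<^sub>R w))) = indicator {0..t} \<tau> * (LINT x|lborel. \<bar>g x\<bar>)" for \<tau>
    using lborel_integral_translate[of "\<lambda>x. \<bar>g x\<bar>" "\<tau> *\<^sub>R w"] by (simp add: abs_mult)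
  moreover have "integrable lborel (\<lambda>\<tau>. indicator {0..t} \<tau> * (LINT x|lborel. \<bar>g x\<bar>))"
    by (intro Bochner_Integration.integrable_mult_left integrable_real_indicator) (use t in auto)
  ultimately show "integrable lborel (\<lambda>\<tau>. LINT x|lborel. norm (case (\<tau>, x) of (\<tau>, x) \<Rightarrow> indicator {0..t} \<tau> * g (x + \<tau> *\<^sub>R w)))"
    by simp
qed

text \<open>Increments along \<open>w\<close> are used instead of pointwise derivatives, so
  \<open>g\<close> may be singular at the sphere. Transforming the increment identity gives the
  phase factor \<open>cis (t * \<theta>) - 1\<close> on the left and its integral representation on
  the right; one \<open>t\<close> for which it does not vanish suffices.\<close>

lemma ft_line_derivative_AE:
  fixes f g :: "'a::euclidean_space \<Rightarrow> real"
  assumes f: "integrable lborel f" and g: "integrable lborel g"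
    and inc: "\<And>t. t > 0 \<Longrightarrow> AE x in lborel. f (x + t *\<^sub>R w) - f x = (LINT \<tau>|lborel. indicator {0..t} \<tau> * g (x + \<tau> *\<^sub>R w))"
  shows "\<i> * of_real (w \<bullet> \<xi>) * ft f \<xi> = ft g \<xi>"
proof -
  note [measurable] = borel_measurable_integrable[OF f] borel_measurable_integrable[OF g]
  define \<theta> where "\<theta> = w \<bullet> \<xi>"
  have main: "(cis (t * \<theta>) - 1) * ft f \<xi> = (LINT \<tau>|lborel. indicator {0..t} \<tau> *\<^sub>R cis (\<tau> * \<theta>)) * ft g \<xi>" if t: "t > 0" for t
  proof -
    have fi: "integrable lborel (\<lambda>x. f (x + t *\<^sub>R w))" by (rule lborel_integrable_translate[OF f])
    have "(cis (t * \<theta>) - 1) * ft f \<xi> = ft (\<lambda>x. f (x + t *\<^sub>R w)) \<xi> - ft f \<xi>"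
      by (simp add: ft_translate \<theta>_def algebra_simps)
    also have "\<dots> = ft (\<lambda>x. f (x + t *\<^sub>R w) - f x) \<xi>"
      by (rule ft_diff[OF fi f, symmetric])
    also have "\<dots> = ft (\<lambda>x. LINT \<tau>|lborel. indicator {0..t} \<tau> * g (x + \<tau> *\<^sub>R w)) \<xi>"
      by (rule ft_cong_AE[OF _ _ inc[OF t]]) measurable
    also have "\<dots> = (LINT x|lborel. (LINT \<tau>|lborel. cis (- (x \<bullet> \<xi>)) * of_real (indicator {0..t} \<tau> * g (x + \<tau> *\<^sub>R w))))"
      unfolding ft_def by (simp only: Bochner_Integration.integral_mult_right_zero integral_complex_of_real)
    also have "\<dots> = (LINT \<tau>|lborel. (LINT x|lborel. cis (- (x \<bullet> \<xi>)) * of_real (indicator {0..t} \<tau> * g (x + \<tau> *\<^sub>R w))))"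
    proof (rule lborel_pair.Fubini_integral)
      have "integrable (lborel \<Otimes>\<^sub>M lborel) (\<lambda>(\<tau>,x). cis (- (x \<bullet> \<xi>)) * complex_of_real (indicator {0..t} \<tau> * g (x + \<tau> *\<^sub>R w)))"
        by (rule Bochner_Integration.integrable_bound[OF integrable_line_average[OF g t, of w]]) (auto simp: norm_mult abs_mult)
      then show "integrable (lborel \<Otimes>\<^sub>M lborel) (\<lambda>(\<tau>,x). cis (- (x \<bullet> \<xi>)) * complex_of_real (indicator {0..t} \<tau> * g (x + \<tau> *\<^sub>R w)))" .
    qed
    also have "\<dots> = (LINT \<tau>|lborel. (indicator {0..t} \<tau> *\<^sub>R cis (\<tau> * \<theta>)) * ft g \<xi>)"
    proof (rule Bochner_Integration.integral_cong[OF refl])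
      fix \<tau> :: real
      have "(LINT x|lborel. cis (- (x \<bullet> \<xi>)) * of_real (indicator {0..t} \<tau> * g (x + \<tau> *\<^sub>R w))) = of_real (indicator {0..t} \<tau>) * ft (\<lambda>x. g (x + \<tau> *\<^sub>R w)) \<xi>"
        unfolding ft_def Bochner_Integration.integral_mult_right_zero[symmetric] by (simp add: mult_ac)
      then show "(LINT x|lborel. cis (- (x \<bullet> \<xi>)) * of_real (indicator {0..t} \<tau> * g (x + \<tau> *\<^sub>R w))) = (indicator {0..t} \<tau> *\<^sub>R cis (\<tau> * \<theta>)) * ft g \<xi>"
        by (simp add: ft_translate \<theta>_def scaleR_conv_of_real mult.assoc)
    qed
    also have "\<dots> = (LINT \<tau>|lborel. indicator {0..t} \<tau> *\<^sub>R cis (\<tau> * \<theta>)) * ft g \<xi>"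
      by (rule Bochner_Integration.integral_mult_left_zero)
    finally show ?thesis .
  qed
  show ?thesis
  proof (cases "\<theta> = 0")
    case True
    have "0 = (LINT \<tau>|lborel. indicator {0..1::real} \<tau> *\<^sub>R (1::complex)) * ft g \<xi>"
      using main[of 1] True by simp
    also have "(LINT \<tau>|lborel. indicator {0..1::real} \<tau> *\<^sub>R (1::complex)) = 1"
      by (subst Bochner_Integration.integral_scaleR_left) auto
    finally show ?thesis using True by (simp add: \<theta>_def)
  next
    case False
    \<comment> \<open>Then \<open>t * \<theta>\<close> is 1 or -1, and sin 1 > 0 keeps
      \<open>cis (t * \<theta>)\<close> away from 1.\<close>
    define t where "t = 1 / \<bar>\<theta>\<bar>"
    have t: "t > 0" using False by (simp add: t_def)
    have "t * \<theta> = 1 \<or> t * \<theta> = -1" using False by (auto simp: t_def abs_if)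
    then have "cis (t * \<theta>) \<noteq> 1"
    proof -
      have "sin (1::real) > 0" by (rule sin_gt_zero) (use pi_gt3 in auto)
      then have "sin (t * \<theta>) \<noteq> 0" using \<open>t * \<theta> = 1 \<or> t * \<theta> = -1\<close> by auto
      then show ?thesis by (auto simp: complex_eq_iff)
    qed
    then have ne: "cis (t * \<theta>) - 1 \<noteq> 0" by simp
    have "(cis (t * \<theta>) - 1) * (\<i> * of_real \<theta> * ft f \<xi>) = \<i> * of_real \<theta> * ((cis (t * \<theta>) - 1) * ft f \<xi>)" by simp
    also have "\<dots> = (\<i> * of_real \<theta> * (LINT \<tau>|lborel. indicator {0..t} \<tau> *\<^sub>R cis (\<tau> * \<theta>))) * ft g \<xi>"
      unfolding main[OF t] by simp
    also have "\<dots> = (cis (t * \<theta>) - 1) * ft g \<xi>" unfolding integral_cis_interval[OF t] ..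
    finally show ?thesis using ne by (simp add: \<theta>_def)
  qed
qed

text \<open>A line meets the sphere in finitely many points, where differentiability may fail, which
  is the role of \<open>S\<close>. The increment identity holds for almost every base point only,
  because Fubini gives integrability of \<open>g\<close> on almost every line.\<close>

lemma ft_line_derivative:
  fixes f g :: "'a::euclidean_space \<Rightarrow> real"
  assumes f: "integrable lborel f" and g: "integrable lborel g"
    and cont: "\<And>x t. continuous_on {0..t} (\<lambda>\<tau>. f (x + \<tau> *\<^sub>R w))"
    and deriv: "\<And>x t. \<exists>S. finite S \<and> (\<forall>\<tau>\<in>{0<..<t} - S. ((\<lambda>\<tau>. f (x + \<tau> *\<^sub>R w)) has_real_derivative g (x + \<tau> *\<^sub>R w)) (at \<tau>))"
  shows "\<i> * of_real (w \<bullet> \<xi>) * ft f \<xi> = ft g \<xi>"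
proof (rule ft_line_derivative_AE[OF f g])
  fix t :: real assume t: "t > 0"
  have "AE x in lborel. integrable lborel (\<lambda>\<tau>. indicator {0..t} \<tau> * g (x + \<tau> *\<^sub>R w))"
    using lborel_pair.AE_integrable_snd[OF integrable_line_average[OF g t, of w]] by simp
  then show "AE x in lborel. f (x + t *\<^sub>R w) - f x = (LINT \<tau>|lborel. indicator {0..t} \<tau> * g (x + \<tau> *\<^sub>R w))"
  proof (rule eventually_mono)
    fix x assume i: "integrable lborel (\<lambda>\<tau>. indicator {0..t} \<tau> * g (x + \<tau> *\<^sub>R w))"
    obtain S where S: "finite S" "\<And>\<tau>. \<tau> \<in> {0<..<t} - S \<Longrightarrow> ((\<lambda>\<tau>. f (x + \<tau> *\<^sub>R w)) has_real_derivative g (x + \<tau> *\<^sub>R w)) (at \<tau>)"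
      using deriv[of t x] by blast
    have "((\<lambda>\<tau>. g (x + \<tau> *\<^sub>R w)) has_integral f (x + t *\<^sub>R w) - f (x + 0 *\<^sub>R w)) {0..t}"
      by (rule fundamental_theorem_of_calculus_interior_strong[OF S(1)])
        (use t S(2) cont in \<open>auto simp: has_real_derivative_iff_has_vector_derivative\<close>)
    moreover have "((\<lambda>\<tau>. g (x + \<tau> *\<^sub>R w)) has_integral (LINT \<tau>|lborel. indicator {0..t} \<tau> * g (x + \<tau> *\<^sub>R w))) {0..t}"
      using set_borel_integral_eq_integral[of "{0..t}" "\<lambda>\<tau>. g (x + \<tau> *\<^sub>R w)"] i
      by (simp add: set_integrable_def set_lebesgue_integral_def has_integral_iff)
    ultimately show "f (x + t *\<^sub>R w) - f x = (LINT \<tau>|lborel. indicator {0..t} \<tau> * g (x + \<tau> *\<^sub>R w))"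
      by (auto dest: has_integral_unique)
  qed
qed

lemma real_norm_le_norm: "0 \<le> x \<Longrightarrow> x \<le> y \<Longrightarrow> norm x \<le> norm (y::real)"
  by simp

text \<open>Differentiating \<open>ballpow (b + 1) 1\<close> in direction \<open>w\<close> produces
  \<open>x \<bullet> w\<close> times \<open>ballpow b 1\<close>. Admitting all powers of
  \<open>x \<bullet> w\<close> gives a family closed under this differentiation.\<close>

definition monopow :: "'a::euclidean_space \<Rightarrow> nat \<Rightarrow> real \<Rightarrow> 'a \<Rightarrow> real" where
  "monopow w i b x = (x \<bullet> w) ^ i * ballpow b 1 x"

lemma monopow_measurable [measurable]: "monopow w i b \<in> borel_measurable borel"
  unfolding monopow_def by measurable

lemma monopow_bound: "\<bar>monopow w i b x\<bar> \<le> norm w ^ i * ballpow b 1 x"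
proof (cases "norm x < 1")
  case True
  have "\<bar>x \<bullet> w\<bar> \<le> norm x * norm w" by (rule Cauchy_Schwarz_ineq2)
  also have "\<dots> \<le> 1 * norm w" using True by (intro mult_right_mono) auto
  finally have "\<bar>x \<bullet> w\<bar> ^ i \<le> norm w ^ i" by (intro power_mono) auto
  then show ?thesis by (simp add: monopow_def abs_mult power_abs mult_right_mono)
qed (simp add: monopow_def ballpow_outside)

lemma monopow_integrable:
  assumes "-1 < b" "2 \<le> DIM('a)"
  shows "integrable lborel (monopow (w::'a::euclidean_space) i b)"
  by (rule Bochner_Integration.integrable_bound[where f="\<lambda>x. norm w ^ i * ballpow b 1 x"])
    (use ballpow_integrable[OF assms] monopow_bound[of w i b] in \<open>auto intro!: AE_I2 simp: abs_mult\<close>)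

text \<open>On a line the weight is a quadratic polynomial with nonzero leading coefficient, so it
  has at most two zeros. Away from them the truncated power is either smooth or locally 0; at them
  it is continuous because \<open>b + 1\<close> is positive.\<close>

lemma max_powr_line:
  fixes c0 c1 c2 b :: real
  assumes c2: "c2 \<noteq> 0" and b: "-1 < b"
  defines "p \<equiv> \<lambda>\<tau>. c0 + c1 * \<tau> + c2 * \<tau>\<^sup>2"
  shows "continuous_on S (\<lambda>\<tau>. (max 0 (p \<tau>)) powr (b + 1))"
    and "finite {\<tau>. p \<tau> = 0}"
    and "p \<tau> \<noteq> 0 \<Longrightarrow> ((\<lambda>\<tau>. (max 0 (p \<tau>)) powr (b + 1)) has_real_derivative (b + 1) * (c1 + 2 * c2 * \<tau>) * (max 0 (p \<tau>)) powr b) (at \<tau>)"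
proof -
  show "continuous_on S (\<lambda>\<tau>. (max 0 (p \<tau>)) powr (b + 1))"
    unfolding p_def using b by (intro continuous_on_powr' continuous_intros) auto
  have "{\<tau>. p \<tau> = 0} = {\<tau>. poly [:c0, c1, c2:] \<tau> = 0}"
    by (auto simp: p_def power2_eq_square algebra_simps)
  then show "finite {\<tau>. p \<tau> = 0}" using poly_roots_finite[of "[:c0, c1, c2:]"] c2 by simp
  have dp: "(p has_real_derivative (c1 + 2 * c2 * \<tau>)) (at \<tau>)"
    unfolding p_def by (auto intro!: derivative_eq_intros)
  have cp: "continuous_on UNIV p" unfolding p_def by (intro continuous_intros)
  assume ne: "p \<tau> \<noteq> 0"
  show "((\<lambda>\<tau>. (max 0 (p \<tau>)) powr (b + 1)) has_real_derivative (b + 1) * (c1 + 2 * c2 * \<tau>) * (max 0 (p \<tau>)) powr b) (at \<tau>)"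
  proof (cases "p \<tau> > 0")
    case True
    have ev: "eventually (\<lambda>x. (max 0 (p x)) powr (b + 1) = p x powr (b + 1)) (nhds \<tau>)"
    proof -
      have "eventually (\<lambda>x. x \<in> {x. 0 < p x}) (nhds \<tau>)"
        by (rule eventually_nhds_in_open) (use True cp in \<open>auto intro: open_Collect_less continuous_on_const\<close>)
      then show ?thesis by (rule eventually_mono) auto
    qed
    have "((\<lambda>x. p x powr (b + 1)) has_real_derivative (b + 1) * p \<tau> powr (b + 1 - 1) * (c1 + 2 * c2 * \<tau>)) (at \<tau>)"
      using has_real_derivative_powr[OF True, of "b+1"] dp by (rule DERIV_chain2)
    then show ?thesis using True by (subst DERIV_cong_ev[OF refl ev refl]) (simp add: mult_ac)
  next
    case False
    then have neg: "p \<tau> < 0" using ne by simp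
    have ev: "eventually (\<lambda>x. (max 0 (p x)) powr (b + 1) = 0) (nhds \<tau>)"
    proof -
      have "eventually (\<lambda>x. x \<in> {x. p x < 0}) (nhds \<tau>)"
        by (rule eventually_nhds_in_open) (use neg cp in \<open>auto intro: open_Collect_less continuous_on_const\<close>)
      then show ?thesis by (rule eventually_mono) auto
    qed
    show ?thesis using neg by (subst DERIV_cong_ev[OF refl ev refl]) simp
  qed
qed

text \<open>
  The case \<open>i = 0\<close> relies on \<open>real i = 0\<close> annihilating the term with the truncated index \<open>i - 1\<close>.
\<close>
lemma ft_monopow:
  fixes w :: "'a::euclidean_space"
  assumes b: "-1 < b" and N: "2 \<le> DIM('a)" and w: "w \<noteq> 0"
  shows "\<i> * of_real (w \<bullet> \<xi>) * ft (monopow w i (b + 1)) \<xi> =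
    of_real (real i * (norm w)\<^sup>2) * ft (monopow w (i - 1) (b + 1)) \<xi> - of_real (2 * (b + 1)) * ft (monopow w (i + 1) b) \<xi>"
proof -
  define f1 where "f1 = monopow w (i - 1) (b + 1)"
  define f2 where "f2 = monopow w (i + 1) b"
  have i1: "integrable lborel f1" "integrable lborel f2"
    unfolding f1_def f2_def using b N by (auto intro: monopow_integrable)
  have "\<i> * of_real (w \<bullet> \<xi>) * ft (monopow w i (b + 1)) \<xi> = ft (\<lambda>x. (real i * (norm w)\<^sup>2) * f1 x - (2 * (b + 1)) * f2 x) \<xi>"
  proof (rule ft_line_derivative)
    show "integrable lborel (monopow w i (b + 1))" using b N by (intro monopow_integrable) auto
    show "integrable lborel (\<lambda>x. (real i * (norm w)\<^sup>2) * f1 x - (2 * (b + 1)) * f2 x)" using i1 by simp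
  next
    fix x :: 'a and t :: real
    have nrm: "1\<^sup>2 - (norm (x + \<tau> *\<^sub>R w))\<^sup>2 = (1 - (norm x)\<^sup>2) + (- 2 * (x \<bullet> w)) * \<tau> + (- (norm w)\<^sup>2) * \<tau>\<^sup>2" for \<tau>
      unfolding power2_norm_eq_inner by (simp add: inner_simps inner_commute power2_eq_square algebra_simps)
    have c2: "- (norm w)\<^sup>2 \<noteq> 0" using w by simp
    have lin: "(x + \<tau> *\<^sub>R w) \<bullet> w = x \<bullet> w + \<tau> * (norm w)\<^sup>2" for \<tau>
      by (simp add: inner_simps power2_norm_eq_inner)
    have fe: "monopow w i (b + 1) (x + \<tau> *\<^sub>R w) = (x \<bullet> w + \<tau> * (norm w)\<^sup>2) ^ i *
        (max 0 ((1 - (norm x)\<^sup>2) + (- 2 * (x \<bullet> w)) * \<tau> + (- (norm w)\<^sup>2) * \<tau>\<^sup>2)) powr (b + 1)" for \<tau>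
      unfolding monopow_def ballpow_def nrm lin ..
    show "continuous_on {0..t} (\<lambda>\<tau>. monopow w i (b + 1) (x + \<tau> *\<^sub>R w))"
      unfolding fe by (intro continuous_on_mult max_powr_line(1)[OF c2 b] continuous_intros)
    let ?p = "\<lambda>\<tau>. (1 - (norm x)\<^sup>2) + (- 2 * (x \<bullet> w)) * \<tau> + (- (norm w)\<^sup>2) * \<tau>\<^sup>2"
    show "\<exists>S. finite S \<and> (\<forall>\<tau>\<in>{0<..<t} - S. ((\<lambda>\<tau>. monopow w i (b + 1) (x + \<tau> *\<^sub>R w)) has_real_derivative
        (real i * (norm w)\<^sup>2) * f1 (x + \<tau> *\<^sub>R w) - (2 * (b + 1)) * f2 (x + \<tau> *\<^sub>R w)) (at \<tau>))"
    proof (intro exI conjI ballI)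
      show "finite {\<tau>. ?p \<tau> = 0}" by (rule max_powr_line(2)[OF c2 b])
      fix \<tau> assume "\<tau> \<in> {0<..<t} - {\<tau>. ?p \<tau> = 0}"
      then have ne: "?p \<tau> \<noteq> 0" by simp
      have d1: "((\<lambda>\<tau>. (x \<bullet> w + \<tau> * (norm w)\<^sup>2) ^ i) has_real_derivative real i * (x \<bullet> w + \<tau> * (norm w)\<^sup>2) ^ (i - 1) * (norm w)\<^sup>2) (at \<tau>)"
        by (auto intro!: derivative_eq_intros)
      have "((\<lambda>\<tau>. monopow w i (b + 1) (x + \<tau> *\<^sub>R w)) has_real_derivative
         (real i * (x \<bullet> w + \<tau> * (norm w)\<^sup>2) ^ (i - 1) * (norm w)\<^sup>2) * (max 0 (?p \<tau>)) powr (b + 1) +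
         ((b + 1) * (- 2 * (x \<bullet> w) + 2 * (- (norm w)\<^sup>2) * \<tau>) * (max 0 (?p \<tau>)) powr b) * (x \<bullet> w + \<tau> * (norm w)\<^sup>2) ^ i) (at \<tau>)"
        unfolding fe by (rule DERIV_mult[OF d1 max_powr_line(3)[OF c2 b ne]])
      moreover have "(real i * (x \<bullet> w + \<tau> * (norm w)\<^sup>2) ^ (i - 1) * (norm w)\<^sup>2) * (max 0 (?p \<tau>)) powr (b + 1) +
         ((b + 1) * (- 2 * (x \<bullet> w) + 2 * (- (norm w)\<^sup>2) * \<tau>) * (max 0 (?p \<tau>)) powr b) * (x \<bullet> w + \<tau> * (norm w)\<^sup>2) ^ i
        = (real i * (norm w)\<^sup>2) * f1 (x + \<tau> *\<^sub>R w) - (2 * (b + 1)) * f2 (x + \<tau> *\<^sub>R w)"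
      proof -
        define q where "q = x \<bullet> w + \<tau> * (norm w)\<^sup>2"
        have d: "- 2 * (x \<bullet> w) + 2 * (- (norm w)\<^sup>2) * \<tau> = - 2 * q" by (simp add: q_def)
        have gen: "(real i * q ^ (i - 1) * (norm w)\<^sup>2) * Q + ((b + 1) * (- 2 * q) * P) * q ^ i =
          (real i * (norm w)\<^sup>2) * (q ^ (i - 1) * Q) - (2 * (b + 1)) * (q ^ (i + 1) * P)" for P Q
          by (simp add: algebra_simps)
        show ?thesis
          unfolding f1_def f2_def monopow_def ballpow_def nrm lin q_def[symmetric] d by (rule gen)
      qed
      ultimately show "((\<lambda>\<tau>. monopow w i (b + 1) (x + \<tau> *\<^sub>R w)) has_real_derivative
        (real i * (norm w)\<^sup>2) * f1 (x + \<tau> *\<^sub>R w) - (2 * (b + 1)) * f2 (x + \<tau> *\<^sub>R w)) (at \<tau>)" by simp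
    qed
  qed
  also have "\<dots> = of_real (real i * (norm w)\<^sup>2) * ft f1 \<xi> - of_real (2 * (b + 1)) * ft f2 \<xi>"
    using i1 by (subst ft_diff) (simp_all add: ft_cmult)
  finally show ?thesis unfolding f1_def f2_def .
qed

text \<open>Each factor \<open>w \<bullet> \<xi>\<close> is traded for a derivative by
  \<open>ft_monopow\<close>, which lowers the exponent by at most one and shifts the power of
  \<open>x \<bullet> w\<close>; hence the generalisation over \<open>i\<close>. The condition
  \<open>m \<le> n\<close> keeps the exponent at least \<open>a\<close>, where
  \<open>nonpositive_order_energy_finite\<close> closes the induction.\<close>

lemma finite_energy_monopow:
  fixes w :: "'a::euclidean_space"
  assumes a: "-1 < a" "a \<le> 0" and N: "2 \<le> DIM('a)" and w: "w \<noteq> 0" and "m \<le> n"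
  shows "integrable lborel (\<lambda>\<xi>. norm \<xi> powr (2*a) * (\<bar>w \<bullet> \<xi>\<bar> ^ m * cmod (ft (monopow w i (a + real n)) \<xi>))\<^sup>2)"
  using \<open>m \<le> n\<close>
proof (induction m arbitrary: n i)
  case 0
  have "\<bar>monopow w i (a + real n) x\<bar> \<le> norm w ^ i * ballpow a 1 x" for x
    using monopow_bound[of w i "a + real n" x] mult_left_mono[OF ballpow_mono_exponent[of a "a + real n" x], of "norm w ^ i"] by simp
  from nonpositive_order_energy_finite[OF a N monopow_measurable this] show ?case by simp
next
  case (Suc m)
  then obtain n' where n': "n = Suc n'" "m \<le> n'" by (cases n) auto
  define b where "b = a + real n'"
  have b: "-1 < b" "a + real n = b + 1" using a by (auto simp: b_def n')
  define c1 where "c1 = real i * (norm w)\<^sup>2"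
  define c2 where "c2 = 2 * (b + 1)"
  let ?f1 = "\<lambda>\<xi>. \<bar>w \<bullet> \<xi>\<bar> ^ m * cmod (ft (monopow w (i - 1) (b + 1)) \<xi>)"
  let ?f2 = "\<lambda>\<xi>. \<bar>w \<bullet> \<xi>\<bar> ^ m * cmod (ft (monopow w (i + 1) b) \<xi>)"
  have I1: "integrable lborel (\<lambda>\<xi>. norm \<xi> powr (2*a) * (?f1 \<xi>)\<^sup>2)"
    using Suc.IH[of n "i - 1"] n' unfolding b(2) by simp
  have I2: "integrable lborel (\<lambda>\<xi>. norm \<xi> powr (2*a) * (?f2 \<xi>)\<^sup>2)"
    using Suc.IH[of n' "i + 1"] n' unfolding b_def by simp
  have "integrable lborel (\<lambda>\<xi>. 2 * c1\<^sup>2 * (norm \<xi> powr (2*a) * (?f1 \<xi>)\<^sup>2) + 2 * c2\<^sup>2 * (norm \<xi> powr (2*a) * (?f2 \<xi>)\<^sup>2))"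
    using I1 I2 by simp
  then show ?case unfolding b(2)
  proof (rule Bochner_Integration.integrable_bound)
    show "AE \<xi> in lborel. norm (norm \<xi> powr (2*a) * (\<bar>w \<bullet> \<xi>\<bar> ^ Suc m * cmod (ft (monopow w i (b + 1)) \<xi>))\<^sup>2)
      \<le> norm (2 * c1\<^sup>2 * (norm \<xi> powr (2*a) * (?f1 \<xi>)\<^sup>2) + 2 * c2\<^sup>2 * (norm \<xi> powr (2*a) * (?f2 \<xi>)\<^sup>2))"
    proof (rule AE_I2)
      fix \<xi> :: 'a
      have "\<bar>w \<bullet> \<xi>\<bar> * cmod (ft (monopow w i (b + 1)) \<xi>) = cmod (\<i> * of_real (w \<bullet> \<xi>) * ft (monopow w i (b + 1)) \<xi>)"
        by (simp add: norm_mult)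
      also have "\<dots> = cmod (of_real c1 * ft (monopow w (i - 1) (b + 1)) \<xi> - of_real c2 * ft (monopow w (i + 1) b) \<xi>)"
        unfolding ft_monopow[OF b(1) N w] c1_def c2_def ..
      also have "\<dots> \<le> \<bar>c1\<bar> * cmod (ft (monopow w (i - 1) (b + 1)) \<xi>) + \<bar>c2\<bar> * cmod (ft (monopow w (i + 1) b) \<xi>)"
        by (rule order_trans[OF norm_triangle_ineq4]) (simp add: norm_mult)
      finally have "\<bar>w \<bullet> \<xi>\<bar> ^ m * (\<bar>w \<bullet> \<xi>\<bar> * cmod (ft (monopow w i (b + 1)) \<xi>)) \<le> \<bar>w \<bullet> \<xi>\<bar> ^ m * (\<bar>c1\<bar> * cmod (ft (monopow w (i - 1) (b + 1)) \<xi>) + \<bar>c2\<bar> * cmod (ft (monopow w (i + 1) b) \<xi>))"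
        by (rule mult_left_mono) simp
      then have "\<bar>w \<bullet> \<xi>\<bar> ^ Suc m * cmod (ft (monopow w i (b + 1)) \<xi>) \<le> \<bar>c1\<bar> * ?f1 \<xi> + \<bar>c2\<bar> * ?f2 \<xi>"
        by (simp add: algebra_simps)
      then have "(\<bar>w \<bullet> \<xi>\<bar> ^ Suc m * cmod (ft (monopow w i (b + 1)) \<xi>))\<^sup>2 \<le> (\<bar>c1\<bar> * ?f1 \<xi> + \<bar>c2\<bar> * ?f2 \<xi>)\<^sup>2"
        by (rule power_mono) simp
      also have "\<dots> \<le> 2 * (\<bar>c1\<bar> * ?f1 \<xi>)\<^sup>2 + 2 * (\<bar>c2\<bar> * ?f2 \<xi>)\<^sup>2"
        using sum_squares_bound[of "\<bar>c1\<bar> * ?f1 \<xi>" "\<bar>c2\<bar> * ?f2 \<xi>"] by (simp add: power2_sum)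
      also have "\<dots> = 2 * c1\<^sup>2 * (?f1 \<xi>)\<^sup>2 + 2 * c2\<^sup>2 * (?f2 \<xi>)\<^sup>2" by (simp add: power_mult_distrib)
      finally have "norm \<xi> powr (2*a) * (\<bar>w \<bullet> \<xi>\<bar> ^ Suc m * cmod (ft (monopow w i (b + 1)) \<xi>))\<^sup>2 \<le> norm \<xi> powr (2*a) * (2 * c1\<^sup>2 * (?f1 \<xi>)\<^sup>2 + 2 * c2\<^sup>2 * (?f2 \<xi>)\<^sup>2)"
        by (rule mult_left_mono) simp
      also have "\<dots> = 2 * c1\<^sup>2 * (norm \<xi> powr (2*a) * (?f1 \<xi>)\<^sup>2) + 2 * c2\<^sup>2 * (norm \<xi> powr (2*a) * (?f2 \<xi>)\<^sup>2)"
        by (simp only: distrib_left mult_ac)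
      finally show "norm (norm \<xi> powr (2*a) * (\<bar>w \<bullet> \<xi>\<bar> ^ Suc m * cmod (ft (monopow w i (b + 1)) \<xi>))\<^sup>2)
      \<le> norm (2 * c1\<^sup>2 * (norm \<xi> powr (2*a) * (?f1 \<xi>)\<^sup>2) + 2 * c2\<^sup>2 * (norm \<xi> powr (2*a) * (?f2 \<xi>)\<^sup>2))"
        by (rule real_norm_le_norm[rotated]) simp
    qed
  qed measurable
qed

lemma sum_power_le:
  fixes f :: "'b \<Rightarrow> real"
  assumes "finite B" "B \<noteq> {}" "\<And>b. b \<in> B \<Longrightarrow> f b \<ge> 0"
  shows "(sum f B) ^ m \<le> real (card B) ^ m * (\<Sum>b\<in>B. f b ^ m)"
proof -
  have "sum f B \<le> real (card B) * Max (f ` B)"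
    using sum_bounded_above[of B f "Max (f ` B)"] assms by simp
  then have "(sum f B) ^ m \<le> (real (card B) * Max (f ` B)) ^ m"
    using assms by (intro power_mono sum_nonneg) auto
  also have "\<dots> = real (card B) ^ m * Max (f ` B) ^ m" by (simp add: power_mult_distrib)
  also have "Max (f ` B) \<in> f ` B" using assms by (intro Max_in) auto
  then obtain b where b: "b \<in> B" "Max (f ` B) = f b" by auto
  have "Max (f ` B) ^ m \<le> (\<Sum>b\<in>B. f b ^ m)"
    unfolding b(2) by (rule member_le_sum[OF b(1)]) (use assms in auto)
  then have "real (card B) ^ m * Max (f ` B) ^ m \<le> real (card B) ^ m * (\<Sum>b\<in>B. f b ^ m)" by (intro mult_left_mono) auto
  finally show ?thesis .
qed

text \<open>With m the ceiling of \<open>s\<close>, the weight splits as the order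
  \<open>a = s - m\<close>, covered above, times \<open>((norm \<xi>)\<^sup>2) ^ m\<close>. The
  latter is bounded by the sum of the 2m-th powers of the coordinates, and each coordinate is a
  direction for \<open>finite_energy_monopow\<close>.\<close>

lemma finite_energy_ballpow:
  assumes s: "0 < s" and N: "2 \<le> DIM('a)"
  shows "integrable lborel (\<lambda>\<xi>. norm (\<xi>::'a::euclidean_space) powr (2 * s) * (cmod (ft (ballpow s 1) \<xi>))\<^sup>2)"
proof -
  define m where "m = nat \<lceil>s\<rceil>"
  define a where "a = s - real m"
  have a: "-1 < a" "a \<le> 0" and sa: "s = a + real m"
    using s unfolding a_def m_def by linarith+
  have m0: "ballpow s 1 = monopow w 0 s" for w :: 'a by (simp add: monopow_def fun_eq_iff)
  let ?S = "\<lambda>\<xi>::'a. real DIM('a) ^ m * (\<Sum>b\<in>Basis. norm \<xi> powr (2*a) * (\<bar>b \<bullet> \<xi>\<bar> ^ m * cmod (ft (monopow b 0 (a + real m)) \<xi>))\<^sup>2)"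
  have "integrable lborel ?S"
    by (intro Bochner_Integration.integrable_mult_right Bochner_Integration.integrable_sum finite_energy_monopow[OF a N]) (auto simp: nonzero_Basis)
  then show ?thesis
  proof (rule Bochner_Integration.integrable_bound)
    show "AE \<xi>::'a in lborel. norm (norm \<xi> powr (2 * s) * (cmod (ft (ballpow s 1) \<xi>))\<^sup>2) \<le> norm (?S \<xi>)"
    proof (rule AE_I2)
      fix \<xi> :: 'a
      let ?c = "cmod (ft (ballpow s 1) \<xi>)"
      have e: "norm \<xi> powr (2 * s) = norm \<xi> powr (2*a) * ((norm \<xi>)\<^sup>2) ^ m" 
      proof (cases "\<xi> = 0")
        case False
        have "norm \<xi> powr (2 * s) = norm \<xi> powr (2*a) * norm \<xi> powr (2 * real m)"
          unfolding sa by (simp add: powr_add[symmetric] distrib_left)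
        also have "norm \<xi> powr (2 * real m) = ((norm \<xi>)\<^sup>2) ^ m"
          using False powr_realpow[of "norm \<xi>" "2*m"] by (simp add: power_mult)
        finally show ?thesis .
      qed simp
      have pw: "((\<xi> \<bullet> b)\<^sup>2) ^ m = (\<bar>b \<bullet> \<xi>\<bar> ^ m)\<^sup>2" for b
        by (metis inner_commute power2_abs power_mult mult.commute)
      have "((norm \<xi>)\<^sup>2) ^ m \<le> real DIM('a) ^ m * (\<Sum>b\<in>Basis. ((\<xi> \<bullet> b)\<^sup>2) ^ m)"
        unfolding norm_power2_sum_Basis by (rule sum_power_le) auto
      then have "(norm \<xi> powr (2*a) * ?c\<^sup>2) * ((norm \<xi>)\<^sup>2) ^ m \<le> (norm \<xi> powr (2*a) * ?c\<^sup>2) * (real DIM('a) ^ m * (\<Sum>b\<in>Basis. ((\<xi> \<bullet> b)\<^sup>2) ^ m))"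
        by (rule mult_left_mono) simp
      also have "\<dots> = ?S \<xi>"
        unfolding sa[symmetric] m0[symmetric]
        by (simp add: sum_distrib_left power_mult_distrib pw mult_ac)
      finally show "norm (norm \<xi> powr (2 * s) * ?c\<^sup>2) \<le> norm (?S \<xi>)"
        unfolding e by (simp add: mult_ac)
    qed
  qed measurable
qed

section \<open>Powers of the frequency and rapid decay\<close>

lemma pred_mem_ball [measurable]:
  "Measurable.pred borel (\<lambda>x::'a::euclidean_space. x \<in> ball c r)"
  "Measurable.pred borel (\<lambda>x::'a::euclidean_space. x \<in> - ball c r)"
  unfolding mem_ball Compl_iff by measurable

text \<open>Already the radial factor \<open>k ^ (DIM('a) - 1) \<le> k\<close> on the unit interval
  makes \<open>k powr (j + 1)\<close> integrable. The threshold -2 is uniform in the dimension and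
  fits the weights \<open>2 * a\<close> with \<open>a > -1\<close>.\<close>

lemma integrable_norm_powr_ball:
  fixes j :: real
  assumes N: "2 \<le> DIM('a::euclidean_space)" and j: "j > -2"
  shows "integrable lborel (\<lambda>x::'a. indicator (ball 0 1) x * norm x powr j)"
proof -
  let ?F = "\<lambda>x::'a. ennreal (indicator (ball 0 1) x * norm x powr j)"
  have "(\<integral>\<^sup>+x. ?F x \<partial>lborel) = (\<integral>\<^sup>+z. indicator {z. 1 \<le> norm z \<and> norm z \<le> exp 1} z *
      (\<integral>\<^sup>+k. ennreal (k ^ (DIM('a) - 1)) * ?F (k *\<^sub>R z) * indicator {0<..} k \<partial>lborel) \<partial>(lborel::'a measure))"
    by (rule nn_integral_shell) measurable
  also have "\<dots> \<le> (\<integral>\<^sup>+z. indicator (cball 0 (exp 1)) z * ennreal (exp \<bar>j\<bar> * (1 / (j + 2))) \<partial>(lborel::'a measure))"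
  proof (rule nn_integral_mono)
    fix z :: 'a
    show "indicator {z. 1 \<le> norm z \<and> norm z \<le> exp 1} z * (\<integral>\<^sup>+k. ennreal (k ^ (DIM('a) - 1)) * ?F (k *\<^sub>R z) * indicator {0<..} k \<partial>lborel)
      \<le> indicator (cball 0 (exp 1)) z * ennreal (exp \<bar>j\<bar> * (1 / (j + 2)))"
    proof (cases "1 \<le> norm z \<and> norm z \<le> exp 1")
      case True
      have zj: "norm z powr j \<le> exp \<bar>j\<bar>"
      proof -
        have l0: "0 \<le> ln (norm z)" using True by simp
        have "0 < norm z" using True by linarith
        then have "ln (norm z) \<le> ln (exp 1)" using True by (subst ln_le_cancel_iff) auto
        then have l1: "ln (norm z) \<le> 1" by simp
        have "j * ln (norm z) \<le> \<bar>j\<bar> * ln (norm z)" by (rule mult_right_mono[OF abs_ge_self l0])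
        also have "\<dots> \<le> \<bar>j\<bar> * 1" by (rule mult_left_mono[OF l1]) simp
        finally have "j * ln (norm z) \<le> \<bar>j\<bar>" by simp
        then show ?thesis using True by (auto simp: powr_def)
      qed
      have "(\<integral>\<^sup>+k. ennreal (k ^ (DIM('a) - 1)) * ?F (k *\<^sub>R z) * indicator {0<..} k \<partial>lborel)
        \<le> (\<integral>\<^sup>+k. ennreal (exp \<bar>j\<bar>) * (ennreal (k powr (j + 1)) * indicator {0..1} k) \<partial>lborel)"
      proof (rule nn_integral_mono)
        fix k :: real
        show "ennreal (k ^ (DIM('a) - 1)) * ?F (k *\<^sub>R z) * indicator {0<..} k \<le> ennreal (exp \<bar>j\<bar>) * (ennreal (k powr (j + 1)) * indicator {0..1} k)"
        proof (cases "0 < k \<and> k * norm z < 1")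
          case k: True
          have "k \<le> k * norm z" using True k by simp
          then have k1: "k \<le> 1" using k by linarith
          have "k ^ (DIM('a) - 1) \<le> k ^ 1" using k k1 N by (intro power_decreasing) auto
          then have "k ^ (DIM('a) - 1) * (k * norm z) powr j \<le> k * (k * norm z) powr j" by (intro mult_right_mono) auto
          also have "\<dots> = (k powr (j + 1)) * norm z powr j" using k True by (simp add: powr_mult powr_add)
          also have "\<dots> \<le> k powr (j + 1) * exp \<bar>j\<bar>" using zj by (intro mult_left_mono) auto
          finally have "k ^ (DIM('a) - 1) * (k * norm z) powr j \<le> exp \<bar>j\<bar> * k powr (j + 1)" by (simp add: mult.commute)
          then show ?thesis using k k1 by (simp add: ennreal_mult'[symmetric] ennreal_leI)
        qed (auto simp: indicator_def)
      qed
      also have "\<dots> = ennreal (exp \<bar>j\<bar>) * ennreal (1 powr (j + 1 + 1) / (j + 1 + 1))"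
        using j by (subst nn_integral_cmult, measurable,
          subst nn_integral_has_integral_lebesgue'[OF _ has_integral_powr_from_0]) auto
      also have "\<dots> = ennreal (exp \<bar>j\<bar> * (1 / (j + 2)))" using j by (simp add: ennreal_mult'[symmetric] add.commute)
      finally show ?thesis using True by simp
    qed simp
  qed
  also have "\<dots> < \<infinity>"
    using emeasure_lborel_cball_finite[of "0::'a" "exp 1"] by (subst nn_integral_multc) (auto simp: ennreal_mult_less_top intro!: borel_measurable_indicator)
  finally show ?thesis by (intro integrableI_bounded) auto
qed

lemma integrable_norm_powr_outside:
  "integrable lborel (\<lambda>x::'a::euclidean_space. indicator (- ball 0 1) x * norm x powr (- real DIM('a) - 1))"
proof -
  let ?n = "real DIM('a)"
  let ?F = "\<lambda>x::'a. ennreal (indicator (- ball 0 1) x * norm x powr (- ?n - 1))"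
  have "(\<integral>\<^sup>+x. ?F x \<partial>lborel) = (\<integral>\<^sup>+z. indicator {z. 1 \<le> norm z \<and> norm z \<le> exp 1} z *
      (\<integral>\<^sup>+k. ennreal (k ^ (DIM('a) - 1)) * ?F (k *\<^sub>R z) * indicator {0<..} k \<partial>lborel) \<partial>(lborel::'a measure))"
    by (rule nn_integral_shell) measurable
  also have "\<dots> \<le> (\<integral>\<^sup>+z. indicator (cball 0 (exp 1)) z * ennreal (exp 1) \<partial>(lborel::'a measure))"
  proof (rule nn_integral_mono)
    fix z :: 'a
    show "indicator {z. 1 \<le> norm z \<and> norm z \<le> exp 1} z * (\<integral>\<^sup>+k. ennreal (k ^ (DIM('a) - 1)) * ?F (k *\<^sub>R z) * indicator {0<..} k \<partial>lborel)
      \<le> indicator (cball 0 (exp 1)) z * ennreal (exp 1)"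
    proof (cases "1 \<le> norm z \<and> norm z \<le> exp 1")
      case True
      have "(\<integral>\<^sup>+k. ennreal (k ^ (DIM('a) - 1)) * ?F (k *\<^sub>R z) * indicator {0<..} k \<partial>lborel)
        \<le> (\<integral>\<^sup>+k. (ennreal (k powr (-2)) * indicator {exp (-1)..} k) \<partial>lborel)"
      proof (rule nn_integral_mono)
        fix k :: real
        show "ennreal (k ^ (DIM('a) - 1)) * ?F (k *\<^sub>R z) * indicator {0<..} k \<le> ennreal (k powr (-2)) * indicator {exp (-1)..} k"
        proof (cases "0 < k \<and> 1 \<le> k * norm z")
          case k: True
          have "1 \<le> k * exp 1" using k True mult_left_mono[of "norm z" "exp 1" k] by linarith
          then have k1: "exp (-1) \<le> k" by (simp add: exp_minus field_simps)
          have "k ^ (DIM('a) - 1) = k powr (?n - 1)" using k by (simp add: powr_realpow[symmetric] of_nat_diff Suc_leI)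
          then have "k ^ (DIM('a) - 1) * (k * norm z) powr (- ?n - 1) = (k powr (?n - 1) * k powr (- ?n - 1)) * norm z powr (- ?n - 1)"
            using k True by (simp add: powr_mult)
          also have "\<dots> = k powr (-2) * norm z powr (- ?n - 1)" by (simp add: powr_add[symmetric])
          also have "\<dots> \<le> k powr (-2) * 1"
            using True powr_mono[of "- ?n - 1" 0 "norm z"] by (intro mult_left_mono) (auto split: if_splits)
          finally show ?thesis using k k1 by (simp add: ennreal_mult'[symmetric] ennreal_leI)
        qed (auto simp: indicator_def)
      qed
      also have "\<dots> = ennreal (- (exp (-1) powr (-2 + 1)) / (-2 + 1))"
        by (rule nn_integral_has_integral_lebesgue'[OF _ has_integral_powr_to_inf]) auto
      also have "\<dots> = ennreal (exp 1)" by (simp add: powr_minus exp_minus)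
      finally show ?thesis using True by simp
    qed simp
  qed
  also have "\<dots> < \<infinity>"
    using emeasure_lborel_cball_finite[of "0::'a" "exp 1"] by (subst nn_integral_multc) (auto simp: ennreal_mult_less_top intro!: borel_measurable_indicator)
  finally show ?thesis by (intro integrableI_bounded) auto
qed

text \<open>One condition for all the weights in the induction: it encodes decay at infinity through
  large \<open>j\<close> and integrability at the origin through \<open>j\<close> close to -2, the
  infimum of \<open>2 * a\<close> over the starting orders.\<close>

definition rapid :: "('a::euclidean_space \<Rightarrow> real) \<Rightarrow> bool" where
  "rapid v \<longleftrightarrow> (\<forall>j>-2. integrable lborel (\<lambda>\<xi>. norm \<xi> powr j * cmod (ft v \<xi>)))"

lemma pairing_at_iff:
  "pairing_at TYPE('a::euclidean_space) a \<kappa> \<longleftrightarrow> (\<forall>v::'a \<Rightarrow> real. integrable lborel v \<longrightarrow> (\<forall>x. norm x \<ge> 1 \<longrightarrow> v x = 0) \<longrightarrow> rapid v \<longrightarrow>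
     (LINT \<xi>|lborel. of_real (norm \<xi> powr (2*a)) * ft v \<xi> * cnj (ft (ballpow a 1) \<xi>)) = of_real (\<kappa> * (LINT x|lborel. v x)))"
  unfolding pairing_at_def rapid_def ..

lemma rapid_dilate:
  fixes v :: "'a::euclidean_space \<Rightarrow> real"
  assumes v: "rapid v" and c: "c > 0"
  shows "rapid (\<lambda>x. v (x /\<^sub>R c))"
  unfolding rapid_def
proof (intro allI impI)
  fix j :: real assume j: "j > -2"
  have "integrable lborel (\<lambda>\<xi>. (c ^ DIM('a) * c powr (-j)) * (norm (0 + c *\<^sub>R \<xi>) powr j * cmod (ft v (0 + c *\<^sub>R \<xi>))))"
    using v j c by (intro Bochner_Integration.integrable_mult_right lborel_integrable_affine) (auto simp: rapid_def)
  then show "integrable lborel (\<lambda>\<xi>. norm \<xi> powr j * cmod (ft (\<lambda>x. v (x /\<^sub>R c)) \<xi>))"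
    using c by (simp add: ft_scale norm_mult powr_mult norm_power powr_minus mult_ac)
qed

text \<open>Low frequencies use the bound of the transform by the mass of
  \<open>\<bar>v\<bar>\<close> and the integrability of \<open>norm \<xi> powr j\<close> near 0;
  high frequencies use the decay.\<close>

lemma rapidI_decay:
  fixes v :: "'a::euclidean_space \<Rightarrow> real"
  assumes N: "2 \<le> DIM('a)" and v: "integrable lborel v"
    and decay: "\<And>k::nat. \<exists>C. \<forall>\<xi>. norm \<xi> ^ k * cmod (ft v \<xi>) \<le> C"
  shows "rapid v"
  unfolding rapid_def
proof (intro allI impI)
  fix j :: real assume j: "j > -2"
  note [measurable] = borel_measurable_integrable[OF v]
  \<comment> \<open>The decay must absorb the growth \<open>j\<close> and still leave the power
    \<open>- DIM('a) - 1\<close>, which is integrable at infinity.\<close>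
  define k where "k = nat \<lceil>\<bar>j\<bar>\<rceil> + DIM('a) + 1"
  have k: "j + DIM('a) + 1 \<le> real k" unfolding k_def by linarith
  obtain C where C: "\<And>\<xi>. norm \<xi> ^ k * cmod (ft v \<xi>) \<le> C" using decay[of k] by blast
  have C0: "C \<ge> 0" using C[of 0] order_trans[of 0 "norm (0::'a) ^ k * cmod (ft v 0)" C] by simp
  define D where "D = (LINT x|lborel. \<bar>v x\<bar>)"
  have D: "cmod (ft v \<xi>) \<le> D" for \<xi> unfolding D_def by (rule ft_bound[OF v])
  have D0: "D \<ge> 0" unfolding D_def by simp
  let ?w = "\<lambda>\<xi>::'a. D * (indicator (ball 0 1) \<xi> * norm \<xi> powr j) + C * (indicator (- ball 0 1) \<xi> * norm \<xi> powr (- real DIM('a) - 1))"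
  have "integrable lborel ?w"
    using integrable_norm_powr_ball[OF N j] integrable_norm_powr_outside[where 'a='a] by simp
  then show "integrable lborel (\<lambda>\<xi>. norm \<xi> powr j * cmod (ft v \<xi>))"
  proof (rule Bochner_Integration.integrable_bound)
    show "AE \<xi> in lborel. norm (norm \<xi> powr j * cmod (ft v \<xi>)) \<le> norm (?w \<xi>)"
    proof (rule AE_I2)
      fix \<xi> :: 'a
      have "norm \<xi> powr j * cmod (ft v \<xi>) \<le> ?w \<xi>"
      proof (cases "norm \<xi> < 1")
        case True
        then show ?thesis using mult_left_mono[OF D[of \<xi>], of "norm \<xi> powr j"] by (simp add: mult.commute)
      next
        case False
        then have n: "norm \<xi> \<ge> 1" by simp
        have "norm \<xi> powr j \<le> norm \<xi> powr (real k + (- real DIM('a) - 1))"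
          using n k by (intro powr_mono) auto
        also have "\<dots> = norm \<xi> ^ k * norm \<xi> powr (- real DIM('a) - 1)"
          using n powr_realpow[of "norm \<xi>" k] by (simp only: powr_add)
        finally have "norm \<xi> powr j * cmod (ft v \<xi>) \<le> norm \<xi> ^ k * norm \<xi> powr (- real DIM('a) - 1) * cmod (ft v \<xi>)"
          by (rule mult_right_mono) simp
        also have "\<dots> = (norm \<xi> ^ k * cmod (ft v \<xi>)) * norm \<xi> powr (- real DIM('a) - 1)" by (simp only: mult_ac)
        also have "\<dots> \<le> C * norm \<xi> powr (- real DIM('a) - 1)" by (rule mult_right_mono[OF C]) simp
        finally show ?thesis using False by simp
      qed
      then show "norm (norm \<xi> powr j * cmod (ft v \<xi>)) \<le> norm (?w \<xi>)" by (rule real_norm_le_norm[rotated]) simp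
    qed
  qed measurable
qed

section \<open>Raising the order by differentiation in the dilation parameter\<close>

lemma tendsto_difference_quotient:
  fixes f :: "'b::real_normed_field \<Rightarrow> 'b"
  assumes d: "(f has_field_derivative D) (at x)" and h: "h \<longlonglongrightarrow> 0" and ne: "\<And>n. h n \<noteq> 0"
  shows "(\<lambda>n. (f (x + h n) - f x) / h n) \<longlonglongrightarrow> D"
proof -
  have "((\<lambda>h. (f (x + h) - f x) / h) \<longlongrightarrow> D) (at 0)" using d by (simp add: DERIV_def)
  moreover have "filterlim h (at 0) sequentially" using h ne by (simp add: filterlim_at)
  ultimately show ?thesis by (rule filterlim_compose)
qed

lemma tendsto_cis_quotient:
  assumes h: "h \<longlonglongrightarrow> (0::real)" and ne: "\<And>n. h n \<noteq> 0"
  shows "(\<lambda>n. (cis (- ((1 + h n) * c)) - cis (- c)) / of_real (h n)) \<longlonglongrightarrow> - \<i> * of_real c * cis (- c)"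
proof -
  have "((\<lambda>z. exp (- \<i> * of_real c * z)) has_field_derivative (- \<i> * of_real c) * exp (- \<i> * of_real c * 0)) (at 0)"
    by (auto intro!: derivative_eq_intros)
  from tendsto_difference_quotient[OF this, of "\<lambda>n. of_real (h n)"]
  have "(\<lambda>n. (exp (- \<i> * of_real c * of_real (h n)) - 1) / of_real (h n)) \<longlonglongrightarrow> - \<i> * of_real c"
    using h ne by (simp add: tendsto_of_real_iff[of h 0, simplified])
  then have T: "(\<lambda>n. (exp (- \<i> * of_real c * of_real (h n)) - 1) / of_real (h n) * cis (- c)) \<longlonglongrightarrow> (- \<i> * of_real c) * cis (- c)"
    by (rule tendsto_mult) (rule tendsto_const)
  have E: "(exp (- \<i> * of_real c * of_real (h n)) - 1) / of_real (h n) * cis (- c) = (cis (- ((1 + h n) * c)) - cis (- c)) / of_real (h n)" for n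
  proof -
    have "cis (- ((1 + h n) * c)) = cis (- (h n * c)) * cis (- c)" by (simp add: cis_mult algebra_simps)
    moreover have "exp (- \<i> * of_real c * of_real (h n)) = cis (- (h n * c))" by (simp add: cis_conv_exp mult_ac)
    ultimately show ?thesis by (simp add: algebra_simps diff_divide_distrib)
  qed
  show ?thesis using T unfolding E .
qed

text \<open>Differentiating under the integral brings down \<open>x \<bullet> \<xi>\<close>. Since x
  times \<open>ballpow a 1\<close> is, up to the factor -2 (a + 1), the gradient of
  \<open>ballpow (a + 1) 1\<close>, \<open>ft_monopow\<close> with \<open>w = \<xi>\<close> and
  \<open>i = 0\<close> converts this moment into \<open>(norm \<xi>)\<^sup>2\<close> times the next
  transform.\<close>

lemma ft_ballpow_radial_derivative:
  fixes \<xi> :: "'a::euclidean_space"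
  assumes a: "-1 < a" and N: "2 \<le> DIM('a)" and h: "h \<longlonglongrightarrow> 0" and ne: "\<And>n. h n \<noteq> 0"
  shows "(\<lambda>n. (ft (ballpow a 1) ((1 + h n) *\<^sub>R \<xi>) - ft (ballpow a 1) \<xi>) / of_real (h n))
     \<longlonglongrightarrow> - of_real ((norm \<xi>)\<^sup>2 / (2 * (a + 1))) * ft (ballpow (a + 1) 1) \<xi>"
proof -
  let ?G = "ballpow a 1 :: 'a \<Rightarrow> real"
  have G: "integrable lborel ?G" by (rule ballpow_integrable[OF a N])
  let ?c = "\<lambda>n x. (cis (- (x \<bullet> ((1 + h n) *\<^sub>R \<xi>))) - cis (- (x \<bullet> \<xi>))) / of_real (h n)"
  have eq: "(ft ?G ((1 + h n) *\<^sub>R \<xi>) - ft ?G \<xi>) / of_real (h n) = (LINT x|lborel. ?c n x * of_real (?G x))" for n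
  proof -
    have "(ft ?G ((1 + h n) *\<^sub>R \<xi>) - ft ?G \<xi>) / of_real (h n) = 
      (LINT x|lborel. (cis (- (x \<bullet> ((1 + h n) *\<^sub>R \<xi>))) * of_real (?G x) - cis (- (x \<bullet> \<xi>)) * of_real (?G x))) / of_real (h n)"
      unfolding ft_def by (simp only: Bochner_Integration.integral_diff[OF integrable_ft[OF G] integrable_ft[OF G]])
    also have "\<dots> = (LINT x|lborel. (cis (- (x \<bullet> ((1 + h n) *\<^sub>R \<xi>))) * of_real (?G x) - cis (- (x \<bullet> \<xi>)) * of_real (?G x)) / of_real (h n))"
      by (rule Bochner_Integration.integral_divide_zero[symmetric])
    also have "\<dots> = (LINT x|lborel. ?c n x * of_real (?G x))"
      by (intro Bochner_Integration.integral_cong refl) (simp add: diff_divide_distrib left_diff_distrib)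
    finally show ?thesis .
  qed
  have lim: "(\<lambda>n. LINT x|lborel. ?c n x * of_real (?G x)) \<longlonglongrightarrow> (LINT x|lborel. (- \<i> * of_real (x \<bullet> \<xi>) * cis (- (x \<bullet> \<xi>))) * of_real (?G x))"
  proof (rule integral_dominated_convergence[where w="\<lambda>x. norm \<xi> * ?G x"])
    show "integrable lborel (\<lambda>x. norm \<xi> * ?G x)" using G by simp
    show "AE x in lborel. (\<lambda>n. ?c n x * of_real (?G x)) \<longlonglongrightarrow> (- \<i> * of_real (x \<bullet> \<xi>) * cis (- (x \<bullet> \<xi>))) * of_real (?G x)"
      using tendsto_cis_quotient[OF h ne] by (intro AE_I2 tendsto_mult tendsto_const) simp
    show "AE x in lborel. norm (?c n x * of_real (?G x)) \<le> norm \<xi> * ?G x" for n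
    proof (rule AE_I2)
      fix x :: 'a
      show "norm (?c n x * of_real (?G x)) \<le> norm \<xi> * ?G x"
      proof (cases "norm x < 1")
        case True
        have "cmod (cis (- (x \<bullet> ((1 + h n) *\<^sub>R \<xi>))) - cis (- (x \<bullet> \<xi>))) \<le> \<bar>- (x \<bullet> ((1 + h n) *\<^sub>R \<xi>)) - - (x \<bullet> \<xi>)\<bar>"
          by (rule cis_diff_bound)
        also have "\<dots> = \<bar>h n\<bar> * \<bar>x \<bullet> \<xi>\<bar>" by (simp add: algebra_simps abs_mult[symmetric])
        also have "\<bar>x \<bullet> \<xi>\<bar> \<le> norm x * norm \<xi>" by (rule Cauchy_Schwarz_ineq2)
        also have "\<dots> \<le> 1 * norm \<xi>" using True by (intro mult_right_mono) auto
        finally have "cmod (?c n x) \<le> norm \<xi>" using ne[of n] by (simp add: norm_divide field_simps mult_left_mono)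
        from mult_right_mono[OF this ballpow_nonneg[of a 1 x]] show ?thesis
          by (simp only: norm_mult norm_of_real abs_of_nonneg ballpow_nonneg)
      qed (simp add: ballpow_outside)
    qed
  qed measurable
  have "(LINT x|lborel. (- \<i> * of_real (x \<bullet> \<xi>) * cis (- (x \<bullet> \<xi>))) * of_real (?G x)) = - \<i> * ft (monopow \<xi> 1 a) \<xi>"
    unfolding ft_def monopow_def Bochner_Integration.integral_mult_right_zero[symmetric] by (simp add: mult_ac)
  also have "\<dots> = - of_real ((norm \<xi>)\<^sup>2 / (2 * (a + 1))) * ft (ballpow (a + 1) 1) \<xi>"
  proof (cases "\<xi> = 0")
    case True
    then show ?thesis by (simp add: ft_def monopow_def)
  next
    case False
    have m0: "monopow \<xi> 0 (a + 1) = ballpow (a + 1) 1" by (simp add: monopow_def fun_eq_iff)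
    define c where "c = complex_of_real (2 * (a + 1))"
    define Y where "Y = ft (monopow \<xi> 1 a) \<xi>"
    define X where "X = of_real ((norm \<xi>)\<^sup>2) * ft (ballpow (a + 1) 1) \<xi>"
    have c: "c \<noteq> 0" unfolding c_def using a by (simp del: of_real_mult of_real_add)
    have e: "\<i> * X = - c * Y"
      using ft_monopow[OF a N False, of \<xi> 0] unfolding m0 X_def Y_def c_def power2_norm_eq_inner
      by (simp add: mult.assoc del: of_real_mult of_real_add)
    have "c * (- \<i> * Y) = \<i> * (- c * Y)" by simp
    also have "\<dots> = \<i> * (\<i> * X)" by (simp only: e)
    also have "\<dots> = - X" by (simp add: mult.assoc[symmetric])
    finally have "- \<i> * Y = - X / c" using c by (simp add: eq_divide_eq mult.commute)
    then have "- \<i> * ft (monopow \<xi> 1 a) \<xi> = - (of_real ((norm \<xi>)\<^sup>2) * ft (ballpow (a + 1) 1) \<xi>) / of_real (2 * (a + 1))"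
      unfolding X_def Y_def c_def .
    then show ?thesis by simp
  qed
  finally show ?thesis using lim unfolding eq by simp
qed

text \<open>Up to a power of \<open>l\<close>, the transform at \<open>l *\<^sub>R \<xi>\<close> is
  that of the profile of the ball of radius \<open>l\<close>, which for \<open>l \<ge> 1\<close>
  still contains the support of \<open>v\<close>. The identity is transported from radius 1 by
  testing with the contracted function that sends x to v (l x).\<close>

lemma pairing_dilated:
  fixes v :: "'a::euclidean_space \<Rightarrow> real"
  assumes pair: "pairing_at TYPE('a) a \<kappa>" and v: "integrable lborel v" and supp: "\<And>x. norm x \<ge> 1 \<Longrightarrow> v x = 0"
    and rap: "rapid v" and l: "l \<ge> 1"
  shows "(LINT \<xi>|lborel. of_real (norm \<xi> powr (2*a)) * ft v \<xi> * cnj (ft (ballpow a 1) (l *\<^sub>R \<xi>)))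
    = of_real (\<kappa> * l powr (- real DIM('a) - 2*a) * (LINT x|lborel. v x))"
proof -
  have l0: "l > 0" using l by simp
  let ?v = "\<lambda>x. v (x /\<^sub>R (1/l))"
  have iv: "integrable lborel ?v" using lborel_integrable_affine[OF v, of l 0] l0 by simp
  have Iv: "(LINT x|lborel. v x) = l ^ DIM('a) * (LINT x|lborel. ?v x)"
    using lborel_integral_affine[of l v 0] l0 by simp
  have sv: "norm x \<ge> 1 \<Longrightarrow> ?v x = 0" for x
    using supp[of "l *\<^sub>R x"] l mult_mono[of 1 l 1 "norm x"] by simp
  have rv: "rapid ?v" by (rule rapid_dilate[OF rap]) (use l0 in simp)
  let ?F = "\<lambda>\<xi>. of_real (norm \<xi> powr (2*a)) * ft ?v \<xi> * cnj (ft (ballpow a 1) \<xi>)"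
  have fs: "ft ?v \<xi> = of_real ((1/l) ^ DIM('a)) * ft v ((1/l) *\<^sub>R \<xi>)" for \<xi>
    by (rule ft_scale) (use l0 in simp)
  have "of_real (\<kappa> * (LINT x|lborel. ?v x)) = (LINT \<xi>|lborel. ?F \<xi>)"
    by (rule pair[unfolded pairing_at_iff, rule_format, symmetric, OF iv sv rv])
  also have "\<dots> = of_real (l ^ DIM('a)) * (LINT \<xi>|lborel. ?F (0 + l *\<^sub>R \<xi>))"
    using lborel_integral_affine[of l ?F 0] l0 by (simp add: scaleR_conv_of_real)
  also have "(\<lambda>\<xi>. ?F (0 + l *\<^sub>R \<xi>)) = (\<lambda>\<xi>. of_real (l powr (2*a) * (1/l) ^ DIM('a)) * (of_real (norm \<xi> powr (2*a)) * ft v \<xi> * cnj (ft (ballpow a 1) (l *\<^sub>R \<xi>))))"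
    unfolding fs using l0 by (simp add: fun_eq_iff powr_mult)
  also have "(LINT \<xi>|lborel. of_real (l powr (2*a) * (1/l) ^ DIM('a)) * (of_real (norm \<xi> powr (2*a)) * ft v \<xi> * cnj (ft (ballpow a 1) (l *\<^sub>R \<xi>))))
    = of_real (l powr (2*a) * (1/l) ^ DIM('a)) * (LINT \<xi>|lborel. of_real (norm \<xi> powr (2*a)) * ft v \<xi> * cnj (ft (ballpow a 1) (l *\<^sub>R \<xi>)))" (is "_ = _ * ?J")
    by (rule Bochner_Integration.integral_mult_right_zero)
  finally have "complex_of_real (\<kappa> * (LINT x|lborel. ?v x)) = of_real (l ^ DIM('a) * (l powr (2*a) * (1/l) ^ DIM('a))) * ?J"
    by (simp add: mult.assoc)
  also have "l ^ DIM('a) * (l powr (2*a) * (1/l) ^ DIM('a)) = l powr (2*a)"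
    using l0 by (simp add: power_divide)
  finally have e: "complex_of_real (\<kappa> * (LINT x|lborel. ?v x)) = of_real (l powr (2*a)) * ?J" .
  have "?J = of_real (l powr (- (2*a))) * (of_real (l powr (2*a)) * ?J)"
    using l0 by (simp add: mult.assoc[symmetric] powr_minus flip: of_real_mult)
  also have "\<dots> = of_real (l powr (- (2*a)) * (\<kappa> * (LINT x|lborel. ?v x)))" unfolding e[symmetric] by simp
  also have "l powr (- (2*a)) * (\<kappa> * (LINT x|lborel. ?v x)) = \<kappa> * l powr (- real DIM('a) - 2*a) * (LINT x|lborel. v x)"
  proof -
    have "l powr (- real DIM('a) - 2*a) * l ^ DIM('a) = l powr (- (2*a))"
      using l0 by (simp add: powr_realpow[symmetric] powr_add[symmetric])
    then show ?thesis unfolding Iv by (simp add: algebra_simps)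
  qed
  finally show ?thesis .
qed

text \<open>
  Differentiating the identity for \<open>ballpow a\<close> under dilation raises the order, because the radial derivative of
  \<open>ft (ballpow a 1)\<close> is a multiple of \<open>|\<xi>|\<^sup>2 ft (ballpow (a + 1) 1)\<close>.
\<close>
lemma pairing_step:
  assumes a: "-1 < a" and N: "2 \<le> DIM('a::euclidean_space)" and pair: "pairing_at TYPE('a) a \<kappa>"
  shows "pairing_at TYPE('a) (a + 1) (2 * (a + 1) * (real DIM('a) + 2*a) * \<kappa>)"
  unfolding pairing_at_iff
proof (intro allI impI)
  fix v :: "'a \<Rightarrow> real"
  assume v: "integrable lborel v" and supp: "\<forall>x. norm x \<ge> 1 \<longrightarrow> v x = 0" and rap: "rapid v"
  note [measurable] = borel_measurable_integrable[OF v]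
  let ?G = "ballpow a 1 :: 'a \<Rightarrow> real" and ?H = "ballpow (a + 1) 1 :: 'a \<Rightarrow> real"
  have G: "integrable lborel ?G" by (rule ballpow_integrable[OF a N])
  define D where "D = (LINT x|lborel. \<bar>?G x\<bar>)"
  \<comment> \<open>Increments are positive because \<open>pairing_dilated\<close> covers only
    \<open>l \<ge> 1\<close>; the one-sided difference quotient suffices, as both sides of the
    identity have limits along it.\<close>
  define h :: "nat \<Rightarrow> real" where "h n = 1 / real (Suc n)" for n
  have h: "h \<longlonglongrightarrow> 0" unfolding h_def using LIMSEQ_inverse_real_of_nat by (simp add: inverse_eq_divide)
  have hp: "h n > 0" for n by (simp add: h_def)
  then have ne: "h n \<noteq> 0" for n by (metis less_irrefl)
  let ?w = "\<lambda>\<xi>::'a. norm \<xi> powr (2*a)"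
  let ?J = "\<lambda>l. LINT \<xi>|lborel. of_real (?w \<xi>) * ft v \<xi> * cnj (ft ?G (l *\<^sub>R \<xi>))"
  let ?I = "LINT x|lborel. v x"
  let ?e = "- real DIM('a) - 2*a"
  have J: "?J l = of_real (\<kappa> * l powr ?e * ?I)" if "l \<ge> 1" for l
    by (rule pairing_dilated[OF pair v _ rap that]) (use supp in auto)
  have r1: "integrable lborel (\<lambda>\<xi>. ?w \<xi> * cmod (ft v \<xi>))"
    using rap a unfolding rapid_def by auto
  have r2: "integrable lborel (\<lambda>\<xi>. norm \<xi> powr (2*a + 1) * cmod (ft v \<xi>))"
    using rap a unfolding rapid_def by auto
  have iJ: "integrable lborel (\<lambda>\<xi>. of_real (?w \<xi>) * ft v \<xi> * cnj (ft ?G (l *\<^sub>R \<xi>)))" for l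
  proof (rule Bochner_Integration.integrable_bound)
    show "integrable lborel (\<lambda>\<xi>. (?w \<xi> * cmod (ft v \<xi>)) * D)" using r1 by simp
    show "AE \<xi> in lborel. norm (of_real (?w \<xi>) * ft v \<xi> * cnj (ft ?G (l *\<^sub>R \<xi>))) \<le> norm ((?w \<xi> * cmod (ft v \<xi>)) * D)"
    proof (rule AE_I2)
      fix \<xi> :: 'a
      have "(?w \<xi> * cmod (ft v \<xi>)) * cmod (ft ?G (l *\<^sub>R \<xi>)) \<le> (?w \<xi> * cmod (ft v \<xi>)) * D"
        unfolding D_def by (rule mult_left_mono[OF ft_bound[OF G]]) simp
      then show "norm (of_real (?w \<xi>) * ft v \<xi> * cnj (ft ?G (l *\<^sub>R \<xi>))) \<le> norm ((?w \<xi> * cmod (ft v \<xi>)) * D)"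
        by (simp add: norm_mult abs_mult D_def)
    qed
  qed measurable
  let ?q = "\<lambda>n \<xi>. (ft ?G ((1 + h n) *\<^sub>R \<xi>) - ft ?G \<xi>) / of_real (h n)"
  \<comment> \<open>The Lipschitz bound of the transform costs one power of the frequency, so the
    dominating weight has order \<open>2 * a + 1\<close>, still within the reach of
    \<open>rapid\<close>.\<close>
  have A: "(\<lambda>n. LINT \<xi>|lborel. of_real (?w \<xi>) * ft v \<xi> * cnj (?q n \<xi>)) \<longlonglongrightarrow>
     (LINT \<xi>|lborel. of_real (?w \<xi>) * ft v \<xi> * cnj (- of_real ((norm \<xi>)\<^sup>2 / (2 * (a + 1))) * ft ?H \<xi>))"
  proof (rule integral_dominated_convergence[where w="\<lambda>\<xi>. D * (norm \<xi> powr (2*a + 1) * cmod (ft v \<xi>))"])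
    show "integrable lborel (\<lambda>\<xi>. D * (norm \<xi> powr (2*a + 1) * cmod (ft v \<xi>)))" using r2 by simp
    show "AE \<xi> in lborel. (\<lambda>n. of_real (?w \<xi>) * ft v \<xi> * cnj (?q n \<xi>)) \<longlonglongrightarrow> of_real (?w \<xi>) * ft v \<xi> * cnj (- of_real ((norm \<xi>)\<^sup>2 / (2 * (a + 1))) * ft ?H \<xi>)"
      by (intro AE_I2 tendsto_mult tendsto_const tendsto_cnj ft_ballpow_radial_derivative[OF a N h ne])
    show "AE \<xi> in lborel. norm (of_real (?w \<xi>) * ft v \<xi> * cnj (?q n \<xi>)) \<le> D * (norm \<xi> powr (2*a + 1) * cmod (ft v \<xi>))" for n
    proof (rule AE_I2)
      fix \<xi> :: 'a
      have "cmod (ft ?G ((1 + h n) *\<^sub>R \<xi>) - ft ?G \<xi>) \<le> D * norm ((1 + h n) *\<^sub>R \<xi> - \<xi>)"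
        unfolding D_def by (rule ft_lipschitz[OF G]) (auto simp: ballpow_outside)
      also have "norm ((1 + h n) *\<^sub>R \<xi> - \<xi>) = h n * norm \<xi>" using hp[of n] by (simp add: algebra_simps)
      finally have "cmod (?q n \<xi>) \<le> D * norm \<xi>" using hp[of n] by (simp add: norm_divide field_simps)
      then have "(?w \<xi> * cmod (ft v \<xi>)) * cmod (?q n \<xi>) \<le> (?w \<xi> * cmod (ft v \<xi>)) * (D * norm \<xi>)"
        by (rule mult_left_mono) simp
      also have "\<dots> = D * ((?w \<xi> * norm \<xi>) * cmod (ft v \<xi>))" by (simp only: mult_ac)
      also have "?w \<xi> * norm \<xi> = norm \<xi> powr (2*a + 1)" by (simp add: powr_add)
      finally show "norm (of_real (?w \<xi>) * ft v \<xi> * cnj (?q n \<xi>)) \<le> D * (norm \<xi> powr (2*a + 1) * cmod (ft v \<xi>))"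
        by (simp only: norm_mult complex_mod_cnj norm_of_real abs_of_nonneg powr_ge_zero)
    qed
  qed measurable
  have B: "(LINT \<xi>|lborel. of_real (?w \<xi>) * ft v \<xi> * cnj (?q n \<xi>)) = of_real (\<kappa> * ?I * (((1 + h n) powr ?e - 1 powr ?e) / h n))" for n
  proof -
    have "(LINT \<xi>|lborel. of_real (?w \<xi>) * ft v \<xi> * cnj (?q n \<xi>)) =
      (LINT \<xi>|lborel. (of_real (?w \<xi>) * ft v \<xi> * cnj (ft ?G ((1 + h n) *\<^sub>R \<xi>)) - of_real (?w \<xi>) * ft v \<xi> * cnj (ft ?G (1 *\<^sub>R \<xi>))) / of_real (h n))"
      by (intro Bochner_Integration.integral_cong refl) (simp add: diff_divide_distrib right_diff_distrib)
    also have "\<dots> = (?J (1 + h n) - ?J 1) / of_real (h n)"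
      by (simp only: Bochner_Integration.integral_divide_zero Bochner_Integration.integral_diff[OF iJ iJ])
    also have "\<dots> = of_real (\<kappa> * ?I * (((1 + h n) powr ?e - 1 powr ?e) / h n))"
      using hp[of n] by (subst J, simp, subst J, simp) (simp add: diff_divide_distrib algebra_simps)
    finally show ?thesis .
  qed
  \<comment> \<open>The derivative of \<open>l powr ?e\<close> at 1 is
    \<open>- (DIM('a) + 2 * a)\<close>; divided by the factor \<open>- 1 / (2 * (a + 1))\<close> of
    the radial derivative it gives the constant of the new order.\<close>
  have "((\<lambda>x. x powr ?e) has_field_derivative ?e * 1 powr (?e - 1)) (at 1)"
    by (rule has_real_derivative_powr) simp
  from tendsto_difference_quotient[OF this h ne]
  have "(\<lambda>n. ((1 + h n) powr ?e - 1 powr ?e) / h n) \<longlonglongrightarrow> ?e" by simp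
  then have C: "(\<lambda>n. complex_of_real (\<kappa> * ?I * (((1 + h n) powr ?e - 1 powr ?e) / h n))) \<longlonglongrightarrow> of_real (\<kappa> * ?I * ?e)"
    by (intro tendsto_of_real tendsto_mult tendsto_const)
  have "(LINT \<xi>|lborel. of_real (?w \<xi>) * ft v \<xi> * cnj (- of_real ((norm \<xi>)\<^sup>2 / (2 * (a + 1))) * ft ?H \<xi>)) = of_real (\<kappa> * ?I * ?e)"
    using A C unfolding B by (rule LIMSEQ_unique)
  also have "(LINT \<xi>|lborel. of_real (?w \<xi>) * ft v \<xi> * cnj (- of_real ((norm \<xi>)\<^sup>2 / (2 * (a + 1))) * ft ?H \<xi>))
     = (LINT \<xi>|lborel. of_real (- 1 / (2 * (a + 1))) * (of_real (norm \<xi> powr (2 * (a + 1))) * ft v \<xi> * cnj (ft ?H \<xi>)))"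
  proof (intro Bochner_Integration.integral_cong refl)
    fix \<xi> :: 'a
    have "norm \<xi> powr (2 * (a + 1)) = ?w \<xi> * (norm \<xi>)\<^sup>2"
    proof (cases "\<xi> = 0")
      case False
      then show ?thesis using powr_realpow[of "norm \<xi>" 2] by (simp add: distrib_left powr_add)
    qed simp
    then show "of_real (?w \<xi>) * ft v \<xi> * cnj (- of_real ((norm \<xi>)\<^sup>2 / (2 * (a + 1))) * ft ?H \<xi>) =
      of_real (- 1 / (2 * (a + 1))) * (of_real (norm \<xi> powr (2 * (a + 1))) * ft v \<xi> * cnj (ft ?H \<xi>))"
      by simp
  qed
  also have "\<dots> = of_real (- 1 / (2 * (a + 1))) * (LINT \<xi>|lborel. of_real (norm \<xi> powr (2 * (a + 1))) * ft v \<xi> * cnj (ft ?H \<xi>))" (is "_ = _ * ?X")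
    by (rule Bochner_Integration.integral_mult_right_zero)
  finally have e: "of_real (- 1 / (2 * (a + 1))) * ?X = complex_of_real (\<kappa> * ?I * ?e)" .
  have "?X = of_real (- (2 * (a + 1))) * (of_real (- 1 / (2 * (a + 1))) * ?X)"
  proof -
    have "(- y) * (- 1 / y) = 1" if "y \<noteq> 0" for y :: real using that by simp
    then have "(- (2 * (a + 1))) * (- 1 / (2 * (a + 1))) = 1" by this (use a in simp)
    then have "complex_of_real (- (2 * (a + 1))) * of_real (- 1 / (2 * (a + 1))) = 1"
      unfolding of_real_mult[symmetric] by (simp only: of_real_1)
    then show ?thesis by (simp only: mult.assoc[symmetric]) simp
  qed
  also have "\<dots> = of_real (2 * (a + 1) * (real DIM('a) + 2*a) * \<kappa> * ?I)"
    unfolding e of_real_mult[symmetric] by (simp add: algebra_simps)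
  finally show "?X = of_real (2 * (a + 1) * (real DIM('a) + 2*a) * \<kappa> * ?I)" .
qed

text \<open>\<open>s\<close> minus its ceiling lies in (-1, 0], and as many steps as the ceiling
  lead back to \<open>s\<close>.\<close>

lemma pairing_exists:
  assumes s: "0 < s" and N: "2 \<le> DIM('a::euclidean_space)"
  shows "\<exists>\<kappa>. pairing_at TYPE('a) s \<kappa>"
proof -
  define m where "m = nat \<lceil>s\<rceil>"
  define a where "a = s - real m"
  have a: "-1 < a" "a \<le> 0" and sa: "s = a + real m"
    using s unfolding a_def m_def by linarith+
  have "\<exists>\<kappa>. pairing_at TYPE('a) (a + real k) \<kappa>" for k
  proof (induction k)
    case 0 show ?case using pairing_at_nonpositive[OF a N] by simp
  next
    case (Suc k)
    then obtain \<kappa> where "pairing_at TYPE('a) (a + real k) \<kappa>" by blast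
    from pairing_step[OF _ N this] a show ?case by (auto simp: add_ac)
  qed
  then show ?thesis unfolding sa .
qed

section \<open>Test functions and mollification\<close>

definition smooth :: "(real^'n \<Rightarrow> real) \<Rightarrow> bool" where
  "smooth f \<longleftrightarrow> (\<forall>k. Ck k f)"

definition dirderiv :: "(real^'n \<Rightarrow> real) \<Rightarrow> real^'n \<Rightarrow> real^'n \<Rightarrow> real" where
  "dirderiv f v x = frechet_derivative f (at x) v"

lemma smooth_differentiable: "smooth f \<Longrightarrow> f differentiable (at x)"
  unfolding smooth_def by (metis Ck.simps(2) UNIV_I differentiable_on_def)

lemma smooth_has_derivative: "smooth f \<Longrightarrow> (f has_derivative (\<lambda>v. dirderiv f v x)) (at x)"
  using smooth_differentiable[of f x] unfolding dirderiv_def by (simp add: frechet_derivative_works)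

lemma smooth_continuous: "smooth f \<Longrightarrow> continuous_on UNIV f"
  unfolding smooth_def by (metis Ck.simps(1))

lemma smooth_dirderiv: "smooth f \<Longrightarrow> smooth (dirderiv f v)"
  unfolding smooth_def dirderiv_def[abs_def] by (metis Ck.simps(2))

lemma smooth_measurable: "smooth f \<Longrightarrow> f \<in> borel_measurable borel"
  by (intro borel_measurable_continuous_onI smooth_continuous)

text \<open>Smoothness is obtained from a class of differentiable functions closed under directional
  derivatives, by induction on the order with the function left general. It serves for dilates, for
  the standard bump and for convolutions.\<close>

lemma smooth_coinduct:
  assumes P: "P f"
    and diff: "\<And>f x. P f \<Longrightarrow> f differentiable (at x)"
    and step: "\<And>f v. P f \<Longrightarrow> P (dirderiv f v)"
  shows "smooth f"
proof -
  have "Ck k f" if "P f" for k f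
    using that
  proof (induction k arbitrary: f)
    case 0
    then show ?case using diff by (auto intro!: differentiable_imp_continuous_on simp: differentiable_on_def)
  next
    case (Suc k)
    then show ?case using diff[of f] step[of f] by (auto simp: differentiable_on_def dirderiv_def[abs_def])
  qed
  then show ?thesis using P unfolding smooth_def by blast
qed

lemma dirderiv_eq: "(f has_derivative D) (at x) \<Longrightarrow> dirderiv f v x = D v"
  unfolding dirderiv_def by (metis frechet_derivative_at)

text \<open>The support is recorded by a radius instead of a closure, so that it can be followed
  through derivatives, dilations and convolutions; test functions of the unit ball correspond to
  radii below 1. A negative \<open>R\<close> leaves only the zero function.\<close>

definition bumps :: "real \<Rightarrow> (real^'n \<Rightarrow> real) set" where
  "bumps R = {f. smooth f \<and> (\<forall>x. norm x > R \<longrightarrow> f x = 0)}"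

lemma bumps_dirderiv:
  fixes f :: "real^'n \<Rightarrow> real"
  assumes "f \<in> bumps R" shows "dirderiv f v \<in> bumps R"
proof -
  have "dirderiv f v x = 0" if x: "norm x > R" for x
  proof -
    have "((\<lambda>_. 0) has_derivative (\<lambda>_. 0)) (at x)" by simp
    then have "(f has_derivative (\<lambda>_. 0)) (at x)"
    proof (rule has_derivative_transform_within_open)
      show "open {y::real^'n. R < norm y}" by (intro open_Collect_less continuous_intros)
    qed (use x assms in \<open>auto simp: bumps_def\<close>)
    then show ?thesis by (simp add: dirderiv_eq)
  qed
  then show ?thesis using assms smooth_dirderiv by (auto simp: bumps_def)
qed

lemma bumps_bounded:
  assumes "f \<in> bumps R" shows "\<exists>M. \<forall>x. \<bar>f x\<bar> \<le> M"
proof -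
  have "compact (f ` cball 0 R)"
    using assms by (intro compact_continuous_image continuous_on_subset[OF smooth_continuous]) (auto simp: bumps_def)
  then have "bounded (f ` cball 0 R)" by (rule compact_imp_bounded)
  then obtain M where "\<forall>y\<in>f ` cball 0 R. norm y \<le> M" unfolding bounded_iff by blast
  then have M: "\<And>x. norm x \<le> R \<Longrightarrow> \<bar>f x\<bar> \<le> M" by auto
  have "\<bar>f x\<bar> \<le> max M 0" for x
    using M[of x] assms by (cases "norm x \<le> R") (auto simp: bumps_def)
  then show ?thesis by blast
qed

lemma bumps_integrable:
  assumes f: "f \<in> bumps R" shows "integrable lborel f"
proof -
  obtain M where "\<And>x. \<bar>f x\<bar> \<le> M" using bumps_bounded[OF f] by blast
  then show ?thesis
    by (rule integrable_bounded_in_ball[where R="R+1", rotated]) (use f in \<open>auto simp: bumps_def smooth_measurable\<close>)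
qed

text \<open>The norm attains its maximum on the compact support, and the maximum is below 1 because
  the support lies in the open ball.\<close>

lemma test_functions_iff_bumps:
  assumes "f \<in> test_functions (ball 0 1)" shows "\<exists>R<1. f \<in> bumps R"
proof -
  let ?K = "closure {x. f x \<noteq> 0}"
  have K: "compact ?K" "?K \<subseteq> ball 0 1" using assms by (auto simp: test_functions_def)
  have "\<exists>R<1. \<forall>x\<in>?K. norm x \<le> R"
  proof (cases "?K = {}")
    case True then show ?thesis by (auto intro: exI[of _ 0])
  next
    case False
    have "continuous_on ?K norm" by (intro continuous_intros)
    then obtain y where "y \<in> ?K" "\<forall>x\<in>?K. norm x \<le> norm y"
      using continuous_attains_sup[OF K(1) False] by blast
    then show ?thesis using K(2) by (intro exI[of _ "norm y"]) auto
  qed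
  then obtain R where R: "R < 1" "\<And>x. x \<in> ?K \<Longrightarrow> norm x \<le> R" by blast
  have "f x = 0" if "norm x > R" for x
    using R(2)[of x] closure_subset[of "{x. f x \<noteq> 0}"] that by force
  then show ?thesis using assms R(1) by (auto simp: bumps_def smooth_def test_functions_def)
qed

lemma bumps_imp_test_function:
  assumes f: "f \<in> bumps R" and R: "R < 1" shows "f \<in> test_functions (ball 0 1)"
proof -
  have "{x. f x \<noteq> 0} \<subseteq> cball 0 R" using f by (force simp: bumps_def)
  then have sub: "closure {x. f x \<noteq> 0} \<subseteq> cball 0 R" by (rule closure_minimal) simp
  have "compact (closure {x. f x \<noteq> 0})"
    using sub by (meson bounded_cball bounded_subset compact_closure closure_subset order_trans)
  moreover have "cball 0 R \<subseteq> ball (0::real^'n) 1" using R by auto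
  ultimately show ?thesis using sub f by (auto simp: test_functions_def bumps_def smooth_def)
qed

lemma ft_dirderiv:
  fixes f :: "real^'n \<Rightarrow> real"
  assumes f: "f \<in> bumps R"
  shows "\<i> * of_real (w \<bullet> \<xi>) * ft f \<xi> = ft (dirderiv f w) \<xi>"
proof (rule ft_line_derivative[OF bumps_integrable[OF f] bumps_integrable[OF bumps_dirderiv[OF f]]])
  have s: "smooth f" using f by (simp add: bumps_def)
  fix x :: "real^'n" and t :: real
  show "continuous_on {0..t} (\<lambda>\<tau>. f (x + \<tau> *\<^sub>R w))"
    by (intro continuous_on_compose2[OF smooth_continuous[OF s]] continuous_intros) auto
  have "((\<lambda>\<tau>. f (x + \<tau> *\<^sub>R w)) has_real_derivative dirderiv f w (x + \<tau> *\<^sub>R w)) (at \<tau>)" for \<tau>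
  proof -
    have "((\<lambda>\<tau>. f (x + \<tau> *\<^sub>R w)) has_derivative (\<lambda>h. dirderiv f (h *\<^sub>R w) (x + \<tau> *\<^sub>R w))) (at \<tau>)"
      by (rule has_derivative_compose[OF _ smooth_has_derivative[OF s], of "\<lambda>\<tau>. x + \<tau> *\<^sub>R w"]) (auto intro!: derivative_eq_intros)
    moreover have "dirderiv f (h *\<^sub>R w) y = dirderiv f w y * h" for h y
      using linear_scale[OF bounded_linear.linear[OF has_derivative_bounded_linear[OF smooth_has_derivative[OF s, of y]]], of h w] by simp
    ultimately show ?thesis by (simp add: has_field_derivative_def)
  qed
  then show "\<exists>S. finite S \<and> (\<forall>\<tau>\<in>{0<..<t} - S. ((\<lambda>\<tau>. f (x + \<tau> *\<^sub>R w)) has_real_derivative dirderiv f w (x + \<tau> *\<^sub>R w)) (at \<tau>))"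
    by (intro exI[of _ "{}"]) auto
qed

lemma bumps_decay_direction:
  fixes f :: "real^'n \<Rightarrow> real"
  assumes "f \<in> bumps R"
  shows "\<exists>C. \<forall>\<xi>. \<bar>w \<bullet> \<xi>\<bar> ^ k * cmod (ft f \<xi>) \<le> C"
  using assms
proof (induction k arbitrary: f)
  case 0
  then show ?case using ft_bound[OF bumps_integrable[OF 0]] by auto
next
  case (Suc k)
  obtain C where C: "\<And>\<xi>. \<bar>w \<bullet> \<xi>\<bar> ^ k * cmod (ft (dirderiv f w) \<xi>) \<le> C"
    using Suc.IH[OF bumps_dirderiv[OF Suc.prems, of w]] by blast
  have "\<bar>w \<bullet> \<xi>\<bar> ^ Suc k * cmod (ft f \<xi>) \<le> C" for \<xi>
    using C[of \<xi>] unfolding ft_dirderiv[OF Suc.prems, of w \<xi>, symmetric] by (simp add: norm_mult mult_ac)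
  then show ?case by blast
qed

text \<open>Repeated derivatives give decay along each basis direction, and the norm is at most the
  sum of the absolute coordinates.\<close>

lemma bumps_rapid:
  fixes f :: "real^'n \<Rightarrow> real"
  assumes f: "f \<in> bumps R" and N: "2 \<le> CARD('n)"
  shows "rapid f"
proof (rule rapidI_decay)
  fix k :: nat
  obtain C where C: "\<And>b \<xi>. \<bar>b \<bullet> \<xi>\<bar> ^ k * cmod (ft f \<xi>) \<le> C b"
    using bumps_decay_direction[OF f, of _ k] by metis
  have "norm \<xi> ^ k * cmod (ft f \<xi>) \<le> real DIM(real^'n) ^ k * (\<Sum>b\<in>Basis. C b)" for \<xi> :: "real^'n"
  proof -
    have "norm \<xi> \<le> (\<Sum>b\<in>Basis. \<bar>\<xi> \<bullet> b\<bar>)" by (rule norm_le_l1)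
    then have "norm \<xi> ^ k \<le> (\<Sum>b\<in>Basis. \<bar>\<xi> \<bullet> b\<bar>) ^ k" by (intro power_mono) auto
    also have "\<dots> \<le> real DIM(real^'n) ^ k * (\<Sum>b\<in>Basis. \<bar>\<xi> \<bullet> b\<bar> ^ k)" by (rule sum_power_le) auto
    finally have "norm \<xi> ^ k * cmod (ft f \<xi>) \<le> real DIM(real^'n) ^ k * (\<Sum>b\<in>Basis. \<bar>\<xi> \<bullet> b\<bar> ^ k) * cmod (ft f \<xi>)"
      by (rule mult_right_mono) simp
    also have "\<dots> = real DIM(real^'n) ^ k * (\<Sum>b\<in>Basis. \<bar>b \<bullet> \<xi>\<bar> ^ k * cmod (ft f \<xi>))"
      by (simp add: sum_distrib_right mult.assoc inner_commute)
    also have "\<dots> \<le> real DIM(real^'n) ^ k * (\<Sum>b\<in>Basis. C b)"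
      by (intro mult_left_mono sum_mono C) auto
    finally show ?thesis .
  qed
  then show "\<exists>C. \<forall>\<xi>. norm \<xi> ^ k * cmod (ft f \<xi>) \<le> C" by blast
qed (use N bumps_integrable[OF f] in auto)

lemma smooth_cmult_scale:
  fixes f :: "real^'n \<Rightarrow> real"
  assumes "smooth f" shows "smooth (\<lambda>x. a * f (c *\<^sub>R x))"
proof (rule smooth_coinduct[where P="\<lambda>g. \<exists>a f. smooth f \<and> g = (\<lambda>x. a * f (c *\<^sub>R x))"])
  have d: "((\<lambda>x. a * f (c *\<^sub>R x)) has_derivative (\<lambda>v. a * dirderiv f (c *\<^sub>R v) (c *\<^sub>R x))) (at x)"
    if "smooth f" for a f and x :: "real^'n"
    by (intro has_derivative_mult_right has_derivative_compose[OF _ smooth_has_derivative[OF that]]) (auto intro!: derivative_eq_intros)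
  show "g differentiable (at x)" if g: "\<exists>a f. smooth f \<and> g = (\<lambda>x. a * f (c *\<^sub>R x))" for g :: "real^'n \<Rightarrow> real" and x
    using g d unfolding differentiable_def by blast
  show "\<exists>a f. smooth f \<and> dirderiv g v = (\<lambda>x. a * f (c *\<^sub>R x))" if g: "\<exists>a f. smooth f \<and> g = (\<lambda>x. a * f (c *\<^sub>R x))" for g :: "real^'n \<Rightarrow> real" and v
  proof -
    obtain a f where f: "smooth f" "g = (\<lambda>x. a * f (c *\<^sub>R x))" using g by blast
    have "dirderiv g v = (\<lambda>x. a * dirderiv f (c *\<^sub>R v) (c *\<^sub>R x))"
      unfolding f(2) by (rule ext) (rule dirderiv_eq[OF d[OF f(1)]])
    then show ?thesis using smooth_dirderiv[OF f(1)] by blast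
  qed
qed (intro exI conjI, rule assms, rule refl)

lemma bumps_dilate:
  assumes "f \<in> bumps R" "c > 0" shows "(\<lambda>x. f (x /\<^sub>R c)) \<in> bumps (c * R)"
  using assms smooth_cmult_scale[of f 1 "inverse c"] by (auto simp: bumps_def field_simps)

text \<open>The negative powers of \<open>t\<close> are carried along so that the derivative of a
  member is again a combination of members.\<close>

definition expinv :: "nat \<Rightarrow> real \<Rightarrow> real" where
  "expinv m t = (if t > 0 then exp (- 1 / t) / t ^ m else 0)"

text \<open>One term of the exponential series at 1/t, of degree \<open>m + 2\<close>, outweighs the
  pole of order \<open>m\<close> and leaves a square. The square makes the difference quotient at 0
  vanish in \<open>expinv_derivative\<close>.\<close>

lemma expinv_le: "expinv m t \<le> fact (m + 2) * t\<^sup>2" "expinv m t \<ge> 0"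
proof -
  show "expinv m t \<ge> 0" by (simp add: expinv_def)
  show "expinv m t \<le> fact (m + 2) * t\<^sup>2"
  proof (cases "t > 0")
    case True
    have "(1 / t) ^ (m + 2) / fact (m + 2) \<le> exp (1 / t)"
      using True by (intro exp_ge_power_div_fact) simp
    then have "inverse (exp (1 / t)) \<le> inverse ((1 / t) ^ (m + 2) / fact (m + 2))"
      using True by (intro le_imp_inverse_le divide_pos_pos zero_less_power) auto
    then have "exp (- 1 / t) \<le> fact (m + 2) * t ^ (m + 2)"
      by (simp only: exp_minus minus_divide_left[symmetric] power_divide power_one inverse_divide divide_divide_eq_right)
    then have "exp (- 1 / t) / t ^ m \<le> fact (m + 2) * t ^ (m + 2) / t ^ m"
      using True by (intro divide_right_mono) auto
    then show ?thesis using True by (simp add: expinv_def power_add power2_eq_square mult_ac)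
  qed (simp add: expinv_def)
qed

lemma expinv_derivative: "(expinv m has_real_derivative expinv (m + 2) t - real m * expinv (m + 1) t) (at t)"
proof -
  consider "t > 0" | "t < 0" | "t = 0" by linarith
  then show ?thesis
  proof cases
    case 1
    have ev: "eventually (\<lambda>x. expinv m x = exp (- 1 / x) / x ^ m) (nhds t)"
      using eventually_nhds_in_open[of "{0<..}" t] 1 by (auto elim: eventually_mono simp: expinv_def)
    have d1: "((\<lambda>x. exp (- 1 / x)) has_real_derivative exp (- 1 / t) * (1 / t\<^sup>2)) (at t)"
      using 1 by (auto intro!: derivative_eq_intros simp: power2_eq_square)
    have "((\<lambda>x. exp (- 1 / x) / x ^ m) has_real_derivative
        (exp (- 1 / t) * (1 / t\<^sup>2) * t ^ m - exp (- 1 / t) * (real m * t ^ (m - Suc 0))) / (t ^ m * t ^ m)) (at t)"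
      by (rule DERIV_divide[OF d1 DERIV_pow]) (use 1 in auto)
    moreover have "(exp (- 1 / t) * (1 / t\<^sup>2) * t ^ m - exp (- 1 / t) * (real m * t ^ (m - Suc 0))) / (t ^ m * t ^ m)
       = expinv (m + 2) t - real m * expinv (m + 1) t"
    proof (cases m)
      case 0
      then show ?thesis using 1 by (simp add: expinv_def power2_eq_square)
    next
      case (Suc k)
      define E P where "E = exp (- 1 / t)" and "P = t ^ k"
      have P: "P > 0" using 1 by (simp add: P_def)
      have "(E * (1 / t\<^sup>2) * (t * P) - E * (real m * P)) / ((t * P) * (t * P)) = E / (t * t * (t * P)) - real m * (E / (t * (t * P)))"
        using 1 P by (simp add: field_simps power2_eq_square)
      then show ?thesis using 1 Suc by (simp add: expinv_def E_def P_def power2_eq_square mult_ac)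
    qed
    ultimately have "((\<lambda>x. exp (- 1 / x) / x ^ m) has_real_derivative expinv (m + 2) t - real m * expinv (m + 1) t) (at t)"
      by simp
    then show ?thesis by (subst DERIV_cong_ev[OF refl ev refl])
  next
    case 2
    have ev: "eventually (\<lambda>x. expinv m x = 0) (nhds t)"
      using eventually_nhds_in_open[of "{..<0}" t] 2 by (auto elim: eventually_mono simp: expinv_def)
    show ?thesis using 2 by (subst DERIV_cong_ev[OF refl ev refl]) (simp add: expinv_def)
  next
    case 3
    have "(\<lambda>h. (expinv m (0 + h) - expinv m 0) / h) \<midarrow>0\<rightarrow> 0"
    proof (rule tendsto_0_le[where K="fact (m + 2)"])
      show "(\<lambda>h::real. h) \<midarrow>0\<rightarrow> 0" by (rule tendsto_ident_at)
      show "eventually (\<lambda>h. norm ((expinv m (0 + h) - expinv m 0) / h) \<le> norm h * fact (m + 2)) (at 0)"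
      proof (rule eventually_at_filter[THEN iffD2], rule always_eventually, intro allI impI)
        fix h :: real assume "h \<noteq> 0"
        have "expinv m h \<le> (\<bar>h\<bar> * fact (m + 2)) * \<bar>h\<bar>"
        proof -
          have "(\<bar>h\<bar> * fact (m + 2)) * \<bar>h\<bar> = fact (m + 2) * \<bar>h\<bar>\<^sup>2" by (simp only: power2_eq_square mult_ac)
          then show ?thesis using expinv_le(1)[of m h] by (simp only: power2_abs)
        qed
        then show "norm ((expinv m (0 + h) - expinv m 0) / h) \<le> norm h * fact (m + 2)"
          using \<open>h \<noteq> 0\<close> expinv_le(2)[of m h] by (simp add: expinv_def[of _ 0] pos_divide_le_eq)
      qed
    qed
    then have "(expinv m has_real_derivative 0) (at 0)" unfolding DERIV_def .
    then show ?thesis using 3 by (simp add: expinv_def)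
  qed
qed

text \<open>A family containing the standard bump and closed under directional derivatives.\<close>
inductive bump_class :: "(real^'n \<Rightarrow> real) \<Rightarrow> bool" where
  base: "bump_class (\<lambda>x. expinv m (1 - x \<bullet> x))"
| mult: "bump_class f \<Longrightarrow> bump_class (\<lambda>x. (x \<bullet> w) * f x)"
| scale: "bump_class f \<Longrightarrow> bump_class (\<lambda>x. c * f x)"
| add: "bump_class f \<Longrightarrow> bump_class g \<Longrightarrow> bump_class (\<lambda>x. f x + g x)"

lemma bump_class_derivative:
  assumes "bump_class (f :: real^'n \<Rightarrow> real)"
  shows "\<exists>D. (\<forall>x. (f has_derivative (\<lambda>v. D v x)) (at x)) \<and> (\<forall>v. bump_class (D v))"
  using assms
proof induction
  case (base m)
  let ?D = "\<lambda>v x::real^'n. (- 2) * ((x \<bullet> v) * (expinv (m + 2) (1 - x \<bullet> x) + (- real m) * expinv (m + 1) (1 - x \<bullet> x)))"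
  have "((\<lambda>x. expinv m (1 - x \<bullet> x)) has_derivative (\<lambda>v. ?D v x)) (at x)" for x :: "real^'n"
  proof -
    have 1: "((\<lambda>x::real^'n. 1 - x \<bullet> x) has_derivative (\<lambda>v. - (2 * (x \<bullet> v)))) (at x)"
      by (auto intro!: derivative_eq_intros simp: inner_commute)
    have 2: "(expinv m has_derivative (*) (expinv (m + 2) (1 - x \<bullet> x) - real m * expinv (m + 1) (1 - x \<bullet> x))) (at (1 - x \<bullet> x))"
      using expinv_derivative by (simp add: has_field_derivative_def)
    show ?thesis
      by (rule has_derivative_eq_rhs[OF has_derivative_compose[OF 1 2]]) (simp add: fun_eq_iff algebra_simps)
  qed
  moreover have "bump_class (?D v)" for v :: "real^'n"
    by (intro bump_class.intros)
  ultimately show ?case by (intro exI[of _ ?D]) blast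
next
  case (mult f w)
  then obtain D where D: "\<And>x. (f has_derivative (\<lambda>v. D v x)) (at x)" "\<And>v. bump_class (D v)" and f: "bump_class f" by blast
  let ?D = "\<lambda>v x. (x \<bullet> w) * D v x + (v \<bullet> w) * f x"
  have "((\<lambda>x. (x \<bullet> w) * f x) has_derivative (\<lambda>v. ?D v x)) (at x)" for x
    by (auto intro!: derivative_eq_intros D(1))
  moreover have "bump_class (?D v)" for v by (intro bump_class.intros D(2) f)
  ultimately show ?case by (intro exI[of _ ?D]) blast
next
  case (scale f c)
  then obtain D where D: "\<And>x. (f has_derivative (\<lambda>v. D v x)) (at x)" "\<And>v. bump_class (D v)" by blast
  let ?D = "\<lambda>v x. c * D v x"
  have "((\<lambda>x. c * f x) has_derivative (\<lambda>v. ?D v x)) (at x)" for x by (intro has_derivative_mult_right D(1))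
  moreover have "bump_class (?D v)" for v by (intro bump_class.intros D(2))
  ultimately show ?case by (intro exI[of _ ?D]) blast
next
  case (add f g)
  then obtain D E where D: "\<And>x. (f has_derivative (\<lambda>v. D v x)) (at x)" "\<And>v. bump_class (D v)" 
    and E: "\<And>x. (g has_derivative (\<lambda>v. E v x)) (at x)" "\<And>v. bump_class (E v)" by blast
  let ?D = "\<lambda>v x. D v x + E v x"
  have "((\<lambda>x. f x + g x) has_derivative (\<lambda>v. ?D v x)) (at x)" for x by (intro has_derivative_add D(1) E(1))
  moreover have "bump_class (?D v)" for v by (intro bump_class.intros D(2) E(2))
  ultimately show ?case by (intro exI[of _ ?D]) blast
qed

lemma bump_class_smooth: "bump_class f \<Longrightarrow> smooth f"
proof (erule smooth_coinduct)
  show "f differentiable (at x)" if "bump_class f" for f :: "real^'n \<Rightarrow> real" and x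
    using bump_class_derivative[OF that] unfolding differentiable_def by blast
  show "bump_class (dirderiv f v)" if f: "bump_class f" for f :: "real^'n \<Rightarrow> real" and v
  proof -
    obtain D where D: "\<And>x. (f has_derivative (\<lambda>v. D v x)) (at x)" "\<And>v. bump_class (D v)"
      using bump_class_derivative[OF f] by blast
    have "dirderiv f v = D v" by (rule ext) (rule dirderiv_eq[OF D(1)])
    then show ?thesis using D(2) by simp
  qed
qed

lemma mollifier_exists:
  "\<exists>\<Phi>::real^'n \<Rightarrow> real. \<Phi> \<in> bumps 1 \<and> (\<forall>x. \<Phi> x \<ge> 0) \<and> (LINT x|lborel. \<Phi> x) = 1"
proof -
  let ?f = "\<lambda>x::real^'n. expinv 0 (1 - x \<bullet> x)"
  have x2: "1 - x \<bullet> x \<le> 0" if "norm x > 1" for x :: "real^'n"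
    using that by (simp add: dot_square_norm one_le_power)
  have f: "?f \<in> bumps 1"
  proof -
    have "?f x = 0" if "norm x > 1" for x using x2[OF that] by (simp add: expinv_def)
    then show ?thesis using bump_class_smooth[OF bump_class.base[of 0]] by (auto simp: bumps_def)
  qed
  note fi = bumps_integrable[OF f]
  have pos: "(LINT x|lborel. ?f x) > 0"
  proof -
    have "(LINT x|lborel. ?f x) \<noteq> 0"
    proof
      assume "(LINT x|lborel. ?f x) = 0"
      then have "AE x in lborel. ?f x = 0"
        using fi by (subst (asm) integral_nonneg_eq_0_iff_AE) (auto simp: expinv_le(2))
      then have "AE x::real^'n in lborel. x \<notin> ball 0 1"
        by (rule eventually_mono) (auto simp: expinv_def dot_square_norm abs_square_less_1 split: if_splits)
      then have "ball (0::real^'n) 1 \<in> null_sets lborel"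
        by (subst (asm) AE_iff_null_sets[symmetric]) auto
      then show False
        using open_not_negligible[of "ball (0::real^'n) 1"] null_sets_completionI[of "ball (0::real^'n) 1" lborel]
        by (auto simp: negligible_iff_null_sets)
    qed
    moreover have "(LINT x|lborel. ?f x) \<ge> 0" by (rule Bochner_Integration.integral_nonneg) (rule expinv_le(2))
    ultimately show ?thesis by simp
  qed
  define c where "c = 1 / (LINT x|lborel. ?f x)"
  let ?\<Phi> = "\<lambda>x. c * ?f x"
  have "?\<Phi> \<in> bumps 1" using f bump_class_smooth[OF bump_class.scale[OF bump_class.base[of 0]]] by (auto simp: bumps_def)
  moreover have "?\<Phi> x \<ge> 0" for x using pos by (simp add: c_def expinv_le(2))
  moreover have "(LINT x|lborel. ?\<Phi> x) = 1" using pos by (simp add: c_def)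
  ultimately show ?thesis by blast
qed

section \<open>Convolution with a bump\<close>

definition conv :: "('a::euclidean_space \<Rightarrow> real) \<Rightarrow> ('a \<Rightarrow> real) \<Rightarrow> 'a \<Rightarrow> real" where
  "conv f \<Phi> x = (LINT y|lborel. f y * \<Phi> (x - y))"

lemma bumps_lipschitz:
  fixes f :: "real^'n \<Rightarrow> real"
  assumes f: "f \<in> bumps R"
  shows "\<exists>L\<ge>0. \<forall>x y. \<bar>f x - f y\<bar> \<le> L * norm (x - y)"
proof -
  have s: "smooth f" using f by (simp add: bumps_def)
  obtain M where M: "\<And>b x. \<bar>dirderiv f b x\<bar> \<le> M b"
    using bumps_bounded[OF bumps_dirderiv[OF f]] by metis
  define L where "L = (\<Sum>b\<in>Basis. M b)"
  have M0: "M b \<ge> 0" for b using M[of b 0] by linarith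
  have L0: "L \<ge> 0" unfolding L_def by (intro sum_nonneg M0)
  have on: "onorm (\<lambda>v. dirderiv f v x) \<le> L" for x
  proof (rule onorm_le)
    fix v :: "real^'n"
    have lin: "linear (\<lambda>v. dirderiv f v x)" using has_derivative_bounded_linear[OF smooth_has_derivative[OF s]] by (rule bounded_linear.linear)
    have "dirderiv f v x = dirderiv f (\<Sum>b\<in>Basis. (v \<bullet> b) *\<^sub>R b) x" by (simp add: euclidean_representation)
    also have "\<dots> = (\<Sum>b\<in>Basis. (v \<bullet> b) * dirderiv f b x)"
      using linear_sum[OF lin, of "\<lambda>b. (v \<bullet> b) *\<^sub>R b" Basis] linear_scale[OF lin] by simp
    finally have "\<bar>dirderiv f v x\<bar> \<le> (\<Sum>b\<in>Basis. \<bar>(v \<bullet> b) * dirderiv f b x\<bar>)" by (simp add: sum_abs)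
    also have "\<dots> \<le> (\<Sum>b\<in>Basis. norm v * M b)"
      by (intro sum_mono) (simp add: abs_mult mult_mono Basis_le_norm M)
    also have "\<dots> = L * norm v" unfolding L_def sum_distrib_right by (simp add: mult.commute)
    finally show "norm (dirderiv f v x) \<le> L * norm v" by simp
  qed
  have "\<bar>f x - f y\<bar> \<le> L * norm (x - y)" for x y
    using differentiable_bound[of UNIV f "\<lambda>x v. dirderiv f v x" L x y] smooth_has_derivative[OF s] on by simp
  then show ?thesis using L0 by blast
qed

text \<open>The directional derivatives are Lipschitz, so the mean value inequality applied to
  \<open>f\<close> minus its linearisation at \<open>x\<close>, on the ball of radius
  \<open>norm h\<close>, gives a quadratic remainder with a constant uniform in
  \<open>x\<close>.\<close>

lemma bumps_taylor:
  fixes f :: "real^'n \<Rightarrow> real"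
  assumes f: "f \<in> bumps R"
  shows "\<exists>K\<ge>0. \<forall>x h. \<bar>f (x + h) - f x - dirderiv f h x\<bar> \<le> K * (norm h)\<^sup>2"
proof -
  have s: "smooth f" using f by (simp add: bumps_def)
  have "\<forall>b. \<exists>L\<ge>0. \<forall>x y. \<bar>dirderiv f b x - dirderiv f b y\<bar> \<le> L * norm (x - y)"
    using bumps_lipschitz[OF bumps_dirderiv[OF f]] by blast
  then obtain L where L: "\<And>b. L b \<ge> 0" "\<And>b x y. \<bar>dirderiv f b x - dirderiv f b y\<bar> \<le> L b * norm (x - y)" by metis
  define K where "K = (\<Sum>b\<in>Basis. L b)"
  have K0: "K \<ge> 0" unfolding K_def by (intro sum_nonneg L(1))
  have lin: "linear (\<lambda>v. dirderiv f v x)" for x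
    using has_derivative_bounded_linear[OF smooth_has_derivative[OF s]] by (rule bounded_linear.linear)
  have rep: "dirderiv f v x = (\<Sum>b\<in>Basis. (v \<bullet> b) * dirderiv f b x)" for v x
  proof -
    have "dirderiv f v x = dirderiv f (\<Sum>b\<in>Basis. (v \<bullet> b) *\<^sub>R b) x" by (simp add: euclidean_representation)
    also have "\<dots> = (\<Sum>b\<in>Basis. (v \<bullet> b) * dirderiv f b x)"
      using linear_sum[OF lin, of "\<lambda>b. (v \<bullet> b) *\<^sub>R b" Basis] linear_scale[OF lin] by simp
    finally show ?thesis .
  qed
  have "\<bar>f (x + h) - f x - dirderiv f h x\<bar> \<le> K * (norm h)\<^sup>2" for x h
  proof -
    let ?g = "\<lambda>y. f y - dirderiv f y x"
    have dg: "(?g has_derivative (\<lambda>v. dirderiv f v y - dirderiv f v x)) (at y within cball x (norm h))" for y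
      by (intro has_derivative_diff has_derivative_at_withinI[OF smooth_has_derivative[OF s]]
            has_derivative_at_withinI[OF bounded_linear_imp_has_derivative[OF has_derivative_bounded_linear[OF smooth_has_derivative[OF s]]]])
    have on: "onorm (\<lambda>v. dirderiv f v y - dirderiv f v x) \<le> K * norm h" if y: "y \<in> cball x (norm h)" for y
    proof (rule onorm_le)
      fix v :: "real^'n"
      have "\<bar>dirderiv f v y - dirderiv f v x\<bar> = \<bar>\<Sum>b\<in>Basis. (v \<bullet> b) * (dirderiv f b y - dirderiv f b x)\<bar>"
        unfolding rep[of v] by (simp add: sum_subtractf right_diff_distrib)
      also have "\<dots> \<le> (\<Sum>b\<in>Basis. \<bar>(v \<bullet> b) * (dirderiv f b y - dirderiv f b x)\<bar>)" by (rule sum_abs)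
      also have "\<dots> \<le> (\<Sum>b\<in>Basis. norm v * (L b * norm h))"
      proof (rule sum_mono)
        fix b :: "real^'n" assume b: "b \<in> Basis"
        have "\<bar>dirderiv f b y - dirderiv f b x\<bar> \<le> L b * norm h"
          using L(2)[of b y x] mult_left_mono[of "norm (y - x)" "norm h" "L b"] L(1)[of b] y by (simp add: dist_norm norm_minus_commute)
        then show "\<bar>(v \<bullet> b) * (dirderiv f b y - dirderiv f b x)\<bar> \<le> norm v * (L b * norm h)"
          unfolding abs_mult using Basis_le_norm[OF b, of v] by (intro mult_mono) auto
      qed
      also have "\<dots> = K * norm h * norm v" unfolding K_def sum_distrib_right by (simp add: mult_ac)
      finally show "norm (dirderiv f v y - dirderiv f v x) \<le> K * norm h * norm v" by simp
    qed
    have "norm (?g (x + h) - ?g x) \<le> (K * norm h) * norm ((x + h) - x)"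
      by (rule differentiable_bound[OF convex_cball dg on]) (auto simp: dist_norm)
    moreover have "?g (x + h) - ?g x = f (x + h) - f x - dirderiv f h x"
      using linear_add[OF lin[of x], of x h] by simp
    ultimately show ?thesis by (simp add: power2_eq_square mult.assoc)
  qed
  then show ?thesis using K0 by blast
qed

lemma integrable_conv:
  fixes f \<Phi> :: "real^'n \<Rightarrow> real"
  assumes f: "integrable lborel f" and p: "\<Phi> \<in> bumps R"
  shows "integrable lborel (\<lambda>y. f y * \<Phi> (x - y))"
proof -
  obtain M where M: "\<And>x. \<bar>\<Phi> x\<bar> \<le> M" using bumps_bounded[OF p] by blast
  note [measurable] = borel_measurable_integrable[OF f] smooth_measurable[of \<Phi>]
  have [measurable]: "\<Phi> \<in> borel_measurable borel" using p smooth_measurable by (auto simp: bumps_def)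
  show ?thesis
  proof (rule Bochner_Integration.integrable_bound)
    show "integrable lborel (\<lambda>y. M * \<bar>f y\<bar>)" using f by simp
    show "AE y in lborel. norm (f y * \<Phi> (x - y)) \<le> norm (M * \<bar>f y\<bar>)"
    proof (rule AE_I2)
      fix y
      have "\<bar>\<Phi> (x - y)\<bar> * \<bar>f y\<bar> \<le> M * \<bar>f y\<bar>" by (intro mult_right_mono M) simp
      moreover have "M \<ge> 0" using M[of 0] by linarith
      ultimately show "norm (f y * \<Phi> (x - y)) \<le> norm (M * \<bar>f y\<bar>)" by (simp add: abs_mult mult.commute)
    qed
  qed measurable
qed

text \<open>The uniform quadratic remainder of \<open>bumps_taylor\<close> is integrated against
  \<open>\<bar>f\<bar>\<close>, so integrability of \<open>f\<close> alone justifies differentiation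
  under the integral.\<close>

lemma conv_has_derivative:
  fixes f \<Phi> :: "real^'n \<Rightarrow> real"
  assumes f: "integrable lborel f" and p: "\<Phi> \<in> bumps R"
  shows "(conv f \<Phi> has_derivative (\<lambda>v. conv f (dirderiv \<Phi> v) x)) (at x)"
proof -
  have s: "smooth \<Phi>" using p by (simp add: bumps_def)
  obtain K where K: "K \<ge> 0" "\<And>x h. \<bar>\<Phi> (x + h) - \<Phi> x - dirderiv \<Phi> h x\<bar> \<le> K * (norm h)\<^sup>2"
    using bumps_taylor[OF p] by blast
  have lin: "linear (\<lambda>v. dirderiv \<Phi> v x)" for x
    using has_derivative_bounded_linear[OF smooth_has_derivative[OF s]] by (rule bounded_linear.linear)
  note i0 = integrable_conv[OF f p] and i1 = integrable_conv[OF f bumps_dirderiv[OF p]]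
  have linc: "linear (\<lambda>v. conv f (dirderiv \<Phi> v) x)"
  proof (rule linearI)
    fix u v show "conv f (dirderiv \<Phi> (u + v)) x = conv f (dirderiv \<Phi> u) x + conv f (dirderiv \<Phi> v) x"
      unfolding conv_def using i1 by (simp add: linear_add[OF lin] distrib_left)
  next
    fix c v show "conv f (dirderiv \<Phi> (c *\<^sub>R v)) x = c *\<^sub>R conv f (dirderiv \<Phi> v) x"
      unfolding conv_def by (simp add: linear_scale[OF lin] mult.left_commute)
  qed
  define A where "A = (LINT y|lborel. \<bar>f y\<bar>) * K"
  have bound: "\<bar>conv f \<Phi> (x + h) - conv f \<Phi> x - conv f (dirderiv \<Phi> h) x\<bar> \<le> A * (norm h)\<^sup>2" for h
  proof -
    have "conv f \<Phi> (x + h) - conv f \<Phi> x - conv f (dirderiv \<Phi> h) x = (LINT y|lborel. f y * (\<Phi> ((x - y) + h) - \<Phi> (x - y) - dirderiv \<Phi> h (x - y)))"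
      unfolding conv_def using i0[of "x + h"] i0[of x] i1[of h x] by (simp add: right_diff_distrib add_diff_eq diff_add_eq)
    also have "\<bar>\<dots>\<bar> \<le> (LINT y|lborel. \<bar>f y\<bar> * (K * (norm h)\<^sup>2))"
    proof -
      have "\<bar>LINT y|lborel. f y * (\<Phi> ((x - y) + h) - \<Phi> (x - y) - dirderiv \<Phi> h (x - y))\<bar> \<le> (LINT y|lborel. \<bar>f y * (\<Phi> ((x - y) + h) - \<Phi> (x - y) - dirderiv \<Phi> h (x - y))\<bar>)"
        by (rule integral_abs_bound)
      also have "\<dots> \<le> (LINT y|lborel. \<bar>f y\<bar> * (K * (norm h)\<^sup>2))"
      proof (rule Bochner_Integration.integral_mono_AE')
        show "integrable lborel (\<lambda>y. \<bar>f y\<bar> * (K * (norm h)\<^sup>2))" using f by simp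
        show "AE y in lborel. \<bar>f y * (\<Phi> ((x - y) + h) - \<Phi> (x - y) - dirderiv \<Phi> h (x - y))\<bar> \<le> \<bar>f y\<bar> * (K * (norm h)\<^sup>2)"
          unfolding abs_mult by (intro AE_I2 mult_left_mono K(2)) simp
      qed (use K(1) in auto)
      finally show ?thesis .
    qed
    also have "\<dots> = A * (norm h)\<^sup>2" by (simp add: A_def)
    finally show ?thesis .
  qed
  show ?thesis
    unfolding has_derivative_at
  proof (intro conjI)
    show "bounded_linear (\<lambda>v. conv f (dirderiv \<Phi> v) x)" using linc linear_conv_bounded_linear by blast
    show "(\<lambda>h. norm (conv f \<Phi> (x + h) - conv f \<Phi> x - conv f (dirderiv \<Phi> h) x) / norm h) \<midarrow>0\<rightarrow> 0"
    proof (rule tendsto_0_le[where K=A])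
      show "(\<lambda>h::real^'n. h) \<midarrow>0\<rightarrow> 0" by (rule tendsto_ident_at)
      show "eventually (\<lambda>h. norm (norm (conv f \<Phi> (x + h) - conv f \<Phi> x - conv f (dirderiv \<Phi> h) x) / norm h) \<le> norm h * A) (at 0)"
      proof (rule eventually_at_filter[THEN iffD2], rule always_eventually, intro allI impI)
        fix h :: "real^'n" assume "h \<noteq> 0"
        then show "norm (norm (conv f \<Phi> (x + h) - conv f \<Phi> x - conv f (dirderiv \<Phi> h) x) / norm h) \<le> norm h * A"
          using bound[of h] by (simp add: pos_divide_le_eq power2_eq_square mult_ac)
      qed
    qed
  qed
qed

lemma conv_smooth:
  fixes f \<Phi> :: "real^'n \<Rightarrow> real"
  assumes f: "integrable lborel f" and p: "\<Phi> \<in> bumps R"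
  shows "smooth (conv f \<Phi>)"
proof (rule smooth_coinduct[where P="\<lambda>g. \<exists>\<Phi>\<in>bumps R. g = conv f \<Phi>"])
  show "\<exists>\<Phi>'\<in>bumps R. conv f \<Phi> = conv f \<Phi>'" using p by blast
  show "g differentiable (at x)" if "\<exists>\<Phi>\<in>bumps R. g = conv f \<Phi>" for g x
    using that conv_has_derivative[OF f] unfolding differentiable_def by blast
  show "\<exists>\<Phi>\<in>bumps R. dirderiv g v = conv f \<Phi>" if g: "\<exists>\<Phi>\<in>bumps R. g = conv f \<Phi>" for g v
  proof -
    obtain \<Phi> where P: "\<Phi> \<in> bumps R" "g = conv f \<Phi>" using g by blast
    have "dirderiv g v = conv f (dirderiv \<Phi> v)"
      unfolding P(2) by (rule ext) (rule dirderiv_eq[OF conv_has_derivative[OF f P(1)]])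
    then show ?thesis using bumps_dirderiv[OF P(1)] by blast
  qed
qed

lemma conv_bumps:
  fixes f \<Phi> :: "real^'n \<Rightarrow> real"
  assumes f: "integrable lborel f" and p: "\<Phi> \<in> bumps \<epsilon>" and supp: "\<And>x. norm x \<ge> r \<Longrightarrow> f x = 0"
  shows "conv f \<Phi> \<in> bumps (r + \<epsilon>)"
proof -
  have "conv f \<Phi> x = 0" if x: "norm x > r + \<epsilon>" for x
  proof -
    have z: "f y * \<Phi> (x - y) = 0" for y
    proof (cases "norm y \<ge> r")
      case False
      have "norm x \<le> norm y + norm (x - y)" by (metis norm_triangle_sub)
      then have "norm (x - y) > \<epsilon>" using False x by linarith
      then show ?thesis using p by (simp add: bumps_def)
    qed (simp add: supp)
    show ?thesis unfolding conv_def z by simp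
  qed
  then show ?thesis using conv_smooth[OF f p] by (simp add: bumps_def)
qed

lemma ft_conv:
  fixes f \<Phi> :: "'a::euclidean_space \<Rightarrow> real"
  assumes f: "integrable lborel f" and p: "integrable lborel \<Phi>"
  shows "ft (conv f \<Phi>) \<xi> = ft f \<xi> * ft \<Phi> \<xi>"
proof -
  note [measurable] = borel_measurable_integrable[OF f] borel_measurable_integrable[OF p]
  have tr: "integrable lborel (\<lambda>x. \<Phi> (x - y))" for y
    using lborel_integrable_translate[OF p, of "- y"] by simp
  have trI: "(LINT x|lborel. \<bar>\<Phi> (x - y)\<bar>) = (LINT x|lborel. \<bar>\<Phi> x\<bar>)" for y
    using lborel_integral_translate[of "\<lambda>x. \<bar>\<Phi> x\<bar>" "- y"] by simp
  have I: "integrable (lborel \<Otimes>\<^sub>M lborel) (\<lambda>(y,x). f y * \<Phi> (x - y))"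
  proof (rule lborel_pair.Fubini_integrable)
    show "AE y in lborel. integrable lborel (\<lambda>x. case (y, x) of (y, x) \<Rightarrow> f y * \<Phi> (x - y))" using tr by simp
    show "integrable lborel (\<lambda>y. LINT x|lborel. norm (case (y, x) of (y, x) \<Rightarrow> f y * \<Phi> (x - y)))"
      using f by (simp add: abs_mult trI)
  qed measurable
  have I2: "integrable (lborel \<Otimes>\<^sub>M lborel) (\<lambda>(y,x). cis (- (x \<bullet> \<xi>)) * complex_of_real (f y * \<Phi> (x - y)))"
    by (rule Bochner_Integration.integrable_bound[OF I]) (auto simp: norm_mult abs_mult)
  have "ft (conv f \<Phi>) \<xi> = (LINT x|lborel. (LINT y|lborel. cis (- (x \<bullet> \<xi>)) * complex_of_real (f y * \<Phi> (x - y))))"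
    unfolding ft_def conv_def by (simp only: Bochner_Integration.integral_mult_right_zero integral_complex_of_real)
  also have "\<dots> = (LINT y|lborel. (LINT x|lborel. cis (- (x \<bullet> \<xi>)) * complex_of_real (f y * \<Phi> (x - y))))"
    by (rule lborel_pair.Fubini_integral[OF I2])
  also have "\<dots> = (LINT y|lborel. (cis (- (y \<bullet> \<xi>)) * of_real (f y)) * ft \<Phi> \<xi>)"
  proof (rule Bochner_Integration.integral_cong[OF refl])
    fix y
    have "(LINT x|lborel. cis (- (x \<bullet> \<xi>)) * complex_of_real (f y * \<Phi> (x - y))) = of_real (f y) * ft (\<lambda>x. \<Phi> (x + - y)) \<xi>"
      unfolding ft_def Bochner_Integration.integral_mult_right_zero[symmetric] by (simp add: mult_ac)
    also have "\<dots> = of_real (f y) * (cis (- (y \<bullet> \<xi>)) * ft \<Phi> \<xi>)" by (simp add: ft_translate del: add_uminus_conv_diff)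
    finally show "(LINT x|lborel. cis (- (x \<bullet> \<xi>)) * complex_of_real (f y * \<Phi> (x - y))) = (cis (- (y \<bullet> \<xi>)) * of_real (f y)) * ft \<Phi> \<xi>"
      by (simp add: mult_ac)
  qed
  also have "\<dots> = ft f \<xi> * ft \<Phi> \<xi>"
    unfolding ft_def[of f] by (rule Bochner_Integration.integral_mult_left_zero)
  finally show ?thesis .
qed

section \<open>The energy space\<close>

definition freq_weight :: "real \<Rightarrow> 'a::euclidean_space \<Rightarrow> real" where
  "freq_weight s \<xi> = norm \<xi> powr (2 * s)"

lemma freq_weight_nonneg [simp]: "freq_weight s \<xi> \<ge> 0" by (simp add: freq_weight_def)

lemma freq_weight_measurable [measurable]: "freq_weight s \<in> borel_measurable borel"
  unfolding freq_weight_def by measurable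

definition eform :: "real \<Rightarrow> ('a::euclidean_space \<Rightarrow> real) \<Rightarrow> ('a \<Rightarrow> real) \<Rightarrow> complex" where
  "eform s u v = (LINT \<xi>|lborel. of_real (freq_weight s \<xi>) * ft u \<xi> * cnj (ft v \<xi>))"

definition qform :: "real \<Rightarrow> ('a::euclidean_space \<Rightarrow> real) \<Rightarrow> real" where
  "qform s u = (LINT \<xi>|lborel. freq_weight s \<xi> * (cmod (ft u \<xi>))\<^sup>2)"

text \<open>Both integrability conditions are bundled so that neither \<open>ft\<close> nor
  \<open>qform\<close> can be the default 0 of a divergent integral.\<close>

definition has_eform :: "real \<Rightarrow> ('a::euclidean_space \<Rightarrow> real) \<Rightarrow> bool" where
  "has_eform s u \<longleftrightarrow> integrable lborel u \<and> integrable lborel (\<lambda>\<xi>. freq_weight s \<xi> * (cmod (ft u \<xi>))\<^sup>2)"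

lemma qform_nonneg [simp]: "qform s u \<ge> 0"
  unfolding qform_def by (intro Bochner_Integration.integral_nonneg) simp

lemma eform_self: "eform s u u = of_real (qform s u)"
proof -
  have "eform s u u = (LINT \<xi>|lborel. complex_of_real (freq_weight s \<xi> * (cmod (ft u \<xi>))\<^sup>2))"
    unfolding eform_def by (simp add: mult.assoc complex_norm_square[symmetric] del: of_real_power)
  also have "\<dots> = of_real (qform s u)" unfolding qform_def by (rule integral_complex_of_real)
  finally show ?thesis .
qed

lemma eform_cnj: "eform s v u = cnj (eform s u v)"
  unfolding eform_def Bochner_Integration.integral_cnj[symmetric] by (simp add: mult_ac)

lemma eform_integrable:
  assumes u: "has_eform s u" and v: "has_eform s v"
  shows "integrable lborel (\<lambda>\<xi>. of_real (freq_weight s \<xi>) * ft u \<xi> * cnj (ft v \<xi>))"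
proof -
  have [measurable]: "u \<in> borel_measurable borel" "v \<in> borel_measurable borel"
    using u v unfolding has_eform_def by (auto dest: borel_measurable_integrable)
  have "integrable lborel (\<lambda>\<xi>. freq_weight s \<xi> * (cmod (ft u \<xi>))\<^sup>2 + freq_weight s \<xi> * (cmod (ft v \<xi>))\<^sup>2)"
    using u v unfolding has_eform_def by auto
  then show ?thesis
  proof (rule Bochner_Integration.integrable_bound)
    show "AE \<xi> in lborel. norm (of_real (freq_weight s \<xi>) * ft u \<xi> * cnj (ft v \<xi>)) \<le> norm (freq_weight s \<xi> * (cmod (ft u \<xi>))\<^sup>2 + freq_weight s \<xi> * (cmod (ft v \<xi>))\<^sup>2)"
    proof (rule AE_I2)
      fix \<xi>
      have "cmod (ft u \<xi>) * cmod (ft v \<xi>) \<le> (cmod (ft u \<xi>))\<^sup>2 + (cmod (ft v \<xi>))\<^sup>2"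
        using sum_squares_bound[of "cmod (ft u \<xi>)" "cmod (ft v \<xi>)"] zero_le_power2[of "cmod (ft u \<xi>)"] zero_le_power2[of "cmod (ft v \<xi>)"] by linarith
      then have "freq_weight s \<xi> * (cmod (ft u \<xi>) * cmod (ft v \<xi>)) \<le> freq_weight s \<xi> * ((cmod (ft u \<xi>))\<^sup>2 + (cmod (ft v \<xi>))\<^sup>2)"
        by (rule mult_left_mono) simp
      then show "norm (of_real (freq_weight s \<xi>) * ft u \<xi> * cnj (ft v \<xi>)) \<le> norm (freq_weight s \<xi> * (cmod (ft u \<xi>))\<^sup>2 + freq_weight s \<xi> * (cmod (ft v \<xi>))\<^sup>2)"
        by (simp add: norm_mult mult.assoc distrib_left)
    qed
  qed measurable
qed

lemma has_eform_diff:
  assumes u: "has_eform s u" and v: "has_eform s v"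
  shows "has_eform s (\<lambda>x. u x - v x)"
proof -
  have [measurable]: "u \<in> borel_measurable borel" "v \<in> borel_measurable borel"
    using u v unfolding has_eform_def by (auto dest: borel_measurable_integrable)
  have iu: "integrable lborel u" "integrable lborel v" using u v by (auto simp: has_eform_def)
  have "integrable lborel (\<lambda>\<xi>. 2 * (freq_weight s \<xi> * (cmod (ft u \<xi>))\<^sup>2) + 2 * (freq_weight s \<xi> * (cmod (ft v \<xi>))\<^sup>2))"
    using u v unfolding has_eform_def by auto
  then have "integrable lborel (\<lambda>\<xi>. freq_weight s \<xi> * (cmod (ft (\<lambda>x. u x - v x) \<xi>))\<^sup>2)"
  proof (rule Bochner_Integration.integrable_bound)
    show "AE \<xi> in lborel. norm (freq_weight s \<xi> * (cmod (ft (\<lambda>x. u x - v x) \<xi>))\<^sup>2) \<le> norm (2 * (freq_weight s \<xi> * (cmod (ft u \<xi>))\<^sup>2) + 2 * (freq_weight s \<xi> * (cmod (ft v \<xi>))\<^sup>2))"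
    proof (rule AE_I2)
      fix \<xi>
      have "(cmod (ft u \<xi> - ft v \<xi>))\<^sup>2 \<le> (cmod (ft u \<xi>) + cmod (ft v \<xi>))\<^sup>2"
        by (intro power_mono norm_triangle_ineq4) simp
      also have "\<dots> \<le> 2 * (cmod (ft u \<xi>))\<^sup>2 + 2 * (cmod (ft v \<xi>))\<^sup>2"
        using sum_squares_bound[of "cmod (ft u \<xi>)" "cmod (ft v \<xi>)"] by (simp add: power2_sum)
      finally have "freq_weight s \<xi> * (cmod (ft u \<xi> - ft v \<xi>))\<^sup>2 \<le> freq_weight s \<xi> * (2 * (cmod (ft u \<xi>))\<^sup>2 + 2 * (cmod (ft v \<xi>))\<^sup>2)"
        by (rule mult_left_mono) simp
      then have "freq_weight s \<xi> * (cmod (ft u \<xi> - ft v \<xi>))\<^sup>2 \<le> 2 * (freq_weight s \<xi> * (cmod (ft u \<xi>))\<^sup>2) + 2 * (freq_weight s \<xi> * (cmod (ft v \<xi>))\<^sup>2)"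
        by (simp add: distrib_left mult_ac)
      then show "norm (freq_weight s \<xi> * (cmod (ft (\<lambda>x. u x - v x) \<xi>))\<^sup>2) \<le> norm (2 * (freq_weight s \<xi> * (cmod (ft u \<xi>))\<^sup>2) + 2 * (freq_weight s \<xi> * (cmod (ft v \<xi>))\<^sup>2))"
        unfolding ft_diff[OF iu] by (rule real_norm_le_norm[rotated]) simp
    qed
  qed measurable
  then show ?thesis using iu by (simp add: has_eform_def)
qed

lemma has_eform_cmult: "has_eform s u \<Longrightarrow> has_eform s (\<lambda>x. c * u x)"
  unfolding has_eform_def by (simp add: ft_cmult norm_mult power_mult_distrib mult.left_commute[of _ "c\<^sup>2"])

lemma eform_cmult: "eform s (\<lambda>x. c * u x) v = of_real c * eform s u v"
  unfolding eform_def Bochner_Integration.integral_mult_right_zero[symmetric] by (simp add: ft_cmult mult_ac)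

lemma eform_diff:
  assumes u: "has_eform s u" and v: "has_eform s v" and w: "has_eform s w"
  shows "eform s (\<lambda>x. u x - v x) w = eform s u w - eform s v w"
proof -
  have iu: "integrable lborel u" "integrable lborel v" using u v by (auto simp: has_eform_def)
  show ?thesis
    unfolding eform_def Bochner_Integration.integral_diff[OF eform_integrable[OF u w] eform_integrable[OF v w], symmetric]
    by (simp add: ft_diff[OF iu] algebra_simps)
qed

lemma eform_diff_right:
  assumes u: "has_eform s u" and v: "has_eform s v" and w: "has_eform s w"
  shows "eform s w (\<lambda>x. u x - v x) = eform s w u - eform s w v"
  using eform_diff[OF assms] eform_cnj[of s w "\<lambda>x. u x - v x"] eform_cnj[of s w u] eform_cnj[of s w v]
  by (metis complex_cnj_cnj complex_cnj_diff eform_cnj)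

lemma qform_diff:
  assumes u: "has_eform s u" and v: "has_eform s v"
  shows "qform s (\<lambda>x. u x - v x) = qform s u - 2 * Re (eform s u v) + qform s v"
proof -
  have "eform s (\<lambda>x. u x - v x) (\<lambda>x. u x - v x) = eform s u (\<lambda>x. u x - v x) - eform s v (\<lambda>x. u x - v x)"
    by (rule eform_diff[OF u v has_eform_diff[OF u v]])
  also have "eform s u (\<lambda>x. u x - v x) = of_real (qform s u) - eform s u v"
    using eform_diff_right[OF u v u] by (simp only: eform_self)
  also have "eform s v (\<lambda>x. u x - v x) = eform s v u - of_real (qform s v)"
    using eform_diff_right[OF u v v] by (simp only: eform_self)
  finally have "eform s (\<lambda>x. u x - v x) (\<lambda>x. u x - v x) = (of_real (qform s u) - eform s u v) - (eform s v u - of_real (qform s v))" .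
  then have "of_real (qform s (\<lambda>x. u x - v x)) = (of_real (qform s u) - eform s u v) - (eform s v u - of_real (qform s v))"
    by (simp only: eform_self)
  from arg_cong[OF this, of Re] show ?thesis
    unfolding eform_cnj[of s v u] by simp
qed

lemma qform_cmult: "qform s (\<lambda>x. c * u x) = c\<^sup>2 * qform s u"
  unfolding qform_def Bochner_Integration.integral_mult_right_zero[symmetric]
  by (simp add: ft_cmult norm_mult power_mult_distrib mult_ac)

lemma quadratic_nonneg_imp:
  fixes A B X :: real
  assumes q: "\<And>t. 0 \<le> t\<^sup>2 * A - 2 * t * X + B" and A: "A \<ge> 0" and X: "X \<ge> 0"
  shows "X\<^sup>2 \<le> A * B"
proof (cases "A = 0")
  case True
  have "X = 0"
  proof (rule ccontr)
    assume "X \<noteq> 0"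
    \<comment> \<open>For \<open>A = 0\<close> the expression is affine in \<open>t\<close>, and
      this \<open>t\<close> would give it the value -1.\<close>
    then have "2 * ((B + 1) / (2 * X)) * X = B + 1" by simp
    then show False using q[of "(B + 1) / (2 * X)"] True by simp
  qed
  then show ?thesis using True by simp
next
  case False
  then have A: "A > 0" using A by simp
  have "(X / A)\<^sup>2 * A - 2 * (X / A) * X + B = B - X\<^sup>2 / A"
    using A by (simp add: power2_eq_square field_simps)
  then have "X\<^sup>2 / A \<le> B" using q[of "X / A"] by linarith
  then show ?thesis using A by (simp add: pos_divide_le_eq mult.commute)
qed

lemma integral_Cauchy_Schwarz:
  fixes f g :: "'a \<Rightarrow> real"
  assumes f: "integrable M (\<lambda>x. (f x)\<^sup>2)" and g: "integrable M (\<lambda>x. (g x)\<^sup>2)" and fg: "integrable M (\<lambda>x. \<bar>f x\<bar> * \<bar>g x\<bar>)"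
  shows "(LINT x|M. \<bar>f x\<bar> * \<bar>g x\<bar>)\<^sup>2 \<le> (LINT x|M. (f x)\<^sup>2) * (LINT x|M. (g x)\<^sup>2)"
proof (rule quadratic_nonneg_imp)
  fix t :: real
  have "0 \<le> (LINT x|M. (t * \<bar>f x\<bar> - \<bar>g x\<bar>)\<^sup>2)" by (rule Bochner_Integration.integral_nonneg) simp
  also have "\<dots> = (LINT x|M. (t\<^sup>2 * (f x)\<^sup>2 - 2 * t * (\<bar>f x\<bar> * \<bar>g x\<bar>)) + (g x)\<^sup>2)"
    by (intro Bochner_Integration.integral_cong refl) (simp add: power2_diff power_mult_distrib mult_ac)
  also have "\<dots> = t\<^sup>2 * (LINT x|M. (f x)\<^sup>2) - 2 * t * (LINT x|M. \<bar>f x\<bar> * \<bar>g x\<bar>) + (LINT x|M. (g x)\<^sup>2)"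
    using f g fg by simp
  finally show "0 \<le> \<dots>" .
qed auto

lemma eform_Cauchy_Schwarz:
  assumes u: "has_eform s u" and v: "has_eform s v"
  shows "(cmod (eform s u v))\<^sup>2 \<le> qform s u * qform s v"
proof -
  let ?f = "\<lambda>\<xi>. sqrt (freq_weight s \<xi>) * cmod (ft u \<xi>)" and ?g = "\<lambda>\<xi>. sqrt (freq_weight s \<xi>) * cmod (ft v \<xi>)"
  have fg: "\<bar>?f \<xi>\<bar> * \<bar>?g \<xi>\<bar> = cmod (of_real (freq_weight s \<xi>) * ft u \<xi> * cnj (ft v \<xi>))" for \<xi>
  proof -
    have "\<bar>?f \<xi>\<bar> * \<bar>?g \<xi>\<bar> = (sqrt (freq_weight s \<xi>) * sqrt (freq_weight s \<xi>)) * (cmod (ft u \<xi>) * cmod (ft v \<xi>))"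
      by (simp add: abs_mult)
    then show ?thesis by (simp add: norm_mult)
  qed
  have f2: "(\<lambda>\<xi>. (?f \<xi>)\<^sup>2) = (\<lambda>\<xi>. freq_weight s \<xi> * (cmod (ft u \<xi>))\<^sup>2)" by (simp add: power_mult_distrib)
  have g2: "(\<lambda>\<xi>. (?g \<xi>)\<^sup>2) = (\<lambda>\<xi>. freq_weight s \<xi> * (cmod (ft v \<xi>))\<^sup>2)" by (simp add: power_mult_distrib)
  have "cmod (eform s u v) \<le> (LINT \<xi>|lborel. \<bar>?f \<xi>\<bar> * \<bar>?g \<xi>\<bar>)"
    unfolding eform_def fg by (rule integral_norm_bound)
  then have "(cmod (eform s u v))\<^sup>2 \<le> (LINT \<xi>|lborel. \<bar>?f \<xi>\<bar> * \<bar>?g \<xi>\<bar>)\<^sup>2" by (intro power_mono) auto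
  also have "\<dots> \<le> (LINT \<xi>|lborel. (?f \<xi>)\<^sup>2) * (LINT \<xi>|lborel. (?g \<xi>)\<^sup>2)"
  proof (rule integral_Cauchy_Schwarz)
    show "integrable lborel (\<lambda>\<xi>. \<bar>?f \<xi>\<bar> * \<bar>?g \<xi>\<bar>)" unfolding fg by (rule integrable_norm[OF eform_integrable[OF u v]])
  qed (use u v in \<open>simp_all only: f2 g2 has_eform_def\<close>)
  finally show ?thesis unfolding f2 g2 qform_def .
qed

text \<open>Each transform contributes \<open>r ^ DIM('a)\<close>, the change of the frequency
  variable removes one such factor, and the weight contributes \<open>r powr (- (2 * s))\<close>.
  The exponent left over dictates the amplitude r^(-(N - 2s)/2), N the dimension, of the
  energy-preserving dilation.\<close>

lemma eform_dilate:
  fixes u v :: "'a::euclidean_space \<Rightarrow> real"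
  assumes r: "r > 0"
  shows "eform s (\<lambda>x. u (x /\<^sub>R r)) (\<lambda>x. v (x /\<^sub>R r)) = of_real (r powr (real DIM('a) - 2 * s)) * eform s u v"
proof -
  let ?F = "\<lambda>\<xi>. of_real (freq_weight s \<xi>) * ft u \<xi> * cnj (ft v \<xi>)"
  have "eform s u v = of_real (r ^ DIM('a)) * (LINT \<xi>|lborel. ?F (0 + r *\<^sub>R \<xi>))"
    unfolding eform_def using lborel_integral_affine[of r ?F 0] r by (simp add: scaleR_conv_of_real)
  also have "(\<lambda>\<xi>. ?F (0 + r *\<^sub>R \<xi>)) = (\<lambda>\<xi>. of_real (r powr (2 * s)) * (of_real (freq_weight s \<xi>) * ft u (r *\<^sub>R \<xi>) * cnj (ft v (r *\<^sub>R \<xi>))))"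
    using r by (simp add: fun_eq_iff freq_weight_def powr_mult)
  also have "(LINT \<xi>|lborel. of_real (r powr (2 * s)) * (of_real (freq_weight s \<xi>) * ft u (r *\<^sub>R \<xi>) * cnj (ft v (r *\<^sub>R \<xi>))))
    = of_real (r powr (2 * s)) * (LINT \<xi>|lborel. of_real (freq_weight s \<xi>) * ft u (r *\<^sub>R \<xi>) * cnj (ft v (r *\<^sub>R \<xi>)))" (is "_ = _ * ?X")
    by (rule Bochner_Integration.integral_mult_right_zero)
  finally have X: "eform s u v = of_real (r ^ DIM('a) * r powr (2 * s)) * ?X" by (simp add: mult.assoc)
  have "eform s (\<lambda>x. u (x /\<^sub>R r)) (\<lambda>x. v (x /\<^sub>R r)) = (LINT \<xi>|lborel. of_real (r ^ DIM('a) * r ^ DIM('a)) * (of_real (freq_weight s \<xi>) * ft u (r *\<^sub>R \<xi>) * cnj (ft v (r *\<^sub>R \<xi>))))"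
    unfolding eform_def ft_scale[OF r] by (simp add: mult_ac)
  also have "\<dots> = of_real (r ^ DIM('a) * r ^ DIM('a)) * ?X"
    by (rule Bochner_Integration.integral_mult_right_zero)
  also have "r ^ DIM('a) * r ^ DIM('a) = r powr (real DIM('a) - 2 * s) * (r ^ DIM('a) * r powr (2 * s))"
    using r by (simp add: powr_realpow[symmetric] powr_add[symmetric])
  also have "of_real (r powr (real DIM('a) - 2 * s) * (r ^ DIM('a) * r powr (2 * s))) * ?X = of_real (r powr (real DIM('a) - 2 * s)) * eform s u v"
    unfolding X by (simp add: mult.assoc)
  finally show ?thesis .
qed

lemma has_eform_dilate:
  fixes u :: "'a::euclidean_space \<Rightarrow> real"
  assumes u: "has_eform s u" and r: "r > 0"
  shows "has_eform s (\<lambda>x. u (x /\<^sub>R r))"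
proof -
  have 1: "integrable lborel (\<lambda>x. u (0 + inverse r *\<^sub>R x))"
    by (rule lborel_integrable_affine) (use u r in \<open>auto simp: has_eform_def\<close>)
  have 2: "integrable lborel (\<lambda>\<xi>. (r ^ DIM('a))\<^sup>2 * r powr (- (2 * s)) * (freq_weight s (0 + r *\<^sub>R \<xi>) * (cmod (ft u (0 + r *\<^sub>R \<xi>)))\<^sup>2))"
    using u r by (intro Bochner_Integration.integrable_mult_right lborel_integrable_affine) (auto simp: has_eform_def)
  have 3: "(\<lambda>\<xi>. (r ^ DIM('a))\<^sup>2 * r powr (- (2 * s)) * (freq_weight s (0 + r *\<^sub>R \<xi>) * (cmod (ft u (0 + r *\<^sub>R \<xi>)))\<^sup>2)) = (\<lambda>\<xi>. freq_weight s \<xi> * (cmod (ft (\<lambda>x. u (x /\<^sub>R r)) \<xi>))\<^sup>2)"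
    using r by (simp add: fun_eq_iff ft_scale freq_weight_def powr_mult norm_mult norm_power power_mult_distrib powr_minus mult_ac)
  show ?thesis using 1 2[unfolded 3] unfolding has_eform_def by simp
qed

lemma qform_dilate:
  fixes u :: "'a::euclidean_space \<Rightarrow> real"
  assumes r: "r > 0"
  shows "qform s (\<lambda>x. u (x /\<^sub>R r)) = r powr (real DIM('a) - 2 * s) * qform s u"
  using eform_dilate[OF r, of s u u] unfolding eform_self of_real_mult[symmetric] of_real_eq_iff .

text \<open>Low frequencies are controlled by a pointwise bound on the transform, high frequencies by the energy.\<close>
lemma L2_split:
  fixes w :: "'a::euclidean_space \<Rightarrow> real"
  assumes s: "s > 0" and w: "has_eform s w" and b: "\<And>x. \<bar>w x\<bar> \<le> M" and supp: "\<And>x. norm x \<ge> 1 \<Longrightarrow> w x = 0"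
    and ae: "AE x in lborel. isCont w x" and R: "R > 0" and D: "\<And>\<xi>. norm \<xi> < R \<Longrightarrow> cmod (ft w \<xi>) \<le> D"
  shows "heat_mass TYPE('a) * (LINT x|lborel. (w x)\<^sup>2) \<le> D\<^sup>2 * measure lborel (ball (0::'a) R) + R powr (- (2 * s)) * qform s w"
proof -
  have [measurable]: "w \<in> borel_measurable borel" using w unfolding has_eform_def by (auto dest: borel_measurable_integrable)
  let ?h = "\<lambda>\<xi>::'a. D\<^sup>2 * indicator (ball 0 R) \<xi> + R powr (- (2 * s)) * (freq_weight s \<xi> * (cmod (ft w \<xi>))\<^sup>2)"
  have ib: "integrable lborel (\<lambda>\<xi>::'a. indicator (ball 0 R) \<xi> :: real)"
    using emeasure_lborel_ball_finite[of "0::'a" R] by (intro integrable_real_indicator) auto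
  have ih: "integrable lborel ?h" using ib w unfolding has_eform_def by auto
  have le: "(cmod (ft w \<xi>))\<^sup>2 \<le> ?h \<xi>" for \<xi>
  proof (cases "norm \<xi> < R")
    case True
    then have "(cmod (ft w \<xi>))\<^sup>2 \<le> D\<^sup>2" using D by (intro power_mono) auto
    then show ?thesis using True by (simp add: add_increasing2)
  next
    case False
    then have "R powr (2 * s) \<le> freq_weight s \<xi>" unfolding freq_weight_def using R s by (intro powr_mono2) auto
    then have "1 \<le> R powr (- (2 * s)) * freq_weight s \<xi>" using R by (simp add: powr_minus field_simps)
    then have "1 * (cmod (ft w \<xi>))\<^sup>2 \<le> (R powr (- (2 * s)) * freq_weight s \<xi>) * (cmod (ft w \<xi>))\<^sup>2" by (rule mult_right_mono) simp
    then show ?thesis using False by (simp add: mult.assoc)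
  qed
  have i2: "integrable lborel (\<lambda>\<xi>. (cmod (ft w \<xi>))\<^sup>2)"
    by (rule Bochner_Integration.integrable_bound[OF ih]) (use le in \<open>auto intro!: AE_I2 order_trans[OF _ abs_ge_self]\<close>)
  have "heat_mass TYPE('a) * (LINT x|lborel. (w x)\<^sup>2) \<le> (LINT \<xi>|lborel. (cmod (ft w \<xi>))\<^sup>2)"
    by (rule plancherel_inequality[OF _ b supp ae i2]) auto
  also have "\<dots> \<le> (LINT \<xi>|lborel. ?h \<xi>)" by (rule integral_mono[OF i2 ih le])
  also have "\<dots> = D\<^sup>2 * measure lborel (ball (0::'a) R) + R powr (- (2 * s)) * qform s w"
    using ib w unfolding has_eform_def qform_def by simp
  finally show ?thesis .
qed

text \<open>The transform is bounded by the L1 norm, which the Cauchy-Schwarz inequality on the ball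
  bounds by the L2 norm. Over a small ball of frequencies this contribution is absorbed into the
  left-hand side of \<open>L2_split\<close>, and only the energy remains.\<close>

lemma poincare:
  assumes s: "s > 0"
  shows "\<exists>C\<ge>0. \<forall>w::'a::euclidean_space \<Rightarrow> real. has_eform s w \<longrightarrow> (\<exists>M. \<forall>x. \<bar>w x\<bar> \<le> M) \<longrightarrow> (\<forall>x. norm x \<ge> 1 \<longrightarrow> w x = 0) \<longrightarrow>
     (AE x in lborel. isCont w x) \<longrightarrow> (LINT x|lborel. \<bar>w x\<bar>)\<^sup>2 \<le> C * qform s w"
proof -
  define A where "A = heat_mass TYPE('a)"
  have A: "A > 0" unfolding A_def by (rule heat_mass_pos)
  define V where "V = measure lborel (ball (0::'a) 1)"
  have V: "V \<ge> 0" by (simp add: V_def)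
  define N where "N = real DIM('a)"
  \<comment> \<open>One factor \<open>V\<close> is the scaled volume of the frequency ball, the
    other comes from Cauchy-Schwarz on the unit ball; their product with the power of \<epsilon>
    must drop below \<open>A / 2\<close> for the absorption.\<close>
  have lim: "((\<lambda>\<epsilon>. \<epsilon> ^ DIM('a) * V * V) \<longlongrightarrow> 0 ^ DIM('a) * V * V) (at_right 0)"
    by (intro tendsto_intros)
  then have "eventually (\<lambda>\<epsilon>. \<epsilon> ^ DIM('a) * V * V < A / 2) (at_right 0)"
    using A by (intro order_tendstoD(2)) (auto simp: zero_power[OF DIM_positive])
  then have "eventually (\<lambda>\<epsilon>. \<epsilon> > 0 \<and> \<epsilon> ^ DIM('a) * V * V < A / 2) (at_right 0)"
    using eventually_at_right_less[of 0] by eventually_elim auto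
  then have "\<exists>\<epsilon>. \<epsilon> > 0 \<and> \<epsilon> ^ DIM('a) * V * V < A / 2"
    by (rule eventually_happens'[OF trivial_limit_at_right_real])
  then obtain \<epsilon> where eps: "\<epsilon> > 0" "\<epsilon> ^ DIM('a) * V * V < A / 2" by blast
  have ballV: "measure lborel (ball (0::'a) \<epsilon>) = \<epsilon> ^ DIM('a) * V"
    unfolding V_def using eps by (simp add: content_ball)
  define C where "C = V * (2 / A * \<epsilon> powr (- (2 * s)))"
  have C: "C \<ge> 0" using V A by (simp add: C_def)
  have "(LINT x|lborel. \<bar>w x\<bar>)\<^sup>2 \<le> C * qform s w"
    if w: "has_eform s w" and M: "\<exists>M. \<forall>x. \<bar>w x\<bar> \<le> M" and supp: "\<forall>x. norm x \<ge> 1 \<longrightarrow> w x = 0" and ae: "AE x in lborel. isCont w x" for w :: "'a \<Rightarrow> real"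
  proof -
    obtain M where M: "\<And>x. \<bar>w x\<bar> \<le> M" using M by blast
    have iw: "integrable lborel w" using w by (simp add: has_eform_def)
    have [measurable]: "w \<in> borel_measurable borel" using iw by auto
    have M0: "M \<ge> 0" using M[of 0] by linarith
    have w2: "(w x)\<^sup>2 \<le> M\<^sup>2" for x using power_mono[OF M, of x 2] by simp
    have iw2: "integrable lborel (\<lambda>x. (w x)\<^sup>2)"
      by (rule integrable_bounded_in_ball[where M="M\<^sup>2" and R=1]) (use w2 supp in auto)
    define X where "X = (LINT x|lborel. (w x)\<^sup>2)"
    define L where "L = (LINT x|lborel. \<bar>w x\<bar>)"
    have L2: "L\<^sup>2 \<le> X * V"
    proof -
      have e: "\<bar>w x\<bar> * \<bar>indicator (ball 0 1) x\<bar> = \<bar>w x\<bar>" for x using supp by (auto simp: indicator_def)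
      have ip: "(indicator (ball 0 1) x :: real)\<^sup>2 = indicator (ball 0 1) x" for x :: 'a by (simp add: indicator_def)
      have ib: "integrable lborel (\<lambda>x::'a. (indicator (ball 0 1) x :: real)\<^sup>2)"
        unfolding ip using emeasure_lborel_ball_finite[of "0::'a" 1] by (intro integrable_real_indicator) auto
      have "(LINT x|lborel. \<bar>w x\<bar> * \<bar>indicator (ball 0 1) x\<bar>)\<^sup>2 \<le> (LINT x|lborel. (w x)\<^sup>2) * (LINT x|lborel. (indicator (ball (0::'a) 1) x :: real)\<^sup>2)"
        by (rule integral_Cauchy_Schwarz[OF iw2 ib], unfold e) (use iw in simp)
      then show ?thesis unfolding e ip L_def X_def V_def by simp
    qed
    have "A * X \<le> L\<^sup>2 * measure lborel (ball (0::'a) \<epsilon>) + \<epsilon> powr (- (2 * s)) * qform s w"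
      unfolding A_def X_def L_def
      by (rule L2_split[OF s w M _ ae eps(1)]) (use supp ft_bound[OF iw] in auto)
    also have "L\<^sup>2 * measure lborel (ball (0::'a) \<epsilon>) \<le> (X * V) * (\<epsilon> ^ DIM('a) * V)"
      unfolding ballV using eps V by (intro mult_right_mono L2) auto
    also have "(X * V) * (\<epsilon> ^ DIM('a) * V) = X * (\<epsilon> ^ DIM('a) * V * V)" by (simp add: mult_ac)
    also have "\<dots> \<le> X * (A / 2)" using eps(2) unfolding X_def by (intro mult_left_mono) auto
    finally have "X * (A / 2) \<le> \<epsilon> powr (- (2 * s)) * qform s w" by (simp add: algebra_simps)
    then have "X \<le> 2 / A * \<epsilon> powr (- (2 * s)) * qform s w" using A by (simp add: field_simps)
    then have "X * V \<le> (2 / A * \<epsilon> powr (- (2 * s)) * qform s w) * V" by (rule mult_right_mono[OF _ V])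
    then show ?thesis using L2 unfolding L_def[symmetric] C_def by (simp add: mult_ac)
  qed
  then show ?thesis using C by blast
qed

section \<open>Passage from the unitary energy space to \<open>eform\<close> and
  \<open>qform\<close>\<close>

definition fourier_const :: "'n::finite itself \<Rightarrow> real" where
  "fourier_const _ = (2 * pi) powr (- real CARD('n) / 2)"

lemma fourier_const_pos: "fourier_const TYPE('n::finite) > 0"
  by (simp add: fourier_const_def)

lemma fourier_ft: "fourier u \<xi> = of_real (fourier_const TYPE('n)) * ft u (\<xi> :: real^'n)"
  by (simp add: fourier_def ft_def fourier_const_def)

text \<open>The unitary prefactor occurs once in each transform, so energies differ by its square;
  this square is the constant \<open>k\<close> in the weak equation of the nonexistence
  argument.\<close>

lemma energy_eform: "energy s u v = of_real ((fourier_const TYPE('n))\<^sup>2) * eform s u (v :: real^'n \<Rightarrow> real)"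
  unfolding energy_def eform_def Bochner_Integration.integral_mult_right_zero[symmetric] fourier_ft freq_weight_def
  by (simp add: power2_eq_square mult_ac)

lemma energy_norm_qform: "energy_norm s u = fourier_const TYPE('n) * sqrt (qform s (u :: real^'n \<Rightarrow> real))"
proof -
  have "Re (energy s u u) = (fourier_const TYPE('n))\<^sup>2 * qform s u"
    unfolding energy_eform eform_self of_real_mult[symmetric] by (rule Re_complex_of_real)
  then show ?thesis
    unfolding energy_norm_def using fourier_const_pos[where 'n='n] by (simp add: real_sqrt_mult)
qed

lemma finite_energy_iff:
  fixes u :: "real^'n \<Rightarrow> real"
  shows "u \<in> finite_energy s \<longleftrightarrow> u \<in> borel_measurable borel \<and> (AE x in lborel. x \<notin> ball 0 1 \<longrightarrow> u x = 0) \<and>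
     integrable lborel (\<lambda>x. (u x)\<^sup>2) \<and> has_eform s u"
proof -
  have "(\<lambda>\<xi>. norm \<xi> powr (2 * s) * (cmod (fourier u \<xi>))\<^sup>2) = (\<lambda>\<xi>. (fourier_const TYPE('n))\<^sup>2 * (freq_weight s \<xi> * (cmod (ft u \<xi>))\<^sup>2))"
    by (simp add: fun_eq_iff fourier_ft norm_mult power_mult_distrib freq_weight_def mult_ac)
  then have 1: "integrable lborel (\<lambda>\<xi>. norm \<xi> powr (2 * s) * (cmod (fourier u \<xi>))\<^sup>2) \<longleftrightarrow> integrable lborel (\<lambda>\<xi>. freq_weight s \<xi> * (cmod (ft u \<xi>))\<^sup>2)"
    using fourier_const_pos[where 'n='n] by simp
  \<comment> \<open>\<open>finite_energy\<close> asks for square integrability; on the ball, of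
    finite measure, the bound of \<open>\<bar>u\<bar>\<close> by \<open>u\<^sup>2 + 1\<close> yields
    the integrability on which \<open>ft\<close> relies.\<close>
  have 2: "integrable lborel u" if [measurable]: "u \<in> borel_measurable borel" and ae: "AE x in lborel. x \<notin> ball 0 1 \<longrightarrow> u x = 0"
    and sq: "integrable lborel (\<lambda>x. (u x)\<^sup>2)"
  proof -
    have "integrable lborel (\<lambda>x::real^'n. (u x)\<^sup>2 + indicator (ball 0 1) x)"
      using sq emeasure_lborel_ball_finite[of "0::real^'n" 1] by (intro Bochner_Integration.integrable_add integrable_real_indicator) auto
    then show ?thesis
    proof (rule Bochner_Integration.integrable_bound)
      show "AE x in lborel. norm (u x) \<le> norm ((u x)\<^sup>2 + indicator (ball 0 1) x)"
        using ae
      proof (rule eventually_mono)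
        fix x :: "real^'n" assume x: "x \<notin> ball 0 1 \<longrightarrow> u x = 0"
        have "\<bar>u x\<bar> \<le> (u x)\<^sup>2 + 1"
          using sum_squares_bound[of "\<bar>u x\<bar>" 1] by (simp add: power2_eq_square)
        then show "norm (u x) \<le> norm ((u x)\<^sup>2 + indicator (ball 0 1) x)"
          using x by (cases "x \<in> ball 0 1") auto
      qed
    qed simp
  qed
  have b: "u \<in> borel_measurable lborel \<longleftrightarrow> u \<in> borel_measurable borel" by simp
  show ?thesis unfolding finite_energy_def mem_Collect_eq 1 has_eform_def b using 2 by blast
qed

lemma finite_energy_has_eform: "u \<in> finite_energy s \<Longrightarrow> has_eform s u"
  by (simp add: finite_energy_iff)

lemma energy_norm_tendsto_iff:
  fixes g :: "nat \<Rightarrow> real^'n \<Rightarrow> real"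
  shows "(\<lambda>n. energy_norm s (g n)) \<longlonglongrightarrow> 0 \<longleftrightarrow> (\<lambda>n. qform s (g n)) \<longlonglongrightarrow> 0"
proof
  assume "(\<lambda>n. energy_norm s (g n)) \<longlonglongrightarrow> 0"
  then have "(\<lambda>n. (energy_norm s (g n) / fourier_const TYPE('n))\<^sup>2) \<longlonglongrightarrow> (0 / fourier_const TYPE('n))\<^sup>2"
    using fourier_const_pos[where 'n='n] by (intro tendsto_intros) auto
  then show "(\<lambda>n. qform s (g n)) \<longlonglongrightarrow> 0"
    using fourier_const_pos[where 'n='n] by (simp add: energy_norm_qform)
next
  assume "(\<lambda>n. qform s (g n)) \<longlonglongrightarrow> 0"
  then have "(\<lambda>n. fourier_const TYPE('n) * sqrt (qform s (g n))) \<longlonglongrightarrow> fourier_const TYPE('n) * sqrt 0"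
    by (intro tendsto_intros)
  then show "(\<lambda>n. energy_norm s (g n)) \<longlonglongrightarrow> 0" by (simp add: energy_norm_qform)
qed

lemma D0_iff:
  fixes u :: "real^'n \<Rightarrow> real"
  shows "u \<in> D0 s \<longleftrightarrow> u \<in> finite_energy s \<and> (\<exists>\<phi>. (\<forall>n::nat. \<exists>R<1. \<phi> n \<in> bumps R) \<and> (\<lambda>n. qform s (\<lambda>x. \<phi> n x - u x)) \<longlonglongrightarrow> 0)"
proof -
  have "(\<exists>R<1. f \<in> bumps R) \<longleftrightarrow> f \<in> test_functions (ball 0 1)" for f :: "real^'n \<Rightarrow> real"
    using test_functions_iff_bumps bumps_imp_test_function by blast
  then show ?thesis unfolding D0_def by (simp add: energy_norm_tendsto_iff)
qed

lemma bumps_finite_energy: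
  fixes f :: "real^'n \<Rightarrow> real"
  assumes f: "f \<in> bumps R" "R < 1" and N: "2 \<le> CARD('n)" and s: "s > 0"
  shows "f \<in> finite_energy s"
proof -
  have [measurable]: "f \<in> borel_measurable borel" using f smooth_measurable by (auto simp: bumps_def)
  have i: "integrable lborel f" by (rule bumps_integrable[OF f(1)])
  obtain M where M: "\<And>x. \<bar>f x\<bar> \<le> M" using bumps_bounded[OF f(1)] by blast
  have out: "norm x \<ge> 1 \<Longrightarrow> f x = 0" for x using f by (auto simp: bumps_def)
  have "(f x)\<^sup>2 \<le> M\<^sup>2" for x using power_mono[OF M, of x 2] by simp
  then have 2: "integrable lborel (\<lambda>x. (f x)\<^sup>2)"
    by (intro integrable_bounded_in_ball[where M="M\<^sup>2" and R=1]) (auto simp: out)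
  define D where "D = (LINT x|lborel. \<bar>f x\<bar>)"
  have "integrable lborel (\<lambda>\<xi>. norm \<xi> powr (2 * s) * cmod (ft f \<xi>))"
    using bumps_rapid[OF f(1) N] s unfolding rapid_def by auto
  then have "integrable lborel (\<lambda>\<xi>. D * (norm \<xi> powr (2 * s) * cmod (ft f \<xi>)))" by simp
  then have "integrable lborel (\<lambda>\<xi>. freq_weight s \<xi> * (cmod (ft f \<xi>))\<^sup>2)"
  proof (rule Bochner_Integration.integrable_bound)
    show "AE \<xi> in lborel. norm (freq_weight s \<xi> * (cmod (ft f \<xi>))\<^sup>2) \<le> norm (D * (norm \<xi> powr (2 * s) * cmod (ft f \<xi>)))"
    proof (rule AE_I2)
      fix \<xi>
      have "cmod (ft f \<xi>) * (norm \<xi> powr (2 * s) * cmod (ft f \<xi>)) \<le> D * (norm \<xi> powr (2 * s) * cmod (ft f \<xi>))"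
        unfolding D_def by (rule mult_right_mono[OF ft_bound[OF i]]) simp
      then have "freq_weight s \<xi> * (cmod (ft f \<xi>))\<^sup>2 \<le> D * (norm \<xi> powr (2 * s) * cmod (ft f \<xi>))"
        by (simp add: freq_weight_def power2_eq_square mult_ac)
      then show "norm (freq_weight s \<xi> * (cmod (ft f \<xi>))\<^sup>2) \<le> norm (D * (norm \<xi> powr (2 * s) * cmod (ft f \<xi>)))"
        by (rule real_norm_le_norm[rotated]) simp
    qed
  qed measurable
  then show ?thesis using 2 i out by (simp add: finite_energy_iff has_eform_def)
qed

lemma finite_energy_dilate:
  fixes u :: "real^'n \<Rightarrow> real"
  assumes u: "u \<in> finite_energy s" and r: "0 < r" "r \<le> 1"
  shows "(\<lambda>x. u (x /\<^sub>R r)) \<in> finite_energy s"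
proof -
  have [measurable]: "u \<in> borel_measurable borel" and ae: "AE x in lborel. x \<notin> ball 0 1 \<longrightarrow> u x = 0"
    and sq: "integrable lborel (\<lambda>x. (u x)\<^sup>2)" and f: "has_eform s u" using u by (auto simp: finite_energy_iff)
  have "AE x in lborel. 0 + inverse r *\<^sub>R x \<notin> ball 0 1 \<longrightarrow> u (0 + inverse r *\<^sub>R x) = 0"
    by (rule AE_lborel_affine[OF _ ae]) (use r in auto)
  then have "AE x in lborel. x \<notin> ball 0 1 \<longrightarrow> u (x /\<^sub>R r) = 0"
  proof (rule eventually_mono)
    fix x :: "real^'n" assume h: "0 + inverse r *\<^sub>R x \<notin> ball 0 1 \<longrightarrow> u (0 + inverse r *\<^sub>R x) = 0"
    have "1 \<le> norm (inverse r *\<^sub>R x)" if "1 \<le> norm x" using that r by (simp add: field_simps)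
    then show "x \<notin> ball 0 1 \<longrightarrow> u (x /\<^sub>R r) = 0" using h by auto
  qed
  moreover have "integrable lborel (\<lambda>x. (u (x /\<^sub>R r))\<^sup>2)"
    using lborel_integrable_affine[OF sq, of "inverse r" 0] r by simp
  ultimately show ?thesis using has_eform_dilate[OF f r(1)] by (simp add: finite_energy_iff)
qed

lemma D0_dilate:
  fixes u :: "real^'n \<Rightarrow> real"
  assumes u: "u \<in> D0 s" and r: "0 < r" "r \<le> 1"
  shows "(\<lambda>x. u (x /\<^sub>R r)) \<in> D0 s"
proof -
  obtain \<phi> where phi: "\<And>n. \<exists>R<1. \<phi> n \<in> bumps R" and lim: "(\<lambda>n::nat. qform s (\<lambda>x. \<phi> n x - u x)) \<longlonglongrightarrow> 0"
    using u unfolding D0_iff by blast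
  have "\<exists>R<1. (\<lambda>x. \<phi> n (x /\<^sub>R r)) \<in> bumps R" for n
  proof -
    obtain R where R: "R < 1" "\<phi> n \<in> bumps R" using phi by blast
    \<comment> \<open>\<open>R\<close> may be negative, so this is not plain monotonicity of the
      product.\<close>
    have "r * R < 1" using r R by (smt (verit) mult_less_cancel_left2 mult_nonneg_nonpos zero_less_mult_iff)
    then show ?thesis using bumps_dilate[OF R(2) r(1)] by blast
  qed
  moreover have "(\<lambda>n. qform s (\<lambda>x. \<phi> n (x /\<^sub>R r) - u (x /\<^sub>R r))) \<longlonglongrightarrow> 0"
  proof -
    have "(\<lambda>n. r powr (real DIM(real^'n) - 2 * s) * qform s (\<lambda>x. \<phi> n x - u x)) \<longlonglongrightarrow> r powr (real DIM(real^'n) - 2 * s) * 0"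
      by (intro tendsto_mult tendsto_const lim)
    then show ?thesis using qform_dilate[OF r(1), of s "\<lambda>x. \<phi> n x - u x" for n] by simp
  qed
  moreover have "(\<lambda>x. u (x /\<^sub>R r)) \<in> finite_energy s"
    by (rule finite_energy_dilate) (use u r in \<open>auto simp: D0_iff\<close>)
  ultimately show ?thesis unfolding D0_iff by (intro conjI exI[of _ "\<lambda>n x. \<phi> n (x /\<^sub>R r)"]) auto
qed

section \<open>Convergence in energy and the ball profile as an element of \<open>D0\<close>\<close>

text \<open>
  Pointwise convergence of the transforms together with convergence of the dominating energies
  gives convergence in energy (the argument behind Scheffe's lemma).
\<close>
lemma qform_tendsto:
  fixes G :: "'a::euclidean_space \<Rightarrow> real" and g :: "nat \<Rightarrow> 'a \<Rightarrow> real"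
  assumes G: "has_eform s G" and g: "\<And>n. has_eform s (g n)" and G0: "AE x in lborel. norm x \<ge> 1 \<longrightarrow> G x = 0"
    and ft: "\<And>n \<xi>. ft (g n) \<xi> = of_real (a n) * ft G (r n *\<^sub>R \<xi>) * m n \<xi>"
    and a: "a \<longlonglongrightarrow> 1" and r: "r \<longlonglongrightarrow> 1" "\<And>n. r n > 0" and m: "\<And>n \<xi>. cmod (m n \<xi>) \<le> 1" "\<And>\<xi>. (\<lambda>n. m n \<xi>) \<longlonglongrightarrow> 1"
  shows "(\<lambda>n. qform s (\<lambda>x. g n x - G x)) \<longlonglongrightarrow> 0"
proof -
  have iG: "integrable lborel G" using G by (simp add: has_eform_def)
  have ig: "integrable lborel (g n)" for n using g by (simp add: has_eform_def)
  have [measurable]: "G \<in> borel_measurable borel" using iG by auto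
  define P where "P n \<xi> = freq_weight s \<xi> * (a n * cmod (ft G (r n *\<^sub>R \<xi>)))\<^sup>2" for n \<xi>
  define q where "q \<xi> = freq_weight s \<xi> * (cmod (ft G \<xi>))\<^sup>2" for \<xi>
  define d where "d n \<xi> = freq_weight s \<xi> * (cmod (ft (\<lambda>x. g n x - G x) \<xi>))\<^sup>2" for n \<xi>
  have iq: "integrable lborel q" using G unfolding has_eform_def q_def[abs_def] by blast
  have id: "integrable lborel (d n)" for n
    using has_eform_diff[OF g[of n] G] unfolding has_eform_def d_def[abs_def] by blast
  have Pq: "P n = (\<lambda>\<xi>. (a n)\<^sup>2 * r n powr (- (2 * s)) * q (0 + r n *\<^sub>R \<xi>))" for n
    using r(2)[of n] by (simp add: P_def q_def fun_eq_iff freq_weight_def powr_mult power_mult_distrib powr_minus mult_ac)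
  have iP: "integrable lborel (P n)" for n
    unfolding Pq using lborel_integrable_affine[OF iq, of "r n" 0] r(2)[of n] by simp
  have IP: "(LINT \<xi>|lborel. P n \<xi>) = (a n)\<^sup>2 * r n powr (- (2 * s) - DIM('a)) * qform s G" for n
  proof -
    have "qform s G = r n ^ DIM('a) * (LINT \<xi>|lborel. q (0 + r n *\<^sub>R \<xi>))"
      unfolding qform_def q_def[symmetric] using lborel_integral_affine[of "r n" q 0] r(2)[of n] by simp
    moreover have "(LINT \<xi>|lborel. P n \<xi>) = (a n)\<^sup>2 * r n powr (- (2 * s)) * (LINT \<xi>|lborel. q (0 + r n *\<^sub>R \<xi>))"
      unfolding Pq by (rule Bochner_Integration.integral_mult_right_zero)
    moreover have "r n powr (- (2 * s) - DIM('a)) * r n ^ DIM('a) = r n powr (- (2 * s))"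
      using r(2)[of n] by (simp add: powr_realpow[symmetric] powr_add[symmetric])
    ultimately show ?thesis by (metis mult.assoc)
  qed
  have contG: "(\<lambda>n. ft G (r n *\<^sub>R \<xi>)) \<longlonglongrightarrow> ft G \<xi>" for \<xi>
  proof (rule Lim_null[THEN iffD2], rule tendsto_0_le[where K="(LINT x|lborel. \<bar>G x\<bar>)"])
    have "(\<lambda>n. r n *\<^sub>R \<xi> - \<xi>) \<longlonglongrightarrow> 1 *\<^sub>R \<xi> - \<xi>" by (intro tendsto_intros r)
    then show "(\<lambda>n. r n *\<^sub>R \<xi> - \<xi>) \<longlonglongrightarrow> 0" by simp
    show "eventually (\<lambda>n. norm (ft G (r n *\<^sub>R \<xi>) - ft G \<xi>) \<le> norm (r n *\<^sub>R \<xi> - \<xi>) * (LINT x|lborel. \<bar>G x\<bar>)) sequentially"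
      using ft_lipschitz[OF iG G0] by (intro always_eventually allI) (simp add: mult.commute[of "norm _"])
  qed
  have Plim: "(\<lambda>n. P n \<xi>) \<longlonglongrightarrow> q \<xi>" for \<xi>
  proof -
    have "(\<lambda>n. P n \<xi>) \<longlonglongrightarrow> freq_weight s \<xi> * (1 * cmod (ft G \<xi>))\<^sup>2"
      unfolding P_def by (intro tendsto_intros a contG)
    then show ?thesis by (simp add: q_def)
  qed
  have dlim: "(\<lambda>n. d n \<xi>) \<longlonglongrightarrow> 0" for \<xi>
  proof -
    have "(\<lambda>n. d n \<xi>) \<longlonglongrightarrow> freq_weight s \<xi> * (cmod (of_real 1 * ft G \<xi> * 1 - ft G \<xi>))\<^sup>2"
      unfolding d_def ft_diff[OF ig iG] ft by (intro tendsto_intros a contG m(2))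
    then show ?thesis by simp
  qed
  have dle: "d n \<xi> \<le> 2 * P n \<xi> + 2 * q \<xi>" for n \<xi>
  proof -
    have "cmod (ft (g n) \<xi>) \<le> \<bar>a n\<bar> * cmod (ft G (r n *\<^sub>R \<xi>))"
      unfolding ft norm_mult norm_of_real using mult_left_mono[OF m(1), of "\<bar>a n\<bar> * cmod (ft G (r n *\<^sub>R \<xi>))" n \<xi>] by simp
    then have le1: "(cmod (ft (g n) \<xi>))\<^sup>2 \<le> (a n * cmod (ft G (r n *\<^sub>R \<xi>)))\<^sup>2"
      using power_mono[of "cmod (ft (g n) \<xi>)" "\<bar>a n\<bar> * cmod (ft G (r n *\<^sub>R \<xi>))" 2] by (simp add: power_mult_distrib)
    have "(cmod (ft (g n) \<xi> - ft G \<xi>))\<^sup>2 \<le> (cmod (ft (g n) \<xi>) + cmod (ft G \<xi>))\<^sup>2"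
      by (intro power_mono norm_triangle_ineq4) simp
    also have "\<dots> \<le> 2 * (cmod (ft (g n) \<xi>))\<^sup>2 + 2 * (cmod (ft G \<xi>))\<^sup>2"
      using sum_squares_bound[of "cmod (ft (g n) \<xi>)" "cmod (ft G \<xi>)"] by (simp add: power2_sum)
    also have "\<dots> \<le> 2 * (a n * cmod (ft G (r n *\<^sub>R \<xi>)))\<^sup>2 + 2 * (cmod (ft G \<xi>))\<^sup>2" using le1 by simp
    finally have "freq_weight s \<xi> * (cmod (ft (g n) \<xi> - ft G \<xi>))\<^sup>2 \<le> freq_weight s \<xi> * (2 * (a n * cmod (ft G (r n *\<^sub>R \<xi>)))\<^sup>2 + 2 * (cmod (ft G \<xi>))\<^sup>2)"
      by (rule mult_left_mono) simp
    then show ?thesis unfolding d_def P_def q_def ft_diff[OF ig iG] by (simp add: distrib_left mult_ac)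
  qed
  have d0: "d n \<xi> \<ge> 0" for n \<xi> by (simp add: d_def)
  \<comment> \<open>\<open>F n\<close> is nonnegative by \<open>dle\<close> and tends pointwise to
    \<open>4 * q\<close>. Its L1 convergence, combined with the convergence of the integrals of
    \<open>P n\<close>, leaves the integrals of \<open>d n\<close> no limit but 0.\<close>
  define F where "F n \<xi> = 2 * P n \<xi> + 2 * q \<xi> - d n \<xi>" for n \<xi>
  have F0: "F n \<xi> \<ge> 0" for n \<xi> using dle[of n \<xi>] by (simp add: F_def)
  have iF: "integrable lborel (F n)" for n unfolding F_def[abs_def] using iP[of n] iq id[of n] by simp
  have IF: "(LINT \<xi>|lborel. F n \<xi>) = 2 * (LINT \<xi>|lborel. P n \<xi>) + 2 * qform s G - qform s (\<lambda>x. g n x - G x)" for n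
    unfolding F_def using iP[of n] iq id[of n] by (simp add: qform_def q_def[symmetric] d_def[symmetric])
  have i4: "integrable lborel (\<lambda>\<xi>. 4 * q \<xi>)" using iq by simp
  have PQ: "(\<lambda>n. LINT \<xi>|lborel. P n \<xi>) \<longlonglongrightarrow> qform s G"
  proof -
    have "(\<lambda>n. LINT \<xi>|lborel. P n \<xi>) \<longlonglongrightarrow> 1\<^sup>2 * 1 powr (- (2 * s) - DIM('a)) * qform s G"
      unfolding IP by (intro tendsto_intros a r) simp
    then show ?thesis by simp
  qed
  have q0: "q \<xi> \<ge> 0" for \<xi> by (simp add: q_def)
  have "(\<lambda>n. \<integral>\<^sup>+\<xi>. ennreal (norm (F n \<xi> - 4 * q \<xi>)) \<partial>lborel) \<longlonglongrightarrow> 0"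
  proof (rule Scheffe_lemma1[OF iF i4])
    show "AE \<xi> in lborel. (\<lambda>n. F n \<xi>) \<longlonglongrightarrow> 4 * q \<xi>"
    proof (rule AE_I2)
      fix \<xi> have "(\<lambda>n. F n \<xi>) \<longlonglongrightarrow> 2 * q \<xi> + 2 * q \<xi> - 0" unfolding F_def by (intro tendsto_intros Plim dlim)
      then show "(\<lambda>n. F n \<xi>) \<longlonglongrightarrow> 4 * q \<xi>" by simp
    qed
    have "(\<integral>\<^sup>+\<xi>. ennreal (norm (F n \<xi>)) \<partial>lborel) \<le> ennreal (2 * (LINT \<xi>|lborel. P n \<xi>) + 2 * qform s G)" for n
    proof -
      have "(\<integral>\<^sup>+\<xi>. ennreal (norm (F n \<xi>)) \<partial>lborel) = ennreal (LINT \<xi>|lborel. F n \<xi>)"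
        using nn_integral_eq_integral[OF iF[of n]] F0 by simp
      also have "\<dots> \<le> ennreal (2 * (LINT \<xi>|lborel. P n \<xi>) + 2 * qform s G)" unfolding IF by (intro ennreal_leI) simp
      finally show ?thesis .
    qed
    then have "limsup (\<lambda>n. \<integral>\<^sup>+\<xi>. ennreal (norm (F n \<xi>)) \<partial>lborel) \<le> limsup (\<lambda>n. ennreal (2 * (LINT \<xi>|lborel. P n \<xi>) + 2 * qform s G))"
      by (intro Limsup_mono always_eventually) auto
    also have "\<dots> = ennreal (2 * qform s G + 2 * qform s G)"
      by (intro lim_imp_Limsup tendsto_ennrealI tendsto_intros PQ) simp
    also have "\<dots> = (\<integral>\<^sup>+\<xi>. ennreal (norm (4 * q \<xi>)) \<partial>lborel)"
      using nn_integral_eq_integral[OF i4] q0 by (simp add: qform_def q_def[symmetric])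
    finally show "limsup (\<lambda>n. \<integral>\<^sup>+\<xi>. ennreal (norm (F n \<xi>)) \<partial>lborel) \<le> (\<integral>\<^sup>+\<xi>. ennreal (norm (4 * q \<xi>)) \<partial>lborel)" .
  qed
  then have "(\<lambda>n. LINT \<xi>|lborel. F n \<xi>) \<longlonglongrightarrow> (LINT \<xi>|lborel. 4 * q \<xi>)"
    by (intro tendsto_L1_int[OF iF i4]) simp
  then have FL: "(\<lambda>n. LINT \<xi>|lborel. F n \<xi>) \<longlonglongrightarrow> 4 * qform s G" by (simp add: qform_def q_def[symmetric])
  have "(\<lambda>n. 2 * (LINT \<xi>|lborel. P n \<xi>) + 2 * qform s G - (LINT \<xi>|lborel. F n \<xi>)) \<longlonglongrightarrow> 2 * qform s G + 2 * qform s G - 4 * qform s G"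
    by (intro tendsto_intros PQ FL)
  then show ?thesis by (simp add: IF)
qed

lemma has_eform_ballpow_1:
  assumes s: "0 < s" and N: "2 \<le> DIM('a::euclidean_space)"
  shows "has_eform s (ballpow s 1 :: 'a \<Rightarrow> real)"
  using finite_energy_ballpow[OF s N] ballpow_integrable[of s, OF _ N] s by (simp add: has_eform_def freq_weight_def)

lemma ballpow_scale:
  assumes r: "r > 0"
  shows "ballpow s r x = r powr (2 * s) * ballpow s 1 (x /\<^sub>R r)"
proof -
  have "r\<^sup>2 - (norm x)\<^sup>2 = r\<^sup>2 * (1\<^sup>2 - (norm (x /\<^sub>R r))\<^sup>2)"
    using r by (simp add: field_simps power_mult_distrib)
  then have "max 0 (r\<^sup>2 - (norm x)\<^sup>2) = r\<^sup>2 * max 0 (1\<^sup>2 - (norm (x /\<^sub>R r))\<^sup>2)"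
    using r by (metis max_mult_distrib_left mult_zero_right zero_le_power2)
  moreover have "(r\<^sup>2) powr s = r powr (2 * s)" using r by (simp add: powr_powr flip: powr_numeral)
  ultimately show ?thesis using r by (simp add: ballpow_def powr_mult)
qed

lemma ballpow_le_1: "s \<ge> 0 \<Longrightarrow> ballpow s 1 x \<le> 1"
  using powr_mono2[of s "max 0 (1 - (norm x)\<^sup>2)" 1] by (simp add: ballpow_def)

lemma ballpow_finite_energy:
  assumes s: "0 < s" and N: "2 \<le> CARD('n::finite)"
  shows "(ballpow s 1 :: real^'n \<Rightarrow> real) \<in> finite_energy s"
proof -
  have "has_eform s (ballpow s 1 :: real^'n \<Rightarrow> real)" by (rule has_eform_ballpow_1[OF s]) (use N in simp)
  moreover have "integrable lborel (\<lambda>x::real^'n. (ballpow s 1 x)\<^sup>2)"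
    by (rule integrable_bounded_in_ball[where M=1 and R=1])
      (use s in \<open>auto simp: ballpow_outside intro!: power_le_one ballpow_le_1\<close>)
  ultimately show ?thesis by (auto simp: finite_energy_iff ballpow_outside)
qed

lemma ft_ballpow_scale:
  fixes \<xi> :: "'a::euclidean_space"
  assumes r: "r > 0"
  shows "ft (ballpow s r) \<xi> = of_real (r powr (2 * s) * r ^ DIM('a)) * ft (ballpow s 1) (r *\<^sub>R \<xi>)"
proof -
  have "ballpow s r = (\<lambda>x::'a. r powr (2 * s) * ballpow s 1 (x /\<^sub>R r))"
    by (rule ext) (rule ballpow_scale[OF r])
  then have "ft (ballpow s r) \<xi> = ft (\<lambda>x. r powr (2 * s) * ballpow s 1 (x /\<^sub>R r)) \<xi>" by simp
  then show ?thesis unfolding ft_cmult ft_scale[OF r] by simp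
qed

lemma has_eform_ballpow:
  fixes r :: real
  assumes s: "0 < s" and r: "r > 0" and N: "2 \<le> DIM('a::euclidean_space)"
  shows "has_eform s (ballpow s r :: 'a \<Rightarrow> real)"
proof -
  have "ballpow s r = (\<lambda>x::'a. r powr (2 * s) * ballpow s 1 (x /\<^sub>R r))"
    by (rule ext) (rule ballpow_scale[OF r])
  then show ?thesis using has_eform_cmult[OF has_eform_dilate[OF has_eform_ballpow_1[OF s N] r]] by simp
qed

lemma bumps_cmult: "f \<in> bumps R \<Longrightarrow> (\<lambda>x. c * f x) \<in> bumps R"
  using smooth_cmult_scale[of f c 1] by (auto simp: bumps_def)

text \<open>
  The approximants are mollifications of dilates of the profile, whose transforms are \<open>ft (ballpow s 1)\<close> rescaled
  and multiplied by factors of modulus at most 1.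
\<close>
lemma ballpow_D0:
  assumes s: "0 < s" and N: "2 \<le> CARD('n::finite)"
  shows "(ballpow s 1 :: real^'n \<Rightarrow> real) \<in> D0 s"
proof -
  have N': "2 \<le> DIM(real^'n)" using N by simp
  obtain \<Phi> :: "real^'n \<Rightarrow> real" where P: "\<Phi> \<in> bumps 1" "\<And>x. \<Phi> x \<ge> 0" "(LINT x|lborel. \<Phi> x) = 1"
    using mollifier_exists by blast
  have iP: "integrable lborel \<Phi>" by (rule bumps_integrable[OF P(1)])
  have IP: "(LINT x|lborel. \<bar>\<Phi> x\<bar>) = 1" using P by simp
  have P0: "AE x in lborel. norm x \<ge> 1 \<longrightarrow> \<Phi> x = 0"
    using AE_norm_neq[of 1] by (rule eventually_mono) (use P(1) in \<open>auto simp: bumps_def\<close>)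
  \<comment> \<open>Mollifying at scale \<epsilon> a profile of radius 1 - 2 \<epsilon> leaves
    support in radius 1 - \<epsilon>, strictly inside the ball; the offset 3 keeps the radius
    positive for all \<open>n\<close>.\<close>
  define \<epsilon> :: "nat \<Rightarrow> real" where "\<epsilon> n = 1 / (real n + 3)" for n
  define r where "r n = 1 - 2 * \<epsilon> n" for n
  have eps: "0 < \<epsilon> n" "r n > 0" for n by (auto simp: \<epsilon>_def r_def field_simps)
  have elim: "\<epsilon> \<longlonglongrightarrow> 0"
    unfolding \<epsilon>_def using LIMSEQ_ignore_initial_segment[OF LIMSEQ_inverse_real_of_nat, of 2] by (simp add: inverse_eq_divide add_ac)
  have rlim: "r \<longlonglongrightarrow> 1" unfolding r_def using tendsto_diff[OF tendsto_const tendsto_mult[OF tendsto_const elim], of 1 2] by simp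
  define \<Psi> where "\<Psi> n x = inverse (\<epsilon> n ^ CARD('n)) * \<Phi> (x /\<^sub>R \<epsilon> n)" for n x
  have bPsi: "\<Psi> n \<in> bumps (\<epsilon> n)" for n
    unfolding \<Psi>_def[abs_def] using bumps_cmult[OF bumps_dilate[OF P(1) eps(1)]] by simp
  have ftPsi: "ft (\<Psi> n) \<xi> = ft \<Phi> (\<epsilon> n *\<^sub>R \<xi>)" for n \<xi>
    unfolding \<Psi>_def[abs_def] ft_cmult ft_scale[OF eps(1)] using eps(1)[of n] by (simp add: field_simps)
  define \<phi> where "\<phi> n = conv (ballpow s (r n)) (\<Psi> n)" for n
  have ir: "integrable lborel (ballpow s (r n) :: real^'n \<Rightarrow> real)" for n
    using has_eform_ballpow[OF s eps(2) N'] by (simp add: has_eform_def)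
  have bphi: "\<phi> n \<in> bumps (1 - \<epsilon> n)" for n
  proof -
    have "\<phi> n \<in> bumps (r n + \<epsilon> n)"
      unfolding \<phi>_def by (rule conv_bumps[OF ir bPsi]) (use eps(2)[of n] in \<open>simp add: ballpow_outside\<close>)
    then show ?thesis by (simp add: r_def)
  qed
  have lt: "1 - \<epsilon> n < 1" for n using eps(1) by simp
  have "(\<lambda>n. qform s (\<lambda>x. \<phi> n x - ballpow s 1 x)) \<longlonglongrightarrow> 0"
  proof (rule qform_tendsto)
    show "has_eform s (ballpow s 1 :: real^'n \<Rightarrow> real)" by (rule has_eform_ballpow_1[OF s N'])
    show "has_eform s (\<phi> n)" for n by (rule finite_energy_has_eform[OF bumps_finite_energy[OF bphi lt N s]])
    show "AE x::real^'n in lborel. 1 \<le> norm x \<longrightarrow> ballpow s 1 x = 0" by (simp add: ballpow_outside)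
    show "ft (\<phi> n) \<xi> = of_real (r n powr (2 * s) * r n ^ CARD('n)) * ft (ballpow s 1) (r n *\<^sub>R \<xi>) * ft \<Phi> (\<epsilon> n *\<^sub>R \<xi>)" for n \<xi>
      unfolding \<phi>_def ft_conv[OF ir bumps_integrable[OF bPsi]] ftPsi ft_ballpow_scale[OF eps(2)] by simp
    have "(\<lambda>n. r n powr (2 * s) * r n ^ CARD('n)) \<longlonglongrightarrow> 1 powr (2 * s) * 1 ^ CARD('n)"
      by (intro tendsto_intros rlim) simp
    then show "(\<lambda>n. r n powr (2 * s) * r n ^ CARD('n)) \<longlonglongrightarrow> 1" by simp
    show "cmod (ft \<Phi> (\<epsilon> n *\<^sub>R \<xi>)) \<le> 1" for n \<xi> using ft_bound[OF iP] unfolding IP .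
    show "(\<lambda>n. ft \<Phi> (\<epsilon> n *\<^sub>R \<xi>)) \<longlonglongrightarrow> 1" for \<xi>
    proof -
      have "ft \<Phi> 0 = of_real (LINT x|lborel. \<Phi> x)" unfolding ft_def by (simp add: integral_complex_of_real)
      then have f0: "ft \<Phi> 0 = 1" using P(3) by simp
      have "(\<lambda>n. ft \<Phi> (\<epsilon> n *\<^sub>R \<xi>) - 1) \<longlonglongrightarrow> 0"
      proof (rule tendsto_0_le[where K="norm \<xi>"])
        show "\<epsilon> \<longlonglongrightarrow> 0" by (rule elim)
        show "eventually (\<lambda>n. norm (ft \<Phi> (\<epsilon> n *\<^sub>R \<xi>) - 1) \<le> norm (\<epsilon> n) * norm \<xi>) sequentially"
        proof (intro always_eventually allI)
          show "norm (ft \<Phi> (\<epsilon> n *\<^sub>R \<xi>) - 1) \<le> norm (\<epsilon> n) * norm \<xi>" for n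
            using ft_lipschitz[OF iP P0, of "\<epsilon> n *\<^sub>R \<xi>" 0] unfolding IP f0 by simp
        qed
      qed
      then show ?thesis by (simp add: Lim_null[symmetric])
    qed
  qed (use eps rlim in auto)
  then show ?thesis
    unfolding D0_iff using ballpow_finite_energy[OF s N] bphi lt by blast
qed

lemma tendsto_of_square_bound:
  fixes f :: "nat \<Rightarrow> 'a::real_normed_vector"
  assumes le: "\<And>n. (norm (f n - l))\<^sup>2 \<le> C * g n" and g: "g \<longlonglongrightarrow> 0"
  shows "f \<longlonglongrightarrow> l"
proof -
  have "(\<lambda>n. C * g n) \<longlonglongrightarrow> 0" using tendsto_mult[OF tendsto_const g, of C] by simp
  then have "(\<lambda>n. (norm (f n - l))\<^sup>2) \<longlonglongrightarrow> 0"
    by (rule tendsto_sandwich[OF _ _ tendsto_const, rotated 2]) (use le in \<open>auto intro!: always_eventually\<close>)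
  then have "(\<lambda>n. sqrt ((norm (f n - l))\<^sup>2)) \<longlonglongrightarrow> sqrt 0" by (rule tendsto_real_sqrt)
  then have "(\<lambda>n. norm (f n - l)) \<longlonglongrightarrow> 0" by simp
  then show ?thesis by (simp add: tendsto_norm_zero_iff Lim_null[symmetric])
qed

text \<open>Both sides are continuous in energy along the approximating bumps: the form by the
  Cauchy-Schwarz inequality, the mass by \<open>poincare\<close>. Boundedness, support and almost
  everywhere continuity of \<open>v\<close> are there to make \<open>poincare\<close> applicable to
  the differences.\<close>

lemma D0_pairing:
  assumes s: "0 < s" and N: "2 \<le> CARD('n::finite)"
  shows "\<exists>\<kappa>. \<forall>v::real^'n \<Rightarrow> real. v \<in> D0 s \<longrightarrow> (\<exists>M. \<forall>x. \<bar>v x\<bar> \<le> M) \<longrightarrow> (\<forall>x. norm x \<ge> 1 \<longrightarrow> v x = 0) \<longrightarrow>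
    (AE x in lborel. isCont v x) \<longrightarrow> eform s v (ballpow s 1) = of_real (\<kappa> * (LINT x|lborel. v x))"
proof -
  have N': "2 \<le> DIM(real^'n)" using N by simp
  obtain \<kappa> where k: "pairing_at TYPE(real^'n) s \<kappa>" using pairing_exists[OF s N'] by blast
  obtain C where C: "\<And>w::real^'n \<Rightarrow> real. has_eform s w \<Longrightarrow> (\<exists>M. \<forall>x. \<bar>w x\<bar> \<le> M) \<Longrightarrow> (\<forall>x. norm x \<ge> 1 \<longrightarrow> w x = 0) \<Longrightarrow>
     (AE x in lborel. isCont w x) \<Longrightarrow> (LINT x|lborel. \<bar>w x\<bar>)\<^sup>2 \<le> C * qform s w"
    using poincare[OF s, where 'a="real^'n"] by blast
  let ?G = "ballpow s 1 :: real^'n \<Rightarrow> real"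
  have fG: "has_eform s ?G" by (rule has_eform_ballpow_1[OF s N'])
  have "eform s v ?G = of_real (\<kappa> * (LINT x|lborel. v x))"
    if v: "v \<in> D0 s" and M: "\<exists>M. \<forall>x. \<bar>v x\<bar> \<le> M" and supp: "\<forall>x. norm x \<ge> 1 \<longrightarrow> v x = 0" and ae: "AE x in lborel. isCont v x" for v
  proof -
    obtain \<phi> where phi: "\<And>n. \<exists>R<1. \<phi> n \<in> bumps R" and lim: "(\<lambda>n::nat. qform s (\<lambda>x. \<phi> n x - v x)) \<longlonglongrightarrow> 0"
      using v unfolding D0_iff by blast
    obtain M where M: "\<And>x. \<bar>v x\<bar> \<le> M" using M by blast
    have fv: "has_eform s v" using v by (simp add: D0_iff finite_energy_has_eform)
    have fphi: "has_eform s (\<phi> n)" for n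
      using phi[of n] bumps_finite_energy[OF _ _ N s] finite_energy_has_eform by blast
    have p1: "eform s (\<phi> n) ?G = of_real (\<kappa> * (LINT x|lborel. \<phi> n x))" for n
    proof -
      obtain R where R: "R < 1" "\<phi> n \<in> bumps R" using phi by blast
      have z: "norm x \<ge> 1 \<Longrightarrow> \<phi> n x = 0" for x using R by (auto simp: bumps_def)
      show ?thesis
        unfolding eform_def freq_weight_def
        by (rule k[unfolded pairing_at_iff, rule_format, OF bumps_integrable[OF R(2)] z bumps_rapid[OF R(2) N]])
    qed
    have L1: "(\<lambda>n. eform s (\<phi> n) ?G) \<longlonglongrightarrow> eform s v ?G"
    proof (rule tendsto_of_square_bound[OF _ lim])
      fix n
      show "(norm (eform s (\<phi> n) ?G - eform s v ?G))\<^sup>2 \<le> qform s ?G * qform s (\<lambda>x. \<phi> n x - v x)"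
        using eform_Cauchy_Schwarz[OF has_eform_diff[OF fphi[of n] fv] fG] unfolding eform_diff[OF fphi[of n] fv fG] by (simp add: mult.commute)
    qed
    have L2: "(\<lambda>n. LINT x|lborel. \<phi> n x) \<longlonglongrightarrow> (LINT x|lborel. v x)"
    proof (rule tendsto_of_square_bound[OF _ lim])
      fix n
      obtain R where R: "R < 1" "\<phi> n \<in> bumps R" using phi by blast
      obtain M' where M': "\<And>x. \<bar>\<phi> n x\<bar> \<le> M'" using bumps_bounded[OF R(2)] by blast
      have sm: "smooth (\<phi> n)" using R(2) by (simp add: bumps_def)
      have i: "integrable lborel (\<phi> n)" "integrable lborel v" using fphi fv by (auto simp: has_eform_def)
      have "\<bar>(LINT x|lborel. \<phi> n x) - (LINT x|lborel. v x)\<bar> \<le> (LINT x|lborel. \<bar>\<phi> n x - v x\<bar>)"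
        unfolding Bochner_Integration.integral_diff[OF i, symmetric] by (rule integral_abs_bound)
      then have "(norm ((LINT x|lborel. \<phi> n x) - (LINT x|lborel. v x)))\<^sup>2 \<le> (LINT x|lborel. \<bar>\<phi> n x - v x\<bar>)\<^sup>2"
        unfolding real_norm_def by (rule power_mono) simp
      also have "\<dots> \<le> C * qform s (\<lambda>x. \<phi> n x - v x)"
      proof (rule C[OF has_eform_diff[OF fphi fv]])
        have "\<bar>\<phi> n x - v x\<bar> \<le> M' + M" for x using M'[of x] M[of x] by linarith
        then show "\<exists>M. \<forall>x. \<bar>\<phi> n x - v x\<bar> \<le> M" by blast
        show "\<forall>x. 1 \<le> norm x \<longrightarrow> \<phi> n x - v x = 0" using supp R by (auto simp: bumps_def)
        show "AE x in lborel. isCont (\<lambda>x. \<phi> n x - v x) x"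
          using ae by (rule eventually_mono)
            (use smooth_continuous[OF sm] in \<open>auto intro!: continuous_intros simp: continuous_on_eq_continuous_at\<close>)
      qed
      finally show "(norm ((LINT x|lborel. \<phi> n x) - (LINT x|lborel. v x)))\<^sup>2 \<le> C * qform s (\<lambda>x. \<phi> n x - v x)" .
    qed
    have "(\<lambda>n. eform s (\<phi> n) ?G) \<longlonglongrightarrow> of_real (\<kappa> * (LINT x|lborel. v x))"
      unfolding p1 by (intro tendsto_of_real tendsto_mult tendsto_const L2)
    then show ?thesis using L1 LIMSEQ_unique by blast
  qed
  then show ?thesis by blast
qed

section \<open>Nonexistence\<close>

lemma powr_tangent:
  fixes a b P :: real
  assumes P: "1 \<le> P" and a: "0 \<le> a" and b: "0 \<le> b"
  shows "a powr P + P * a powr (P - 1) * (b - a) \<le> b powr P"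
proof (cases "a = 0")
  case True
  then show ?thesis by simp
next
  case False
  then have a: "a > 0" using a by simp
  have aP: "a powr P = a powr (P - 1) * a" using powr_add[of a "P - 1" 1] a by simp
  show ?thesis
  proof (cases "b = 0")
    case True
    have "1 * a powr P \<le> P * a powr P" using P by (intro mult_right_mono) auto
    then show ?thesis using True by (simp add: aP algebra_simps)
  next
    case False
    then have b: "b > 0" using b by simp
    define t where "t = b / a"
    have t: "t > 0" using a b by (simp add: t_def)
    \<comment> \<open>The weighted arithmetic-geometric mean inequality for \<open>t powr P\<close>
      and 1 with weights 1/P and 1 - 1/P is Bernoulli's inequality, that is, the tangent at 1;
      scaling by \<open>a\<close> moves it to \<open>a\<close>.\<close>
    have "(t powr P) powr (1 / P) * 1 powr (1 - 1 / P) \<le> 1 / P * t powr P + (1 - 1 / P) * 1"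
      by (rule Youngs_inequality_0) (use P t in auto)
    then have "t \<le> 1 / P * t powr P + (1 - 1 / P)" using P t by (simp add: powr_powr)
    then have "P * t \<le> P * (1 / P * t powr P + (1 - 1 / P))" using P by (intro mult_left_mono) auto
    also have "\<dots> = t powr P + (P - 1)" using P by (simp add: field_simps)
    finally have "1 + P * (t - 1) \<le> t powr P" by (simp add: algebra_simps)
    then have "a powr P * (1 + P * (t - 1)) \<le> a powr P * t powr P" by (rule mult_left_mono) simp
    also have "a powr P * t powr P = b powr P" using a b by (simp add: powr_mult[symmetric] t_def)
    also have "a powr P * (1 + P * (t - 1)) = a powr P + P * a powr (P - 1) * (b - a)"
    proof -
      have "a * (t - 1) = b - a" using a by (simp add: t_def field_simps)
      then have "a powr P * (P * (t - 1)) = P * a powr (P - 1) * (b - a)" unfolding aP by (metis mult.assoc mult.left_commute)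
      then show ?thesis by (simp add: distrib_left)
    qed
    finally show ?thesis .
  qed
qed

text \<open>The tangent inequality at the larger point bounds the increment of the power, and the
  slope there is at most \<open>p * K powr (p - 1)\<close>.\<close>

lemma powr_diff_bound:
  fixes a b p K :: real
  assumes p: "1 \<le> p" and a: "0 \<le> a" "a \<le> K" and b: "0 \<le> b" "b \<le> K"
  shows "(a powr p - b powr p) * (a - b) \<le> p * K powr (p - 1) * (a - b)\<^sup>2"
proof -
  have main: "(x powr p - y powr p) * (x - y) \<le> p * K powr (p - 1) * (x - y)\<^sup>2" if "0 \<le> y" "y \<le> x" "x \<le> K" for x y
  proof -
    have "x powr p - y powr p \<le> p * x powr (p - 1) * (x - y)"
      using powr_tangent[OF p, of x y] that by (simp add: algebra_simps)
    also have "\<dots> \<le> p * K powr (p - 1) * (x - y)"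
      using that p by (intro mult_right_mono mult_left_mono powr_mono2) auto
    finally have "(x powr p - y powr p) * (x - y) \<le> (p * K powr (p - 1) * (x - y)) * (x - y)"
      using that by (intro mult_right_mono) auto
    then show ?thesis by (simp add: power2_eq_square mult.assoc)
  qed
  show ?thesis
  proof (cases "b \<le> a")
    case True
    then show ?thesis using main a b by simp
  next
    case False
    have "(a powr p - b powr p) * (a - b) = (b powr p - a powr p) * (b - a)" by (simp add: algebra_simps)
    moreover have "(a - b)\<^sup>2 = (b - a)\<^sup>2" by (simp add: power2_commute)
    ultimately show ?thesis using main[of a b] a b False by simp
  qed
qed

text \<open>Expanding the energy of the difference leaves the equation tested with \<open>u\<close>
  minus its rescaled dilate, and convexity turns this into an L2 bound without any rate. The rate
  enters through the low frequencies alone, where the transform of \<open>u\<close> is Lipschitz;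
  thus no regularity of \<open>u\<close> at the sphere is involved. The divisor \<open>k\<close>
  accounts for the normalisation of the transform.\<close>

lemma dilated_difference_energy:
  fixes u :: "real^'n \<Rightarrow> real" and s k M :: real
  defines "N \<equiv> real CARD('n)"
  defines "P \<equiv> 2 * N / (N - 2 * s)"
  assumes s: "0 < s" and N2: "2 \<le> CARD('n)" and Ns: "2 * s < N" and k: "k > 0"
    and u: "u \<in> D0 s" and u0: "\<And>x. 0 \<le> u x" and uM: "\<And>x. u x \<le> M" and supp: "\<And>x. norm x \<ge> 1 \<Longrightarrow> u x = 0"
    and ae: "AE x in lborel. isCont u x"
    and eq: "\<And>v. v \<in> D0 s \<Longrightarrow> eform s u v = of_real ((LINT x|lborel. u x powr (P - 1) * v x) / k)"
  shows "\<exists>C. \<forall>r. 1/2 \<le> r \<longrightarrow> r < 1 \<longrightarrow> qform s (\<lambda>x. u x - r powr (- (N - 2 * s) / 2) * u (x /\<^sub>R r)) \<le> C * (1 - r)\<^sup>2"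
proof -
  have DN: "real DIM(real^'n) = N" by (simp add: N_def)
  have N0: "N > 0" using N2 by (simp add: N_def)
  have P1: "P > 1" using s Ns N0 unfolding P_def by (simp add: field_simps)
  define p where "p = P - 1"
  have p1: "p \<ge> 1" unfolding p_def P_def using s Ns N0 by (simp add: field_simps)
  have M0: "M \<ge> 0" using u0[of 0] uM[of 0] by linarith
  \<comment> \<open>A common bound for \<open>u\<close> and its rescaled dilates: for
    \<open>r \<ge> 1/2\<close> the amplitude is at most
    \<open>2 powr ((N - 2 * s) / 2)\<close>.\<close>
  define K where "K = 2 powr ((N - 2 * s) / 2) * M"
  have K0: "K \<ge> 0" using M0 by (simp add: K_def)
  define L where "L = 2 / k * (p * K powr (p - 1))"
  have L0: "L \<ge> 0" using k p1 by (simp add: L_def)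
  define A where "A = heat_mass TYPE(real^'n)"
  have A: "A > 0" unfolding A_def by (rule heat_mass_pos)
  have fu: "has_eform s u" using u by (simp add: D0_iff finite_energy_has_eform)
  have iu: "integrable lborel u" using fu by (simp add: has_eform_def)
  have um[measurable]: "u \<in> borel_measurable borel" using iu by auto
  define U where "U = (LINT x|lborel. \<bar>u x\<bar>)"
  have U0: "U \<ge> 0" by (simp add: U_def)
  \<comment> \<open>Chosen so that \<open>R powr (- (2 * s)) * L \<le> A / 2\<close>: the
    high-frequency term of \<open>L2_split\<close>, bounded by means of \<open>QL\<close>, is then
    absorbed into half of the left-hand side. The summand 1 guards against
    \<open>L = 0\<close>.\<close>
  define R where "R = (2 * (L + 1) / A) powr (1 / (2 * s))"
  have R: "R > 0" "R powr (- (2 * s)) = A / (2 * (L + 1))"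
  proof -
    show "R > 0" using A L0 by (simp add: R_def)
    have "R powr (- (2 * s)) = (2 * (L + 1) / A) powr (1 / (2 * s) * (- (2 * s)))" by (simp only: R_def powr_powr)
    also have "1 / (2 * s) * (- (2 * s)) = - 1" using s by simp
    finally show "R powr (- (2 * s)) = A / (2 * (L + 1))" using A L0 by (simp add: powr_minus)
  qed
  \<comment> \<open>The total power of \<open>r\<close> in front of the transform of the rescaled
    dilate: the Jacobian gives N, the amplitude -(N - 2s)/2. It is at least 1, so Bernoulli's
    inequality bounds \<open>1 - r powr e0\<close> by \<open>e0 * (1 - r)\<close>.\<close>
  define e0 where "e0 = (N + 2 * s) / 2"
  have e0: "e0 \<ge> 1" using N2 s by (simp add: e0_def N_def)
  define V where "V = measure lborel (ball (0::real^'n) R)"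
  define B where "B = U * R + e0 * U"
  define C where "C = 2 * L / A * (B\<^sup>2 * V)"
  have "qform s (\<lambda>x. u x - r powr (- (N - 2 * s) / 2) * u (x /\<^sub>R r)) \<le> C * (1 - r)\<^sup>2" if r: "1/2 \<le> r" "r < 1" for r
  proof -
    have r0: "r > 0" using r by simp
    define \<alpha> where "\<alpha> = r powr (- (N - 2 * s) / 2)"
    define T where "T x = u (x /\<^sub>R r)" for x
    define w where "w x = u x - \<alpha> * T x" for x
    have al0: "\<alpha> > 0" using r0 by (simp add: \<alpha>_def)
    have alle: "\<alpha> \<le> 2 powr ((N - 2 * s) / 2)"
    proof -
      have "\<alpha> = r powr (- ((N - 2 * s) / 2))" unfolding \<alpha>_def by (simp only: minus_divide_left)
      also have "\<dots> = (1 / r) powr ((N - 2 * s) / 2)" using r0 unfolding powr_minus_divide by (simp add: powr_divide)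
      also have "\<dots> \<le> 2 powr ((N - 2 * s) / 2)" using r r0 Ns by (intro powr_mono2) (auto simp: field_simps)
      finally show ?thesis .
    qed
    have TD: "T \<in> D0 s" unfolding T_def[abs_def] by (rule D0_dilate[OF u r0]) (use r in simp)
    have fT: "has_eform s T" using TD by (simp add: D0_iff finite_energy_has_eform)
    have Tm[measurable]: "T \<in> borel_measurable borel" unfolding T_def[abs_def] by measurable
    have T0: "0 \<le> T x" "T x \<le> M" for x using u0 uM by (auto simp: T_def)
    have Tsupp: "T x = 0" if "norm x \<ge> 1" for x
    proof -
      have "1 \<le> norm (x /\<^sub>R r)" using that r r0 by (simp add: field_simps)
      then show ?thesis by (simp add: T_def supp)
    qed
    have fw: "has_eform s w" unfolding w_def[abs_def] by (rule has_eform_diff[OF fu has_eform_cmult[OF fT]])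
    have uK: "u x \<le> K" for x
    proof -
      have "1 \<le> 2 powr ((N - 2 * s) / 2)" using Ns by (intro ge_one_powr_ge_zero) auto
      then have "1 * M \<le> K" unfolding K_def using M0 by (intro mult_right_mono) auto
      then show ?thesis using uM[of x] by simp
    qed
    have aT: "0 \<le> \<alpha> * T x" "\<alpha> * T x \<le> K" for x
      unfolding K_def using T0[of x] al0 alle by (auto intro!: mult_mono)
    have int_bd: "integrable lborel g" if "g \<in> borel_measurable borel" "\<And>x. \<bar>g x\<bar> \<le> X" "\<And>x. norm x \<ge> 1 \<Longrightarrow> g x = 0" for g :: "real^'n \<Rightarrow> real" and X
      by (rule integrable_bounded_in_ball[OF that])
    have pw: "x powr p \<le> K powr p" "x powr P \<le> K powr P" if "0 \<le> x" "x \<le> K" for x :: real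
      using that p1 P1 by (auto intro!: powr_mono2)
    have i_uu: "integrable lborel (\<lambda>x. u x powr p * u x)"
      by (rule int_bd[where X="K powr p * K"]) (use u0 uK supp pw(1) K0 in \<open>auto simp: abs_mult intro!: mult_mono\<close>)
    have i_ua: "integrable lborel (\<lambda>x. u x powr p * (\<alpha> * T x))"
    proof (rule int_bd[where X="K powr p * K"])
      show "\<bar>u x powr p * (\<alpha> * T x)\<bar> \<le> K powr p * K" for x
        unfolding abs_mult[of "_ powr _"] abs_of_nonneg[OF aT(1)] abs_of_nonneg[OF powr_ge_zero]
        by (intro mult_mono pw(1) aT K0 powr_ge_zero u0 uK)
    qed (use supp in auto)
    have i_aa: "integrable lborel (\<lambda>x. (\<alpha> * T x) powr p * (\<alpha> * T x))"
    proof (rule int_bd[where X="K powr p * K"])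
      show "\<bar>(\<alpha> * T x) powr p * (\<alpha> * T x)\<bar> \<le> K powr p * K" for x
        unfolding abs_mult[of "_ powr _"] abs_of_nonneg[OF aT(1)] abs_of_nonneg[OF powr_ge_zero]
        by (intro mult_mono pw(1) aT K0 powr_ge_zero)
    qed (use Tsupp in auto)
    have i_au: "integrable lborel (\<lambda>x. (\<alpha> * T x) powr p * u x)"
    proof (rule int_bd[where X="K powr p * K"])
      show "\<bar>(\<alpha> * T x) powr p * u x\<bar> \<le> K powr p * K" for x
        unfolding abs_mult[of "_ powr _"] abs_of_nonneg[OF u0] abs_of_nonneg[OF powr_ge_zero]
        by (intro mult_mono pw(1) aT K0 powr_ge_zero u0 uK)
    qed (use supp in auto)
    have i_uP: "integrable lborel (\<lambda>x. u x powr P)"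
      by (rule int_bd[where X="K powr P"]) (use u0 uK supp pw(2) in auto)
    have i_aP: "integrable lborel (\<lambda>x. (\<alpha> * T x) powr P)"
      by (rule int_bd[where X="K powr P"]) (use aT Tsupp pw(2) in auto)
    have powP: "x powr p * x = x powr P" if "0 \<le> x" for x :: real
      using that powr_add[of x p 1] by (cases "x = 0") (auto simp: p_def)
    \<comment> \<open>Here \<open>P\<close> has to be the critical exponent:
      \<open>\<alpha> powr P\<close> is \<open>r powr (- N)\<close> and cancels the
      Jacobian.\<close>
    have mass: "(LINT x|lborel. (\<alpha> * T x) powr P) = (LINT x|lborel. u x powr P)"
    proof -
      have "(LINT x|lborel. (\<alpha> * T x) powr P) = \<alpha> powr P * (LINT x|lborel. T x powr P)"
        unfolding Bochner_Integration.integral_mult_right_zero[symmetric] using al0 T0 by (simp add: powr_mult)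
      also have "(LINT x|lborel. T x powr P) = r ^ CARD('n) * (LINT x|lborel. u x powr P)"
        unfolding T_def using lborel_integral_affine[of r "\<lambda>x. u (x /\<^sub>R r) powr P" 0] r0 by simp
      also have "\<alpha> powr P * (r ^ CARD('n) * (LINT x|lborel. u x powr P)) = (\<alpha> powr P * r powr N) * (LINT x|lborel. u x powr P)"
        using r0 by (simp add: N_def powr_realpow)
      also have "\<alpha> powr P * r powr N = r powr ((- (N - 2 * s) / 2) * P + N)"
        unfolding \<alpha>_def by (simp add: powr_powr powr_add)
      also have "(- (N - 2 * s) / 2) * P + N = 0"
        unfolding P_def using Ns by (simp add: field_simps)
      finally show ?thesis using r0 by simp
    qed
    have Qu: "qform s u = (LINT x|lborel. u x powr p * u x) / k"
      using eq[OF u] unfolding eform_self of_real_eq_iff p_def .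
    have pT: "Re (eform s u (\<lambda>x. \<alpha> * T x)) = (LINT x|lborel. u x powr p * (\<alpha> * T x)) / k"
    proof -
      have "eform s u (\<lambda>x. \<alpha> * T x) = cnj (eform s (\<lambda>x. \<alpha> * T x) u)" by (rule eform_cnj)
      also have "\<dots> = of_real \<alpha> * eform s u T" unfolding eform_cmult by (simp add: eform_cnj[of s u T, symmetric])
      also have "\<dots> = of_real (\<alpha> * ((LINT x|lborel. u x powr p * T x) / k))" unfolding eq[OF TD] p_def by simp
      finally have "Re (eform s u (\<lambda>x. \<alpha> * T x)) = \<alpha> * ((LINT x|lborel. u x powr p * T x) / k)" by (simp only: Re_complex_of_real)
      also have "\<dots> = (LINT x|lborel. \<alpha> * (u x powr p * T x)) / k" unfolding Bochner_Integration.integral_mult_right_zero by simp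
      finally show ?thesis by (simp add: mult_ac)
    qed
    have QT: "qform s (\<lambda>x. \<alpha> * T x) = qform s u"
    proof -
      have "qform s (\<lambda>x. \<alpha> * T x) = (\<alpha>\<^sup>2 * r powr (N - 2 * s)) * qform s u"
        unfolding qform_cmult T_def qform_dilate[OF r0] DN by (simp add: mult.assoc)
      also have "\<alpha>\<^sup>2 = r powr (- (N - 2 * s))"
      proof -
        have "- (N - 2 * s) / 2 + - (N - 2 * s) / 2 = - (N - 2 * s)" by (simp add: field_simps)
        then show ?thesis unfolding \<alpha>_def power2_eq_square powr_add[symmetric] by (rule arg_cong)
      qed
      finally show ?thesis using r0 by (simp add: powr_add[symmetric])
    qed
    have Qw: "qform s w = 2 / k * (LINT x|lborel. u x powr p * (u x - \<alpha> * T x))"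
    proof -
      have arith: "a / c - 2 * (b / c) + a / c = 2 / c * (a - b)" if "c \<noteq> 0" for a b c :: real
        using that by (simp add: divide_simps)
      have "qform s w = qform s u - 2 * Re (eform s u (\<lambda>x. \<alpha> * T x)) + qform s u"
        unfolding w_def[abs_def] qform_diff[OF fu has_eform_cmult[OF fT]] QT ..
      also have "\<dots> = 2 / k * ((LINT x|lborel. u x powr p * u x) - (LINT x|lborel. u x powr p * (\<alpha> * T x)))"
        unfolding pT Qu using arith[OF less_imp_neq[OF k, symmetric]] .
      also have "(LINT x|lborel. u x powr p * u x) - (LINT x|lborel. u x powr p * (\<alpha> * T x)) = (LINT x|lborel. u x powr p * (u x - \<alpha> * T x))"
        unfolding Bochner_Integration.integral_diff[OF i_uu i_ua, symmetric] by (simp add: right_diff_distrib)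
      finally show ?thesis .
    qed
    \<comment> \<open>The tangent inequality at \<open>\<alpha> * T x\<close> bounds the integrand
      by a difference of P-th powers, whose integrals agree by \<open>mass\<close>. Subtracting this
      nonpositive integral symmetrises the expression for \<open>qform s w\<close> in
      \<open>QL\<close>.\<close>
    have neg: "(LINT x|lborel. (\<alpha> * T x) powr p * (u x - \<alpha> * T x)) \<le> 0"
    proof -
      have "(LINT x|lborel. (\<alpha> * T x) powr p * (u x - \<alpha> * T x)) \<le> (LINT x|lborel. (u x powr P - (\<alpha> * T x) powr P) / P)"
      proof (rule integral_mono)
        show "integrable lborel (\<lambda>x. (\<alpha> * T x) powr p * (u x - \<alpha> * T x))"
          using Bochner_Integration.integrable_diff[OF i_au i_aa] by (simp add: right_diff_distrib)
        show "integrable lborel (\<lambda>x. (u x powr P - (\<alpha> * T x) powr P) / P)" using i_uP i_aP by simp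
        fix x
        have "(\<alpha> * T x) powr P + P * (\<alpha> * T x) powr (P - 1) * (u x - \<alpha> * T x) \<le> u x powr P"
          by (rule powr_tangent) (use P1 aT u0 in auto)
        then have "((\<alpha> * T x) powr p * (u x - \<alpha> * T x)) * P \<le> u x powr P - (\<alpha> * T x) powr P"
          unfolding p_def by (simp add: algebra_simps)
        then show "(\<alpha> * T x) powr p * (u x - \<alpha> * T x) \<le> (u x powr P - (\<alpha> * T x) powr P) / P"
          using P1 by (simp add: pos_le_divide_eq)
      qed
      also have "\<dots> = ((LINT x|lborel. u x powr P) - (LINT x|lborel. (\<alpha> * T x) powr P)) / P"
        using i_uP i_aP by simp
      finally show ?thesis unfolding mass by simp
    qed
    have i_w2: "integrable lborel (\<lambda>x. (w x)\<^sup>2)"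
    proof (rule int_bd[where X="(K + K)\<^sup>2"])
      show "\<bar>(w x)\<^sup>2\<bar> \<le> (K + K)\<^sup>2" for x
      proof -
        have "\<bar>w x\<bar> \<le> K + K" unfolding w_def using u0[of x] uK[of x] aT[of x] by linarith
        then show ?thesis using power_mono[of "\<bar>w x\<bar>" "K + K" 2] by simp
      qed
    qed (use supp Tsupp in \<open>auto simp: w_def\<close>)
    have i_d: "integrable lborel (\<lambda>x. (u x powr p - (\<alpha> * T x) powr p) * (u x - \<alpha> * T x))"
      using Bochner_Integration.integrable_diff[OF Bochner_Integration.integrable_diff[OF i_uu i_ua] Bochner_Integration.integrable_diff[OF i_au i_aa]]
      by (simp add: algebra_simps)
    have QL: "qform s w \<le> L * (LINT x|lborel. (w x)\<^sup>2)"
    proof -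
      have "(LINT x|lborel. u x powr p * (u x - \<alpha> * T x)) \<le> (LINT x|lborel. u x powr p * (u x - \<alpha> * T x)) - (LINT x|lborel. (\<alpha> * T x) powr p * (u x - \<alpha> * T x))"
        using neg by simp
      also have "\<dots> = (LINT x|lborel. (u x powr p - (\<alpha> * T x) powr p) * (u x - \<alpha> * T x))"
      proof -
        have 1: "integrable lborel (\<lambda>x. u x powr p * (u x - \<alpha> * T x))"
          using Bochner_Integration.integrable_diff[OF i_uu i_ua] by (simp add: right_diff_distrib)
        have 2: "integrable lborel (\<lambda>x. (\<alpha> * T x) powr p * (u x - \<alpha> * T x))"
          using Bochner_Integration.integrable_diff[OF i_au i_aa] by (simp add: right_diff_distrib)
        show ?thesis unfolding Bochner_Integration.integral_diff[OF 1 2, symmetric] by (simp add: left_diff_distrib)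
      qed
      also have "\<dots> \<le> (LINT x|lborel. p * K powr (p - 1) * (w x)\<^sup>2)"
      proof (rule integral_mono[OF i_d])
        show "integrable lborel (\<lambda>x. p * K powr (p - 1) * (w x)\<^sup>2)" using i_w2 by simp
        show "(u x powr p - (\<alpha> * T x) powr p) * (u x - \<alpha> * T x) \<le> p * K powr (p - 1) * (w x)\<^sup>2" for x
          unfolding w_def by (rule powr_diff_bound[OF p1 u0 uK aT])
      qed
      finally have "(LINT x|lborel. u x powr p * (u x - \<alpha> * T x)) \<le> p * K powr (p - 1) * (LINT x|lborel. (w x)\<^sup>2)" by simp
      then have "2 / k * (LINT x|lborel. u x powr p * (u x - \<alpha> * T x)) \<le> 2 / k * (p * K powr (p - 1) * (LINT x|lborel. (w x)\<^sup>2))"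
        using k by (intro mult_left_mono) auto
      then show ?thesis unfolding Qw L_def by (simp only: mult.assoc)
    qed
    have D: "cmod (ft w \<xi>) \<le> B * (1 - r)" if xi: "norm \<xi> < R" for \<xi>
    proof -
      have ftT: "ft (\<lambda>x. \<alpha> * T x) \<xi> = of_real (r powr e0) * ft u (r *\<^sub>R \<xi>)"
      proof -
        have "ft (\<lambda>x. \<alpha> * T x) \<xi> = of_real (\<alpha> * r ^ CARD('n)) * ft u (r *\<^sub>R \<xi>)"
          unfolding ft_cmult T_def ft_scale[OF r0] by simp
        also have "\<alpha> * r ^ CARD('n) = r powr (- (N - 2 * s) / 2 + N)"
          unfolding \<alpha>_def using r0 by (simp add: powr_add N_def powr_realpow)
        also have "- (N - 2 * s) / 2 + N = e0" by (simp add: e0_def field_simps)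
        finally show ?thesis .
      qed
      have "ft w \<xi> = (ft u \<xi> - ft u (r *\<^sub>R \<xi>)) + of_real (1 - r powr e0) * ft u (r *\<^sub>R \<xi>)"
        unfolding w_def[abs_def] using ft_diff[OF iu, of "\<lambda>x. \<alpha> * T x" \<xi>] has_eform_cmult[OF fT, of \<alpha>] ftT by (simp add: has_eform_def algebra_simps)
      then have "cmod (ft w \<xi>) \<le> cmod (ft u \<xi> - ft u (r *\<^sub>R \<xi>)) + \<bar>1 - r powr e0\<bar> * cmod (ft u (r *\<^sub>R \<xi>))"
        by (metis norm_triangle_ineq norm_mult norm_of_real)
      also have "cmod (ft u \<xi> - ft u (r *\<^sub>R \<xi>)) \<le> U * norm (\<xi> - r *\<^sub>R \<xi>)"
        unfolding U_def by (rule ft_lipschitz[OF iu]) (simp add: supp)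
      also have "norm (\<xi> - r *\<^sub>R \<xi>) = (1 - r) * norm \<xi>" 
      proof -
        have "\<xi> - r *\<^sub>R \<xi> = (1 - r) *\<^sub>R \<xi>" by (simp add: algebra_simps)
        then show ?thesis using r by simp
      qed
      also have "U * ((1 - r) * norm \<xi>) \<le> U * ((1 - r) * R)" using xi r U0 by (intro mult_left_mono) auto
      also have "\<bar>1 - r powr e0\<bar> * cmod (ft u (r *\<^sub>R \<xi>)) \<le> (e0 * (1 - r)) * U"
      proof (rule mult_mono)
        have "r powr e0 \<le> 1" using r r0 e0 by (intro powr_le1) auto
        moreover have "1 - r powr e0 \<le> e0 * (1 - r)"
          using powr_tangent[OF e0, of 1 r] r0 by (simp add: algebra_simps)
        ultimately show "\<bar>1 - r powr e0\<bar> \<le> e0 * (1 - r)" by simp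
        show "cmod (ft u (r *\<^sub>R \<xi>)) \<le> U" unfolding U_def by (rule ft_bound[OF iu])
      qed (use e0 r in auto)
      finally show ?thesis by (simp add: B_def algebra_simps)
    qed
    have wb: "\<bar>w x\<bar> \<le> K + K" for x unfolding w_def using u0[of x] uK[of x] aT[of x] by linarith
    have wae: "AE x in lborel. isCont w x"
    proof -
      have "AE x in lborel. isCont u (0 + inverse r *\<^sub>R x)" by (rule AE_lborel_affine[OF _ ae]) (use r0 in simp)
      with ae show ?thesis
      proof eventually_elim
        fix x assume c: "isCont u x" "isCont u (0 + inverse r *\<^sub>R x)"
        have "isCont (\<lambda>x. u (inverse r *\<^sub>R x)) x"
          by (rule isCont_o2[where g=u and f="\<lambda>x. inverse r *\<^sub>R x"]) (use c in \<open>auto intro!: continuous_intros\<close>)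
        then show "isCont w x" unfolding w_def[abs_def] T_def using c by (intro continuous_intros) auto
      qed
    qed
    have "A * (LINT x|lborel. (w x)\<^sup>2) \<le> (B * (1 - r))\<^sup>2 * V + R powr (- (2 * s)) * qform s w"
      unfolding A_def V_def by (rule L2_split[OF s fw wb _ wae R(1) D]) (auto simp: w_def supp Tsupp)
    also have "R powr (- (2 * s)) * qform s w \<le> (A / (2 * (L + 1))) * (L * (LINT x|lborel. (w x)\<^sup>2))"
      unfolding R(2) using A L0 by (intro mult_left_mono QL) auto
    also have "\<dots> \<le> (A / 2) * (LINT x|lborel. (w x)\<^sup>2)"
    proof -
      have "L / (L + 1) \<le> 1" using L0 by simp
      then have "(A / 2) * (L / (L + 1)) \<le> (A / 2) * 1" using A by (intro mult_left_mono) auto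
      then have "((A / 2) * (L / (L + 1))) * (LINT x|lborel. (w x)\<^sup>2) \<le> (A / 2) * (LINT x|lborel. (w x)\<^sup>2)"
        by (intro mult_right_mono) auto
      then show ?thesis by simp
    qed
    finally have "(LINT x|lborel. (w x)\<^sup>2) * (A / 2) \<le> (B * (1 - r))\<^sup>2 * V" by (simp add: algebra_simps)
    then have "(LINT x|lborel. (w x)\<^sup>2) \<le> 2 / A * ((B * (1 - r))\<^sup>2 * V)" using A by (simp add: field_simps)
    then have "L * (LINT x|lborel. (w x)\<^sup>2) \<le> L * (2 / A * ((B * (1 - r))\<^sup>2 * V))" by (rule mult_left_mono[OF _ L0])
    also have "\<dots> = C * (1 - r)\<^sup>2" by (simp add: C_def power_mult_distrib)
    finally have "qform s w \<le> C * (1 - r)\<^sup>2" using QL by simp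
    then show ?thesis unfolding w_def[abs_def] T_def \<alpha>_def .
  qed
  then show ?thesis by blast
qed

lemma eform_cmult_right: "eform s u (\<lambda>x. c * v x) = of_real c * eform s u v"
  unfolding eform_def Bochner_Integration.integral_mult_right_zero[symmetric] by (simp add: ft_cmult mult_ac)

section \<open>Comparison of ball profiles of different radii\<close>

lemma ballpow_mono_radius:
  assumes "0 \<le> s" "0 \<le> r" "r \<le> 1"
  shows "ballpow s r x \<le> ballpow s 1 x"
  using assms power_mono[of r 1 2] unfolding ballpow_def by (intro powr_mono2) auto

text \<open>With A and B the two weights, A^s - B^s is at least A^(s-1) (A - B), because
  \<open>s \<ge> 1\<close> gives B^(s-1) \<le> A^(s-1), and A - B = 1 - r^2 \<ge> 1 - r. The
  minorant, divided by 1 - r, does not depend on \<open>r\<close>.\<close>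

lemma ballpow_gap:
  assumes s: "1 \<le> s" and r: "r < 1" and x: "norm x < r"
  shows "(1 - r) * ballpow (s - 1) 1 x \<le> ballpow s 1 x - ballpow s r x"
proof -
  define A B where "A = 1 - (norm x)\<^sup>2" and "B = r\<^sup>2 - (norm x)\<^sup>2"
  have r0: "0 < r" using x norm_ge_zero[of x] by linarith
  have B: "0 < B" using power_strict_mono[OF x, of 2] by (simp add: B_def)
  have rr: "r * r \<le> r" using r r0 mult_right_mono[of r 1 r] by simp
  then have AB: "1 - r \<le> A - B" by (simp add: A_def B_def power2_eq_square)
  have A: "0 < A" using AB B r by linarith
  have split: "X powr s = X powr (s - 1) * X" if "0 < X" for X :: real
    using powr_add[of X "s - 1" 1] that by simp
  have "(1 - r) * A powr (s - 1) \<le> (A - B) * A powr (s - 1)" using AB by (rule mult_right_mono) simp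
  also have "\<dots> = A powr s - A powr (s - 1) * B" unfolding split[OF A] by (simp add: algebra_simps)
  also have "B powr (s - 1) * B \<le> A powr (s - 1) * B"
    using AB B r s by (intro mult_right_mono powr_mono2) auto
  then have "A powr s - A powr (s - 1) * B \<le> A powr s - B powr s" unfolding split[OF B] by simp
  finally show ?thesis using A B by (simp add: ballpow_def A_def B_def)
qed

text \<open>The fractional Laplacian of \<open>ballpow s r\<close> is the same constant for every radius \<open>r\<close>, so the difference
  of two of them is orthogonal to everything supported in the smaller ball.\<close>
lemma dilate_orthogonal_ballpow_diff:
  fixes u :: "real^'n \<Rightarrow> real"
  assumes s: "0 < s" and N: "2 \<le> CARD('n)" and r: "0 < r" "r \<le> 1" and u: "u \<in> D0 s"
    and uM: "\<And>x. \<bar>u x\<bar> \<le> M" and supp: "\<And>x. norm x \<ge> 1 \<Longrightarrow> u x = 0" and ae: "AE x in lborel. isCont u x"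
  shows "eform s (\<lambda>x. u (x /\<^sub>R r)) (\<lambda>x. ballpow s 1 x - ballpow s r x) = 0"
proof -
  have N': "2 \<le> DIM(real^'n)" using N by simp
  let ?G = "ballpow s 1 :: real^'n \<Rightarrow> real" and ?T = "\<lambda>x. u (x /\<^sub>R r)"
  obtain \<kappa> where k: "\<And>v::real^'n \<Rightarrow> real. v \<in> D0 s \<Longrightarrow> \<exists>M. \<forall>x. \<bar>v x\<bar> \<le> M \<Longrightarrow> \<forall>x. norm x \<ge> 1 \<longrightarrow> v x = 0 \<Longrightarrow>
    AE x in lborel. isCont v x \<Longrightarrow> eform s v ?G = of_real (\<kappa> * (LINT x|lborel. v x))"
    using D0_pairing[OF s N] by blast
  have TD: "?T \<in> D0 s" by (rule D0_dilate[OF u r])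
  have Tsupp: "norm x \<ge> 1 \<longrightarrow> ?T x = 0" for x
  proof
    assume "norm x \<ge> 1"
    then have "1 \<le> norm (x /\<^sub>R r)" using r by (simp add: field_simps)
    then show "?T x = 0" by (rule supp)
  qed
  have Tae: "AE x in lborel. isCont ?T x"
  proof -
    have "AE x in lborel. isCont u (0 + inverse r *\<^sub>R x)" by (rule AE_lborel_affine[OF _ ae]) (use r in simp)
    then show ?thesis
    proof eventually_elim
      fix x assume "isCont u (0 + inverse r *\<^sub>R x)"
      then show "isCont ?T x"
        by (intro isCont_o2[where g=u and f="\<lambda>x. inverse r *\<^sub>R x"]) (auto intro!: continuous_intros)
    qed
  qed
  have bs: "ballpow s r = (\<lambda>x::real^'n. r powr (2 * s) * ?G (x /\<^sub>R r))"
    by (rule ext) (rule ballpow_scale[OF r(1)])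
  have fT: "has_eform s ?T" using TD by (simp add: D0_iff finite_energy_has_eform)
  have "eform s ?T ?G = of_real (\<kappa> * (LINT x|lborel. ?T x))"
    using k[OF TD] uM Tsupp Tae by blast
  also have "(LINT x|lborel. ?T x) = r ^ CARD('n) * (LINT x|lborel. u x)"
    using lborel_integral_affine[of r ?T 0] r by simp
  finally have 1: "eform s ?T ?G = of_real (\<kappa> * (r ^ CARD('n) * (LINT x|lborel. u x)))" .
  have "eform s ?T (ballpow s r) = of_real (r powr (2 * s)) * (of_real (r powr (real DIM(real^'n) - 2 * s)) * eform s u ?G)"
    unfolding bs eform_cmult_right eform_dilate[OF r(1)] ..
  also have "eform s u ?G = of_real (\<kappa> * (LINT x|lborel. u x))" using k[OF u] uM supp ae by blast
  also have "of_real (r powr (2 * s)) * (of_real (r powr (real DIM(real^'n) - 2 * s)) * complex_of_real (\<kappa> * (LINT x|lborel. u x)))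
    = of_real ((r powr (2 * s) * r powr (real CARD('n) - 2 * s)) * (\<kappa> * (LINT x|lborel. u x)))" by (simp add: mult_ac)
  also have "r powr (2 * s) * r powr (real CARD('n) - 2 * s) = r ^ CARD('n)"
    using r by (simp add: powr_add[symmetric] powr_realpow)
  finally have 2: "eform s ?T (ballpow s r) = of_real (r ^ CARD('n) * (\<kappa> * (LINT x|lborel. u x)))" .
  show ?thesis
    using eform_diff_right[OF has_eform_ballpow_1[OF s N'] has_eform_ballpow[OF s r(1) N'] fT] 1 2 by (simp add: mult_ac)
qed

text \<open>The transforms of the profiles are rescalings of one another, so
  \<open>qform_tendsto\<close> applies with trivial multiplier. It yields no rate, and the final
  comparison asks for none.\<close>

lemma ballpow_radius_tendsto:
  fixes r :: "nat \<Rightarrow> real"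
  assumes s: "0 < s" and N: "2 \<le> DIM('a::euclidean_space)" and r: "r \<longlonglongrightarrow> 1" "\<And>n. r n > 0"
  shows "(\<lambda>n. qform s (\<lambda>x::'a. ballpow s 1 x - ballpow s (r n) x)) \<longlonglongrightarrow> 0"
proof -
  have "(\<lambda>n. r n powr (2 * s) * r n ^ DIM('a)) \<longlonglongrightarrow> 1 powr (2 * s) * 1 ^ DIM('a)"
    using r by (intro tendsto_intros) auto
  then have a: "(\<lambda>n. r n powr (2 * s) * r n ^ DIM('a)) \<longlonglongrightarrow> 1" by simp
  have "(\<lambda>n. qform s (\<lambda>x::'a. ballpow s (r n) x - ballpow s 1 x)) \<longlonglongrightarrow> 0"
  proof (rule qform_tendsto[where m="\<lambda>_ _. 1", OF has_eform_ballpow_1[OF s N] has_eform_ballpow[OF s r(2) N] _ _ a r])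
    show "ft (ballpow s (r n)) \<xi> = complex_of_real (r n powr (2 * s) * r n ^ DIM('a)) * ft (ballpow s 1) (r n *\<^sub>R \<xi>) * 1" for n and \<xi> :: 'a
      unfolding ft_ballpow_scale[OF r(2)] by simp
  qed (auto simp: ballpow_outside)
  moreover have "qform s (\<lambda>x::'a. ballpow s (r n) x - ballpow s 1 x) = qform s (\<lambda>x::'a. ballpow s 1 x - ballpow s (r n) x)" for n
    using qform_cmult[of s "-1" "\<lambda>x::'a. ballpow s (r n) x - ballpow s 1 x"] by simp
  ultimately show ?thesis by simp
qed

text \<open>If \<open>u x0 > 0\<close>, the weak equation bounds the pairing of \<open>u\<close>
  with the profile difference below by a fixed multiple of 1 - r, while Cauchy-Schwarz bounds it
  above by 1 - r times a quantity tending to 0. Dividing by 1 - r before the limit gives the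
  contradiction.\<close>

lemma nonneg_solution_vanishes:
  fixes u :: "real^'n \<Rightarrow> real" and s k M :: real
  defines "N \<equiv> real CARD('n)"
  defines "P \<equiv> 2 * N / (N - 2 * s)"
  assumes s: "1 \<le> s" and N2: "2 \<le> CARD('n)" and Ns: "2 * s < N" and k: "k > 0"
    and u: "u \<in> D0 s" and u0: "\<And>x. 0 \<le> u x" and uM: "\<And>x. u x \<le> M" and supp: "\<And>x. norm x \<ge> 1 \<Longrightarrow> u x = 0"
    and ae: "AE x in lborel. isCont u x"
    and eq: "\<And>v. v \<in> D0 s \<Longrightarrow> eform s u v = of_real ((LINT x|lborel. u x powr (P - 1) * v x) / k)"
    and x0: "norm x0 < 1" "isCont u x0"
  shows "u x0 = 0"
proof (rule ccontr)
  assume "u x0 \<noteq> 0"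
  then have ux0: "u x0 > 0" using u0[of x0] by linarith
  have s0: "0 < s" using s by simp
  have N': "2 \<le> DIM(real^'n)" using N2 by simp
  have N0: "N > 0" using N2 by (simp add: N_def)
  have p0: "P - 1 \<ge> 0" unfolding P_def using s0 Ns N0 by (simp add: field_simps)
  let ?G = "ballpow s 1 :: real^'n \<Rightarrow> real"
  define f where "f x = u x powr (P - 1)" for x
  define H where "H r x = ?G x - ballpow s r x" for r x
  have fu: "has_eform s u" using u by (simp add: D0_iff finite_energy_has_eform)
  have um[measurable]: "u \<in> borel_measurable borel" using fu by (auto simp: has_eform_def)
  have fm[measurable]: "f \<in> borel_measurable borel" unfolding f_def[abs_def] by measurable
  have f0: "0 \<le> f x" for x by (simp add: f_def)
  have fM: "f x \<le> M powr (P - 1)" for x unfolding f_def using u0 uM p0 by (intro powr_mono2) auto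
  \<comment> \<open>Halfway between \<open>x0\<close> and the sphere: the ball of radius
    \<open>r0\<close> contains \<open>x0\<close> and lies in every ball of radius
    \<open>r \<ge> r0\<close>, so one region serves for all \<open>r\<close> near 1.\<close>
  define r0 where "r0 = (1 + norm x0) / 2"
  have r0: "norm x0 < r0" "r0 < 1" "0 < r0"
    using x0(1) by (simp_all add: r0_def add_pos_nonneg)
  \<comment> \<open>The minorant of \<open>f x * H r x / (1 - r)\<close> supplied by
    \<open>ballpow_gap\<close>; being independent of \<open>r\<close>, it gives a lower bound for
    the pairing linear in 1 - r.\<close>
  define g where "g x = indicator (ball 0 r0) x * (f x * ballpow (s - 1) 1 x)" for x
  have gm[measurable]: "g \<in> borel_measurable borel" unfolding g_def[abs_def] by measurable
  have g0: "0 \<le> g x" for x by (simp add: g_def f0 ballpow_nonneg)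
  have gi: "integrable lborel g"
  proof (rule integrable_bounded_in_ball[where M="M powr (P - 1) * 1" and R=1])
    show "\<bar>g x\<bar> \<le> M powr (P - 1) * 1" for x
    proof -
      have "f x * ballpow (s - 1) 1 x \<le> M powr (P - 1) * 1"
        using s by (intro mult_mono fM ballpow_le_1) auto
      then show ?thesis using f0[of x] by (auto simp: g_def indicator_def abs_mult)
    qed
    show "g x = 0" if "norm x \<ge> 1" for x using that r0 by (simp add: g_def)
  qed measurable
  define \<delta> where "\<delta> = (LINT x|lborel. g x)"
  have delta: "\<delta> > 0"
  proof -
    have "\<delta> \<ge> 0" unfolding \<delta>_def using g0 by (intro Bochner_Integration.integral_nonneg)
    moreover have "\<delta> \<noteq> 0"
    proof
      assume "\<delta> = 0"
      then have ae0: "AE x in lborel. g x = 0"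
        unfolding \<delta>_def using integral_nonneg_eq_0_iff_AE[OF gi] g0 by simp
      have "\<forall>\<^sub>F x in nhds x0. u x \<in> {0<..}"
        using x0(2) ux0 topological_tendstoD[of u "u x0" "nhds x0" "{0<..}"]
        by (simp add: isCont_def tendsto_at_iff_tendsto_nhds)
      then obtain S where S: "open S" "x0 \<in> S" "\<And>x. x \<in> S \<Longrightarrow> u x > 0"
        unfolding eventually_nhds by auto
      let ?S = "S \<inter> ball 0 r0"
      have "g x \<noteq> 0" if "x \<in> ?S" for x
      proof -
        have "norm x < r0" using that by simp
        then have "(norm x)\<^sup>2 < 1" using r0 power_strict_mono[of "norm x" 1 2] by simp
        then show ?thesis using that S(3)[of x] by (auto simp: g_def f_def ballpow_def)
      qed
      then have "AE x in lborel. x \<notin> ?S" using ae0 by (auto elim!: eventually_mono)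
      then have "?S \<in> null_sets lborel" using S(1) by (subst AE_iff_null_sets) auto
      then have "negligible ?S" using null_sets_completionI negligible_iff_null_sets by blast
      moreover have "open ?S" "?S \<noteq> {}" using S r0 by auto
      ultimately show False using open_not_negligible by blast
    qed
    ultimately show ?thesis by simp
  qed
  obtain C where C: "\<And>r. 1/2 \<le> r \<Longrightarrow> r < 1 \<Longrightarrow> qform s (\<lambda>x. u x - r powr (- (N - 2 * s) / 2) * u (x /\<^sub>R r)) \<le> C * (1 - r)\<^sup>2"
    using dilated_difference_energy[OF s0 N2 Ns[unfolded N_def] k u u0 uM supp ae eq[unfolded P_def N_def]]
    unfolding N_def by blast
  \<comment> \<open>Upper and lower bounds both carry the factor \<open>(1 - r)\<^sup>2\<close>;
    after cancelling it the left-hand side is fixed while the right-hand side tends to 0.\<close>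
  have key: "(\<delta> / k)\<^sup>2 \<le> C * qform s (H r)" if r: "1/2 \<le> r" "r0 \<le> r" "r < 1" for r
  proof -
    have rp: "r > 0" "r \<le> 1" using r by auto
    define \<alpha> where "\<alpha> = r powr (- (N - 2 * s) / 2)"
    define T where "T x = u (x /\<^sub>R r)" for x
    have TD: "T \<in> D0 s" unfolding T_def[abs_def] by (rule D0_dilate[OF u rp])
    have fT: "has_eform s (\<lambda>x. \<alpha> * T x)" using TD by (intro has_eform_cmult) (simp add: D0_iff finite_energy_has_eform)
    have fH: "has_eform s (H r)" unfolding H_def[abs_def]
      by (rule has_eform_diff[OF has_eform_ballpow_1[OF s0 N'] has_eform_ballpow[OF s0 rp(1) N']])
    have "eform s T (H r) = 0" unfolding T_def[abs_def] H_def[abs_def]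
      by (rule dilate_orthogonal_ballpow_diff[OF s0 N2 rp u _ supp ae]) (use u0 uM in simp)
    then have "eform s u (H r) = eform s (\<lambda>x. u x - \<alpha> * T x) (H r)"
      unfolding eform_diff[OF fu fT fH] eform_cmult by simp
    then have "(cmod (eform s u (H r)))\<^sup>2 \<le> qform s (\<lambda>x. u x - \<alpha> * T x) * qform s (H r)"
      using eform_Cauchy_Schwarz[OF has_eform_diff[OF fu fT] fH] by simp
    also have "\<dots> \<le> (C * (1 - r)\<^sup>2) * qform s (H r)"
      unfolding \<alpha>_def T_def using C[OF r(1,3)] by (rule mult_right_mono) simp
    finally have up: "(cmod (eform s u (H r)))\<^sup>2 \<le> (C * (1 - r)\<^sup>2) * qform s (H r)" .
    have GD: "?G \<in> D0 s" by (rule ballpow_D0[OF s0 N2])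
    have bs: "ballpow s r = (\<lambda>x::real^'n. r powr (2 * s) * ?G (x /\<^sub>R r))"
      by (rule ext) (rule ballpow_scale[OF rp(1)])
    have bi: "integrable lborel (\<lambda>x::real^'n. f x * ballpow s q x)" if "0 \<le> q" "q \<le> 1" for q
    proof (rule integrable_bounded_in_ball[where M="M powr (P - 1) * 1" and R=1])
      show "\<bar>f x * ballpow s q x\<bar> \<le> M powr (P - 1) * 1" for x :: "real^'n"
      proof -
        have "ballpow s q x \<le> 1"
          using ballpow_le_1[of s x] ballpow_mono_radius[of s q x] that s0 by linarith
        then have "f x * ballpow s q x \<le> M powr (P - 1) * 1" by (intro mult_mono fM) auto
        then show ?thesis using f0[of x] by (simp add: abs_mult)
      qed
      show "f x * ballpow s q x = 0" if "norm x \<ge> 1" for x :: "real^'n"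
        using supp[OF that] by (simp add: f_def)
    qed measurable
    have "eform s u (H r) = eform s u ?G - eform s u (ballpow s r)"
      unfolding H_def[abs_def] by (rule eform_diff_right[OF has_eform_ballpow_1[OF s0 N'] has_eform_ballpow[OF s0 rp(1) N'] fu])
    also have "eform s u (ballpow s r) = of_real ((LINT x|lborel. f x * ballpow s r x) / k)"
    proof -
      have "eform s u (ballpow s r) = of_real (r powr (2 * s)) * of_real ((LINT x|lborel. f x * ?G (x /\<^sub>R r)) / k)"
        unfolding bs eform_cmult_right f_def eq[OF D0_dilate[OF GD rp]] ..
      also have "\<dots> = of_real ((r powr (2 * s) * (LINT x|lborel. f x * ?G (x /\<^sub>R r))) / k)" by simp
      also have "r powr (2 * s) * (LINT x|lborel. f x * ?G (x /\<^sub>R r)) = (LINT x|lborel. f x * ballpow s r x)"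
        unfolding bs Bochner_Integration.integral_mult_right_zero[symmetric] by (simp add: mult_ac)
      finally show ?thesis .
    qed
    also have "eform s u ?G = of_real ((LINT x|lborel. f x * ?G x) / k)" unfolding f_def by (rule eq[OF GD])
    also have "complex_of_real ((LINT x|lborel. f x * ?G x) / k) - of_real ((LINT x|lborel. f x * ballpow s r x) / k)
      = of_real ((LINT x|lborel. f x * H r x) / k)"
      unfolding H_def right_diff_distrib using bi[of 1] bi[of r] rp by (simp add: diff_divide_distrib)
    finally have pe: "cmod (eform s u (H r)) = \<bar>(LINT x|lborel. f x * H r x) / k\<bar>" by (simp only: norm_of_real)
    have "(1 - r) * \<delta> \<le> (LINT x|lborel. f x * H r x)"
      unfolding \<delta>_def Bochner_Integration.integral_mult_right_zero[symmetric]
    proof (rule integral_mono)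
      show "integrable lborel (\<lambda>x. f x * H r x)"
        unfolding H_def right_diff_distrib using bi[of 1] bi[of r] rp by simp
      show "(1 - r) * g x \<le> f x * H r x" for x
      proof (cases "norm x < r0")
        case True
        then have "(1 - r) * ballpow (s - 1) 1 x \<le> H r x"
          unfolding H_def using r by (intro ballpow_gap s) auto
        then have "f x * ((1 - r) * ballpow (s - 1) 1 x) \<le> f x * H r x" using f0 by (rule mult_left_mono)
        then show ?thesis using True by (simp add: g_def mult_ac)
      next
        case False
        then show ?thesis using f0[of x] ballpow_mono_radius[of s r x] s0 rp by (simp add: g_def H_def)
      qed
    qed (use gi in simp)
    then have "(1 - r) * \<delta> / k \<le> (LINT x|lborel. f x * H r x) / k" using k by (intro divide_right_mono) auto
    then have "(1 - r) * (\<delta> / k) \<le> cmod (eform s u (H r))"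
      unfolding pe times_divide_eq_right by (rule order_trans[OF _ abs_ge_self])
    then have "((1 - r) * (\<delta> / k))\<^sup>2 \<le> (cmod (eform s u (H r)))\<^sup>2"
      using r delta k by (intro power_mono) auto
    with up have "((1 - r) * (\<delta> / k))\<^sup>2 \<le> (C * (1 - r)\<^sup>2) * qform s (H r)" by linarith
    then have "(1 - r)\<^sup>2 * (\<delta> / k)\<^sup>2 \<le> (1 - r)\<^sup>2 * (C * qform s (H r))" unfolding power_mult_distrib by (simp only: mult_ac)
    then show ?thesis using r by (simp add: mult_le_cancel_left_pos)
  qed
  \<comment> \<open>The offset 2 gives \<open>r n \<ge> 1/2\<close> from the start, as the rate
    estimate requires.\<close>
  define r where "r n = 1 - 1 / real (n + 2)" for n
  have rl: "r \<longlonglongrightarrow> 1" unfolding r_def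
    using tendsto_diff[OF tendsto_const LIMSEQ_ignore_initial_segment[OF lim_1_over_n, of 2], of 1] by simp
  have rb: "1/2 \<le> r n" "r n < 1" for n by (auto simp: r_def field_simps)
  have "(\<lambda>n. C * qform s (H (r n))) \<longlonglongrightarrow> C * 0"
    unfolding H_def using rb by (intro tendsto_mult tendsto_const ballpow_radius_tendsto[OF s0 N' rl]) (metis half_gt_zero_iff less_le_trans zero_less_one)
  moreover have "\<forall>\<^sub>F n in sequentially. (\<delta> / k)\<^sup>2 \<le> C * qform s (H (r n))"
    using order_tendstoD(1)[OF rl r0(2)] by eventually_elim (use rb key in auto)
  ultimately have "(\<delta> / k)\<^sup>2 \<le> C * 0" by (rule tendsto_lowerbound) simp
  then show False using delta k by simp
qed

section \<open>Hoelder functions and modification on null sets\<close>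

lemma holder_bounded_ball:
  assumes "u \<in> holder_space \<alpha> (cball 0 1)" and \<alpha>: "\<alpha> > 0"
  obtains M where "\<And>x. x \<in> cball 0 1 \<Longrightarrow> \<bar>u x\<bar> \<le> M"
proof -
  obtain C where C: "\<And>x y. x \<in> cball 0 1 \<Longrightarrow> y \<in> cball 0 1 \<Longrightarrow> \<bar>u x - u y\<bar> \<le> C * norm (x - y) powr \<alpha>"
    using assms(1) unfolding holder_space_def by blast
  have "\<bar>u x\<bar> \<le> \<bar>u 0\<bar> + \<bar>C\<bar>" if x: "x \<in> cball 0 1" for x
  proof -
    have "norm x powr \<alpha> \<le> 1" using x \<alpha> powr_mono2[of \<alpha> "norm x" 1] by simp
    then have "C * norm x powr \<alpha> \<le> \<bar>C\<bar> * 1" by (intro mult_mono) auto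
    then show ?thesis using C[OF x, of 0] by simp
  qed
  then show ?thesis by (rule that)
qed

lemma holder_continuous_on:
  assumes "u \<in> holder_space \<alpha> S" and \<alpha>: "\<alpha> > 0"
  shows "continuous_on S u"
proof -
  obtain C where C: "\<And>x y. x \<in> S \<Longrightarrow> y \<in> S \<Longrightarrow> \<bar>u x - u y\<bar> \<le> C * norm (x - y) powr \<alpha>"
    using assms(1) unfolding holder_space_def by blast
  show ?thesis unfolding continuous_on
  proof
    fix x assume x: "x \<in> S"
    have "((\<lambda>y. C * norm (y - x) powr \<alpha>) \<longlongrightarrow> C * norm (x - x) powr \<alpha>) (at x within S)"
      using \<alpha> by (intro tendsto_intros) auto
    then have "((\<lambda>y. C * norm (y - x) powr \<alpha>) \<longlongrightarrow> 0) (at x within S)" by simp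
    moreover have "\<forall>\<^sub>F y in at x within S. norm (u y - u x) \<le> C * norm (y - x) powr \<alpha>"
      unfolding eventually_at_filter using C x by (intro always_eventually) simp
    ultimately have "((\<lambda>y. u y - u x) \<longlongrightarrow> 0) (at x within S)" by (rule Lim_null_comparison[rotated])
    then show "(u \<longlongrightarrow> u x) (at x within S)" by (simp add: LIM_zero_iff)
  qed
qed

lemma has_eform_cong_AE:
  assumes "u \<in> borel_measurable borel" "v \<in> borel_measurable borel" and "AE x in lborel. u x = v x"
  shows "has_eform s u \<longleftrightarrow> has_eform s v"
  using integrable_cong_AE[of u lborel v] ft_cong_AE[OF assms] assms by (simp add: has_eform_def)

lemma eform_cong_AE:
  assumes "u \<in> borel_measurable borel" "v \<in> borel_measurable borel" and "AE x in lborel. u x = v x"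
  shows "eform s u w = eform s v w"
  using ft_cong_AE[OF assms] by (simp add: eform_def)

text \<open>Energies and approximation see the function through integrals only. This allows a
  solution to be replaced by a representative that vanishes everywhere off the open ball.\<close>

lemma D0_cong_AE:
  fixes u v :: "real^'n \<Rightarrow> real"
  assumes m[measurable]: "u \<in> borel_measurable borel" "v \<in> borel_measurable borel" and ae: "AE x in lborel. u x = v x"
    and u: "u \<in> D0 s"
  shows "v \<in> D0 s"
proof -
  have fe: "u \<in> finite_energy s" using u by (simp add: D0_def)
  have "AE x in lborel. x \<notin> ball 0 1 \<longrightarrow> u x = 0" using fe unfolding finite_energy_iff by blast
  then have "AE x in lborel. x \<notin> ball 0 1 \<longrightarrow> v x = 0" using ae by eventually_elim auto
  moreover have "AE x in lborel. (u x)\<^sup>2 = (v x)\<^sup>2" using ae by eventually_elim auto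
  then have "integrable lborel (\<lambda>x. (v x)\<^sup>2)"
    using fe integrable_cong_AE[of "\<lambda>x. (u x)\<^sup>2" lborel "\<lambda>x. (v x)\<^sup>2"] by (auto simp: finite_energy_iff)
  ultimately have v: "v \<in> finite_energy s"
    using fe has_eform_cong_AE[OF m ae] m(2) by (auto simp: finite_energy_iff)
  obtain \<phi> where phi: "\<And>n. \<exists>R<1. \<phi> n \<in> bumps R" and lim: "(\<lambda>n::nat. qform s (\<lambda>x. \<phi> n x - u x)) \<longlonglongrightarrow> 0"
    using u unfolding D0_iff by blast
  have "qform s (\<lambda>x. \<phi> n x - u x) = qform s (\<lambda>x. \<phi> n x - v x)" for n
  proof -
    have [measurable]: "\<phi> n \<in> borel_measurable borel" using phi[of n] smooth_measurable by (auto simp: bumps_def)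
    have "AE x in lborel. \<phi> n x - u x = \<phi> n x - v x" using ae by eventually_elim auto
    then have "ft (\<lambda>x. \<phi> n x - u x) \<xi> = ft (\<lambda>x. \<phi> n x - v x) \<xi>" for \<xi>
      by (intro ft_cong_AE) measurable
    then show ?thesis by (simp add: qform_def)
  qed
  then show ?thesis using v phi lim unfolding D0_iff by auto
qed

theorem proposition1p2:
  fixes \<alpha> s :: real
  assumes "0 < \<alpha>" and "\<alpha> < 1"
    and "s > 1"
    and "real CARD('n::finite) > 2 * s"
  shows "\<not> (\<exists>u :: real^'n \<Rightarrow> real.
    u \<in> D0 s \<inter> holder_space \<alpha> (cball 0 1) \<and> is_solution s u \<and>
    (\<forall>x\<in>ball 0 1. 0 \<le> u x) \<and> (\<exists>x\<in>ball 0 1. u x \<noteq> 0))"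
proof
  assume "\<exists>u :: real^'n \<Rightarrow> real. u \<in> D0 s \<inter> holder_space \<alpha> (cball 0 1) \<and> is_solution s u \<and>
    (\<forall>x\<in>ball 0 1. 0 \<le> u x) \<and> (\<exists>x\<in>ball 0 1. u x \<noteq> 0)"
  then obtain u0 :: "real^'n \<Rightarrow> real" and x0 where D: "u0 \<in> D0 s" and hol: "u0 \<in> holder_space \<alpha> (cball 0 1)"
    and sol: "is_solution s u0" and pos: "\<And>x. x \<in> ball 0 1 \<Longrightarrow> 0 \<le> u0 x" and x0: "x0 \<in> ball 0 1" "u0 x0 \<noteq> 0"
    by blast
  \<comment> \<open>Membership in \<open>D0\<close> fixes \<open>u0\<close> off the ball only almost
    everywhere, and the Hoelder condition speaks of the closed ball alone. The truncation vanishes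
    off the ball and can be discontinuous only on the sphere, a null set, so its boundary values on
    the sphere do not matter.\<close>
  define u where "u x = (if x \<in> ball 0 1 then u0 x else 0)" for x
  define N where "N = real CARD('n)"
  define P where "P = 2 * N / (N - 2 * s)"
  have P: "critical_exponent TYPE('n) s = P" by (simp add: critical_exponent_def P_def N_def)
  have m0[measurable]: "u0 \<in> borel_measurable borel" using D by (simp add: D0_def finite_energy_def)
  have m[measurable]: "u \<in> borel_measurable borel" unfolding u_def[abs_def] by measurable
  have ae: "AE x in lborel. u0 x = u x"
  proof -
    have "AE x in lborel. x \<notin> ball 0 1 \<longrightarrow> u0 x = 0" using D by (simp add: D0_def finite_energy_def)
    then show ?thesis by eventually_elim (simp add: u_def)
  qed
  have uD: "u \<in> D0 s" by (rule D0_cong_AE[OF m0 m ae D])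
  obtain M0 where M0: "\<And>x. x \<in> cball 0 1 \<Longrightarrow> \<bar>u0 x\<bar> \<le> M0" using holder_bounded_ball[OF hol assms(1)] by blast
  have M00: "0 \<le> M0" using M0[of 0] by simp
  have uM: "u x \<le> M0" for x using M0[of x] M00 by (auto simp: u_def)
  have u_nonneg: "0 \<le> u x" for x using pos by (simp add: u_def)
  have supp: "u x = 0" if "norm x \<ge> 1" for x using that by (simp add: u_def)
  have cont_in: "isCont u x" if "norm x < 1" for x
  proof -
    have "continuous_on (ball 0 1) u0"
      by (rule continuous_on_subset[OF holder_continuous_on[OF hol assms(1)]]) auto
    then have "continuous_on (ball 0 1) u" by (rule continuous_on_eq) (simp add: u_def)
    then show ?thesis using that by (simp add: continuous_on_eq_continuous_at)
  qed
  have cont_out: "isCont u x" if "norm x > 1" for x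
  proof -
    have "continuous_on (- cball 0 1) u"
      by (rule continuous_on_eq[OF continuous_on_const[of _ 0]]) (simp add: u_def)
    then show ?thesis using that by (simp add: continuous_on_eq_continuous_at open_Compl)
  qed
  have uae: "AE x in lborel. isCont u x"
    using AE_norm_neq[of 1] by eventually_elim (use cont_in cont_out in \<open>metis linorder_neqE\<close>)
  \<comment> \<open>Rewriting the unitary energy as \<open>eform\<close> leaves this factor in front
    of the form, and division moves it to the nonlinear side.\<close>
  let ?k = "(fourier_const TYPE('n))\<^sup>2"
  have k: "?k > 0" using fourier_const_pos[where 'n='n] by simp
  have eq: "eform s u v = of_real ((LINT x|lborel. u x powr (P - 1) * v x) / ?k)" if v: "v \<in> D0 s" for v
  proof -
    have "energy s u0 v = of_real (LINT x:ball 0 1|lborel. \<bar>u0 x\<bar> powr (P - 2) * u0 x * v x)"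
      using sol v unfolding is_solution_def P by blast
    also have "(LINT x:ball 0 1|lborel. \<bar>u0 x\<bar> powr (P - 2) * u0 x * v x) = (LINT x|lborel. u x powr (P - 1) * v x)"
      unfolding set_lebesgue_integral_def
    proof (intro Bochner_Integration.integral_cong refl)
      fix x
      \<comment> \<open>At \<open>t = 0\<close> both sides vanish, since \<open>0 powr x = 0\<close>
        for every exponent.\<close>
      have "t powr (P - 2) * t = t powr (P - 1)" if "0 \<le> t" for t :: real
        using that powr_add[of t "P - 2" 1] by (cases "t = 0") auto
      then show "indicator (ball 0 1) x *\<^sub>R (\<bar>u0 x\<bar> powr (P - 2) * u0 x * v x) = u x powr (P - 1) * v x"
        using pos[of x] by (simp add: u_def)
    qed
    also have "energy s u0 v = of_real ?k * eform s u v"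
      unfolding energy_eform eform_cong_AE[OF m0 m ae] ..
    finally have "of_real ?k * eform s u v = of_real (LINT x|lborel. u x powr (P - 1) * v x)" .
    then show ?thesis using k by (simp add: nonzero_eq_divide_eq mult_ac)
  qed
  have N2: "2 \<le> CARD('n)" using assms(3,4) by linarith
  have "u x0 = 0"
    using nonneg_solution_vanishes[OF _ N2 _ k uD u_nonneg uM supp uae, of x0] eq x0 cont_in[of x0] assms(3,4)
    unfolding P_def N_def by simp
  then show False using x0 by (simp add: u_def)
qed

end
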